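(* The following are equivalent over $\mathsf{RCA}_0$: (a) $\mathsf{ACA}_0$; (b) the $\mathrm{CFP}$ for either $f$ or $V$ continuous (that is: every Caristi system $(\mathcal X,f,V)$ in which $f$ is continuous or $V$ is continuous has a fixed point); (c) the $\mathrm{CFP}$ for compact $\mathcal X$; (d) the $\mathrm{CFP}$ for Baire class $1$ functions $f$ on $\mathcal X=[0,1]$; (e) the $\mathrm{CFP}$ for continuous $f,V$ on the Baire space $\mathcal X=\mathbb N^{\mathbb N}$.
   Context: $\mathsf{RCA}_0$ and $\mathsf{ACA}_0$ are the usual subsystems of second-order arithmetic. Metric spaces. A (code for a) complete separable metric space $\mathcal X=\widehat X$ is a nonempty set $X\subseteq\mathbb N$ with a sequence of reals $d\colon X\times X\to\mathbb R$ such that $d(a,a)=0$, $d(a,b)=d(b,a)\ge 0$ and $d(a,b)+d(b,c)\ge d(a,c)$. A point of $\mathcal X$ is a sequence $x=\langle x_i\rangle_{i\in\mathbb N}$ in $X$ with $d(x_i,x_j)\le 2^{-i}$ for $i\le j$; $d(x,y)=\lim_n d(x_n,y_n)$, and $x=y$ means $d(x,y)=0$. For $a\in X$, $r\in\mathbb Q^{>0}$, $B_r(a)$ is the rational open ball coded by $\langle a,r\rangle$. $\mathcal X$ is compact if there is a sequence of (finite sequences of) points witnessing total boundedness (Simpson, Definition III.2.3). The Baire space is $\mathbb N^{\mathbb N}$ with $d(\Lambda,\Lambda')=2^{-n}$ for the least $n$ with $\Lambda(n)\ne\Lambda'(n)$ (and $0$ if there is no such $n$); $[0,1]$ has its usual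 metric. Borel functions. A Borel code for a subset of $\mathcal X$ is a tree $S\subseteq\mathbb N^{<\mathbb N}$ with no infinite path, with exactly one $n$ such that $\langle n\rangle\in S$, and all of whose leaves have the form $\tau^\frown\langle B_r(a)\rangle$ with $a\in X$, $r\in\mathbb Q^{>0}$. Put $U_S(\sigma)=B_r(a)$ if $\sigma=\upsilon^\frown\langle B_r(a)\rangle$ is a leaf; for non-leaves $\sigma=\upsilon^\frown\langle n\rangle$, $U_S(\sigma)$ is $\bigcup\{U_S(\sigma^\frown\langle k\rangle):\sigma^\frown\langle k\rangle\in S\}$ if $n$ is odd and $\bigcap\{U_S(\sigma^\frown\langle k\rangle):\sigma^\frown\langle k\rangle\in S\}$ if $n$ is even; $U_S(\langle\rangle)=U_S(\langle n\rangle)$ for the unique $\langle n\rangle\in S$. $S$ codes the set $U_S(\langle\rangle)$; membership is formalized through evaluation maps satisfying these clauses (Simpson, Section V.3), and open sets are represented as unions of open balls. A code for a Borel function $\mathcal X\to\mathcal Y=\widehat Y$ is a sequence $\Upsilon$ of Borel codes $\Upsilon_{\langle a,r\rangle}$, $\langle a,r\rangle\in Y\times\mathbb Q^{>0}$, such that, writing $\Upsilon(B_r(a))=U_{\Upsilon_{\langle a,r\rangle}}(\langle\rangle)$, for all rational open balls $B,B'$ of $\mathcal Y$: (i) $B\subseteq B'$ implies $\Upsilon(B)\subseteq\Upsilon(B')$; (ii) $B\cap B'=\varnothing$ implies $\Upsilon(B)\cap\Upsilon(B')=\varnothing$. It codes the (partial) function $f$ with $f(x)=y$ iff $y$ is the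 unique point such that $x\in\Upsilon(B)$ for every rational ball $B\ni y$. Continuous functions are those coded as Borel functions in which the preimage of every open ball is open (equivalently over $\mathsf{RCA}_0$, by the standard codes of Simpson, Definition II.6.1). Baire functions. A code for a partial Baire function is a well-founded tree $\Xi$ in which each leaf is labelled by a code for a partial continuous function and each non-leaf $\sigma$ has $\sigma^\frown\langle i\rangle\in\Xi$ for all $i\in\mathbb N$. Define $f_{\Xi,\sigma}(x)=f(x)$ if $\sigma$ is a leaf labelled by $f$; otherwise $f_{\Xi,\sigma}(x)=\lim_{n}f_{\Xi,\sigma^\frown\langle n\rangle}(x)$ if all $f_{\Xi,\sigma^\frown\langle n\rangle}(x)$ and the limit exist, and undefined otherwise. The coded function is $f_\Xi=f_{\Xi,\langle\rangle}$; it is a Baire function if $f_\Xi(x)$ exists for all $x$. A Baire class $1$ function is one given as the pointwise limit of a sequence of continuous functions. Potentials. A potential on $\mathcal X$ is a (coded) function $V\colon\mathcal X\to[0,\infty)$ that is the pointwise limit of a sequence of continuous functions $V_n$ with $V_n(x)\le V_m(x)$ for all $x$ and $n\le m$. Caristi. A Caristi system is $(\mathcal X,f,V)$ with $\mathcal X$ a coded complete separable metric space, $f\colon\mathcal X\to\mathcal X$ a coded (total) Baire or Borel function, $V\colon\mathcal X\to[0,\infty)$ a coded potential, and $d(x,f(x))\le V(x)-V(f(x))$ for all $x\in\mathcal X$. The $\mathrm{CFP}$ (Caristi fixed point theorem) for given classes of $\mathcal X,f,V$ states: every Caristi system with components in these classes has a fixed point $x_*=f(x_* )$. Classes not mentioned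 are unrestricted (all coded complete separable metric spaces, all Baire or Borel $f$, all coded potentials). *)

theory Defs
  imports Main
begin

section \<open>Structures for second-order arithmetic\<close>

text \<open>A (Henkin) structure for the language of second-order arithmetic consists of a type
  \<open>'a\<close> carrying interpretations of \<open>0, 1, +, *, <\<close>, over which the number variables range, and a
  family \<open>S\<close> of sets over which the set variables range.  The class below is purely
  syntactic: nothing is assumed about the five symbols, so \<open>'a\<close> may be any first-order
  structure, in particular a nonstandard one.  The symbol \<open>\<le>\<close> of class \<open>ord\<close> is not part of the
  language and is never used.

  A sentence is provable from a theory iff it is true in all its Henkin models, hence
  ``equivalent over RCA\<open>\<^sub>0\<close>'' is rendered as ``equivalent in every model of RCA\<open>\<^sub>0\<close>''.
  Everything below that depends on \<open>S\<close> quantifies only over elements of \<open>'a\<close> and of \<open>S\<close>; a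
  quantifier over functions \<open>f :: 'a \<Rightarrow> 'a\<close> is always restricted to those with \<open>fn S f\<close>, i.e.
  whose graph belongs to \<open>S\<close>.\<close>

class l2_sig = zero + one + plus + times + ord

definition leq :: "'a::l2_sig \<Rightarrow> 'a \<Rightarrow> bool" (infix "\<preceq>" 50) where
  "x \<preceq> y \<longleftrightarrow> x < y \<or> x = y"

datatype l2_term =
    Var nat | Zero | One | Add l2_term l2_term | Mul l2_term l2_term

text \<open>Formulas without set quantifiers (but with set parameters), i.e. arithmetical formulas.
  \<open>Mem t j\<close> says that \<open>t\<close> is a member of the \<open>j\<close>-th set variable.\<close>

datatype l2_form =
    Equal l2_term l2_term | Less l2_term l2_term | Mem l2_term nat
  | Neg l2_form | Conj l2_form l2_form | Exis nat l2_form

primrec tvars :: "l2_term \<Rightarrow> nat set" where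
  "tvars (Var i) = {i}"
| "tvars Zero = {}"
| "tvars One = {}"
| "tvars (Add s t) = tvars s \<union> tvars t"
| "tvars (Mul s t) = tvars s \<union> tvars t"

primrec tval :: "(nat \<Rightarrow> 'a::l2_sig) \<Rightarrow> l2_term \<Rightarrow> 'a" where
  "tval e (Var i) = e i"
| "tval e Zero = 0"
| "tval e One = 1"
| "tval e (Add s t) = tval e s + tval e t"
| "tval e (Mul s t) = tval e s * tval e t"

primrec sat :: "(nat \<Rightarrow> 'a::l2_sig set) \<Rightarrow> (nat \<Rightarrow> 'a) \<Rightarrow> l2_form \<Rightarrow> bool" where
  "sat E e (Equal s t) \<longleftrightarrow> tval e s = tval e t"
| "sat E e (Less s t) \<longleftrightarrow> tval e s < tval e t"
| "sat E e (Mem t j) \<longleftrightarrow> tval e t \<in> E j"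
| "sat E e (Neg \<phi>) \<longleftrightarrow> \<not> sat E e \<phi>"
| "sat E e (Conj \<phi> \<psi>) \<longleftrightarrow> sat E e \<phi> \<and> sat E e \<psi>"
| "sat E e (Exis i \<phi>) \<longleftrightarrow> (\<exists>a. sat E (e(i := a)) \<phi>)"

inductive Sigma00 :: "l2_form \<Rightarrow> bool" where
  "Sigma00 (Equal s t)"
| "Sigma00 (Less s t)"
| "Sigma00 (Mem t j)"
| "Sigma00 \<phi> \<Longrightarrow> Sigma00 (Neg \<phi>)"
| "Sigma00 \<phi> \<Longrightarrow> Sigma00 \<psi> \<Longrightarrow> Sigma00 (Conj \<phi> \<psi>)"
| "Sigma00 \<phi> \<Longrightarrow> i \<notin> tvars t \<Longrightarrow> Sigma00 (Exis i (Conj (Less (Var i) t) \<phi>))"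

definition Sigma01 :: "l2_form \<Rightarrow> bool" where
  "Sigma01 \<phi> \<longleftrightarrow> (\<exists>i \<theta>. Sigma00 \<theta> \<and> \<phi> = Exis i \<theta>)"

definition Pi01 :: "l2_form \<Rightarrow> bool" where
  "Pi01 \<phi> \<longleftrightarrow> (\<exists>i \<theta>. Sigma00 \<theta> \<and> \<phi> = Neg (Exis i (Neg \<theta>)))"

definition basic_axioms :: "'a::l2_sig itself \<Rightarrow> bool" where
  "basic_axioms _ \<longleftrightarrow>
     (\<forall>m::'a. m + 1 \<noteq> 0) \<and>
     (\<forall>m n::'a. m + 1 = n + 1 \<longrightarrow> m = n) \<and>
     (\<forall>m::'a. m + 0 = m) \<and>
     (\<forall>m n::'a. m + (n + 1) = (m + n) + 1) \<and>
     (\<forall>m::'a. m * 0 = 0) \<and>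
     (\<forall>m n::'a. m * (n + 1) = m * n + m) \<and>
     (\<forall>m::'a. \<not> m < 0) \<and>
     (\<forall>m n::'a. m < n + 1 \<longleftrightarrow> m < n \<or> m = n)"

text \<open>\<open>\<Sigma>\<^sup>0\<^sub>1\<close>-induction and \<open>\<Delta>\<^sup>0\<^sub>1\<close>-comprehension, with number and set parameters.\<close>

definition RCA0 :: "'a::l2_sig set set \<Rightarrow> bool" where
  "RCA0 S \<longleftrightarrow> basic_axioms TYPE('a) \<and>
     (\<forall>\<phi> E e i. Sigma01 \<phi> \<and> range E \<subseteq> S \<and>
        sat E (e(i := 0)) \<phi> \<and>
        (\<forall>n. sat E (e(i := n)) \<phi> \<longrightarrow> sat E (e(i := n + 1)) \<phi>) \<longrightarrow>
        (\<forall>n. sat E (e(i := n)) \<phi>)) \<and>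
     (\<forall>\<phi> \<psi> E e i. Sigma01 \<phi> \<and> Pi01 \<psi> \<and> range E \<subseteq> S \<and>
        (\<forall>n. sat E (e(i := n)) \<phi> \<longleftrightarrow> sat E (e(i := n)) \<psi>) \<longrightarrow>
        {n. sat E (e(i := n)) \<phi>} \<in> S) \<and>
     S \<noteq> {}"

definition ACA0 :: "'a::l2_sig set set \<Rightarrow> bool" where
  "ACA0 S \<longleftrightarrow> basic_axioms TYPE('a) \<and>
     (\<forall>X\<in>S. 0 \<in> X \<and> (\<forall>n. n \<in> X \<longrightarrow> n + 1 \<in> X) \<longrightarrow> (\<forall>n. n \<in> X)) \<and>
     (\<forall>\<phi> E e i. range E \<subseteq> S \<longrightarrow> {n. sat E (e(i := n)) \<phi>} \<in> S) \<and>
     S \<noteq> {}"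

section \<open>Coding of pairs, functions and finite sequences\<close>

definition pr :: "'a::l2_sig \<Rightarrow> 'a \<Rightarrow> 'a" where
  "pr i j = (i + j) * (i + j) + i"

definition fn :: "'a::l2_sig set set \<Rightarrow> ('a \<Rightarrow> 'a) \<Rightarrow> bool" where
  "fn S f \<longleftrightarrow> range (\<lambda>i. pr i (f i)) \<in> S"

definition sect :: "'a::l2_sig set \<Rightarrow> 'a \<Rightarrow> 'a set" where
  "sect Z n = {m. pr m n \<in> Z}"

text \<open>Finite sets and finite sequences are coded as in Simpson, Section II.2: the triple
  \<open>(k, m, n)\<close> represents the set of all \<open>i < k\<close> such that \<open>m (i + 1) + 1\<close> divides \<open>n\<close>; the
  code of a finite set is its least representation, and the code of a finite sequence is the
  code of its graph.\<close>

definition elem :: "'a::l2_sig \<Rightarrow> 'a \<Rightarrow> bool" where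
  "elem i c \<longleftrightarrow> (\<exists>k m n. c = pr k (pr m n) \<and> i < k \<and> (\<exists>l. n = (m * (i + 1) + 1) * l))"

definition triple :: "'a::l2_sig \<Rightarrow> bool" where
  "triple c \<longleftrightarrow> (\<exists>k m n. c = pr k (pr m n))"

definition fin_code :: "'a::l2_sig \<Rightarrow> bool" where
  "fin_code c \<longleftrightarrow> triple c \<and>
     \<not> (\<exists>c'. c' < c \<and> triple c' \<and> (\<forall>i. elem i c' \<longleftrightarrow> elem i c))"

definition seq_of_length :: "'a::l2_sig \<Rightarrow> 'a \<Rightarrow> bool" where
  "seq_of_length s l \<longleftrightarrow> fin_code s \<and>
     (\<forall>z. elem z s \<longrightarrow> (\<exists>i v. i < l \<and> z = pr i v)) \<and>
     (\<forall>i. i < l \<longrightarrow> (\<exists>!v. elem (pr i v) s))"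

definition is_seq :: "'a::l2_sig \<Rightarrow> bool" where
  "is_seq s \<longleftrightarrow> (\<exists>l. seq_of_length s l)"

definition lh :: "'a::l2_sig \<Rightarrow> 'a" where
  "lh s = (THE l. seq_of_length s l)"

definition entry :: "'a::l2_sig \<Rightarrow> 'a \<Rightarrow> 'a" where
  "entry s i = (THE v. elem (pr i v) s)"

text \<open>The code of the sequence \<open>\<langle>g 0, \<dots>, g (l - 1)\<rangle>\<close>.\<close>

definition seq_code :: "'a::l2_sig \<Rightarrow> ('a \<Rightarrow> 'a) \<Rightarrow> 'a" where
  "seq_code l g = (THE s. seq_of_length s l \<and> (\<forall>i. i < l \<longrightarrow> elem (pr i (g i)) s))"

definition nil :: "'a::l2_sig" where
  "nil = seq_code 0 (\<lambda>_. 0)"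

definition snoc :: "'a::l2_sig \<Rightarrow> 'a \<Rightarrow> 'a" where
  "snoc s v = seq_code (lh s + 1) (\<lambda>i. if i < lh s then entry s i else v)"

definition tree :: "'a::l2_sig set set \<Rightarrow> 'a set \<Rightarrow> bool" where
  "tree S T \<longleftrightarrow> T \<in> S \<and>
     (\<forall>s\<in>T. is_seq s \<and> (\<forall>m. m \<preceq> lh s \<longrightarrow> seq_code m (entry s) \<in> T))"

definition well_founded_tree :: "'a::l2_sig set set \<Rightarrow> 'a set \<Rightarrow> bool" where
  "well_founded_tree S T \<longleftrightarrow> tree S T \<and> \<not> (\<exists>f. fn S f \<and> (\<forall>n. seq_code n f \<in> T))"

definition leaf :: "'a::l2_sig set \<Rightarrow> 'a \<Rightarrow> bool" where
  "leaf T s \<longleftrightarrow> s \<in> T \<and> \<not> (\<exists>k. snoc s k \<in> T)"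

section \<open>Rationals and reals\<close>

text \<open>The triple \<open>(p, n, k)\<close> with \<open>k \<noteq> 0\<close> stands for the fraction \<open>(p - n) / k\<close>.  A code of a
  rational is the least \<open>pr (pr p n) k\<close> among all triples representing it.\<close>

type_synonym 'a frac = "'a \<times> 'a \<times> 'a"

fun frac_le :: "'a::l2_sig frac \<Rightarrow> 'a frac \<Rightarrow> bool" where
  "frac_le (p, n, k) (p', n', k') \<longleftrightarrow> p * k' + n' * k \<preceq> p' * k + n * k'"

fun frac_eq :: "'a::l2_sig frac \<Rightarrow> 'a frac \<Rightarrow> bool" where
  "frac_eq (p, n, k) (p', n', k') \<longleftrightarrow> p * k' + n' * k = p' * k + n * k'"

fun frac_add :: "'a::l2_sig frac \<Rightarrow> 'a frac \<Rightarrow> 'a frac" where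
  "frac_add (p, n, k) (p', n', k') = (p * k' + p' * k, n * k' + n' * k, k * k')"

fun frac_diff :: "'a::l2_sig frac \<Rightarrow> 'a frac \<Rightarrow> 'a frac" where
  "frac_diff (p, n, k) (p', n', k') = (p * k' + n' * k, n * k' + p' * k, k * k')"

fun frac_rep :: "'a::l2_sig \<Rightarrow> 'a frac \<Rightarrow> bool" where
  "frac_rep q (p, n, k) \<longleftrightarrow> k \<noteq> 0 \<and> q = pr (pr p n) k"

definition is_rat :: "'a::l2_sig \<Rightarrow> bool" where
  "is_rat q \<longleftrightarrow> (\<exists>u. frac_rep q u \<and> \<not> (\<exists>q' u'. q' < q \<and> frac_rep q' u' \<and> frac_eq u' u))"

definition frac_of :: "'a::l2_sig \<Rightarrow> 'a frac" where
  "frac_of q = (THE u. frac_rep q u)"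

definition rat_code :: "'a::l2_sig frac \<Rightarrow> 'a" where
  "rat_code u = (THE q. is_rat q \<and> frac_eq (frac_of q) u)"

definition qle :: "'a::l2_sig \<Rightarrow> 'a \<Rightarrow> bool" where
  "qle a b \<longleftrightarrow> frac_le (frac_of a) (frac_of b)"

definition qadd :: "'a::l2_sig \<Rightarrow> 'a \<Rightarrow> 'a" where
  "qadd a b = rat_code (frac_add (frac_of a) (frac_of b))"

text \<open>The distance \<open>|a - b|\<close> of two rationals.\<close>

definition qdist :: "'a::l2_sig \<Rightarrow> 'a \<Rightarrow> 'a" where
  "qdist a b = rat_code (if qle b a then frac_diff (frac_of a) (frac_of b)
                                    else frac_diff (frac_of b) (frac_of a))"

definition q0 :: "'a::l2_sig" where "q0 = rat_code (0, 0, 1)"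

definition q1 :: "'a::l2_sig" where "q1 = rat_code (1, 0, 1)"

definition pow2 :: "'a::l2_sig set set \<Rightarrow> 'a \<Rightarrow> 'a" where
  "pow2 S = (THE f. fn S f \<and> f 0 = 1 \<and> (\<forall>i. f (i + 1) = f i + f i))"

text \<open>The rational \<open>2\<^sup>-\<^sup>i\<close>.\<close>

definition qpow :: "'a::l2_sig set set \<Rightarrow> 'a \<Rightarrow> 'a" where
  "qpow S i = rat_code (1, 0, pow2 S i)"

text \<open>A real is a sequence of rationals \<open>x\<close> with \<open>|x i - x j| \<le> 2\<^sup>-\<^sup>i\<close> for \<open>i \<le> j\<close>.\<close>

definition is_real :: "'a::l2_sig set set \<Rightarrow> ('a \<Rightarrow> 'a) \<Rightarrow> bool" where
  "is_real S x \<longleftrightarrow> fn S x \<and> (\<forall>i. is_rat (x i)) \<and>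
     (\<forall>i j. i \<preceq> j \<longrightarrow> qle (qdist (x i) (x j)) (qpow S i))"

definition rconst :: "'a::l2_sig \<Rightarrow> 'a \<Rightarrow> 'a" where
  "rconst q = (\<lambda>_. q)"

definition rle :: "'a::l2_sig set set \<Rightarrow> ('a \<Rightarrow> 'a) \<Rightarrow> ('a \<Rightarrow> 'a) \<Rightarrow> bool" where
  "rle S x y \<longleftrightarrow> (\<forall>k. qle (x k) (qadd (y k) (qadd (qpow S k) (qpow S k))))"

definition rlt :: "'a::l2_sig set set \<Rightarrow> ('a \<Rightarrow> 'a) \<Rightarrow> ('a \<Rightarrow> 'a) \<Rightarrow> bool" where
  "rlt S x y \<longleftrightarrow> \<not> rle S y x"

definition req :: "'a::l2_sig set set \<Rightarrow> ('a \<Rightarrow> 'a) \<Rightarrow> ('a \<Rightarrow> 'a) \<Rightarrow> bool" where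
  "req S x y \<longleftrightarrow> rle S x y \<and> rle S y x"

definition radd :: "('a::l2_sig \<Rightarrow> 'a) \<Rightarrow> ('a \<Rightarrow> 'a) \<Rightarrow> 'a \<Rightarrow> 'a" where
  "radd x y = (\<lambda>k. qadd (x (k + 1)) (y (k + 1)))"

section \<open>Complete separable metric spaces\<close>

text \<open>\<open>met X a b\<close> is the real \<open>d(a, b)\<close>, as a sequence of rationals; its values outside
  \<open>dense X\<close> are irrelevant.\<close>

record 'a space =
  dense :: "'a set"
  met :: "'a \<Rightarrow> 'a \<Rightarrow> 'a \<Rightarrow> 'a"

definition coded_space :: "'a::l2_sig set set \<Rightarrow> 'a space \<Rightarrow> bool" where
  "coded_space S X \<longleftrightarrow>
     dense X \<in> S \<and> dense X \<noteq> {} \<and>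
     (\<exists>D. fn S D \<and> (\<forall>a\<in>dense X. \<forall>b\<in>dense X. \<forall>k. D (pr (pr a b) k) = met X a b k)) \<and>
     (\<forall>a\<in>dense X. \<forall>b\<in>dense X. is_real S (met X a b)) \<and>
     (\<forall>a\<in>dense X. req S (met X a a) (rconst q0)) \<and>
     (\<forall>a\<in>dense X. \<forall>b\<in>dense X. req S (met X a b) (met X b a) \<and> rle S (rconst q0) (met X a b)) \<and>
     (\<forall>a\<in>dense X. \<forall>b\<in>dense X. \<forall>c\<in>dense X.
        rle S (met X a c) (radd (met X a b) (met X b c)))"

definition point :: "'a::l2_sig set set \<Rightarrow> 'a space \<Rightarrow> ('a \<Rightarrow> 'a) \<Rightarrow> bool" where
  "point S X x \<longleftrightarrow> fn S x \<and> (\<forall>i. x i \<in> dense X) \<and>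
     (\<forall>i j. i \<preceq> j \<longrightarrow> rle S (met X (x i) (x j)) (rconst (qpow S i)))"

text \<open>The real \<open>lim\<^sub>n d(x n, y n)\<close>.  Since \<open>d(x n, y n)\<close> is within \<open>2\<^sup>-\<^sup>n + 2\<^sup>-\<^sup>n\<close> of the limit, the
  sequence below satisfies the convergence condition for reals.\<close>

definition pdist :: "'a::l2_sig space \<Rightarrow> ('a \<Rightarrow> 'a) \<Rightarrow> ('a \<Rightarrow> 'a) \<Rightarrow> 'a \<Rightarrow> 'a" where
  "pdist X x y = (\<lambda>k. met X (x (k + 1 + 1)) (y (k + 1 + 1)) (k + 1 + 1))"

definition peq :: "'a::l2_sig set set \<Rightarrow> 'a space \<Rightarrow> ('a \<Rightarrow> 'a) \<Rightarrow> ('a \<Rightarrow> 'a) \<Rightarrow> bool" where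
  "peq S X x y \<longleftrightarrow> req S (pdist X x y) (rconst q0)"

text \<open>Codes \<open>pr a r\<close> of rational open balls \<open>B\<^sub>r(a)\<close>.\<close>

definition rat_ball :: "'a::l2_sig space \<Rightarrow> 'a \<Rightarrow> bool" where
  "rat_ball X B \<longleftrightarrow> (\<exists>a r. B = pr a r \<and> a \<in> dense X \<and> is_rat r \<and> \<not> qle r q0)"

definition in_ball :: "'a::l2_sig set set \<Rightarrow> 'a space \<Rightarrow> 'a \<Rightarrow> ('a \<Rightarrow> 'a) \<Rightarrow> bool" where
  "in_ball S X B x \<longleftrightarrow>
     (\<exists>a r. B = pr a r \<and> rlt S (pdist X x (\<lambda>_. a)) (rconst r))"

definition is_compact :: "'a::l2_sig set set \<Rightarrow> 'a space \<Rightarrow> bool" where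
  "is_compact S X \<longleftrightarrow> (\<exists>n P. fn S n \<and> fn S P \<and>
     (\<forall>j i. i \<preceq> n j \<longrightarrow> point S X (\<lambda>k. P (pr (pr i j) k))) \<and>
     (\<forall>x j. point S X x \<longrightarrow>
        (\<exists>i. i \<preceq> n j \<and> rlt S (pdist X (\<lambda>k. P (pr (pr i j) k)) x) (rconst (qpow S j)))))"

definition half_line :: "'a::l2_sig space" where
  "half_line = \<lparr>dense = {q. is_rat q \<and> qle q0 q}, met = (\<lambda>a b. rconst (qdist a b))\<rparr>"

definition unit_interval :: "'a::l2_sig space" where
  "unit_interval =
     \<lparr>dense = {q. is_rat q \<and> qle q0 q \<and> qle q q1}, met = (\<lambda>a b. rconst (qdist a b))\<rparr>"

text \<open>The dense subset of Baire space consists of the finite sequences, each identified with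
  its extension by zeros.\<close>

definition ext0 :: "'a::l2_sig \<Rightarrow> 'a \<Rightarrow> 'a" where
  "ext0 s i = (if i < lh s then entry s i else 0)"

definition baire_space :: "'a::l2_sig set set \<Rightarrow> 'a space" where
  "baire_space S =
     \<lparr>dense = {s. is_seq s},
      met = (\<lambda>s t. rconst (if \<forall>i. ext0 s i = ext0 t i then q0
               else qpow S (THE n. ext0 s n \<noteq> ext0 t n \<and> (\<forall>m. m < n \<longrightarrow> ext0 s m = ext0 t m))))\<rparr>"

section \<open>Borel, continuous and Baire functions\<close>

definition borel_code :: "'a::l2_sig set set \<Rightarrow> 'a space \<Rightarrow> 'a set \<Rightarrow> bool" where
  "borel_code S X T \<longleftrightarrow> well_founded_tree S T \<and> (\<exists>!n. snoc nil n \<in> T) \<and>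
     (\<forall>s. leaf T s \<longrightarrow> (\<exists>t\<in>T. \<exists>B. rat_ball X B \<and> s = snoc t B))"

text \<open>\<open>g\<close> is an evaluation map for the code \<open>T\<close> at \<open>x\<close>: \<open>g s = 1\<close> means that \<open>x\<close> belongs to the
  set coded at the node \<open>s\<close>.\<close>

definition borel_eval ::
  "'a::l2_sig set set \<Rightarrow> 'a space \<Rightarrow> 'a set \<Rightarrow> ('a \<Rightarrow> 'a) \<Rightarrow> ('a \<Rightarrow> 'a) \<Rightarrow> bool" where
  "borel_eval S X T x g \<longleftrightarrow> fn S g \<and>
     (\<forall>s\<in>T. g s = 0 \<or> g s = 1) \<and>
     (\<forall>n. snoc nil n \<in> T \<longrightarrow> g nil = g (snoc nil n)) \<and>
     (\<forall>t\<in>T. \<forall>n. snoc t n \<in> T \<longrightarrow>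
        (if leaf T (snoc t n) then g (snoc t n) = 1 \<longleftrightarrow> in_ball S X n x
         else if \<exists>m. n = m + m + 1 then
           g (snoc t n) = 1 \<longleftrightarrow> (\<exists>k. snoc (snoc t n) k \<in> T \<and> g (snoc (snoc t n) k) = 1)
         else
           g (snoc t n) = 1 \<longleftrightarrow> (\<forall>k. snoc (snoc t n) k \<in> T \<longrightarrow> g (snoc (snoc t n) k) = 1)))"

definition in_borel :: "'a::l2_sig set set \<Rightarrow> 'a space \<Rightarrow> 'a set \<Rightarrow> ('a \<Rightarrow> 'a) \<Rightarrow> bool" where
  "in_borel S X T x \<longleftrightarrow> (\<exists>g. borel_eval S X T x g \<and> g nil = 1)"

text \<open>An open set is coded as an enumerated union of rational balls: \<open>pr n B \<in> U\<close> means that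
  \<open>B\<close> is (at stage \<open>n\<close>) put into the union.\<close>

definition open_code :: "'a::l2_sig set set \<Rightarrow> 'a space \<Rightarrow> 'a set \<Rightarrow> bool" where
  "open_code S X U \<longleftrightarrow> U \<in> S \<and> (\<forall>z\<in>U. \<exists>n B. z = pr n B \<and> rat_ball X B)"

definition in_open :: "'a::l2_sig set set \<Rightarrow> 'a space \<Rightarrow> 'a set \<Rightarrow> ('a \<Rightarrow> 'a) \<Rightarrow> bool" where
  "in_open S X U x \<longleftrightarrow> (\<exists>n B. pr n B \<in> U \<and> in_ball S X B x)"

text \<open>Conditions (i) and (ii) on the preimages \<open>P B\<close> of the rational balls \<open>B\<close> of \<open>Y\<close>, and the
  partial function determined by these preimages.\<close>

definition coherent ::
  "'a::l2_sig set set \<Rightarrow> 'a space \<Rightarrow> 'a space \<Rightarrow> ('a \<Rightarrow> ('a \<Rightarrow> 'a) \<Rightarrow> bool) \<Rightarrow> bool" where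
  "coherent S X Y P \<longleftrightarrow> (\<forall>B B'. rat_ball Y B \<and> rat_ball Y B' \<longrightarrow>
     ((\<forall>y. point S Y y \<and> in_ball S Y B y \<longrightarrow> in_ball S Y B' y) \<longrightarrow>
        (\<forall>x. point S X x \<and> P B x \<longrightarrow> P B' x)) \<and>
     (\<not> (\<exists>y. point S Y y \<and> in_ball S Y B y \<and> in_ball S Y B' y) \<longrightarrow>
        \<not> (\<exists>x. point S X x \<and> P B x \<and> P B' x)))"

definition preimage_val ::
  "'a::l2_sig set set \<Rightarrow> 'a space \<Rightarrow> ('a \<Rightarrow> ('a \<Rightarrow> 'a) \<Rightarrow> bool) \<Rightarrow> ('a \<Rightarrow> 'a) \<Rightarrow> ('a \<Rightarrow> 'a) \<Rightarrow> bool"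
  where
  "preimage_val S Y P x y \<longleftrightarrow>
     (let Q = (\<lambda>y. point S Y y \<and> (\<forall>B. rat_ball Y B \<and> in_ball S Y B y \<longrightarrow> P B x))
      in Q y \<and> (\<forall>y'. Q y' \<longrightarrow> peq S Y y' y))"

definition borel_fun_code ::
  "'a::l2_sig set set \<Rightarrow> 'a space \<Rightarrow> 'a space \<Rightarrow> 'a set \<Rightarrow> bool" where
  "borel_fun_code S X Y U \<longleftrightarrow> U \<in> S \<and> (\<forall>B. rat_ball Y B \<longrightarrow> borel_code S X (sect U B)) \<and>
     coherent S X Y (\<lambda>B. in_borel S X (sect U B))"

definition borel_val ::
  "'a::l2_sig set set \<Rightarrow> 'a space \<Rightarrow> 'a space \<Rightarrow> 'a set \<Rightarrow> ('a \<Rightarrow> 'a) \<Rightarrow> ('a \<Rightarrow> 'a) \<Rightarrow> bool" where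
  "borel_val S X Y U = preimage_val S Y (\<lambda>B. in_borel S X (sect U B))"

definition cont_code ::
  "'a::l2_sig set set \<Rightarrow> 'a space \<Rightarrow> 'a space \<Rightarrow> 'a set \<Rightarrow> bool" where
  "cont_code S X Y U \<longleftrightarrow> U \<in> S \<and> (\<forall>B. rat_ball Y B \<longrightarrow> open_code S X (sect U B)) \<and>
     coherent S X Y (\<lambda>B. in_open S X (sect U B))"

definition cont_val ::
  "'a::l2_sig set set \<Rightarrow> 'a space \<Rightarrow> 'a space \<Rightarrow> 'a set \<Rightarrow> ('a \<Rightarrow> 'a) \<Rightarrow> ('a \<Rightarrow> 'a) \<Rightarrow> bool" where
  "cont_val S X Y U = preimage_val S Y (\<lambda>B. in_open S X (sect U B))"

definition cont_total_code ::
  "'a::l2_sig set set \<Rightarrow> 'a space \<Rightarrow> 'a space \<Rightarrow> 'a set \<Rightarrow> bool" where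
  "cont_total_code S X Y U \<longleftrightarrow>
     cont_code S X Y U \<and> (\<forall>x. point S X x \<longrightarrow> (\<exists>y. cont_val S X Y U x y))"

text \<open>Pointwise limit of a sequence of continuous functions, coded by the sections of \<open>W\<close>.\<close>

definition limit_val ::
  "'a::l2_sig set set \<Rightarrow> 'a space \<Rightarrow> 'a space \<Rightarrow> 'a set \<Rightarrow> ('a \<Rightarrow> 'a) \<Rightarrow> ('a \<Rightarrow> 'a) \<Rightarrow> bool" where
  "limit_val S X Y W x y \<longleftrightarrow> point S Y y \<and>
     (\<forall>n. \<exists>z. cont_val S X Y (sect W n) x z) \<and>
     (\<forall>k. \<exists>N. \<forall>n z. N \<preceq> n \<and> cont_val S X Y (sect W n) x z \<longrightarrow>
        rlt S (pdist Y z y) (rconst (qpow S k)))"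

text \<open>A Baire code is a tree \<open>T\<close> together with a set \<open>L\<close> whose section at a leaf is the label of
  that leaf.\<close>

definition baire_code ::
  "'a::l2_sig set set \<Rightarrow> 'a space \<Rightarrow> 'a space \<Rightarrow> 'a set \<Rightarrow> 'a set \<Rightarrow> bool" where
  "baire_code S X Y T L \<longleftrightarrow> well_founded_tree S T \<and> nil \<in> T \<and> L \<in> S \<and>
     (\<forall>s. leaf T s \<longrightarrow> cont_code S X Y (sect L s)) \<and>
     (\<forall>s\<in>T. \<not> leaf T s \<longrightarrow> (\<forall>i. snoc s i \<in> T))"

text \<open>The recursive clauses for \<open>f\<^bsub>\<Xi>,\<sigma>\<^esub>(x)\<close> are formalized by evaluation maps: \<open>h\<close> assigns the
  point \<open>\<lambda>k. h (pr s k)\<close> to each node \<open>s\<close>.  If the value at the root is defined, then so are the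
  values at all nodes, so evaluation maps are total on \<open>T\<close>.\<close>

definition baire_eval ::
  "'a::l2_sig set set \<Rightarrow> 'a space \<Rightarrow> 'a space \<Rightarrow> 'a set \<Rightarrow> 'a set \<Rightarrow> ('a \<Rightarrow> 'a) \<Rightarrow> ('a \<Rightarrow> 'a) \<Rightarrow> bool"
  where
  "baire_eval S X Y T L x h \<longleftrightarrow> fn S h \<and>
     (let v = (\<lambda>s k. h (pr s k)) in
      \<forall>s\<in>T. point S Y (v s) \<and>
        (if leaf T s then cont_val S X Y (sect L s) x (v s)
         else \<forall>k. \<exists>N. \<forall>n. N \<preceq> n \<longrightarrow> rlt S (pdist Y (v (snoc s n)) (v s)) (rconst (qpow S k))))"

definition baire_val ::
  "'a::l2_sig set set \<Rightarrow> 'a space \<Rightarrow> 'a space \<Rightarrow> 'a set \<Rightarrow> 'a set \<Rightarrow> ('a \<Rightarrow> 'a) \<Rightarrow> ('a \<Rightarrow> 'a) \<Rightarrow> bool"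
  where
  "baire_val S X Y T L x y \<longleftrightarrow> point S Y y \<and>
     (\<exists>h. baire_eval S X Y T L x h \<and> peq S Y (\<lambda>k. h (pr nil k)) y)"

section \<open>Caristi systems\<close>

text \<open>Presentations of functions.  \<open>Continuous\<close> and \<open>Baire1\<close> functions amount to Baire functions
  whose tree has height 0 and 1, respectively.\<close>

datatype 'a fun_code =
    Continuous "'a set" | Baire1 "'a set" | Baire "'a set" "'a set" | Borel "'a set"

primrec is_fun_code ::
  "'a::l2_sig set set \<Rightarrow> 'a space \<Rightarrow> 'a space \<Rightarrow> 'a fun_code \<Rightarrow> bool" where
  "is_fun_code S X Y (Continuous U) \<longleftrightarrow> cont_code S X Y U"
| "is_fun_code S X Y (Baire1 W) \<longleftrightarrow> W \<in> S \<and> (\<forall>n. cont_total_code S X Y (sect W n))"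
| "is_fun_code S X Y (Baire T L) \<longleftrightarrow> baire_code S X Y T L"
| "is_fun_code S X Y (Borel U) \<longleftrightarrow> borel_fun_code S X Y U"

primrec fun_val ::
  "'a::l2_sig set set \<Rightarrow> 'a space \<Rightarrow> 'a space \<Rightarrow> 'a fun_code \<Rightarrow> ('a \<Rightarrow> 'a) \<Rightarrow> ('a \<Rightarrow> 'a) \<Rightarrow> bool"
  where
  "fun_val S X Y (Continuous U) = cont_val S X Y U"
| "fun_val S X Y (Baire1 W) = limit_val S X Y W"
| "fun_val S X Y (Baire T L) = baire_val S X Y T L"
| "fun_val S X Y (Borel U) = borel_val S X Y U"

definition total_fun ::
  "'a::l2_sig set set \<Rightarrow> 'a space \<Rightarrow> 'a space \<Rightarrow> 'a fun_code \<Rightarrow> bool" where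
  "total_fun S X Y F \<longleftrightarrow> is_fun_code S X Y F \<and>
     (\<forall>x. point S X x \<longrightarrow> (\<exists>y. fun_val S X Y F x y))"

definition is_continuous :: "'a fun_code \<Rightarrow> bool" where
  "is_continuous F \<longleftrightarrow> (\<exists>U. F = Continuous U)"

definition is_baire_class_1 :: "'a fun_code \<Rightarrow> bool" where
  "is_baire_class_1 F \<longleftrightarrow> (\<exists>W. F = Baire1 W)"

text \<open>A potential is presented by a continuous code or by a nondecreasing sequence of
  continuous functions into \<open>[0, \<infinity>)\<close>.\<close>

definition potential ::
  "'a::l2_sig set set \<Rightarrow> 'a space \<Rightarrow> 'a fun_code \<Rightarrow> bool" where
  "potential S X V \<longleftrightarrow> total_fun S X half_line V \<and>
     (is_continuous V \<or>
      (\<exists>W. V = Baire1 W \<and>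
         (\<forall>n m x v w. n \<preceq> m \<and> point S X x \<and>
            cont_val S X half_line (sect W n) x v \<and> cont_val S X half_line (sect W m) x w \<longrightarrow>
            rle S v w)))"

text \<open>Points of \<open>half_line\<close> are in particular reals, so that \<open>rle\<close> and \<open>radd\<close> apply to
  them directly.\<close>

definition caristi_system ::
  "'a::l2_sig set set \<Rightarrow> 'a space \<Rightarrow> 'a fun_code \<Rightarrow> 'a fun_code \<Rightarrow> bool" where
  "caristi_system S X F V \<longleftrightarrow>
     coded_space S X \<and> total_fun S X X F \<and> potential S X V \<and>
     (\<forall>x y v w. point S X x \<and> fun_val S X X F x y \<and>
        fun_val S X half_line V x v \<and> fun_val S X half_line V y w \<longrightarrow>
        rle S (radd (pdist X x y) w) v)"

text \<open>The Caristi fixed point theorem for the class \<open>C\<close> of triples \<open>(X, F, V)\<close>.\<close>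

definition CFP ::
  "'a::l2_sig set set \<Rightarrow> ('a space \<Rightarrow> 'a fun_code \<Rightarrow> 'a fun_code \<Rightarrow> bool) \<Rightarrow> bool" where
  "CFP S C \<longleftrightarrow> (\<forall>X F V. caristi_system S X F V \<and> C X F V \<longrightarrow>
     (\<exists>x. point S X x \<and> fun_val S X X F x x))"

end

theory Submission
  imports Defs "HOL-Computational_Algebra.Fraction_Field"
begin

text \<open>The first-order part \<open>'a\<close> of the model is embedded into an ordered field \<open>'a K\<close> of fractions, and
  this into a Cauchy completion \<open>'a R\<close>.  The coded rationals are then exactly the elements of \<open>'a K\<close>,
  and coded reals and distances take their values in \<open>'a R\<close>, where one can calculate as usual.  Only
  statements about membership of sets in \<open>S\<close> need comprehension or induction.

  Given \<open>ACA\<^sub>0\<close>: if \<open>f\<close> is continuous, then the iterates of any point form a sequence in the model,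
  which is Cauchy since the potential decreases by at least the distance moved.  If \<open>V\<close> is continuous,
  then Ekeland's argument on the dense set, with the slope \<open>1 - 2\<^sup>-\<^sup>n\<^sup>-\<^sup>1\<close> at step \<open>n\<close> in place of \<open>1\<close>,
  converges to a critical point.  If \<open>X\<close> is compact, then \<open>V = sup V\<^sub>n\<close> is minimal at any cluster point of
  approximate minimizers of the \<open>V\<^sub>n\<close>.

  Conversely, let \<open>A\<close> be an enumerable set that does not belong to the model.  On Baire space a
  function cannot compute \<open>A\<close>, and \<open>f\<close> corrects its first error; the potential is a sum over
  the elements of \<open>A\<close> that are not yet dealt with.  On \<open>[0,1]\<close> let \<open>c\<^sub>i\<close> be the increasing partial sums of
  \<open>\<Sum>n\<in>A. 2\<^sup>-\<^sup>n\<^sup>-\<^sup>1\<close>, which have no supremum in the model.  Points below some \<open>c\<^sub>i\<close> are mapped to \<open>1\<close>, and the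
  others downwards, but not below the \<open>c\<^sub>i\<close>; a fixed point would be the supremum.\<close>

section \<open>The ring of differences of an ordered semiring\<close>

text \<open>Two things shape the proof. The numbers may be nonstandard, with induction only for
  existential statements, so every recursion, minimum and choice must be an object of
  \<open>S\<close>; outside the model one can merely calculate pointwise. And an arbitrary Baire or
  Borel \<open>f\<close> gives each value separately, with nothing in \<open>S\<close> that collects
  its values along a sequence. For continuous \<open>V\<close> or compact \<open>X\<close> it is
  therefore applied only once, at the limit point. For continuous \<open>f\<close> the iterates need
  one arithmetical definition, as sets cannot be chosen one after the other. In Ekeland's argument
  the competitor \<open>f x\<close> need not lie in the dense set; if it differs from
  \<open>x\<close>, a slope below 1 leaves slack for replacing it by a dense point nearby. In the
  reversals, a correction in place n moves a point of Baire space by at most 2^-n, while the sum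
  over the enumerated set grows by at least 2^-(n+1); hence a factor 2 in the potential. On [0,1]
  the points below some \<open>c i\<close> jump to 1 over a distance of at most 1; the potential is
  1 there, so 2 suffices for them.\<close>

fun drel :: "'n::linordered_semidom \<times> 'n \<Rightarrow> 'n \<times> 'n \<Rightarrow> bool" where
  "drel (a, b) (c, d) \<longleftrightarrow> a + d = c + b"

lemma equivp_drel: "equivp drel"
proof (rule equivpI)
  show "reflp drel" by (auto simp: reflp_def)
  show "symp drel" by (auto simp: symp_def)
  show "transp drel"
  proof (rule transpI)
    fix x y z
    assume xy: "drel x y" and yz: "drel y z"
    obtain a b c d e f where [simp]: "x = (a, b)" "y = (c, d)" "z = (e, f)"
      by (metis prod.exhaust)
    have "(a + f) + (c + d) = (a + d) + (c + f)" by (simp only: ac_simps)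
    also have "\<dots> = (c + b) + (e + d)" using xy yz by simp
    also have "\<dots> = (e + b) + (c + d)" by (simp only: ac_simps)
    finally show "drel x z" by simp
  qed
qed

quotient_type (overloaded) 'n dring = "'n::linordered_semidom \<times> 'n" / drel
  morphisms rep_diff Abs_diff
  by (rule equivp_drel)

text \<open>There is no subtraction yet: adding the mixed terms
  \<open>b' * c + a' * d + a' * c + b' * d\<close> to both sides lets each hypothesis be substituted
  inside a product, and they are cancelled at the end.\<close>

lemma drel_mult:
  fixes a b c d :: "'n::linordered_semidom"
  assumes "a + b' = a' + b" "c + d' = c' + d"
  shows "(a * c + b * d) + (a' * d' + b' * c') = (a' * c' + b' * d') + (a * d + b * c)"
proof -
  have "((a * c + b * d) + (a' * d' + b' * c')) + (b' * c + a' * d + a' * c + b' * d)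
      = (a + b') * c + (a' + b) * d + a' * (c + d') + b' * (c' + d)"
    by (simp add: algebra_simps)
  also have "\<dots> = (a' + b) * c + (a + b') * d + a' * (c' + d) + b' * (c + d')"
    using assms by simp
  also have "\<dots> = ((a' * c' + b' * d') + (a * d + b * c)) + (b' * c + a' * d + a' * c + b' * d)"
    by (simp add: algebra_simps)
  finally show ?thesis by simp
qed

lemma drel_less:
  fixes a b c d :: "'n::linordered_semidom"
  assumes "a + b' = a' + b" "c + d' = c' + d"
  shows "a + d < c + b \<longleftrightarrow> a' + d' < c' + b'"
proof -
  have "a + d < c + b \<longleftrightarrow> (a + d) + (b' + d') < (c + b) + (b' + d')" by simp
  also have "\<dots> \<longleftrightarrow> (a + b') + (d + d') < (c + d') + (b + b')" by (simp add: ac_simps)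
  also have "\<dots> \<longleftrightarrow> (a' + b) + (d + d') < (c' + d) + (b + b')" using assms by simp
  also have "\<dots> \<longleftrightarrow> (a' + d') + (b + d) < (c' + b') + (b + d)" by (simp add: ac_simps)
  finally show ?thesis by simp
qed

instantiation dring :: (linordered_semidom) linordered_idom
begin

lift_definition zero_dring :: "'a dring" is "(0, 0)" .
lift_definition one_dring :: "'a dring" is "(1, 0)" .
lift_definition plus_dring :: "'a dring \<Rightarrow> 'a dring \<Rightarrow> 'a dring"
  is "\<lambda>(a, b) (c, d). (a + c, b + d)"
proof -
  fix x x' y y' :: "'a \<times> 'a"
  assume "drel x x'" "drel y y'"
  then have "(fst x + snd x') + (fst y + snd y') = (fst x' + snd x) + (fst y' + snd y)"
    by (cases x; cases x'; cases y; cases y') simp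
  then show "drel ((case x of (a, b) \<Rightarrow> \<lambda>(c, d). (a + c, b + d)) y)
     ((case x' of (a, b) \<Rightarrow> \<lambda>(c, d). (a + c, b + d)) y')"
    by (simp add: split_beta ac_simps)
qed
lift_definition uminus_dring :: "'a dring \<Rightarrow> 'a dring" is "\<lambda>(a, b). (b, a)"
  by (auto simp: add_ac)
definition minus_dring :: "'a dring \<Rightarrow> 'a dring \<Rightarrow> 'a dring" where
  "x - y = x + - y" for x y :: "'a dring"
lift_definition times_dring :: "'a dring \<Rightarrow> 'a dring \<Rightarrow> 'a dring"
  is "\<lambda>(a, b) (c, d). (a * c + b * d, a * d + b * c)"
  using drel_mult by (auto simp: split_beta)
lift_definition less_dring :: "'a dring \<Rightarrow> 'a dring \<Rightarrow> bool"
  is "\<lambda>(a, b) (c, d). a + d < c + b"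
proof -
  fix x x' y y' :: "'a \<times> 'a"
  assume "drel x x'" "drel y y'"
  then show "(case x of (a, b) \<Rightarrow> \<lambda>(c, d). a + d < c + b) y = (case x' of (a, b) \<Rightarrow> \<lambda>(c, d). a + d < c + b) y'"
    using drel_less[of "fst x" "snd x'" "fst x'" "snd x" "fst y" "snd y'" "fst y'" "snd y"]
    by (cases x; cases x'; cases y; cases y') simp
qed
definition less_eq_dring :: "'a dring \<Rightarrow> 'a dring \<Rightarrow> bool" where
  "x \<le> y \<longleftrightarrow> \<not> y < x" for x y :: "'a dring"
definition abs_dring :: "'a dring \<Rightarrow> 'a dring" where
  "abs_dring x = (if x < 0 then - x else x)"
definition sgn_dring :: "'a dring \<Rightarrow> 'a dring" where
  "sgn_dring x = (if x = 0 then 0 else if 0 < x then 1 else - 1)"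

instance
proof
  fix a b c :: "'a dring"
  show "a * b * c = a * (b * c)" by transfer (auto simp: algebra_simps)
  show "a * b = b * a" by transfer (auto simp: algebra_simps)
  show "1 * a = a" by transfer auto
  show "(a + b) * c = a * c + b * c" by transfer (auto simp: algebra_simps)
  show "a + b + c = a + (b + c)" by transfer (auto simp: algebra_simps)
  show "a + b = b + a" by transfer (auto simp: algebra_simps)
  show "0 + a = a" by transfer auto
  show "- a + a = 0" by transfer (auto simp: algebra_simps)
  show "a - b = a + - b" by (simp add: minus_dring_def)
  show "a + b - a = b" unfolding minus_dring_def by transfer (auto simp: algebra_simps)
  show "a - b - c = a - (b + c)" unfolding minus_dring_def by transfer (auto simp: algebra_simps)
  show "0 * a = 0" "a * 0 = 0" by (transfer; auto)+
  show "(0::'a dring) \<noteq> 1" by transfer auto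
  have trans: "a < c" if "a < b" "b < c"
    using that
  proof transfer
    fix x y z :: "'a \<times> 'a"
    obtain a b c d e f where [simp]: "x = (a, b)" "y = (c, d)" "z = (e, f)"
      by (metis prod.exhaust)
    assume "(case x of (a, b) \<Rightarrow> \<lambda>(c, d). a + d < c + b) y" "(case y of (a, b) \<Rightarrow> \<lambda>(c, d). a + d < c + b) z"
    then have "(a + d) + (c + f) < (c + b) + (e + d)"
      by (intro add_strict_mono[of "a + d" "c + b" "c + f" "e + d"]) auto
    then have "(a + f) + (c + d) < (e + b) + (c + d)" by (simp only: ac_simps)
    then show "(case x of (a, b) \<Rightarrow> \<lambda>(c, d). a + d < c + b) z" by simp
  qed
  have asym: "\<not> y < x" if "x < y" for x y :: "'a dring"
    using that by transfer auto
  have lin: "x < y \<or> x = y \<or> y < x" for x y :: "'a dring"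
    by transfer (auto simp: not_less)
  show "a < b \<longleftrightarrow> a \<le> b \<and> \<not> b \<le> a" using asym by (auto simp: less_eq_dring_def)
  show "a \<le> a" unfolding less_eq_dring_def by (metis asym)
  show "a \<le> b \<or> b \<le> a" unfolding less_eq_dring_def using asym[of a b] by blast
  show "a = b" if "a \<le> b" "b \<le> a" using that lin by (auto simp: less_eq_dring_def)
  show "a \<le> c" if "a \<le> b" "b \<le> c" using that lin trans asym unfolding less_eq_dring_def by metis
  show "c + a \<le> c + b" if "a \<le> b" using that unfolding less_eq_dring_def
    by transfer (auto simp: algebra_simps)
  show "c * a < c * b" if "a < b" "0 < c" using that
  proof transfer
    fix x y z :: "'a \<times> 'a"
    obtain a b c d e f where [simp]: "x = (a, b)" "y = (c, d)" "z = (e, f)"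
      by (metis prod.exhaust)
    assume xy: "(case x of (a, b) \<Rightarrow> \<lambda>(c, d). a + d < c + b) y"
      and z: "(case (0, 0) of (a, b) \<Rightarrow> \<lambda>(c, d). a + d < c + b) z"
    have lt: "a + d < c + b" and "f < e" using xy z by auto
    \<comment> \<open>A positive pair is \<open>(v + f, f)\<close> with \<open>v > 0\<close>; after
      cancelling the common terms, multiplying by it is multiplying by \<open>v\<close>.\<close>
    define v where "v = e - f"
    have e: "e = v + f" and v: "0 < v"
    proof -
      show e: "e = v + f" using le_add_diff_inverse2[of f e] \<open>f < e\<close> by (simp add: v_def)
      show "0 < v" using \<open>f < e\<close> by (simp add: e)
    qed
    have "e * (a + d) + f * (c + b) < e * (c + b) + f * (a + d)"
    proof -
      have "e * (a + d) + f * (c + b) = v * (a + d) + (f * (a + d) + f * (c + b))"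
        "e * (c + b) + f * (a + d) = v * (c + b) + (f * (a + d) + f * (c + b))"
        by (simp_all add: e algebra_simps)
      then show ?thesis using mult_strict_left_mono[OF lt v] by (simp only: add_less_cancel_right)
    qed
    then show "(case (case z of (a, b) \<Rightarrow> \<lambda>(c, d). (a * c + b * d, a * d + b * c)) x of (a, b) \<Rightarrow> \<lambda>(c, d). a + d < c + b)
     ((case z of (a, b) \<Rightarrow> \<lambda>(c, d). (a * c + b * d, a * d + b * c)) y)"
      by (simp add: algebra_simps)
  qed
  show "\<bar>a\<bar> = (if a < 0 then - a else a)" by (rule abs_dring_def)
  show "sgn a = (if a = 0 then 0 else if 0 < a then 1 else - 1)" by (rule sgn_dring_def)
qed

end

lift_definition dr :: "'n::linordered_semidom \<Rightarrow> 'n dring" is "\<lambda>a. (a, 0)" .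

lemma dr_simps [simp]:
  "dr 0 = 0" "dr 1 = 1" "dr (a + b) = dr a + dr b" "dr (a * b) = dr a * dr b"
  "dr a = dr b \<longleftrightarrow> a = b" "dr a < dr b \<longleftrightarrow> a < b"
  by (transfer; simp)+

lemma dr_le [simp]: "dr a \<le> dr b \<longleftrightarrow> a \<le> b"
  by (simp add: not_less[symmetric])

lemma dring_cases: obtains a b where "x = dr a - dr b"
proof -
  have "\<exists>a b. x = dr a - dr b"
    unfolding minus_dring_def by transfer auto
  then show ?thesis using that by blast
qed

section \<open>The Cauchy completion of an ordered field\<close>

declare less_divide_eq_numeral1 [simp del] divide_less_eq_numeral1 [simp del]

text \<open>The index type is a linear order instead of \<open>nat\<close> because it will be the
  model's own numbers. Along standard indices alone, the powers 2^-n of a nonstandard model would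
  stay bounded away from 0.\<close>

definition cauchy :: "('i::linorder \<Rightarrow> 'k::linordered_field) \<Rightarrow> bool" where
  "cauchy f \<longleftrightarrow> (\<forall>e>0. \<exists>N. \<forall>m\<ge>N. \<forall>n\<ge>N. \<bar>f m - f n\<bar> < e)"

definition null :: "('i::linorder \<Rightarrow> 'k::linordered_field) \<Rightarrow> bool" where
  "null f \<longleftrightarrow> (\<forall>e>0. \<exists>N. \<forall>n\<ge>N. \<bar>f n\<bar> < e)"

definition evt :: "('i::linorder \<Rightarrow> bool) \<Rightarrow> bool" where
  "evt P \<longleftrightarrow> (\<exists>N. \<forall>n\<ge>N. P n)"

lemma evt_conj: "evt P \<Longrightarrow> evt Q \<Longrightarrow> evt (\<lambda>n. P n \<and> Q n)"
  unfolding evt_def by (meson max.boundedE)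

lemma evt_mono: "evt P \<Longrightarrow> (\<And>n. P n \<Longrightarrow> Q n) \<Longrightarrow> evt Q"
  unfolding evt_def by blast

lemma evt_const [simp]: "evt (\<lambda>_. P) \<longleftrightarrow> P"
  unfolding evt_def by auto

lemma cauchyD: "cauchy f \<Longrightarrow> e > 0 \<Longrightarrow> \<exists>N. \<forall>n\<ge>N. \<bar>f n - f N\<bar> < e"
  unfolding cauchy_def by (meson order_refl)

lemma cauchyI:
  fixes f :: "'i::linorder \<Rightarrow> 'k::linordered_field"
  assumes "\<And>e. e > 0 \<Longrightarrow> \<exists>N. evt (\<lambda>n. \<bar>f n - f N\<bar> < e)"
  shows "cauchy f"
  unfolding cauchy_def
proof (intro allI impI)
  fix e :: 'k assume "e > 0"
  then obtain N M where N: "\<And>n. n \<ge> M \<Longrightarrow> \<bar>f n - f N\<bar> < e / 2"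
    using assms[of "e / 2"] by (auto simp: evt_def)
  have "\<bar>f m - f n\<bar> < e" if "m \<ge> M" "n \<ge> M" for m n
    using N[OF that(1)] N[OF that(2)] by linarith
  then show "\<exists>N. \<forall>m\<ge>N. \<forall>n\<ge>N. \<bar>f m - f n\<bar> < e" by blast
qed

lemma cauchy_evt: "cauchy f \<Longrightarrow> e > 0 \<Longrightarrow> \<exists>N. evt (\<lambda>n. \<bar>f n - f N\<bar> < e)"
  using cauchyD unfolding evt_def by blast

lemma cauchy_pair:
  assumes "cauchy f" "cauchy g" "e > 0"
  shows "\<exists>N. evt (\<lambda>n. \<bar>f n - f N\<bar> < e \<and> \<bar>g n - g N\<bar> < e)"
proof -
  obtain M where M: "\<forall>m\<ge>M. \<forall>n\<ge>M. \<bar>f m - f n\<bar> < e" using assms unfolding cauchy_def by blast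
  obtain L where L: "\<forall>m\<ge>L. \<forall>n\<ge>L. \<bar>g m - g n\<bar> < e" using assms unfolding cauchy_def by blast
  have "\<forall>n\<ge>max M L. \<bar>f n - f (max M L)\<bar> < e \<and> \<bar>g n - g (max M L)\<bar> < e"
    using M L by simp
  then show ?thesis unfolding evt_def by blast
qed

lemma cauchy_const: "cauchy (\<lambda>_. c)"
  by (auto simp: cauchy_def)

lemma cauchy_add:
  fixes f g :: "'i::linorder \<Rightarrow> 'k::linordered_field"
  assumes "cauchy f" "cauchy g"
  shows "cauchy (\<lambda>i. f i + g i)"
proof (rule cauchyI)
  fix e :: 'k assume "e > 0"
  then obtain N where "evt (\<lambda>n. \<bar>f n - f N\<bar> < e / 2 \<and> \<bar>g n - g N\<bar> < e / 2)"
    using cauchy_pair[OF assms, of "e / 2"] by (auto simp: zero_less_divide_iff)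
  then have "evt (\<lambda>n. \<bar>f n + g n - (f N + g N)\<bar> < e)"
    by (rule evt_mono) linarith
  then show "\<exists>N. evt (\<lambda>n. \<bar>f n + g n - (f N + g N)\<bar> < e)" ..
qed

lemma cauchy_minus: "cauchy f \<Longrightarrow> cauchy (\<lambda>i. - f i)"
  unfolding cauchy_def by (simp add: abs_minus_commute)

lemma cauchy_diff: "cauchy f \<Longrightarrow> cauchy g \<Longrightarrow> cauchy (\<lambda>i. f i - g i)"
  using cauchy_add[OF _ cauchy_minus, of f g] by simp

lemma cauchy_bounded:
  fixes f :: "'i::linorder \<Rightarrow> 'k::linordered_field"
  assumes "cauchy f" obtains b where "b > 0" "evt (\<lambda>n. \<bar>f n\<bar> < b)"
proof -
  obtain N where N: "evt (\<lambda>n. \<bar>f n - f N\<bar> < 1)" using cauchy_evt[OF assms, of 1] by auto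
  have "evt (\<lambda>n. \<bar>f n\<bar> < \<bar>f N\<bar> + 1)"
    using N by (rule evt_mono) linarith
  then show ?thesis using that[of "\<bar>f N\<bar> + 1"] by linarith
qed

lemma abs_mult_less_half:
  fixes a :: "'k::linordered_field"
  assumes "\<bar>a\<bar> < b" "b > 0" "\<bar>d\<bar> < e / (2 * b)"
  shows "\<bar>a * d\<bar> < e / 2"
proof -
  have "\<bar>a * d\<bar> \<le> b * \<bar>d\<bar>" using assms by (simp add: abs_mult mult_right_mono)
  also have "\<dots> < b * (e / (2 * b))" using assms by (intro mult_strict_left_mono)
  also have "\<dots> = e / 2" using assms by simp
  finally show ?thesis .
qed

lemma cauchy_mult:
  fixes f g :: "'i::linorder \<Rightarrow> 'k::linordered_field"
  assumes "cauchy f" "cauchy g"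
  shows "cauchy (\<lambda>i. f i * g i)"
proof (rule cauchyI)
  fix e :: 'k assume "e > 0"
  obtain b where b: "b > 0" "evt (\<lambda>n. \<bar>f n\<bar> < b)" using cauchy_bounded[OF assms(1)] .
  obtain c where c: "c > 0" "evt (\<lambda>n. \<bar>g n\<bar> < c)" using cauchy_bounded[OF assms(2)] .
  define d where "d = e / (2 * (b + c))"
  have d: "d > 0" "d \<le> e / (2 * b)" "d \<le> e / (2 * c)"
    using \<open>e > 0\<close> b(1) c(1) by (auto simp: d_def intro!: divide_left_mono)
  obtain M where M: "\<forall>m\<ge>M. \<bar>f m\<bar> < b \<and> \<bar>g m\<bar> < c"
    using evt_conj[OF b(2) c(2)] unfolding evt_def by blast
  obtain L where L: "\<forall>m\<ge>L. \<forall>n\<ge>L. \<bar>f m - f n\<bar> < d" using assms d unfolding cauchy_def by blast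
  obtain K where K: "\<forall>m\<ge>K. \<forall>n\<ge>K. \<bar>g m - g n\<bar> < d" using assms d unfolding cauchy_def by blast
  define N where "N = max M (max L K)"
  have "\<bar>f n * g n - f N * g N\<bar> < e" if "n \<ge> N" for n
  proof -
    have N: "N \<ge> M" "N \<ge> L" "N \<ge> K" "n \<ge> M" "n \<ge> L" "n \<ge> K" using that by (auto simp: N_def le_max_iff_disj)
    have fN: "\<bar>f n - f N\<bar> < d" "\<bar>g n - g N\<bar> < d" using L K N by blast+
    have "\<bar>f n * (g n - g N)\<bar> < e / 2"
      using M N d fN b(1) by (intro abs_mult_less_half[of _ b]) (auto intro: less_le_trans)
    moreover have "\<bar>g N * (f n - f N)\<bar> < e / 2"
      using M N d fN c(1) by (intro abs_mult_less_half[of _ c]) (auto intro: less_le_trans)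
    moreover have "f n * g n - f N * g N = f n * (g n - g N) + g N * (f n - f N)"
      by (simp add: algebra_simps)
    ultimately show ?thesis by linarith
  qed
  then show "\<exists>N. evt (\<lambda>n. \<bar>f n * g n - f N * g N\<bar> < e)"
    unfolding evt_def by blast
qed

lemma null_iff: "null f \<longleftrightarrow> (\<forall>e>0. evt (\<lambda>n. \<bar>f n\<bar> < e))"
  by (simp add: null_def evt_def)

lemma null_add:
  fixes f g :: "'i::linorder \<Rightarrow> 'k::linordered_field"
  assumes "null f" "null g"
  shows "null (\<lambda>i. f i + g i)"
  unfolding null_iff
proof (intro allI impI)
  fix e :: 'k assume "e > 0"
  then have "evt (\<lambda>n. \<bar>f n\<bar> < e / 2 \<and> \<bar>g n\<bar> < e / 2)"
    using assms by (intro evt_conj) (auto simp: null_iff)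
  then show "evt (\<lambda>n. \<bar>f n + g n\<bar> < e)" by (rule evt_mono) linarith
qed

lemma null_minus: "null f \<Longrightarrow> null (\<lambda>i. - f i)"
  by (simp add: null_def)

lemma null_mult:
  fixes f g :: "'i::linorder \<Rightarrow> 'k::linordered_field"
  assumes "cauchy f" "null g"
  shows "null (\<lambda>i. f i * g i)"
  unfolding null_iff
proof (intro allI impI)
  fix e :: 'k assume "e > 0"
  obtain b where b: "b > 0" "evt (\<lambda>n. \<bar>f n\<bar> < b)" using cauchy_bounded[OF assms(1)] .
  have "evt (\<lambda>n. \<bar>f n\<bar> < b \<and> \<bar>g n\<bar> < e / (2 * b))"
    using assms(2) b \<open>e > 0\<close> by (intro evt_conj) (auto simp: null_iff)
  then have "evt (\<lambda>n. \<bar>f n * g n\<bar> < e / 2)"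
    by (rule evt_mono) (use b abs_mult_less_half in blast)
  then show "evt (\<lambda>n. \<bar>f n * g n\<bar> < e)" by (rule evt_mono) (use \<open>e > 0\<close> in linarith)
qed

definition crel :: "('i::linorder \<Rightarrow> 'k::linordered_field) \<Rightarrow> ('i \<Rightarrow> 'k) \<Rightarrow> bool" where
  "crel f g \<longleftrightarrow> cauchy f \<and> cauchy g \<and> null (\<lambda>i. f i - g i)"

lemma crel_const: "crel (\<lambda>_. c) (\<lambda>_. c)"
  by (simp add: crel_def cauchy_const null_def)

lemma part_equivp_crel: "part_equivp crel"
proof (rule part_equivpI)
  show "\<exists>x. crel x x" using crel_const by blast
  show "symp crel"
    by (auto simp: symp_def crel_def null_def abs_minus_commute)
  show "transp crel"
  proof (rule transpI)
    fix f g h assume "crel f g" "crel g h"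
    then show "crel f h"
      using null_add[of "\<lambda>i. f i - g i" "\<lambda>i. g i - h i"] by (simp add: crel_def)
  qed
qed

quotient_type (overloaded) ('i, 'k) compl = "'i::linorder \<Rightarrow> 'k::linordered_field" / partial: crel
  morphisms rep_cauchy Abs_cauchy
  by (rule part_equivp_crel)

text \<open>The uniform gap makes the relation invariant under adding null sequences, which the mere
  eventual \<open>f n < g n\<close> is not.\<close>

definition evless :: "('i::linorder \<Rightarrow> 'k::linordered_field) \<Rightarrow> ('i \<Rightarrow> 'k) \<Rightarrow> bool" where
  "evless f g \<longleftrightarrow> (\<exists>e>0. evt (\<lambda>n. f n + e < g n))"

lemma evless_cong:
  assumes "crel f f'" "crel g g'" "evless f g"
  shows "evless f' g'"
proof -
  obtain e where e: "e > 0" "evt (\<lambda>n. f n + e < g n)" using assms(3) unfolding evless_def by blast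
  have "evt (\<lambda>n. \<bar>f n - f' n\<bar> < e / 4 \<and> \<bar>g n - g' n\<bar> < e / 4)"
    using assms e by (intro evt_conj) (auto simp: crel_def null_iff)
  from evt_conj[OF e(2) this] have "evt (\<lambda>n. f' n + e / 2 < g' n)"
    by (rule evt_mono) linarith
  then show ?thesis unfolding evless_def using e(1) half_gt_zero by blast
qed

lemma crel_sym: "crel f g \<Longrightarrow> crel g f"
  using part_equivp_crel part_equivp_symp by metis

text \<open>At an index \<open>N\<close> past which both sequences vary by less than
  \<open>e / 8\<close>, a difference of at least \<open>e / 2\<close> would persist with gap
  \<open>e / 8\<close>. Excluding both signs leaves a null difference.\<close>

lemma evless_linear:
  fixes f g :: "'i::linorder \<Rightarrow> 'k::linordered_field"
  assumes "cauchy f" "cauchy g" "\<not> evless f g" "\<not> evless g f"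
  shows "crel f g"
proof -
  have "evt (\<lambda>n. \<bar>f n - g n\<bar> < e)" if "e > 0" for e
  proof -
    obtain N where N: "evt (\<lambda>n. \<bar>f n - f N\<bar> < e / 8 \<and> \<bar>g n - g N\<bar> < e / 8)"
      using cauchy_pair[OF assms(1,2), of "e / 8"] \<open>e > 0\<close> by (fastforce simp: zero_less_divide_iff)
    have "\<bar>f N - g N\<bar> < e / 2"
    proof (rule ccontr)
      assume "\<not> ?thesis"
      then consider "f N \<le> g N - e / 2" | "g N \<le> f N - e / 2" by linarith
      then show False
      proof cases
        case 1
        then have "evt (\<lambda>n. f n + e / 8 < g n)" by (intro evt_mono[OF N]) linarith
        then show False using assms(3) that unfolding evless_def by fastforce
      next
        case 2
        then have "evt (\<lambda>n. g n + e / 8 < f n)" by (intro evt_mono[OF N]) linarith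
        then show False using assms(4) that unfolding evless_def by fastforce
      qed
    qed
    then show ?thesis by (intro evt_mono[OF N]) linarith
  qed
  then show ?thesis using assms(1,2) by (simp add: crel_def null_iff)
qed

lemma evless_asym: "evless f g \<Longrightarrow> \<not> evless g f"
proof
  assume "evless f g" "evless g f"
  then obtain d e where de: "d > 0" "e > 0" "evt (\<lambda>n. f n + e < g n)" "evt (\<lambda>n. g n + d < f n)"
    unfolding evless_def by blast
  from evt_conj[OF de(3,4)] have "evt (\<lambda>n::'a. False)" by (rule evt_mono) (use de(1,2) in linarith)
  then show False by simp
qed

lemma evless_trans: "evless f g \<Longrightarrow> evless g h \<Longrightarrow> evless f h"
proof -
  assume "evless f g" "evless g h"
  then obtain d e where de: "d > 0" "e > 0" "evt (\<lambda>n. f n + e < g n)" "evt (\<lambda>n. g n + d < h n)"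
    unfolding evless_def by blast
  from evt_conj[OF de(3,4)] have "evt (\<lambda>n. f n + e < h n)" by (rule evt_mono) (use de(1,2) in linarith)
  then show ?thesis using de unfolding evless_def by blast
qed

lemma evless_mult:
  assumes "evless f g" "evless (\<lambda>_. 0) h"
  shows "evless (\<lambda>i. h i * f i) (\<lambda>i. h i * g i)"
proof -
  obtain d e where de: "d > 0" "e > 0" "evt (\<lambda>n. f n + e < g n)" "evt (\<lambda>n. 0 + d < h n)"
    using assms unfolding evless_def by blast
  from evt_conj[OF de(3,4)] have "evt (\<lambda>n. h n * f n + d * e < h n * g n)"
  proof (rule evt_mono)
    fix n assume n: "f n + e < g n \<and> 0 + d < h n"
    have "h n * f n + d * e < h n * f n + h n * e" using n de by (simp add: mult_strict_right_mono)
    also have "\<dots> = h n * (f n + e)" by (simp add: algebra_simps)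
    also have "\<dots> < h n * g n" using n de(1) by (intro mult_strict_left_mono) auto
    finally show "h n * f n + d * e < h n * g n" .
  qed
  then show ?thesis using de(1,2) unfolding evless_def by (meson mult_pos_pos)
qed

instantiation compl :: (linorder, linordered_field) linordered_idom
begin

lift_definition zero_compl :: "('a, 'b) compl" is "\<lambda>_. 0" by (rule crel_const)
lift_definition one_compl :: "('a, 'b) compl" is "\<lambda>_. 1" by (rule crel_const)
lift_definition plus_compl :: "('a, 'b) compl \<Rightarrow> ('a, 'b) compl \<Rightarrow> ('a, 'b) compl"
  is "\<lambda>f g i. f i + g i"
proof -
  fix f f' g g' :: "'a \<Rightarrow> 'b" assume "crel f f'" "crel g g'"
  then show "crel (\<lambda>i. f i + g i) (\<lambda>i. f' i + g' i)"
    using null_add[of "\<lambda>i. f i - f' i" "\<lambda>i. g i - g' i"] by (simp add: crel_def cauchy_add algebra_simps)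
qed
lift_definition uminus_compl :: "('a, 'b) compl \<Rightarrow> ('a, 'b) compl" is "\<lambda>f i. - f i"
proof -
  fix f f' :: "'a \<Rightarrow> 'b" assume "crel f f'"
  then show "crel (\<lambda>i. - f i) (\<lambda>i. - f' i)"
    using null_minus[of "\<lambda>i. f i - f' i"] by (simp add: crel_def cauchy_minus)
qed
definition minus_compl :: "('a, 'b) compl \<Rightarrow> ('a, 'b) compl \<Rightarrow> ('a, 'b) compl" where
  "x - y = x + - y" for x y :: "('a, 'b) compl"
lift_definition times_compl :: "('a, 'b) compl \<Rightarrow> ('a, 'b) compl \<Rightarrow> ('a, 'b) compl"
  is "\<lambda>f g i. f i * g i"
proof -
  fix f f' g g' :: "'a \<Rightarrow> 'b" assume "crel f f'" "crel g g'"
  then show "crel (\<lambda>i. f i * g i) (\<lambda>i. f' i * g' i)"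
    using null_add[OF null_mult[of f "\<lambda>i. g i - g' i"] null_mult[of g' "\<lambda>i. f i - f' i"]]
    by (simp add: crel_def cauchy_mult algebra_simps)
qed
lift_definition less_compl :: "('a, 'b) compl \<Rightarrow> ('a, 'b) compl \<Rightarrow> bool" is evless
  using evless_cong crel_sym by blast
definition less_eq_compl :: "('a, 'b) compl \<Rightarrow> ('a, 'b) compl \<Rightarrow> bool" where
  "x \<le> y \<longleftrightarrow> \<not> y < x" for x y :: "('a, 'b) compl"
definition abs_compl :: "('a, 'b) compl \<Rightarrow> ('a, 'b) compl" where
  "abs_compl x = (if x < 0 then - x else x)"
definition sgn_compl :: "('a, 'b) compl \<Rightarrow> ('a, 'b) compl" where
  "sgn_compl x = (if x = 0 then 0 else if 0 < x then 1 else - 1)"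

instance
proof
  fix a b c :: "('a, 'b) compl"
  have asym: "\<not> y < x" if "x < y" for x y :: "('a, 'b) compl"
    using that by transfer (rule evless_asym)
  have lin: "x < y \<or> x = y \<or> y < x" for x y :: "('a, 'b) compl"
    by transfer (auto simp: crel_def dest: evless_linear)
  have trans: "x < z" if "x < y" "y < z" for x y z :: "('a, 'b) compl"
    using that by transfer (rule evless_trans)
  show "a * b * c = a * (b * c)"
    by transfer (simp add: crel_def null_def cauchy_mult algebra_simps)
  show "a * b = b * a" by transfer (simp add: crel_def null_def cauchy_mult algebra_simps)
  show "1 * a = a" by transfer (simp add: crel_def null_def)
  show "(a + b) * c = a * c + b * c"
    by transfer (simp add: crel_def null_def cauchy_mult cauchy_add algebra_simps)
  show "a + b + c = a + (b + c)"
    by transfer (simp add: crel_def null_def cauchy_add algebra_simps)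
  show "a + b = b + a" by transfer (simp add: crel_def null_def cauchy_add algebra_simps)
  show "0 + a = a" by transfer (simp add: crel_def null_def)
  show "- a + a = 0" by transfer (simp add: crel_def null_def cauchy_const)
  show "a - b = a + - b" by (simp add: minus_compl_def)
  show "a + b - a = b" unfolding minus_compl_def
    by transfer (simp add: crel_def null_def cauchy_add cauchy_minus algebra_simps)
  show "a - b - c = a - (b + c)" unfolding minus_compl_def
    by transfer (simp add: crel_def null_def cauchy_add cauchy_minus cauchy_diff algebra_simps)
  show "0 * a = 0" "a * 0 = 0" by (transfer; simp add: crel_def null_def cauchy_const)+
  show "(0::('a, 'b) compl) \<noteq> 1"
    by transfer (auto simp: crel_def null_def intro!: exI[of _ "1::'b"])
  show "a < b \<longleftrightarrow> a \<le> b \<and> \<not> b \<le> a" using asym by (auto simp: less_eq_compl_def)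
  show "a \<le> a" unfolding less_eq_compl_def by (metis asym)
  show "a \<le> b \<or> b \<le> a" unfolding less_eq_compl_def using asym[of a b] by blast
  show "a = b" if "a \<le> b" "b \<le> a" using that lin by (auto simp: less_eq_compl_def)
  show "a \<le> c" if "a \<le> b" "b \<le> c" using that lin trans asym unfolding less_eq_compl_def by metis
  show "c + a \<le> c + b" if "a \<le> b" using that unfolding less_eq_compl_def
    by transfer (simp add: evless_def algebra_simps)
  show "c * a < c * b" if "a < b" "0 < c" using that by transfer (rule evless_mult)
  show "\<bar>a\<bar> = (if a < 0 then - a else a)" by (rule abs_compl_def)
  show "sgn a = (if a = 0 then 0 else if 0 < a then 1 else - 1)" by (rule sgn_compl_def)
qed

end

lift_definition kr :: "'k::linordered_field \<Rightarrow> ('i::linorder, 'k) compl" is "\<lambda>c _. c"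
  by (rule crel_const)

definition cl :: "('i::linorder \<Rightarrow> 'k::linordered_field) \<Rightarrow> ('i, 'k) compl" where
  "cl f = Abs_cauchy f"

lemma kr_eq_cl: "kr c = cl (\<lambda>_. c)"
  by (simp add: cl_def kr.abs_eq crel_const)

lemma cl_add: "cauchy f \<Longrightarrow> cauchy g \<Longrightarrow> cl (\<lambda>i. f i + g i) = cl f + cl g"
  by (simp add: cl_def plus_compl.abs_eq crel_def null_def)

lemma cl_mult: "cauchy f \<Longrightarrow> cauchy g \<Longrightarrow> cl (\<lambda>i. f i * g i) = cl f * cl g"
  by (simp add: cl_def times_compl.abs_eq crel_def null_def)

lemma cl_minus: "cauchy f \<Longrightarrow> cl (\<lambda>i. - f i) = - cl f"
  by (simp add: cl_def uminus_compl.abs_eq crel_def null_def)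

lemma cl_less: "cauchy f \<Longrightarrow> cauchy g \<Longrightarrow> cl f < cl g \<longleftrightarrow> evless f g"
  by (simp add: cl_def less_compl.abs_eq crel_def null_def)

lemma compl_cases:
  fixes x :: "('i::linorder, 'k::linordered_field) compl"
  obtains f where "cauchy f" "x = cl f"
proof -
  have "\<exists>f. cauchy f \<and> x = cl f"
    unfolding cl_def by (induction x rule: compl.abs_induct) (auto simp: crel_def)
  then show ?thesis using that by blast
qed

lemma kr_simps [simp]:
  "kr 0 = 0" "kr 1 = 1" "kr (a + b) = kr a + kr b" "kr (a * b) = kr a * kr b" "kr (- a) = - kr a"
      apply (simp add: kr_eq_cl cl_def zero_compl_def)
     apply (simp add: kr_eq_cl cl_def one_compl_def)
    apply (simp add: kr_eq_cl cl_add[symmetric] cauchy_const)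
   apply (simp add: kr_eq_cl cl_mult[symmetric] cauchy_const)
  apply (simp add: kr_eq_cl cl_minus[symmetric] cauchy_const)
  done

lemma kr_diff [simp]: "kr (a - b) = kr a - kr b"
  by (metis kr_simps(3,5) diff_conv_add_uminus)

lemma kr_numeral [simp]: "kr (numeral n) = numeral n"
  by (induction n) (simp_all only: numeral.simps kr_simps)

lemma kr_less [simp]: "kr a < kr b \<longleftrightarrow> a < b"
proof -
  have "(\<exists>e>0. a + e < b) \<longleftrightarrow> a < b"
    using dense[of 0 "b - a"] by (auto intro: less_trans add_strict_increasing simp: less_diff_eq add.commute)
  then show ?thesis by (simp add: kr_eq_cl cl_less cauchy_const evless_def)
qed

lemma kr_le [simp]: "kr a \<le> kr b \<longleftrightarrow> a \<le> b"
  by (simp add: not_less[symmetric])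

lemma kr_eq [simp]: "kr a = kr b \<longleftrightarrow> a = b"
  by (simp add: eq_iff)

lemma cl_le:
  fixes f g :: "'i::linorder \<Rightarrow> 'k::linordered_field"
  assumes "cauchy f" "cauchy g"
  shows "cl f \<le> cl g \<longleftrightarrow> (\<forall>e>0. evt (\<lambda>n. f n \<le> g n + e))"
proof
  assume le: "cl f \<le> cl g"
  show "\<forall>e>0. evt (\<lambda>n. f n \<le> g n + e)"
  proof (intro allI impI)
    fix e :: 'k assume e: "e > 0"
    obtain N where N: "evt (\<lambda>n. \<bar>f n - f N\<bar> < e / 4 \<and> \<bar>g n - g N\<bar> < e / 4)"
      using cauchy_pair[OF assms, of "e / 4"] e by (auto simp: zero_less_divide_iff)
    have "f N \<le> g N + e / 2"
    proof (rule ccontr)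
      assume "\<not> f N \<le> g N + e / 2"
      then have "evt (\<lambda>n. g n + (f N - g N - e / 2) < f n)"
        by (intro evt_mono[OF N]) linarith
      then have "evless g f" unfolding evless_def using \<open>\<not> f N \<le> g N + e / 2\<close> by (intro exI[of _ "f N - g N - e / 2"]) (auto simp: add.commute)
      then show False using le assms by (simp add: cl_less[symmetric] not_less)
    qed
    then show "evt (\<lambda>n. f n \<le> g n + e)" by (intro evt_mono[OF N]) linarith
  qed
next
  assume *: "\<forall>e>0. evt (\<lambda>n. f n \<le> g n + e)"
  have "\<not> evless g f"
  proof
    assume "evless g f"
    then obtain e where e: "e > 0" "evt (\<lambda>n. g n + e < f n)" unfolding evless_def by blast
    from evt_conj[OF e(2) *[rule_format, OF e(1)]] have "evt (\<lambda>n::'i. False)"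
      by (rule evt_mono) linarith
    then show False by simp
  qed
  then show "cl f \<le> cl g" using assms by (simp add: cl_less[symmetric] not_less)
qed

text \<open>The witness \<open>f N + e / 2\<close> is read off where both sequences have settled to
  within an eighth of the gap \<open>e\<close>.\<close>

lemma kr_dense:
  assumes "x < y" obtains t where "x < kr t" "kr t < y"
proof -
  obtain f g where [simp]: "x = cl f" "y = cl g" and c: "cauchy f" "cauchy g"
    using compl_cases by metis
  obtain e where e: "e > 0" "evt (\<lambda>n. f n + e < g n)"
    using assms c by (auto simp: cl_less evless_def)
  obtain N where N: "evt (\<lambda>n. \<bar>f n - f N\<bar> < e / 8 \<and> \<bar>g n - g N\<bar> < e / 8)"
    using cauchy_pair[OF c, of "e / 8"] e by (auto simp: zero_less_divide_iff)
  have "evt (\<lambda>n. f n + e / 8 < f N + e / 2)" by (rule evt_mono[OF N]) (use e in linarith)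
  moreover have "evt (\<lambda>n. f N + e / 2 + e / 8 < g n)"
    by (rule evt_mono[OF evt_conj[OF N e(2)]]) linarith
  moreover have "e / 8 > 0" using e by (simp add: zero_less_divide_iff)
  ultimately have "evless f (\<lambda>_. f N + e / 2)" "evless (\<lambda>_. f N + e / 2) g"
    unfolding evless_def by blast+
  then have "x < kr (f N + e / 2)" "kr (f N + e / 2) < y"
    using c unfolding kr_eq_cl \<open>x = cl f\<close> \<open>y = cl g\<close> by (simp_all add: cl_less cauchy_const)
  then show ?thesis using that by blast
qed

lemma kr_abs [simp]: "kr \<bar>a\<bar> = \<bar>kr a\<bar>"
  by (simp add: abs_if flip: kr_simps)

lemma cl_approx:
  assumes "cauchy f" "\<And>m. m \<ge> n \<Longrightarrow> \<bar>f m - f n\<bar> \<le> e"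
  shows "\<bar>cl f - kr (f n)\<bar> \<le> kr e"
proof -
  have ev: "evt (\<lambda>m. \<bar>f m - f n\<bar> \<le> e)" using assms(2) by (auto simp: evt_def)
  have "cl f \<le> kr (f n + e)" unfolding kr_eq_cl
    by (subst cl_le[OF assms(1) cauchy_const]) (auto intro!: evt_mono[OF ev])
  moreover have "kr (f n - e) \<le> cl f" unfolding kr_eq_cl
    by (subst cl_le[OF cauchy_const assms(1)]) (auto intro!: evt_mono[OF ev])
  ultimately show ?thesis unfolding kr_simps kr_diff by (intro abs_leI) (simp_all add: algebra_simps)
qed

section \<open>First-order arithmetic in a model of \<open>RCA\<^sub>0\<close>\<close>

text \<open>Bound variables are counted as well, so a variable outside \<open>fvs\<close> does not
  occur at all and can carry a dummy quantifier.\<close>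

primrec fvs :: "l2_form \<Rightarrow> nat set" where
  "fvs (Equal s t) = tvars s \<union> tvars t"
| "fvs (Less s t) = tvars s \<union> tvars t"
| "fvs (Mem t j) = tvars t"
| "fvs (Neg \<phi>) = fvs \<phi>"
| "fvs (Conj \<phi> \<psi>) = fvs \<phi> \<union> fvs \<psi>"
| "fvs (Exis i \<phi>) = insert i (fvs \<phi>)"

lemma finite_tvars: "finite (tvars t)"
  by (induction t) auto

lemma finite_fvs: "finite (fvs \<phi>)"
  by (induction \<phi>) (auto simp: finite_tvars)

lemma tval_cong: "(\<And>i. i \<in> tvars t \<Longrightarrow> e i = e' i) \<Longrightarrow> tval e t = tval e' t"
  by (induction t) auto

lemma sat_cong: "(\<And>i. i \<in> fvs \<phi> \<Longrightarrow> e i = e' i) \<Longrightarrow> sat E e \<phi> = sat E e' \<phi>"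
proof (induction \<phi> arbitrary: e e')
  case (Equal s t)
  have "tval e s = tval e' s" "tval e t = tval e' t"
    by (rule tval_cong, rule Equal.prems, simp)+
  then show ?case by (simp only: sat.simps)
next
  case (Less s t)
  have "tval e s = tval e' s" "tval e t = tval e' t"
    by (rule tval_cong, rule Less.prems, simp)+
  then show ?case by (simp only: sat.simps)
next
  case (Mem t j)
  have "tval e t = tval e' t"
    by (rule tval_cong, rule Mem.prems, simp)
  then show ?case by (simp only: sat.simps)
next
  case (Neg \<phi>)
  have "sat E e \<phi> = sat E e' \<phi>"
    by (rule Neg.IH, rule Neg.prems, simp)
  then show ?case by (simp only: sat.simps)
next
  case (Conj \<phi> \<psi>)
  have "sat E e \<phi> = sat E e' \<phi>" "sat E e \<psi> = sat E e' \<psi>"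
    by (rule Conj.IH, rule Conj.prems, simp)+
  then show ?case by (simp only: sat.simps)
next
  case (Exis j \<phi>)
  have "sat E (e(j := a)) \<phi> = sat E (e'(j := a)) \<phi>" for a
  proof (rule Exis.IH)
    fix i assume "i \<in> fvs \<phi>"
    then show "(e(j := a)) i = (e'(j := a)) i" using Exis.prems[of i] by simp
  qed
  then show ?case by (simp only: sat.simps)
qed

lemma fresh_var: obtains k where "k \<notin> fvs \<phi>" "k \<noteq> i"
proof -
  obtain k where "k \<notin> insert i (fvs \<phi>)"
    using ex_new_if_finite[of "insert i (fvs \<phi>)"] finite_fvs by auto
  then show ?thesis using that by blast
qed

lemma sat_fresh: "k \<notin> fvs \<phi> \<Longrightarrow> sat E (e(k := a)) \<phi> = sat E e \<phi>"
  by (rule sat_cong) auto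

lemma Sigma00_simps [simp]:
  "Sigma00 (Equal s t)" "Sigma00 (Less s t)" "Sigma00 (Mem t j)"
  "Sigma00 (Neg \<phi>) \<longleftrightarrow> Sigma00 \<phi>" "Sigma00 (Conj \<phi> \<psi>) \<longleftrightarrow> Sigma00 \<phi> \<and> Sigma00 \<psi>"
  "i \<notin> tvars t \<Longrightarrow> Sigma00 (Exis i (Conj (Less (Var i) t) \<phi>)) \<longleftrightarrow> Sigma00 \<phi>"
  by (auto intro: Sigma00.intros elim: Sigma00.cases)

locale rca0 =
  fixes S :: "'a::l2_sig set set"
  assumes rca0: "RCA0 S"
begin

section \<open>Induction, comprehension and the laws of an ordered semiring\<close>

lemma ax:
  fixes m n :: 'a
  shows S_nz: "m + 1 \<noteq> 0" and S_inj: "m + 1 = n + 1 \<Longrightarrow> m = n"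
    and add_0: "m + 0 = m" and add_S: "m + (n + 1) = (m + n) + 1"
    and mult_0: "m * 0 = 0" and mult_S: "m * (n + 1) = m * n + m"
    and not_less_0: "\<not> m < 0" and less_S: "m < n + 1 \<longleftrightarrow> m < n \<or> m = n"
  using rca0 by (auto simp: RCA0_def basic_axioms_def)

lemma S_nonempty: obtains X where "X \<in> S"
  using rca0 by (auto simp: RCA0_def)

lemma sigma01_ind:
  assumes "Sigma00 \<theta>" "range E \<subseteq> S"
    and "\<exists>m. sat E (e(i := 0, k := m)) \<theta>"
    and "\<And>n. \<exists>m. sat E (e(i := n, k := m)) \<theta> \<Longrightarrow> \<exists>m. sat E (e(i := n + 1, k := m)) \<theta>"
  shows "\<exists>m. sat E (e(i := n, k := m)) \<theta>"
proof -
  have "Sigma01 (Exis k \<theta>)" using assms(1) by (auto simp: Sigma01_def)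
  then have "\<forall>n. sat E (e(i := n)) (Exis k \<theta>)"
    using assms rca0 unfolding RCA0_def by (metis sat.simps(6))
  then show ?thesis by simp
qed

lemma sigma00_ind:
  assumes "Sigma00 \<theta>" "range E \<subseteq> S" "sat E (e(i := 0)) \<theta>"
    and "\<And>n. sat E (e(i := n)) \<theta> \<Longrightarrow> sat E (e(i := n + 1)) \<theta>"
  shows "sat E (e(i := n)) \<theta>"
proof -
  obtain k where k: "k \<notin> fvs \<theta>" "k \<noteq> i" by (rule fresh_var)
  have "\<exists>m. sat E (e(i := n, k := m)) \<theta>"
    by (rule sigma01_ind) (use assms k in \<open>auto simp: sat_fresh\<close>)
  then show ?thesis using k by (simp add: sat_fresh)
qed

lemma comp01:
  assumes "Sigma00 \<theta>" "Sigma00 \<eta>" "range E \<subseteq> S"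
    and "\<And>n. (\<exists>m. sat E (e(i := n, k := m)) \<theta>) \<longleftrightarrow> (\<forall>m. sat E (e(i := n, k := m)) \<eta>)"
  shows "{n. \<exists>m. sat E (e(i := n, k := m)) \<theta>} \<in> S"
proof -
  have "Sigma01 (Exis k \<theta>)" "Pi01 (Neg (Exis k (Neg \<eta>)))"
    using assms(1,2) by (auto simp: Sigma01_def Pi01_def)
  moreover have "\<forall>n. sat E (e(i := n)) (Exis k \<theta>) \<longleftrightarrow> sat E (e(i := n)) (Neg (Exis k (Neg \<eta>)))"
    using assms(4) by simp
  ultimately have "{n. sat E (e(i := n)) (Exis k \<theta>)} \<in> S"
    using assms(3) rca0 unfolding RCA0_def by blast
  then show ?thesis by simp
qed

lemma comp00:
  assumes "Sigma00 \<theta>" "range E \<subseteq> S"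
  shows "{n. sat E (e(i := n)) \<theta>} \<in> S"
proof -
  obtain k where k: "k \<notin> fvs \<theta>" "k \<noteq> i" by (rule fresh_var)
  have "{n. \<exists>m. sat E (e(i := n, k := m)) \<theta>} \<in> S"
    by (rule comp01[of \<theta> \<theta>]) (use assms k in \<open>auto simp: sat_fresh\<close>)
  then show ?thesis using k by (simp add: sat_fresh)
qed

text \<open>Variable \<open>0\<close> is the induction variable and the others hold parameters. Any
  member of \<open>S\<close> may interpret the set variables, since they do not occur in an equation
  of terms.\<close>

lemma eq_ind:
  assumes "tval (e(0 := 0)) s = tval (e(0 := 0)) t"
    and "\<And>n. tval (e(0 := n)) s = tval (e(0 := n)) t \<Longrightarrow> tval (e(0 := n + 1)) s = tval (e(0 := n + 1)) t"
  shows "tval (e(0 := n :: 'a)) s = tval (e(0 := n)) t"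
proof -
  obtain X where "X \<in> S" by (rule S_nonempty)
  then show ?thesis
    using sigma00_ind[of "Equal s t" "\<lambda>_. X" e 0 n] assms by auto
qed

lemma qf_ind:
  assumes "Sigma00 \<theta>"
    and "\<And>E. sat E (e(0 := 0)) \<theta>"
    and "\<And>E n. sat E (e(0 := n)) \<theta> \<Longrightarrow> sat E (e(0 := n + 1)) \<theta>"
  obtains E where "sat E (e(0 := n :: 'a)) \<theta>"
proof -
  obtain X where "X \<in> S" by (rule S_nonempty)
  then show ?thesis
    using sigma00_ind[of \<theta> "\<lambda>_. X" e 0 n] assms that by auto
qed

lemma add_assoc: "(a + b) + n = a + (b + n :: 'a)"
  using eq_ind[of "(\<lambda>_. 0)(1 := a, 2 := b)" "Add (Add (Var 1) (Var 2)) (Var 0)"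
      "Add (Var 1) (Add (Var 2) (Var 0))" n]
  by (simp add: add_0 add_S)

lemma zero_add: "0 + n = (n :: 'a)"
  using eq_ind[of "\<lambda>_. 0" "Add Zero (Var 0)" "Var 0" n] by (simp add: add_0 add_S)

lemma S_add: "(a + 1) + n = (a + n) + (1 :: 'a)"
  using eq_ind[of "(\<lambda>_. 0)(1 := a)" "Add (Add (Var 1) One) (Var 0)"
      "Add (Add (Var 1) (Var 0)) One" n]
  by (simp add: add_0 add_S)

lemma add_comm: "a + n = n + (a :: 'a)"
  using eq_ind[of "(\<lambda>_. 0)(1 := a)" "Add (Var 1) (Var 0)" "Add (Var 0) (Var 1)" n]
  by (simp add: add_0 zero_add add_S S_add[of _ a])

lemma zero_mult: "0 * n = (0 :: 'a)"
  using eq_ind[of "\<lambda>_. 0" "Mul Zero (Var 0)" "Zero" n] by (simp add: mult_0 mult_S add_0)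

lemma distrib_l: "a * (b + n) = a * b + a * (n :: 'a)"
  using eq_ind[of "(\<lambda>_. 0)(1 := a, 2 := b)" "Mul (Var 1) (Add (Var 2) (Var 0))"
      "Add (Mul (Var 1) (Var 2)) (Mul (Var 1) (Var 0))" n]
  by (simp add: add_0 add_S mult_0 mult_S add_assoc[of "a * b" _ a])

lemma mult_assoc': "(a * b) * n = a * (b * n :: 'a)"
  using eq_ind[of "(\<lambda>_. 0)(1 := a, 2 := b)" "Mul (Mul (Var 1) (Var 2)) (Var 0)"
      "Mul (Var 1) (Mul (Var 2) (Var 0))" n]
  by (simp add: mult_0 mult_S distrib_l[of a _ b])

lemma S_mult: "(a + 1) * n = a * n + (n :: 'a)"
proof -
  have "a + (b + 1) = b + (a + (1 :: 'a))" for a b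
    using add_comm add_assoc by metis
  then have *: "c + b + (a + 1) = c + a + (b + (1 :: 'a))" for a b c
    by (metis add_assoc)
  show ?thesis
    using eq_ind[of "(\<lambda>_. 0)(1 := a)" "Mul (Add (Var 1) One) (Var 0)"
        "Add (Mul (Var 1) (Var 0)) (Var 0)" n] *
    by (simp add: mult_0 add_0 mult_S)
qed

lemma mult_comm: "a * n = n * (a :: 'a)"
  using eq_ind[of "(\<lambda>_. 0)(1 := a)" "Mul (Var 1) (Var 0)" "Mul (Var 0) (Var 1)" n]
  by (simp add: mult_0 zero_mult mult_S S_mult)

lemma one_mult: "1 * a = (a :: 'a)"
  using S_mult[of 0 a] by (simp only: zero_add zero_mult)

lemma zero_le: "0 < n \<or> 0 = (n :: 'a)"
  by (rule qf_ind[of "Neg (Conj (Neg (Less Zero (Var 0))) (Neg (Equal Zero (Var 0))))" "\<lambda>_. 0" n])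
    (auto simp: less_S)

lemma less_trans': "a < b \<Longrightarrow> b < n \<Longrightarrow> a < (n :: 'a)"
  by (rule qf_ind[of "Neg (Conj (Conj (Less (Var 1) (Var 2)) (Less (Var 2) (Var 0))) (Neg (Less (Var 1) (Var 0))))"
      "(\<lambda>_. 0)(1 := a, 2 := b)" n])
    (auto simp: less_S not_less_0)

lemma S_le: "m < n \<Longrightarrow> m + 1 < n \<or> m + 1 = (n :: 'a)"
  by (rule qf_ind[of "Neg (Conj (Less (Var 1) (Var 0)) (Conj (Neg (Less (Add (Var 1) One) (Var 0)))
      (Neg (Equal (Add (Var 1) One) (Var 0)))))" "(\<lambda>_. 0)(1 := m)" n])
    (auto simp: less_S not_less_0)

lemma less_linear': "m < n \<or> m = n \<or> n < (m :: 'a)"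
proof (rule qf_ind[of "Neg (Conj (Neg (Less (Var 0) (Var 1))) (Conj (Neg (Equal (Var 0) (Var 1)))
      (Neg (Less (Var 1) (Var 0)))))" "(\<lambda>_. 0)(1 := n)" m])
qed (use zero_le[of n] in \<open>auto simp: less_S dest: S_le\<close>)

lemma less_irrefl': "\<not> n < (n :: 'a)"
proof -
  have *: "False" if "m + 1 < m + 1" "\<not> m < m" for m :: 'a
    using that less_S less_trans' by metis
  show ?thesis
    by (rule qf_ind[of "Neg (Less (Var 0) (Var 0))" "\<lambda>_. 0" n])
      (auto simp: not_less_0 dest: *)
qed

lemma S_less: "m + 1 < n + 1 \<longleftrightarrow> m < (n :: 'a)"
  by (metis S_le less_S less_irrefl' less_trans')

lemma add_less: "a < b \<Longrightarrow> a + n < b + (n :: 'a)"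
  by (rule qf_ind[of "Neg (Conj (Less (Var 1) (Var 2)) (Neg (Less (Add (Var 1) (Var 0)) (Add (Var 2) (Var 0)))))"
      "(\<lambda>_. 0)(1 := a, 2 := b)" n])
    (auto simp: add_0 add_S S_less)

text \<open>The first induction over a genuine existential quantifier. The implication is moved
  inside it, so that the matrix is quantifier-free.\<close>

lemma less_diff: "m < n \<Longrightarrow> \<exists>k. n = m + (k :: 'a)"
proof -
  obtain X where X: "X \<in> S" by (rule S_nonempty)
  have "\<exists>k. sat (\<lambda>_. X) (((\<lambda>_. 0)(2 := m))(0 := n, 1 := k))
     (Neg (Conj (Less (Var 2) (Var 0)) (Neg (Equal (Var 0) (Add (Var 2) (Var 1))))))"
  proof (rule sigma01_ind)
    fix n assume "\<exists>k. sat (\<lambda>_. X) (((\<lambda>_. 0)(2 := m))(0 := n, 1 := k))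
     (Neg (Conj (Less (Var 2) (Var 0)) (Neg (Equal (Var 0) (Add (Var 2) (Var 1))))))"
    then have *: "m < n \<longrightarrow> (\<exists>k. n = m + k)" by auto
    have "\<exists>k. n + 1 = m + k" if "m < n + 1"
      using * that less_S add_S by metis
    then show "\<exists>k. sat (\<lambda>_. X) (((\<lambda>_. 0)(2 := m))(0 := n + 1, 1 := k))
     (Neg (Conj (Less (Var 2) (Var 0)) (Neg (Equal (Var 0) (Add (Var 2) (Var 1))))))"
      by auto
  qed (use X in \<open>auto simp: not_less_0\<close>)
  then show "m < n \<Longrightarrow> \<exists>k. n = m + k" by auto
qed

lemma mult_less: "a < b \<Longrightarrow> 0 < c \<Longrightarrow> c * a < c * (b :: 'a)"
proof -
  assume ab: "a < b" and c: "0 < c"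
  obtain k where k: "b = a + k" using less_diff[OF ab] by blast
  have "k \<noteq> 0" using ab k less_irrefl' add_0 by metis
  then have "0 < k" using zero_le by metis
  then obtain j where j: "k = 0 + 1 + j" using S_le[of 0 k] less_diff add_0 by metis
  have "c * b = c * a + (c + c * j)"
    unfolding k j distrib_l zero_add by (metis mult_comm one_mult)
  moreover have "0 < c + c * j" using c add_less[OF c, of "c * j"] zero_le[of "c * j"] zero_add less_trans' by metis
  ultimately show ?thesis using add_less[of 0 "c + c * j" "c * a"] by (simp add: zero_add add_comm)
qed

end

section \<open>An ordered field containing the model\<close>

text \<open>Ring, field and completion are formed over every structure, not only over models. The
  laws are packed into one statement about the type, so that the carrier \<open>nn\<close> can be
  defined by cases on it.\<close>

definition good :: "'a::l2_sig itself \<Rightarrow> bool" where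
  "good _ \<longleftrightarrow>
    (\<forall>a b c::'a. a + b + c = a + (b + c)) \<and> (\<forall>a b::'a. a + b = b + a) \<and> (\<forall>a::'a. 0 + a = a) \<and>
    (\<forall>a b c::'a. a * b * c = a * (b * c)) \<and> (\<forall>a b::'a. a * b = b * a) \<and> (\<forall>a::'a. 1 * a = a) \<and>
    (\<forall>a::'a. 0 * a = 0) \<and> (\<forall>a b c::'a. c * (a + b) = c * a + c * b) \<and>
    (\<forall>a::'a. \<not> a < a) \<and> (\<forall>a b c::'a. a < b \<longrightarrow> b < c \<longrightarrow> a < c) \<and>
    (\<forall>a b::'a. a < b \<or> a = b \<or> b < a) \<and> (\<forall>a b c::'a. a < b \<longrightarrow> a + c < b + c) \<and>
    (\<forall>a b c::'a. a < b \<longrightarrow> 0 < c \<longrightarrow> c * a < c * b) \<and> (\<forall>a b::'a. a < b \<longrightarrow> (\<exists>c. b = a + c)) \<and>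
    (0::'a) < 1 \<and> (\<forall>a::'a. 0 < a \<or> 0 = a)"

lemma (in rca0) good: "good TYPE('a)"
proof -
  have "0 < (1::'a)" using less_S[of 0 0] by (simp add: zero_add)
  then show ?thesis
    unfolding good_def
    using add_assoc add_comm zero_add mult_assoc' mult_comm one_mult zero_mult distrib_l less_irrefl'
      less_trans' less_linear' add_less mult_less less_diff zero_le
    by blast
qed

lemma good_laws:
  fixes a b c :: "'a::l2_sig"
  assumes "good TYPE('a)"
  shows "a + b + c = a + (b + c)" "a + b = b + a" "0 + a = a"
    "a * b * c = a * (b * c)" "a * b = b * a" "1 * a = a" "0 * a = 0" "c * (a + b) = c * a + c * b"
    "\<not> a < a" "a < b \<Longrightarrow> b < c \<Longrightarrow> a < c" "a < b \<or> a = b \<or> b < a" "a < b \<Longrightarrow> a + c < b + c"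
    "a < b \<Longrightarrow> 0 < c \<Longrightarrow> c * a < c * b" "a < b \<Longrightarrow> \<exists>c. b = a + c" "(0 :: 'a) < 1" "0 < a \<or> 0 = a"
proof -
  note G = assms[unfolded good_def]
  note G1 = G[THEN conjunct1] and H1 = G[THEN conjunct2]
  note G2 = H1[THEN conjunct1] and H2 = H1[THEN conjunct2]
  note G3 = H2[THEN conjunct1] and H3 = H2[THEN conjunct2]
  note G4 = H3[THEN conjunct1] and H4 = H3[THEN conjunct2]
  note G5 = H4[THEN conjunct1] and H5 = H4[THEN conjunct2]
  note G6 = H5[THEN conjunct1] and H6 = H5[THEN conjunct2]
  note G7 = H6[THEN conjunct1] and H7 = H6[THEN conjunct2]
  note G8 = H7[THEN conjunct1] and H8 = H7[THEN conjunct2]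
  note G9 = H8[THEN conjunct1] and H9 = H8[THEN conjunct2]
  note G10 = H9[THEN conjunct1] and H10 = H9[THEN conjunct2]
  note G11 = H10[THEN conjunct1] and H11 = H10[THEN conjunct2]
  note G12 = H11[THEN conjunct1] and H12 = H11[THEN conjunct2]
  note G13 = H12[THEN conjunct1] and H13 = H12[THEN conjunct2]
  note G14 = H13[THEN conjunct1] and H14 = H13[THEN conjunct2]
  note G15 = H14[THEN conjunct1] and G16 = H14[THEN conjunct2]
  show "a + b + c = a + (b + c)" "a + b = b + a" "0 + a = a"
    "a * b * c = a * (b * c)" "a * b = b * a" "1 * a = a" "0 * a = 0" "c * (a + b) = c * a + c * b"
    "\<not> a < a" "a < b \<Longrightarrow> b < c \<Longrightarrow> a < c" "a < b \<or> a = b \<or> b < a" "a < b \<Longrightarrow> a + c < b + c"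
    "a < b \<Longrightarrow> 0 < c \<Longrightarrow> c * a < c * b" "a < b \<Longrightarrow> \<exists>c. b = a + c" "(0 :: 'a) < 1" "0 < a \<or> 0 = a"
    by (fact G1[rule_format] G2[rule_format] G3[rule_format] G4[rule_format] G5[rule_format] G6[rule_format]
        G7[rule_format] G8[rule_format] G9[rule_format] G10[rule_format] G11[rule_format] G12[rule_format]
        G13[rule_format] G14[rule_format] G15 G16[rule_format])+
qed

text \<open>A copy of \<open>'a\<close> if \<open>'a\<close> satisfies the above axioms, and the standard natural numbers otherwise.
  In this way the type is an ordered semiring unconditionally.\<close>

typedef (overloaded) ('a::l2_sig) nn =
  "{x :: 'a + nat. case x of Inl _ \<Rightarrow> good TYPE('a) | Inr _ \<Rightarrow> \<not> good TYPE('a)}"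
  by (cases "good TYPE('a)") (auto intro: exI[of _ "Inl undefined"] exI[of _ "Inr 0"])

setup_lifting type_definition_nn

instantiation nn :: (l2_sig) "{zero, one, plus, times, minus, ord}"
begin

lift_definition zero_nn :: "'a nn" is "if good TYPE('a) then Inl 0 else Inr 0" by simp
lift_definition one_nn :: "'a nn" is "if good TYPE('a) then Inl 1 else Inr 1" by simp
lift_definition plus_nn :: "'a nn \<Rightarrow> 'a nn \<Rightarrow> 'a nn"
  is "\<lambda>x y. case x of Inl a \<Rightarrow> Inl (a + projl y) | Inr a \<Rightarrow> Inr (a + projr y)"
  by (auto split: sum.splits)
lift_definition times_nn :: "'a nn \<Rightarrow> 'a nn \<Rightarrow> 'a nn"
  is "\<lambda>x y. case x of Inl a \<Rightarrow> Inl (a * projl y) | Inr a \<Rightarrow> Inr (a * projr y)"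
  by (auto split: sum.splits)
lift_definition less_nn :: "'a nn \<Rightarrow> 'a nn \<Rightarrow> bool"
  is "\<lambda>x y. case x of Inl a \<Rightarrow> a < projl y | Inr a \<Rightarrow> a < projr y" .
definition less_eq_nn :: "'a nn \<Rightarrow> 'a nn \<Rightarrow> bool" where
  "x \<le> y \<longleftrightarrow> x < y \<or> x = y" for x y :: "'a nn"
definition minus_nn :: "'a nn \<Rightarrow> 'a nn \<Rightarrow> 'a nn" where
  "x - y = (if y < x then SOME z. x = y + z else 0)" for x y :: "'a nn"

instance ..

end

definition nI :: "'a::l2_sig \<Rightarrow> 'a nn" where "nI a = Abs_nn (Inl a)"
definition nN :: "nat \<Rightarrow> 'a::l2_sig nn" where "nN a = Abs_nn (Inr a)"

lemma nI_simps:
  assumes "good TYPE('a::l2_sig)"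
  shows "0 = nI (0::'a)" "1 = nI (1::'a)" "nI a + nI b = nI (a + b :: 'a)" "nI a * nI b = nI (a * b :: 'a)"
    "nI a < nI b \<longleftrightarrow> a < (b :: 'a)" "nI a = nI b \<longleftrightarrow> a = (b :: 'a)"
  using assms unfolding nI_def
  by (simp_all add: zero_nn_def one_nn_def plus_nn.abs_eq times_nn.abs_eq less_nn.abs_eq eq_onp_def Abs_nn_inject)

lemma nI_cases: assumes "good TYPE('a::l2_sig)" obtains a where "x = nI (a :: 'a)"
proof -
  have "\<exists>a. x = nI a" unfolding nI_def using assms
    by (cases x rule: Abs_nn_cases) (auto split: sum.splits)
  then show ?thesis using that by blast
qed

lemma nN_simps:
  assumes "\<not> good TYPE('a::l2_sig)"
  shows "0 = (nN 0 :: 'a nn)" "1 = (nN 1 :: 'a nn)" "nN a + nN b = (nN (a + b) :: 'a nn)"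
    "nN a * nN b = (nN (a * b) :: 'a nn)" "(nN a :: 'a nn) < nN b \<longleftrightarrow> a < b" "(nN a :: 'a nn) = nN b \<longleftrightarrow> a = b"
  using assms unfolding nN_def
  by (simp_all add: zero_nn_def one_nn_def plus_nn.abs_eq times_nn.abs_eq less_nn.abs_eq eq_onp_def Abs_nn_inject)

lemma nN_cases: assumes "\<not> good TYPE('a::l2_sig)" obtains a where "x = (nN a :: 'a nn)"
proof -
  have "\<exists>a. x = nN a" unfolding nN_def using assms
    by (cases x rule: Abs_nn_cases) (auto split: sum.splits)
  then show ?thesis using that by blast
qed

lemma nn_laws:
  fixes a b c :: "'a::l2_sig nn"
  shows nn_assoc: "a + b + c = a + (b + c)" and nn_comm: "a + b = b + a" and nn_0: "0 + a = a"
    and nn_massoc: "a * b * c = a * (b * c)" and nn_mcomm: "a * b = b * a" and nn_1: "1 * a = a"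
    and nn_m0: "0 * a = 0" and nn_distrib: "c * (a + b) = c * a + c * b"
    and nn_irrefl: "\<not> a < a" and nn_trans: "a < b \<Longrightarrow> b < c \<Longrightarrow> a < c"
    and nn_lin: "a < b \<or> a = b \<or> b < a" and nn_add_less: "a < b \<Longrightarrow> a + c < b + c"
    and nn_mult_less: "a < b \<Longrightarrow> 0 < c \<Longrightarrow> c * a < c * b"
    and nn_diff: "a < b \<Longrightarrow> \<exists>c. b = a + c" and nn_01: "(0 :: 'a nn) < 1" and nn_pos: "0 < a \<or> 0 = a"
proof -
  have "a + b + c = a + (b + c) \<and> a + b = b + a \<and> 0 + a = a \<and> a * b * c = a * (b * c) \<and> a * b = b * a \<and>
    1 * a = a \<and> 0 * a = 0 \<and> c * (a + b) = c * a + c * b \<and> \<not> a < a \<and> (a < b \<longrightarrow> b < c \<longrightarrow> a < c) \<and>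
    (a < b \<or> a = b \<or> b < a) \<and> (a < b \<longrightarrow> a + c < b + c) \<and> (a < b \<longrightarrow> 0 < c \<longrightarrow> c * a < c * b) \<and>
    (a < b \<longrightarrow> (\<exists>c. b = a + c)) \<and> (0 :: 'a nn) < 1 \<and> (0 < a \<or> 0 = a)"
  proof (cases "good TYPE('a)")
    case True
    obtain x y z where x: "a = nI x" "b = nI y" "c = nI z"
      using nI_cases[OF True] by metis
    have "\<exists>c. nI y = nI x + c" if "x < y"
      using good_laws(14)[OF True that] nI_simps(3)[OF True] by metis
    then show ?thesis
      unfolding x nI_simps[OF True]
      by (intro conjI impI)
        ((rule good_laws(1-9,11,15,16)[OF True] | erule (1) good_laws(10,13)[OF True] | erule good_laws(12)[OF True] | assumption)+)
  next
    case False
    obtain x y z where x: "a = nN x" "b = nN y" "c = nN z"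
      using nN_cases[OF False] by metis
    have "\<exists>c. (nN y :: 'a nn) = nN x + c" if "x < y"
      using nN_simps(3)[OF False, of x "y - x"] that by (intro exI[of _ "nN (y - x)"]) simp
    moreover have "x < y \<or> x = y \<or> y < x" "0 < x \<or> x = 0" by auto
    ultimately show ?thesis unfolding x by (simp add: nN_simps[OF False] algebra_simps)
  qed
  then show "a + b + c = a + (b + c)" "a + b = b + a" "0 + a = a"
    "a * b * c = a * (b * c)" "a * b = b * a" "1 * a = a" "0 * a = 0" "c * (a + b) = c * a + c * b"
    "\<not> a < a" "a < b \<Longrightarrow> b < c \<Longrightarrow> a < c" "a < b \<or> a = b \<or> b < a" "a < b \<Longrightarrow> a + c < b + c"
    "a < b \<Longrightarrow> 0 < c \<Longrightarrow> c * a < c * b" "a < b \<Longrightarrow> \<exists>c. b = a + c" "(0 :: 'a nn) < 1" "0 < a \<or> 0 = a"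
    by iprover+
qed

lemma nn_cancel: "a + b = a + c \<Longrightarrow> b = (c :: 'a::l2_sig nn)"
  by (metis nn_add_less nn_comm nn_irrefl nn_lin)

lemma nn_add_diff: "a + b - a = (b :: 'a::l2_sig nn)"
proof (cases "b = 0")
  case True
  then show ?thesis using nn_0[of a] nn_comm[of a 0] by (simp add: minus_nn_def nn_irrefl)
next
  case False
  then have "a < a + b" using nn_pos[of b] nn_add_less[of 0 b a] nn_0 nn_comm by metis
  moreover from this have "(SOME z. a + b = a + z) = b" by (metis (mono_tags, lifting) nn_cancel someI_ex)
  ultimately show ?thesis by (simp add: minus_nn_def)
qed

lemma nn_diff_add: "b < a \<Longrightarrow> b + (a - b) = (a :: 'a::l2_sig nn)"
  using nn_diff nn_add_diff by metis

lemma nn_diff_0: "\<not> b < a \<Longrightarrow> a - b = (0 :: 'a::l2_sig nn)"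
  by (simp add: minus_nn_def)

lemma nn_diff_diff: "a - b - c = a - (b + (c :: 'a::l2_sig nn))"
proof (cases "b + c < a")
  case True
  then have "a = (b + c) + (a - (b + c))" by (simp add: nn_diff_add)
  then have "a = b + (c + (a - (b + c)))" by (simp add: nn_assoc)
  then show ?thesis by (metis nn_add_diff)
next
  case False
  have "\<not> c < a - b"
  proof
    assume c: "c < a - b"
    then have "b < a" using nn_diff_0[of b a] by (metis nn_irrefl nn_trans nn_pos)
    then have "b + c < a" using nn_add_less[OF c, of b] nn_diff_add[of b a] by (simp add: nn_comm)
    then show False using False by blast
  qed
  then show ?thesis using False by (simp add: nn_diff_0)
qed

instance nn :: (l2_sig) linordered_semidom
proof
  fix a b c :: "'a nn"
  show "a + b + c = a + (b + c)" "a * b * c = a * (b * c)" by (rule nn_assoc nn_massoc)+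
  show "a + b = b + a" "a * b = b * a" by (rule nn_comm nn_mcomm)+
  show "0 + a = a" "1 * a = a" "0 * a = 0" by (rule nn_0 nn_1 nn_m0)+
  show "a * 0 = 0" using nn_m0 nn_mcomm by metis
  show "(a + b) * c = a * c + b * c" using nn_distrib nn_mcomm by metis
  show "a + b - a = b" "a - b - c = a - (b + c)" by (rule nn_add_diff nn_diff_diff)+
  show distr: "a * (b + c) = a * b + a * c" by (rule nn_distrib)
  have m0: "a * 0 = 0" for a :: "'a nn" using nn_m0 nn_mcomm by metis
  show "a * (b - c) = a * b - a * c"
  proof (cases "c < b")
    case True
    then have "a * b = a * c + a * (b - c)" using nn_diff_add[OF True] nn_distrib by metis
    then show ?thesis using nn_add_diff by metis
  next
    case False
    then have "\<not> a * c < a * b"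
      using nn_mult_less[of b c a] nn_lin[of b c] nn_pos[of a] nn_m0 nn_irrefl nn_trans by metis
    then show ?thesis using False by (simp add: nn_diff_0 m0)
  qed
  show "a * b \<noteq> 0" if "a \<noteq> 0" "b \<noteq> 0"
    using nn_mult_less[of 0 b a] that nn_pos m0 nn_irrefl by metis
  show "(0 :: 'a nn) \<noteq> 1" "(0 :: 'a nn) < 1" using nn_01 nn_irrefl by metis+
  show "a < b \<longleftrightarrow> a \<le> b \<and> \<not> b \<le> a"
    unfolding less_eq_nn_def using nn_irrefl[of a] nn_irrefl[of b] nn_trans[of a b a] by metis
  show "a \<le> a" "a \<le> b \<or> b \<le> a" unfolding less_eq_nn_def using nn_lin[of a b] by metis+
  show "a = b" if "a \<le> b" "b \<le> a"
    using that unfolding less_eq_nn_def using nn_irrefl[of a] nn_trans[of a b a] by metis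
  show "a \<le> c" if "a \<le> b" "b \<le> c" using that unfolding less_eq_nn_def using nn_trans by metis
  show "c + a \<le> c + b" if "a \<le> b" using that unfolding less_eq_nn_def using nn_add_less nn_comm by metis
  show "c * a < c * b" if "a < b" "0 < c" using that by (rule nn_mult_less)
  show "a - b + b = a" if "b \<le> a" using that unfolding less_eq_nn_def
    using nn_diff_add nn_comm nn_0 nn_diff_0 nn_irrefl by metis
qed

type_synonym 'a K = "'a nn dring fract"
type_synonym 'a R = "('a nn, 'a K) compl"

definition iota :: "'a::l2_sig \<Rightarrow> 'a K" ("\<iota>") where
  "iota a = Fract (dr (nI a)) 1"

context rca0
begin

text \<open>\<open>'a\<close> has bare symbols without any laws attached to them, so calculations
  with numbers are moved along \<open>\<iota>\<close> into the ordered field, where linear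
  arithmetic applies.\<close>

lemma iota_simps [simp]:
  fixes a b :: 'a
  shows "\<iota> (0::'a) = 0" "\<iota> (1::'a) = 1" "\<iota> (a + b) = \<iota> a + \<iota> b" "\<iota> (a * b) = \<iota> a * \<iota> b"
  unfolding iota_def
     apply (simp_all flip: nI_simps[OF good])
  by (simp_all add: fract_collapse)

lemma iota_less: "a < b \<longleftrightarrow> \<iota> a < \<iota> (b :: 'a)"
  by (simp add: iota_def nI_simps[OF good])

lemma iota_eq: "a = b \<longleftrightarrow> \<iota> a = \<iota> (b :: 'a)"
  by (simp add: iota_def nI_simps[OF good] eq_fract)

lemma iota_leq: "a \<preceq> b \<longleftrightarrow> \<iota> a \<le> \<iota> (b :: 'a)"
  by (auto simp: leq_def iota_less iota_eq)

lemmas iota_iff = iota_leq iota_less iota_eq iota_simps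

lemma iota_nonneg [simp]: "0 \<le> \<iota> (a :: 'a)"
  using zero_le[of a] by (auto simp: iota_iff)

lemma iota_discrete: "\<iota> a < \<iota> b \<longleftrightarrow> \<iota> a + 1 \<le> \<iota> (b :: 'a)"
  using S_le[of a b] less_S[of a a] by (auto simp: iota_iff)

lemma iota_diff: assumes "\<iota> a \<le> \<iota> (b :: 'a)" obtains c :: 'a where "\<iota> c = \<iota> b - \<iota> a"
proof (cases "a < b")
  case True
  then obtain c where "b = a + c" using less_diff by blast
  then show ?thesis using that[of c] by simp
next
  case False
  then show ?thesis using that[of 0] assms by (simp add: iota_iff)
qed

lemma K_cases: fixes t :: "'a K" obtains p n k where "\<iota> k > 0" "t = (\<iota> p - \<iota> n) / \<iota> (k :: 'a)"
proof -
  obtain u v where t: "t = Fract u v" and v: "v > 0"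
    by (induction t rule: fract_induct_pos) blast
  obtain a b c d where abcd: "u = dr a - dr b" "v = dr c - dr d" by (metis dring_cases)
  have "d < c" using v unfolding abcd by simp
  then obtain k where c: "c = d + k" using nn_diff by blast
  have k: "v = dr k" "k > 0" using v by (simp_all add: abcd c) (metis dr_simps(1,6))
  obtain a' b' k' where nI: "a = nI a'" "b = nI b'" "k = nI k'" using nI_cases[OF good] by metis
  have "t = (\<iota> a' - \<iota> b') / \<iota> k'"
    using k by (simp add: t abcd(1) k(1) iota_def flip: nI)
  moreover have "\<iota> k' > 0" using k v by (simp add: iota_def zero_less_Fract_iff flip: nI)
  ultimately show ?thesis using that by blast
qed

text \<open>Nonstandard elements do no harm: the field consists of quotients of the model's own
  numbers, and \<open>(p - n) / k\<close> is at most \<open>p\<close> because a nonzero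
  \<open>k\<close> is at least \<open>1\<close>.\<close>

lemma K_arch: obtains k :: 'a where "t < \<iota> k"
proof -
  obtain p n k :: 'a where t: "\<iota> k > 0" "t = (\<iota> p - \<iota> n) / \<iota> k" by (rule K_cases)
  have "\<iota> k \<ge> 1" using t(1) iota_discrete[of 0 k] by simp
  have "t \<le> \<iota> p / \<iota> k" unfolding t using t(1) by (intro divide_right_mono) auto
  also have "\<dots> \<le> \<iota> p" using mult_left_mono[OF \<open>\<iota> k \<ge> 1\<close>, of "\<iota> p"] t(1)
    by (simp add: divide_le_eq)
  also have "\<dots> < \<iota> (p + 1)" by simp
  finally show ?thesis using that by blast
qed

end

section \<open>Computability relative to a model of \<open>RCA\<^sub>0\<close>\<close>

abbreviation TPr :: "l2_term \<Rightarrow> l2_term \<Rightarrow> l2_term" where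
  "TPr s t \<equiv> Add (Mul (Add s t) (Add s t)) s"

abbreviation BEx :: "nat \<Rightarrow> l2_term \<Rightarrow> l2_form \<Rightarrow> l2_form" where
  "BEx i t \<phi> \<equiv> Exis i (Conj (Less (Var i) (Add t One)) \<phi>)"

abbreviation Disj :: "l2_form \<Rightarrow> l2_form \<Rightarrow> l2_form" where
  "Disj \<phi> \<psi> \<equiv> Neg (Conj (Neg \<phi>) (Neg \<psi>))"

abbreviation V :: "nat \<Rightarrow> l2_term" where "V \<equiv> Var"

text \<open>\<open>pr\<close> is not surjective on numbers (3 is not a value), so the projections
  get the default \<open>0\<close>, and being a pair is a condition of its own.\<close>

definition is_pair :: "'a::l2_sig \<Rightarrow> bool" where
  "is_pair z \<longleftrightarrow> (\<exists>i j. z = pr i j)"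

definition p1 :: "'a::l2_sig \<Rightarrow> 'a" where
  "p1 z = (if is_pair z then THE i. \<exists>j. z = pr i j else 0)"

definition p2 :: "'a::l2_sig \<Rightarrow> 'a" where
  "p2 z = (if is_pair z then THE j. \<exists>i. z = pr i j else 0)"

context rca0
begin

lemma less_S_leq: "m < n + 1 \<longleftrightarrow> m \<preceq> (n :: 'a)"
  by (simp add: less_S leq_def)

lemma iota_ge_1: "(k :: 'a) \<noteq> 0 \<Longrightarrow> 1 \<le> \<iota> k"
  using iota_discrete[of 0 k] zero_le[of k] by (auto simp: iota_iff)

lemma iota_square: "\<iota> s \<le> \<iota> s * \<iota> (s :: 'a)"
proof (cases "s = 0")
  case False
  then show ?thesis using mult_left_mono[OF iota_ge_1[OF False], of "\<iota> s"] by simp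
qed simp

lemma pr_ge1: "i \<preceq> pr i (j :: 'a)"
  by (simp add: iota_iff pr_def)

lemma pr_ge2: "j \<preceq> pr i (j :: 'a)"
proof -
  have "\<iota> (i + j) \<le> \<iota> (i + j) * \<iota> (i + j)" by (rule iota_square)
  moreover have "\<iota> (pr i j) = \<iota> (i + j) * \<iota> (i + j) + \<iota> i" by (simp add: pr_def)
  ultimately show ?thesis using iota_nonneg[of i] unfolding iota_leq iota_simps(3) by linarith
qed

lemma leq_refl [simp]: "a \<preceq> (a :: 'a)"
  by (simp add: leq_def)

lemma leq_trans: "a \<preceq> b \<Longrightarrow> b \<preceq> c \<Longrightarrow> a \<preceq> (c :: 'a)"
  by (simp add: iota_leq)

text \<open>With \<open>s = i + j\<close> the code lies between \<open>s * s\<close> and the next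
  square, so it determines \<open>s\<close>, and then \<open>i\<close>.\<close>

lemma pr_inj [simp]: "pr i j = pr i' j' \<longleftrightarrow> i = i' \<and> j = (j' :: 'a)"
proof
  assume eq: "pr i j = pr i' j'"
  have *: "\<not> i + j < i' + j'" if eq: "pr i j = pr i' j'" for i j i' j' :: 'a
  proof
    assume "i + j < i' + j'"
    then have "\<iota> (i + j) + 1 \<le> \<iota> (i' + j')" by (simp only: iota_less flip: iota_discrete)
    then have "(\<iota> (i + j) + 1) * (\<iota> (i + j) + 1) \<le> \<iota> (i' + j') * \<iota> (i' + j')"
      by (intro mult_mono) (auto simp del: iota_simps)
    moreover have "\<iota> (pr i j) = \<iota> (i + j) * \<iota> (i + j) + \<iota> i" for i j :: 'a by (simp add: pr_def)
    moreover have "(\<iota> (i + j) + 1) * (\<iota> (i + j) + 1) = \<iota> (i + j) * \<iota> (i + j) + \<iota> i + \<iota> i + \<iota> j + \<iota> j + 1"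
      by (simp add: algebra_simps)
    ultimately show False using eq iota_nonneg[of i] iota_nonneg[of j] iota_nonneg[of i']
      by (simp only: iota_eq)
  qed
  then have "i + j = i' + j'" using * eq less_linear' by metis
  moreover from this have "i = i'" using eq by (simp add: iota_eq pr_def)
  ultimately show "i = i' \<and> j = j'" by (simp add: iota_eq)
qed simp

lemma p_pr [simp]: "p1 (pr i j) = i" "p2 (pr i j) = j" "is_pair (pr i j)" for i j :: 'a
  by (auto simp: p1_def p2_def is_pair_def)

lemma not_pair [simp]: "\<not> is_pair z \<Longrightarrow> p1 z = 0" "\<not> is_pair z \<Longrightarrow> p2 z = 0" for z :: 'a
  by (auto simp: p1_def p2_def)

lemma pr_p [simp]: "is_pair z \<Longrightarrow> pr (p1 z) (p2 z) = z" for z :: 'a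
  by (auto simp: is_pair_def)

lemma is_pairE: "is_pair z \<Longrightarrow> (\<And>i j. z = pr i j \<Longrightarrow> P) \<Longrightarrow> P" for z :: 'a
  by (auto simp: is_pair_def)

lemma zero_leq [simp]: "0 \<preceq> (a :: 'a)"
  by (simp add: iota_leq)

lemma p_le: "p1 z \<preceq> z" "p2 z \<preceq> z" for z :: 'a
  using pr_ge1 pr_ge2 by (cases "is_pair z"; force simp: is_pair_def)+

lemma is_pair_iff: "is_pair z \<longleftrightarrow> (\<exists>i j. i \<preceq> z \<and> j \<preceq> z \<and> z = pr i (j :: 'a))"
  using pr_ge1 pr_ge2 by (auto simp: is_pair_def)

text \<open>Formulas of the object language are written out only for a few basic cases. Beyond
  these, \<open>dec\<close> and \<open>fn\<close> are closed under the rules collected in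
  \<open>comp\<close>, so comprehension follows the structure of a predicate of the ambient logic.
  Two-place predicates are passed in the form \<open>\<lambda>z. P (p1 z) (p2 z)\<close>.\<close>

definition dec :: "('a \<Rightarrow> bool) \<Rightarrow> bool" where
  "dec P \<longleftrightarrow> {x. P x} \<in> S"

lemma fn_iff: "fn S f \<longleftrightarrow> {z. is_pair z \<and> p2 z = f (p1 z)} \<in> S"
proof -
  have "range (\<lambda>i. pr i (f i)) = {z. is_pair z \<and> p2 z = f (p1 z)}"
    by (auto simp: is_pair_def)
  then show ?thesis by (simp add: fn_def)
qed

lemma comp1:
  assumes "Sigma00 \<theta>" "{x. P x} \<in> S" "{x. Q x} \<in> S"
    and "\<And>z. R z \<longleftrightarrow> sat (\<lambda>j. if j = 0 then {x. P x} else {x. Q x}) (e(0 := z)) \<theta>"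
  shows "{z. R z} \<in> S"
proof -
  have "{z. sat (\<lambda>j. if j = 0 then {x. P x} else {x. Q x}) (e(0 := z)) \<theta>} \<in> S"
    by (rule comp00) (use assms in auto)
  then show ?thesis by (simp add: assms(4))
qed

lemma comp2:
  assumes "Sigma00 \<theta>" "Sigma00 \<eta>" "{x. P x} \<in> S" "{x. Q x} \<in> S"
    and "\<And>z. R z \<longleftrightarrow> (\<exists>w. sat (\<lambda>j. if j = 0 then {x. P x} else {x. Q x}) (e(0 := z, 1 := w)) \<theta>)"
    and "\<And>z. R z \<longleftrightarrow> (\<forall>w. sat (\<lambda>j. if j = 0 then {x. P x} else {x. Q x}) (e(0 := z, 1 := w)) \<eta>)"
  shows "{z. R z} \<in> S"
proof -
  have "{z. \<exists>w. sat (\<lambda>j. if j = 0 then {x. P x} else {x. Q x}) (e(0 := z, 1 := w)) \<theta>} \<in> S"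
    by (rule comp01[of \<theta> \<eta>]) (use assms in auto)
  then show ?thesis by (simp only: assms(5)[symmetric])
qed

lemma set_S: obtains P where "{x. P x} \<in> S"
  using S_nonempty that[of "\<lambda>x. x \<in> _"] by (metis Collect_mem_eq)

text \<open>Variable \<open>0\<close> is the candidate pair, \<open>1\<close> the argument and
  \<open>2\<close> the value. A pair bounds its components, so the graph is given by a bounded
  formula.\<close>

lemma fn_base:
  assumes "Sigma00 \<theta>" "\<And>E z x y. y = f x \<longleftrightarrow> sat E (e(0 := z, 1 := x, 2 := y)) \<theta>"
  shows "fn S f"
proof -
  obtain P where P: "{x. P x} \<in> S" by (rule set_S)
  show ?thesis unfolding fn_iff
  proof (rule comp1[OF _ P P])
    show "Sigma00 (BEx 1 (V 0) (BEx 2 (V 0) (Conj (Equal (V 0) (TPr (V 1) (V 2))) \<theta>)))"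
      using assms(1) by simp
    fix z
    have "is_pair z \<and> p2 z = f (p1 z) \<longleftrightarrow> (\<exists>x y. x \<preceq> z \<and> y \<preceq> z \<and> z = pr x y \<and> y = f x)"
      using pr_ge1 pr_ge2 by (auto simp: is_pair_def)
    also have "\<dots> \<longleftrightarrow> sat (\<lambda>j. if j = 0 then {x. P x} else {x. P x}) (e(0 := z))
       (BEx 1 (V 0) (BEx 2 (V 0) (Conj (Equal (V 0) (TPr (V 1) (V 2))) \<theta>)))"
      unfolding assms(2)[where z = z and E = "\<lambda>j. if j = 0 then {x. P x} else {x. P x}"]
      by (auto simp: less_S_leq simp flip: pr_def)
    finally show "is_pair z \<and> p2 z = f (p1 z) \<longleftrightarrow> sat (\<lambda>j. if j = 0 then {x. P x} else {x. P x}) (e(0 := z))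
       (BEx 1 (V 0) (BEx 2 (V 0) (Conj (Equal (V 0) (TPr (V 1) (V 2))) \<theta>)))" .
  qed
qed

named_theorems comp

lemma dec_const [comp]: "dec (\<lambda>_. P)"
proof -
  obtain X where X: "X \<in> S" by (rule S_nonempty)
  have "{n::'a. sat (\<lambda>_. X) ((\<lambda>_. 0)(0 := n)) (if P then Equal Zero Zero else Less Zero Zero)} \<in> S"
    by (rule comp00) (use X in auto)
  then show ?thesis by (cases P) (auto simp: dec_def not_less_0)
qed

lemma dec_not [comp]: "dec P \<Longrightarrow> dec (\<lambda>x. \<not> P x)"
  unfolding dec_def by (rule comp1[of "Neg (Mem (V 0) 0)" P P _ "\<lambda>_. 0"]) auto

lemma dec_conj [comp]: "dec P \<Longrightarrow> dec Q \<Longrightarrow> dec (\<lambda>x. P x \<and> Q x)"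
  unfolding dec_def by (rule comp1[of "Conj (Mem (V 0) 0) (Mem (V 0) 1)" P Q _ "\<lambda>_. 0"]) auto

lemma dec_disj [comp]: "dec P \<Longrightarrow> dec Q \<Longrightarrow> dec (\<lambda>x. P x \<or> Q x)"
  using dec_not[OF dec_conj[OF dec_not[of P] dec_not[of Q]]] by simp

lemma dec_imp [comp]: "dec P \<Longrightarrow> dec Q \<Longrightarrow> dec (\<lambda>x. P x \<longrightarrow> Q x)"
  using dec_disj[OF dec_not[of P], of Q] by (simp only: imp_conv_disj)

lemma dec_iff [comp]: "dec P \<Longrightarrow> dec Q \<Longrightarrow> dec (\<lambda>x. P x \<longleftrightarrow> Q x)"
  using dec_conj[OF dec_imp[of P Q] dec_imp[of Q P]] by (simp only: iff_conv_conj_imp)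

lemma dec_mem: "X \<in> S \<Longrightarrow> dec (\<lambda>x. x \<in> X)"
  by (simp add: dec_def)

text \<open>\<open>P (f x)\<close> says both that some \<open>w\<close> with \<open>w = f x\<close>
  satisfies \<open>P\<close> and that all such \<open>w\<close> do: an existential and a universal
  definition, as \<open>\<Delta>\<^sup>0\<^sub>1\<close>-comprehension requires.\<close>

lemma dec_comp:
  assumes "dec P" "fn S f" shows "dec (\<lambda>x. P (f x))"
  unfolding dec_def
proof (rule comp2)
  show "{x. P x} \<in> S" "{z. is_pair z \<and> p2 z = f (p1 z)} \<in> S"
    using assms by (auto simp: dec_def fn_iff)
  show "Sigma00 (Conj (Mem (TPr (V 0) (V 1)) 1) (Mem (V 1) 0))"
    "Sigma00 (Neg (Conj (Mem (TPr (V 0) (V 1)) 1) (Neg (Mem (V 1) 0))))" by simp_all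
qed (auto simp flip: pr_def)

lemma fn_pair [comp]:
  assumes "fn S f" "fn S g" shows "fn S (\<lambda>x. pr (f x) (g x))"
  unfolding fn_iff
proof (rule comp1)
  show "{z. is_pair z \<and> p2 z = f (p1 z)} \<in> S" "{z. is_pair z \<and> p2 z = g (p1 z)} \<in> S"
    using assms by (auto simp: fn_iff)
  show "Sigma00 (BEx 1 (V 0) (BEx 2 (V 0) (BEx 3 (V 0) (Conj (Equal (V 0) (TPr (V 1) (TPr (V 2) (V 3))))
     (Conj (Mem (TPr (V 1) (V 2)) 0) (Mem (TPr (V 1) (V 3)) 1))))))" by simp
  fix z
  have "is_pair z \<and> p2 z = pr (f (p1 z)) (g (p1 z)) \<longleftrightarrow>
     (\<exists>x u v. x \<preceq> z \<and> u \<preceq> z \<and> v \<preceq> z \<and> z = pr x (pr u v) \<and> u = f x \<and> v = g x)"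
    using pr_ge1 pr_ge2 by (auto simp: is_pair_def intro: leq_trans[OF pr_ge1 pr_ge2] leq_trans[OF pr_ge2 pr_ge2])
  also have "\<dots> \<longleftrightarrow> sat (\<lambda>j. if j = 0 then {z. is_pair z \<and> p2 z = f (p1 z)} else {z. is_pair z \<and> p2 z = g (p1 z)}) ((\<lambda>_. 0)(0 := z))
      (BEx 1 (V 0) (BEx 2 (V 0) (BEx 3 (V 0) (Conj (Equal (V 0) (TPr (V 1) (TPr (V 2) (V 3))))
     (Conj (Mem (TPr (V 1) (V 2)) 0) (Mem (TPr (V 1) (V 3)) 1))))))"
    by (simp add: less_S_leq flip: pr_def)
  finally show "is_pair z \<and> p2 z = pr (f (p1 z)) (g (p1 z)) \<longleftrightarrow>
     sat (\<lambda>j. if j = 0 then {z. is_pair z \<and> p2 z = f (p1 z)} else {z. is_pair z \<and> p2 z = g (p1 z)}) ((\<lambda>_. 0)(0 := z))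
      (BEx 1 (V 0) (BEx 2 (V 0) (BEx 3 (V 0) (Conj (Equal (V 0) (TPr (V 1) (TPr (V 2) (V 3))))
     (Conj (Mem (TPr (V 1) (V 2)) 0) (Mem (TPr (V 1) (V 3)) 1))))))" .
qed

lemma fn_comp:
  assumes "fn S f" "fn S g" shows "fn S (\<lambda>x. f (g x))"
  unfolding fn_iff
proof (rule comp2)
  show "{z. is_pair z \<and> p2 z = f (p1 z)} \<in> S" "{z. is_pair z \<and> p2 z = g (p1 z)} \<in> S"
    using assms by (auto simp: fn_iff)
  show "Sigma00 (BEx 2 (V 0) (BEx 3 (V 0) (Conj (Equal (V 0) (TPr (V 2) (V 3)))
     (Conj (Mem (TPr (V 2) (V 1)) 1) (Mem (TPr (V 1) (V 3)) 0)))))"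
   "Sigma00 (BEx 2 (V 0) (BEx 3 (V 0) (Conj (Equal (V 0) (TPr (V 2) (V 3)))
     (Neg (Conj (Mem (TPr (V 2) (V 1)) 1) (Neg (Mem (TPr (V 1) (V 3)) 0)))))))" by simp_all
  fix z
  have *: "is_pair z \<and> p2 z = f (g (p1 z)) \<longleftrightarrow> (\<exists>x y. x \<preceq> z \<and> y \<preceq> z \<and> z = pr x y \<and> y = f (g x))"
    using pr_ge1 pr_ge2 by (auto simp: is_pair_def)
  show "is_pair z \<and> p2 z = f (g (p1 z)) \<longleftrightarrow> (\<exists>w. sat (\<lambda>j. if j = 0 then {z. is_pair z \<and> p2 z = f (p1 z)}
     else {z. is_pair z \<and> p2 z = g (p1 z)}) ((\<lambda>_. 0)(0 := z, 1 := w))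
      (BEx 2 (V 0) (BEx 3 (V 0) (Conj (Equal (V 0) (TPr (V 2) (V 3)))
       (Conj (Mem (TPr (V 2) (V 1)) 1) (Mem (TPr (V 1) (V 3)) 0))))))"
    unfolding * by (auto simp: less_S_leq simp flip: pr_def)
  show "is_pair z \<and> p2 z = f (g (p1 z)) \<longleftrightarrow> (\<forall>w. sat (\<lambda>j. if j = 0 then {z. is_pair z \<and> p2 z = f (p1 z)}
     else {z. is_pair z \<and> p2 z = g (p1 z)}) ((\<lambda>_. 0)(0 := z, 1 := w))
      (BEx 2 (V 0) (BEx 3 (V 0) (Conj (Equal (V 0) (TPr (V 2) (V 3)))
       (Neg (Conj (Mem (TPr (V 2) (V 1)) 1) (Neg (Mem (TPr (V 1) (V 3)) 0))))))))"
    unfolding * by (auto simp: less_S_leq simp flip: pr_def) (metis pr_inj)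
qed

lemma fn_id [comp]: "fn S (\<lambda>x. x)"
  by (rule fn_base[of "Equal (V 1) (V 2)" _ "\<lambda>_. 0"]) auto

lemma fn_const [comp]: "fn S (\<lambda>_. c)"
  by (rule fn_base[of "Equal (V 2) (V 3)" _ "(\<lambda>_. 0)(3 := c)"]) auto

lemma fn_pairs: "(\<exists>i j. i \<preceq> x \<and> j \<preceq> x \<and> x = pr i j \<and> P i j) \<longleftrightarrow> is_pair x \<and> P (p1 x) (p2 x)" for x :: 'a
  using pr_ge1 pr_ge2 by (auto simp: is_pair_def)

abbreviation (input) "graph0 \<theta> \<equiv> Disj (BEx 3 (V 1) (BEx 4 (V 1) (Conj (Equal (V 1) (TPr (V 3) (V 4))) \<theta>)))
  (Conj (Neg (BEx 3 (V 1) (BEx 4 (V 1) (Conj (Equal (V 1) (TPr (V 3) (V 4))) (Equal Zero Zero)))))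
    (Equal (V 2) Zero))"

lemma fn_graph0:
  assumes "Sigma00 \<theta>" "\<And>x. \<not> is_pair x \<Longrightarrow> f x = 0"
    "\<And>E z x y i j. y = f (pr i j) \<longleftrightarrow> sat E ((\<lambda>_. 0)(0 := z, 1 := x, 2 := y, 3 := i, 4 := j)) \<theta>"
  shows "fn S f"
proof (rule fn_base)
  show "Sigma00 (graph0 \<theta>)" using assms(1) by simp
  fix E z x y
  have "y = f x \<longleftrightarrow> (\<exists>i j. i \<preceq> x \<and> j \<preceq> x \<and> x = pr i j \<and> y = f (pr i j)) \<or>
    \<not> (\<exists>i j. i \<preceq> x \<and> j \<preceq> x \<and> x = pr i j \<and> (0::'a) = 0) \<and> y = 0"
    unfolding fn_pairs using assms(2)[of x] by (cases "is_pair x") auto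
  also have "\<dots> \<longleftrightarrow> sat E ((\<lambda>_. 0)(0 := z, 1 := x, 2 := y)) (graph0 \<theta>)"
    unfolding assms(3)[where z = z and E = E and x = x] by (auto simp: less_S_leq simp flip: pr_def)
  finally show "y = f x \<longleftrightarrow> sat E ((\<lambda>_. 0)(0 := z, 1 := x, 2 := y)) (graph0 \<theta>)" .
qed

lemma fn_p1: "fn S p1"
  by (rule fn_graph0[of "Equal (V 2) (V 3)"]) auto

lemma fn_p2: "fn S p2"
  by (rule fn_graph0[of "Equal (V 2) (V 4)"]) auto

lemma fn_plus: "fn S (\<lambda>z. p1 z + p2 z)"
  by (rule fn_graph0[of "Equal (V 2) (Add (V 3) (V 4))"]) (auto simp: add_0)

lemma fn_times: "fn S (\<lambda>z. p1 z * p2 z)"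
  by (rule fn_graph0[of "Equal (V 2) (Mul (V 3) (V 4))"]) (auto simp: mult_0)

lemma fn_comp2: "fn S (\<lambda>z. h (p1 z) (p2 z)) \<Longrightarrow> fn S f \<Longrightarrow> fn S g \<Longrightarrow> fn S (\<lambda>x. h (f x) (g x))"
  using fn_comp[OF _ fn_pair, of "\<lambda>z. h (p1 z) (p2 z)" f g] by simp

lemma dec_comp2: "dec (\<lambda>z. P (p1 z) (p2 z)) \<Longrightarrow> fn S f \<Longrightarrow> fn S g \<Longrightarrow> dec (\<lambda>x. P (f x) (g x))"
  using dec_comp[OF _ fn_pair, of "\<lambda>z. P (p1 z) (p2 z)" f g] by simp

lemma fn_p [comp]: "fn S f \<Longrightarrow> fn S (\<lambda>x. p1 (f x))" "fn S f \<Longrightarrow> fn S (\<lambda>x. p2 (f x))"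
  by (rule fn_comp[OF fn_p1] fn_comp[OF fn_p2]; assumption)+

lemma fn_arith [comp]:
  "fn S f \<Longrightarrow> fn S g \<Longrightarrow> fn S (\<lambda>x. f x + g x)" "fn S f \<Longrightarrow> fn S g \<Longrightarrow> fn S (\<lambda>x. f x * g x)"
  by (rule fn_comp2[OF fn_plus] fn_comp2[OF fn_times]; assumption)+

lemma dec_base:
  assumes "Sigma00 \<theta>" "\<And>E x. P x \<longleftrightarrow> sat E ((\<lambda>_. 0)(0 := x)) \<theta>"
  shows "dec P"
proof -
  obtain Q where Q: "{x. Q x} \<in> S" by (rule set_S)
  show ?thesis unfolding dec_def by (rule comp1[OF assms(1) Q Q assms(2)])
qed

lemma dec_is_pair: "dec is_pair"
  by (rule dec_base[of "BEx 1 (V 0) (BEx 2 (V 0) (Equal (V 0) (TPr (V 1) (V 2))))"])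
    (simp_all add: less_S_leq is_pair_iff flip: pr_def)

lemma dec_pair [comp]: "fn S f \<Longrightarrow> dec (\<lambda>x. is_pair (f x))"
  by (rule dec_comp[OF dec_is_pair])

lemma dec_eq [comp]: assumes "fn S f" "fn S g" shows "dec (\<lambda>x. f x = g x)"
proof -
  have "dec (\<lambda>x. is_pair x \<and> p1 x = p2 x)"
    by (rule dec_base[of "BEx 1 (V 0) (Equal (V 0) (TPr (V 1) (V 1)))"])
      (use pr_ge1 in \<open>auto simp: less_S_leq is_pair_def simp flip: pr_def\<close>)
  from dec_comp[OF this fn_pair[OF assms]] show ?thesis by simp
qed

lemma dec_less [comp]: assumes "fn S f" "fn S g" shows "dec (\<lambda>x. f x < g x)"
proof -
  have "dec (\<lambda>x. is_pair x \<and> p1 x < p2 x)"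
    by (rule dec_base[of "BEx 1 (V 0) (BEx 2 (V 0) (Conj (Equal (V 0) (TPr (V 1) (V 2))) (Less (V 1) (V 2))))"])
      (auto simp: less_S_leq is_pair_def pr_ge1 pr_ge2 simp flip: pr_def)
  from dec_comp[OF this fn_pair[OF assms]] show ?thesis by simp
qed

lemma dec_leq [comp]: "fn S f \<Longrightarrow> fn S g \<Longrightarrow> dec (\<lambda>x. f x \<preceq> g x)"
  unfolding leq_def by (intro comp)

lemma dec_bex [comp]:
  assumes "fn S f" "dec (\<lambda>z. P (p1 z) (p2 z))" shows "dec (\<lambda>x. \<exists>y. y < f x \<and> P x y)"
proof -
  have "{z. is_pair z \<and> (\<exists>y. y < p2 z \<and> P (p1 z) y)} \<in> S"
  proof (rule comp1)
    show "{z. P (p1 z) (p2 z)} \<in> S" "{z. P (p1 z) (p2 z)} \<in> S" using assms(2) by (auto simp: dec_def)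
    show "Sigma00 (BEx 1 (V 0) (BEx 2 (V 0) (Conj (Equal (V 0) (TPr (V 1) (V 2)))
       (Exis 3 (Conj (Less (V 3) (V 2)) (Mem (TPr (V 1) (V 3)) 0))))))" by simp
    show "is_pair z \<and> (\<exists>y. y < p2 z \<and> P (p1 z) y) \<longleftrightarrow>
      sat (\<lambda>j. if j = 0 then {z. P (p1 z) (p2 z)} else {z. P (p1 z) (p2 z)}) ((\<lambda>_. 0)(0 := z))
       (BEx 1 (V 0) (BEx 2 (V 0) (Conj (Equal (V 0) (TPr (V 1) (V 2)))
       (Exis 3 (Conj (Less (V 3) (V 2)) (Mem (TPr (V 1) (V 3)) 0))))))" for z
      by (auto simp: less_S_leq is_pair_def pr_ge1 pr_ge2 simp flip: pr_def)
  qed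
  then have "dec (\<lambda>z. is_pair z \<and> (\<exists>y. y < p2 z \<and> P (p1 z) y))" by (simp add: dec_def)
  from dec_comp[OF this fn_pair[OF fn_id assms(1)]] show ?thesis by simp
qed

lemma dec_bex_le [comp]:
  assumes "fn S f" "dec (\<lambda>z. P (p1 z) (p2 z))" shows "dec (\<lambda>x. \<exists>y. y \<preceq> f x \<and> P x y)"
  using dec_bex[of "\<lambda>x. f x + 1" P] assms by (simp add: less_S_leq comp)

lemma dec_ball [comp]:
  assumes "fn S f" "dec (\<lambda>z. P (p1 z) (p2 z))" shows "dec (\<lambda>x. \<forall>y. y < f x \<longrightarrow> P x y)"
  using dec_not[OF dec_bex[OF assms(1) dec_not[OF assms(2)]]] by simp

lemma dec_ball_le [comp]:
  assumes "fn S f" "dec (\<lambda>z. P (p1 z) (p2 z))" shows "dec (\<lambda>x. \<forall>y. y \<preceq> f x \<longrightarrow> P x y)"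
  using dec_not[OF dec_bex_le[OF assms(1) dec_not[OF assms(2)]]] by simp

lemma fnI: "dec (\<lambda>z. p2 z = f (p1 z)) \<Longrightarrow> fn S f"
  unfolding fn_iff using dec_conj[OF dec_is_pair] by (simp add: dec_def)

lemma dec_if [comp]: "dec P \<Longrightarrow> dec Q \<Longrightarrow> dec R \<Longrightarrow> dec (\<lambda>x. if P x then Q x else R x)"
  unfolding if_bool_eq_conj by (intro comp)

lemma fn_if [comp]: assumes "dec P" "fn S f" "fn S g" shows "fn S (\<lambda>x. if P x then f x else g x)"
proof (rule fnI)
  have "dec (\<lambda>z. if P (p1 z) then p2 z = f (p1 z) else p2 z = g (p1 z))"
    by (intro comp dec_comp[OF assms(1)] fn_comp[OF assms(2)] fn_comp[OF assms(3)])
  then show "dec (\<lambda>z. p2 z = (if P (p1 z) then f (p1 z) else g (p1 z)))"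
    by (simp only: if_distrib cong: if_cong)
qed

lemma sigma1_induct:
  assumes "dec (\<lambda>z. P (p1 z) (p2 z))" "\<exists>m. P 0 m" "\<And>n m. P n m \<Longrightarrow> \<exists>m. P (n + 1) m"
  shows "\<exists>m. P n m"
proof -
  have "\<exists>m. sat (\<lambda>_. {z. P (p1 z) (p2 z)}) ((\<lambda>_. 0)(0 := n, 1 := m)) (Mem (TPr (V 0) (V 1)) 0)"
    by (rule sigma01_ind) (use assms in \<open>auto simp: dec_def simp flip: pr_def\<close>)
  then show ?thesis by (simp flip: pr_def)
qed

lemma dec_induct:
  assumes "dec P" "P 0" "\<And>n. P n \<Longrightarrow> P (n + 1)" shows "P n"
proof -
  have "\<exists>m::'a. P n"
  proof (rule sigma1_induct[where P = "\<lambda>n _. P n"])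
    show "dec (\<lambda>z. P (p1 z))" by (intro comp dec_comp[OF assms(1)])
  qed (use assms in auto)
  then show ?thesis by simp
qed

text \<open>Strong induction is available because "no \<open>k < n\<close> satisfies
  \<open>P\<close>" is again decidable.\<close>

lemma dec_least:
  assumes "dec P" "P n" obtains m where "P m" "\<And>k. k < m \<Longrightarrow> \<not> P k"
proof -
  have "\<exists>m. P m \<and> (\<forall>k. k < m \<longrightarrow> \<not> P k)"
  proof (rule ccontr)
    assume *: "\<not> ?thesis"
    have "\<forall>k. k < n + 1 \<longrightarrow> \<not> P k"
    proof (rule dec_induct[where P = "\<lambda>n. \<forall>k. k < n \<longrightarrow> \<not> P k" and n = "n + 1"])
      show "dec (\<lambda>n. \<forall>k. k < n \<longrightarrow> \<not> P k)" by (intro comp dec_comp[OF assms(1)])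
      show "\<forall>k. k < 0 \<longrightarrow> \<not> P k" by (simp add: not_less_0)
      show "\<forall>k. k < m + 1 \<longrightarrow> \<not> P k" if "\<forall>k. k < m \<longrightarrow> \<not> P k" for m
        using that * by (metis less_S)
    qed
    then show False using assms(2) less_S by metis
  qed
  then show ?thesis using that by metis
qed

text \<open>Minimization turns decidable existence into a function of \<open>S\<close>: its graph is
  decidable because the search below the value is bounded. All later choice functions come from
  here.\<close>

lemma mu:
  assumes "dec (\<lambda>z. P (p1 z) (p2 z))" "\<And>x. \<exists>y. P x y"
  obtains f where "fn S f" "\<And>x. P x (f x)" "\<And>x y. y < f x \<Longrightarrow> \<not> P x y"
proof -
  have "\<exists>y. P x y \<and> (\<forall>k. k < y \<longrightarrow> \<not> P x k)" for x
  proof -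
    obtain y where "P x y" using assms(2) by blast
    moreover have "dec (P x)" using dec_comp2[OF assms(1) fn_const fn_id] .
    ultimately show ?thesis using dec_least by metis
  qed
  then obtain f where f: "\<And>x. P x (f x)" "\<And>x k. k < f x \<Longrightarrow> \<not> P x k" by metis
  have eq: "y = f x \<longleftrightarrow> P x y \<and> (\<forall>k. k < y \<longrightarrow> \<not> P x k)" for x y
    using f less_linear' by metis
  have "fn S f"
    by (rule fnI) (unfold eq, intro comp assms(1) dec_comp2[OF assms(1)])
  then show ?thesis using that f by blast
qed

end

section \<open>Codes of finite sets and sequences\<close>

text \<open>Modulo \<open>a = m * c + 1\<close> the element \<open>- c\<close> inverts
  \<open>m\<close>; so if \<open>a\<close> divides \<open>n * m * m\<close>, it divides
  \<open>n\<close>, with the cofactor given explicitly.\<close>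

lemma beta_ring:
  fixes a m c n u :: "'r::comm_ring_1"
  assumes "a = m * c + 1" "n * m * m = a * u"
  shows "n = a * (u * c * c - n * a + 2 * n)"
proof -
  have "a * (u * c * c) = n * ((m * c) * (m * c))" using assms(2) by (metis mult.assoc mult.left_commute)
  also have "m * c = a - 1" using assms(1) by simp
  finally show ?thesis by (simp add: algebra_simps)
qed

context rca0
begin

text \<open>Numbers are sent into the ring of differences instead of the field: divisibility would
  be trivial in the field, while the intermediate cofactors may be negative.\<close>

definition delta :: "'a \<Rightarrow> 'a nn dring" where "delta a = dr (nI a)"

lemma delta_simps [simp]:
  "delta 0 = 0" "delta 1 = 1" "delta (a + b) = delta a + delta b" "delta (a * b) = delta a * delta b"
  by (simp_all add: delta_def flip: nI_simps[OF good])

lemma delta_iff: "a = b \<longleftrightarrow> delta a = delta b" "a < b \<longleftrightarrow> delta a < delta b"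
  by (simp_all add: delta_def nI_simps[OF good])

lemma delta_nonneg [simp]: "0 \<le> delta a"
  using zero_le[of a] by (auto simp: delta_iff)

lemma delta_dvd:
  assumes "delta y = delta x * t" "x \<noteq> 0" obtains l where "y = x * l"
proof -
  have x: "0 < delta x" using assms(2) zero_le[of x] by (auto simp: delta_iff)
  have "0 \<le> t"
    using assms(1) x delta_nonneg[of y] by (simp add: zero_le_mult_iff)
  obtain u v where t: "t = dr u - dr v" by (rule dring_cases)
  have "v \<le> u" using \<open>0 \<le> t\<close> unfolding t by simp
  then have "t = dr (u - v)" unfolding t by (metis add_diff_cancel_right' dr_simps(3) le_add_diff_inverse2)
  then obtain l where "t = delta l" unfolding delta_def using nI_cases[OF good] by metis
  then have "y = x * l" using assms(1) by (simp add: delta_iff)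
  then show ?thesis by (rule that)
qed

text \<open>Put \<open>a = m * (i + 1) + 1\<close>. The two moduli differ by \<open>m * d\<close>,
  where \<open>d\<close> is the distance of \<open>i\<close> and \<open>j\<close>. So
  \<open>a\<close> divides \<open>n * m * d\<close>, hence \<open>n * m * m\<close> because
  \<open>d\<close> divides \<open>m\<close>, hence \<open>n\<close>.\<close>

lemma beta_coprime:
  assumes "n * (m * (j + 1) + 1) = (m * (i + 1) + 1) * l" "i < j \<or> j < i" "i < k" "j < k"
    and m: "\<And>d. d \<noteq> 0 \<Longrightarrow> d \<preceq> k \<Longrightarrow> \<exists>l. m = d * l"
  shows "\<exists>l. n = (m * (i + 1) + 1) * (l :: 'a)"
proof -
  define a where "a = m * (i + 1) + 1"
  have a: "delta a = delta m * (delta i + 1) + 1" "a \<noteq> 0" using S_nz by (auto simp: a_def)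
  have eq: "delta n * (delta m * (delta j + 1) + 1) = delta a * delta l"
    using assms(1) by (simp add: delta_iff a_def)
  have "\<exists>t. delta n * delta m * delta m = delta a * t"
    using assms(2)
  proof
    assume "i < j"
    then obtain d where d: "j = i + d" using less_diff by blast
    have "d \<noteq> 0" using \<open>i < j\<close> d add_0 less_irrefl' by metis
    moreover have "d \<preceq> k" using assms(4) iota_nonneg[of i] unfolding d iota_less iota_leq iota_simps by linarith
    ultimately obtain q where q: "m = d * q" using m by blast
    have "delta n * delta m * delta d = delta a * (delta l - delta n)"
      using eq by (simp add: d a algebra_simps)
    then have "delta n * delta m * (delta d * delta q) = delta a * ((delta l - delta n) * delta q)"
      by (simp flip: mult.assoc)
    then show ?thesis using q by (metis delta_simps(4))
  next
    assume "j < i"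
    then obtain d where d: "i = j + d" using less_diff by blast
    have "d \<noteq> 0" using \<open>j < i\<close> d add_0 less_irrefl' by metis
    moreover have "d \<preceq> k" using assms(3) iota_nonneg[of j] unfolding d iota_less iota_leq iota_simps by linarith
    ultimately obtain q where q: "m = d * q" using m by blast
    have "delta n * delta m * delta d = delta a * (delta n - delta l)"
      using eq by (simp add: d a algebra_simps)
    then have "delta n * delta m * (delta d * delta q) = delta a * ((delta n - delta l) * delta q)"
      by (simp flip: mult.assoc)
    then show ?thesis using q by (metis delta_simps(4))
  qed
  then obtain t where "delta n = delta a * t"
    using beta_ring[OF a(1)] by blast
  then show ?thesis using delta_dvd[OF _ a(2)] unfolding a_def by blast
qed

lemma factor_leq: "n = d * l \<Longrightarrow> d \<noteq> 0 \<Longrightarrow> l \<preceq> (n :: 'a)"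
  using mult_right_mono[OF iota_ge_1[of d], of "\<iota> l"] by (simp add: iota_leq)

text \<open>This replaces the factorial, since primitive recursion will itself rest on the coding of
  sequences. The bound \<open>l \<preceq> m\<close> keeps the matrix of the induction
  decidable.\<close>

lemma common_multiple: "\<exists>m. m \<noteq> 0 \<and> (\<forall>d. d \<noteq> 0 \<longrightarrow> d \<preceq> k \<longrightarrow> (\<exists>l. m = d * (l :: 'a)))"
proof -
  have "\<exists>m. m \<noteq> 0 \<and> (\<forall>d. d \<preceq> k \<longrightarrow> d \<noteq> 0 \<longrightarrow> (\<exists>l. l \<preceq> m \<and> m = d * l))"
  proof (rule sigma1_induct[where n = k])
    show "dec (\<lambda>z. p2 z \<noteq> 0 \<and> (\<forall>d. d \<preceq> p1 z \<longrightarrow> d \<noteq> 0 \<longrightarrow> (\<exists>l. l \<preceq> p2 z \<and> p2 z = d * l)))"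
      by (intro comp)
    show "\<exists>m::'a. m \<noteq> 0 \<and> (\<forall>d. d \<preceq> 0 \<longrightarrow> d \<noteq> 0 \<longrightarrow> (\<exists>l. l \<preceq> m \<and> m = d * l))"
      by (rule exI[of _ 1]) (auto simp: leq_def not_less_0 iota_eq)
    fix k m :: 'a
    assume IH: "m \<noteq> 0 \<and> (\<forall>d. d \<preceq> k \<longrightarrow> d \<noteq> 0 \<longrightarrow> (\<exists>l. l \<preceq> m \<and> m = d * l))"
    have "m * (k + 1) \<noteq> 0" using IH S_nz[of k] by (simp add: iota_eq)
    moreover have "\<exists>l. l \<preceq> m * (k + 1) \<and> m * (k + 1) = d * l" if d: "d \<preceq> k + 1" "d \<noteq> 0" for d
    proof -
      have "d \<preceq> k \<or> d = k + 1" using d(1) by (auto simp: leq_def less_S)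
      then have "\<exists>l. m * (k + 1) = d * l"
      proof
        assume "d \<preceq> k"
        then obtain l where "m = d * l" using IH d by blast
        then show ?thesis using mult_assoc' by metis
      next
        assume "d = k + 1"
        then show ?thesis using mult_comm by metis
      qed
      then show ?thesis using factor_leq d by blast
    qed
    ultimately show "\<exists>m'. m' \<noteq> 0 \<and> (\<forall>d. d \<preceq> k + 1 \<longrightarrow> d \<noteq> 0 \<longrightarrow> (\<exists>l. l \<preceq> m' \<and> m' = d * l))" by blast
  qed
  then show ?thesis by metis
qed

text \<open>\<open>n\<close> is the product of the moduli \<open>m * (i + 1) + 1\<close> over those
  \<open>i < k\<close> with \<open>P i\<close>, built up by induction on the number of treated
  \<open>i\<close>; coprimality guarantees that no further modulus divides it.\<close>

lemma beta:
  assumes "dec P"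
  shows "\<exists>m n. \<forall>i. i < k \<longrightarrow> ((\<exists>l. n = (m * (i + 1) + 1) * l) \<longleftrightarrow> P i)"
proof -
  obtain m :: 'a where m: "m \<noteq> 0" "\<And>d. d \<noteq> 0 \<Longrightarrow> d \<preceq> k \<Longrightarrow> \<exists>l. m = d * l"
    using common_multiple[of k] by metis
  define D where "D n i \<longleftrightarrow> (\<exists>l. l \<preceq> n \<and> n = (m * (i + 1) + 1) * l)" for n i
  have D: "D n i \<longleftrightarrow> (\<exists>l. n = (m * (i + 1) + 1) * l)" for n i
    unfolding D_def using factor_leq S_nz by blast
  have dec_D: "dec (\<lambda>z. D (p1 z) (p2 z))" unfolding D_def by (intro comp)
  have "\<exists>n. n \<noteq> 0 \<and> (\<forall>i. i < k \<longrightarrow> (D n i \<longleftrightarrow> i < k \<and> P i))"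
  proof (rule sigma1_induct[where n = k and P = "\<lambda>j n. n \<noteq> 0 \<and> (\<forall>i. i < k \<longrightarrow> (D n i \<longleftrightarrow> i < j \<and> P i))"])
    show "dec (\<lambda>z. p2 z \<noteq> 0 \<and> (\<forall>i. i < k \<longrightarrow> (D (p2 z) i \<longleftrightarrow> i < p1 z \<and> P i)))"
      by (intro comp dec_comp[OF assms] dec_comp2[OF dec_D])
    have "\<not> D 1 i" for i
    proof
      assume "D 1 i"
      then obtain l where l: "1 = (m * (i + 1) + 1) * l" unfolding D by blast
      then have "l \<noteq> 0" by (auto simp: iota_eq)
      then have "1 \<le> \<iota> l" by (rule iota_ge_1)
      have "0 < \<iota> m * (\<iota> i + 1)" using iota_ge_1[OF m(1)] iota_nonneg[of i]
        by (intro mult_pos_pos) linarith+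
      then have "(\<iota> m * (\<iota> i + 1) + 1) * 1 \<le> (\<iota> m * (\<iota> i + 1) + 1) * \<iota> l"
        by (intro mult_left_mono \<open>1 \<le> \<iota> l\<close>) linarith
      moreover have "(\<iota> m * (\<iota> i + 1) + 1) * \<iota> l = 1" using l by (simp add: iota_eq)
      ultimately have "\<iota> m * (\<iota> i + 1) + 1 \<le> 1" by (metis mult_1_right)
      then show False using \<open>0 < \<iota> m * (\<iota> i + 1)\<close> by simp
    qed
    then show "\<exists>n. n \<noteq> 0 \<and> (\<forall>i. i < k \<longrightarrow> (D n i \<longleftrightarrow> i < 0 \<and> P i))"
      by (intro exI[of _ 1]) (auto simp: not_less_0 iota_eq)
    fix j n
    assume IH: "n \<noteq> 0 \<and> (\<forall>i. i < k \<longrightarrow> (D n i \<longleftrightarrow> i < j \<and> P i))"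
    show "\<exists>n. n \<noteq> 0 \<and> (\<forall>i. i < k \<longrightarrow> (D n i \<longleftrightarrow> i < j + 1 \<and> P i))"
    proof (cases "j < k \<and> P j")
      case False
      then show ?thesis using IH by (intro exI[of _ n]) (auto simp: less_S)
    next
      case True
      let ?n = "n * (m * (j + 1) + 1)"
      have "?n \<noteq> 0" using IH S_nz[of "m * (j + 1)"] by (simp add: iota_eq)
      moreover have "D ?n i \<longleftrightarrow> i < j + 1 \<and> P i" if i: "i < k" for i
      proof (cases "i = j")
        case True
        then have "D ?n i" unfolding D using mult_comm by blast
        then show ?thesis using True \<open>j < k \<and> P j\<close> by (simp add: less_S)
      next
        case False
        have "D ?n i \<longleftrightarrow> D n i"
        proof
          assume "D ?n i"
          then obtain l where "?n = (m * (i + 1) + 1) * l" unfolding D by blast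
          moreover have "i < j \<or> j < i" using False less_linear' by blast
          ultimately show "D n i" unfolding D using beta_coprime[of n m j i l k] i True m(2) by blast
        next
          assume "D n i"
          then show "D ?n i" unfolding D using mult_assoc' by metis
        qed
        then show ?thesis using IH i False by (auto simp: less_S)
      qed
      ultimately show ?thesis by blast
    qed
  qed
  then show ?thesis unfolding D by metis
qed

section \<open>Finite sets and finite sequences as single numbers\<close>

lemma triple_iff: "triple c \<longleftrightarrow> is_pair c \<and> is_pair (p2 c)" for c :: 'a
  by (auto simp: triple_def is_pair_def)

lemma elem_iff: "elem i c \<longleftrightarrow> triple c \<and> i < p1 c \<and>
    (\<exists>l. l \<preceq> p2 (p2 c) \<and> p2 (p2 c) = (p1 (p2 c) * (i + 1) + 1) * l)" for i c :: 'a
proof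
  assume "elem i c"
  then obtain k m n l where "c = pr k (pr m n)" "i < k" "n = (m * (i + 1) + 1) * l" by (auto simp: elem_def)
  then show "triple c \<and> i < p1 c \<and> (\<exists>l. l \<preceq> p2 (p2 c) \<and> p2 (p2 c) = (p1 (p2 c) * (i + 1) + 1) * l)"
    using factor_leq[of n _ l] S_nz by (auto simp: triple_def)
next
  assume "triple c \<and> i < p1 c \<and> (\<exists>l. l \<preceq> p2 (p2 c) \<and> p2 (p2 c) = (p1 (p2 c) * (i + 1) + 1) * l)"
  then show "elem i c" unfolding elem_def triple_iff
    by (intro exI[of _ "p1 c"] exI[of _ "p1 (p2 c)"] exI[of _ "p2 (p2 c)"]) auto
qed

lemma elem_less: "elem i c \<Longrightarrow> i < (c :: 'a)"
  unfolding elem_iff using p_le(1)[of c] by (simp add: iota_iff)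

lemma dec_elem [comp]: assumes "fn S f" "fn S g" shows "dec (\<lambda>x. elem (f x) (g x))"
  unfolding elem_iff triple_iff by (intro comp fn_comp[OF assms(1)] fn_comp[OF assms(2)] assms)

lemma fin_code_iff: "fin_code c \<longleftrightarrow> triple c \<and>
    \<not> (\<exists>c'. c' < c \<and> triple c' \<and> (\<forall>i. i < c \<longrightarrow> (elem i c' \<longleftrightarrow> elem i c)))" for c :: 'a
proof -
  have "(\<forall>i. elem i c' \<longleftrightarrow> elem i c) \<longleftrightarrow> (\<forall>i. i < c \<longrightarrow> (elem i c' \<longleftrightarrow> elem i c))" if "c' < c" for c'
    using elem_less less_trans' that by metis
  then show ?thesis unfolding fin_code_def by blast
qed

lemma dec_fin_code [comp]: assumes "fn S f" shows "dec (\<lambda>x. fin_code (f x))"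
  unfolding fin_code_iff triple_iff by (intro comp fn_comp[OF assms] assms)

lemma fin_code_ext: "fin_code c \<Longrightarrow> fin_code c' \<Longrightarrow> (\<And>i. elem i c \<longleftrightarrow> elem i c') \<Longrightarrow> c = (c' :: 'a)"
  unfolding fin_code_def using less_linear' by blast

lemma fin_code_ex:
  assumes "dec P" shows "\<exists>c. fin_code c \<and> (\<forall>i. elem i c \<longleftrightarrow> i < k \<and> P i)"
proof -
  obtain m n where mn: "\<And>i. i < k \<Longrightarrow> (\<exists>l. n = (m * (i + 1) + 1) * l) \<longleftrightarrow> P i"
    using beta[OF assms, of k] by metis
  define c where "c = pr k (pr m n)"
  have c: "triple c" "\<And>i. elem i c \<longleftrightarrow> i < k \<and> P i"
    using mn by (auto simp: triple_def elem_def c_def)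
  \<comment> \<open>Members of a set are smaller than its code, so comparing up to
    \<open>c' + c\<close> decides whether both codes represent the same set.\<close>
  define Q where "Q c' \<longleftrightarrow> triple c' \<and> (\<forall>i. i < c' + c \<longrightarrow> (elem i c' \<longleftrightarrow> elem i c))" for c'
  have "i < c' + c" if "elem i c' \<or> elem i c" for i c'
    using elem_less[of i c'] elem_less[of i c] that iota_nonneg[of c] iota_nonneg[of c']
    by (auto simp: iota_iff simp del: iota_nonneg)
  then have Q: "Q c' \<longleftrightarrow> triple c' \<and> (\<forall>i. elem i c' \<longleftrightarrow> elem i c)" for c'
    unfolding Q_def by blast
  have "dec Q" unfolding Q_def triple_iff by (intro comp)
  moreover have "Q c" unfolding Q using c by blast
  ultimately obtain c' where c': "Q c'" "\<And>d. d < c' \<Longrightarrow> \<not> Q d" using dec_least by metis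
  have "elem i c' \<longleftrightarrow> i < k \<and> P i" for i using c'(1) c(2) unfolding Q by blast
  moreover have "fin_code c'"
    unfolding fin_code_def
  proof (intro conjI notI)
    show "triple c'" using c'(1) unfolding Q by blast
    assume "\<exists>d. d < c' \<and> triple d \<and> (\<forall>i. elem i d \<longleftrightarrow> elem i c')"
    then obtain d where "d < c'" "triple d" "\<forall>i. elem i d \<longleftrightarrow> elem i c'" by blast
    moreover from this have "Q d" using c'(1) unfolding Q by simp
    ultimately show False using c'(2) by blast
  qed
  ultimately show ?thesis by blast
qed

lemma bound_fn:
  assumes "fn S g" shows "\<exists>b. \<forall>i. i < l \<longrightarrow> g i < b"
proof -
  have "\<exists>b. \<forall>i. i < l \<longrightarrow> g i < b"
  proof (rule sigma1_induct[where n = l])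
    show "dec (\<lambda>z. \<forall>i. i < p1 z \<longrightarrow> g i < p2 z)" by (intro comp fn_comp[OF assms])
    show "\<exists>b. \<forall>i. i < 0 \<longrightarrow> g i < b" by (simp add: not_less_0)
    fix n b assume *: "\<forall>i. i < n \<longrightarrow> g i < b"
    have "g i < b + g n + 1" if "i < n + 1" for i
    proof -
      have "\<iota> (g i) < \<iota> b \<or> g i = g n" using * that[unfolded less_S] by (auto simp: iota_less)
      then show ?thesis using iota_nonneg[of b] iota_nonneg[of "g n"]
        unfolding iota_less iota_simps iota_eq[of "g i"] by linarith
    qed
    then show "\<exists>b. \<forall>i. i < n + 1 \<longrightarrow> g i < b" by blast
  qed
  then show ?thesis .
qed

lemma seq_ex:
  assumes "fn S g"
  shows "\<exists>s. seq_of_length s l \<and> (\<forall>i. i < l \<longrightarrow> elem (pr i (g i)) s)"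
proof -
  have "fn S (\<lambda>i. pr i (g i))" by (intro comp fn_comp[OF assms])
  then obtain b where b: "\<And>i. i < l \<Longrightarrow> pr i (g i) < b" using bound_fn[of "\<lambda>i. pr i (g i)" l] by metis
  have "dec (\<lambda>z. is_pair z \<and> p1 z < l \<and> p2 z = g (p1 z))" by (intro comp fn_comp[OF assms])
  then obtain s where s: "fin_code s" "\<And>z. elem z s \<longleftrightarrow> z < b \<and> is_pair z \<and> p1 z < l \<and> p2 z = g (p1 z)"
    using fin_code_ex[of "\<lambda>z. is_pair z \<and> p1 z < l \<and> p2 z = g (p1 z)" b] by metis
  have e: "elem z s \<longleftrightarrow> (\<exists>i. i < l \<and> z = pr i (g i))" for z
    unfolding s(2) using b by (auto simp: is_pair_def)
  have "seq_of_length s l" unfolding seq_of_length_def e using s(1) by auto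
  moreover have "elem (pr i (g i)) s" if "i < l" for i using that e by blast
  ultimately show ?thesis by blast
qed

lemma seq_elem: "seq_of_length s l \<Longrightarrow> i < l \<Longrightarrow> \<exists>!v. elem (pr i v) (s :: 'a)"
  by (auto simp: seq_of_length_def)

lemma seq_length_unique: assumes "seq_of_length s l" "seq_of_length s l'" shows "l = (l' :: 'a)"
proof -
  have *: "\<not> l < l'" if s: "seq_of_length s l" "seq_of_length s l'" for l l'
  proof
    assume "l < l'"
    then obtain v where "elem (pr l v) s" using seq_elem[OF s(2)] by blast
    then obtain i v' where "i < l \<and> pr l v = pr i v'" using s(1) unfolding seq_of_length_def by metis
    then show False using less_irrefl' by auto
  qed
  show ?thesis using *[OF assms] *[OF assms(2,1)] less_linear' by blast
qed

lemma lh_eq: "seq_of_length s l \<Longrightarrow> lh s = (l :: 'a)"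
  unfolding lh_def using seq_length_unique by blast

lemma entry_eq: "seq_of_length s l \<Longrightarrow> i < l \<Longrightarrow> elem (pr i v) s \<Longrightarrow> entry s i = (v :: 'a)"
  unfolding entry_def using seq_elem by blast

lemma entry_elem: "seq_of_length s l \<Longrightarrow> i < l \<Longrightarrow> elem (pr i (entry s i)) (s :: 'a)"
  using seq_elem entry_eq by metis

lemma seq_ext:
  assumes "seq_of_length s l" "seq_of_length t l" "\<And>i. i < l \<Longrightarrow> entry s i = entry t i"
  shows "s = (t :: 'a)"
proof -
  have "elem z s \<Longrightarrow> elem z t" if H: "seq_of_length s l" "seq_of_length t l" "\<And>i. i < l \<Longrightarrow> entry s i = entry t i"
    for z s t
  proof -
    assume z: "elem z s"
    then obtain i v where "i < l" "z = pr i v" using H(1) unfolding seq_of_length_def by metis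
    then show "elem z t" using entry_eq[OF H(1)] entry_elem[OF H(2)] H(3) z by metis
  qed
  then have "elem z s \<longleftrightarrow> elem z t" for z using assms by metis
  then show ?thesis using assms fin_code_ext unfolding seq_of_length_def by metis
qed

lemma seq_code:
  assumes "fn S g"
  shows "seq_of_length (seq_code l g) l" "i < l \<Longrightarrow> entry (seq_code l g) i = g i"
proof -
  let ?P = "\<lambda>s. seq_of_length s l \<and> (\<forall>i. i < l \<longrightarrow> elem (pr i (g i)) s)"
  obtain s where s: "?P s" using seq_ex[OF assms] by blast
  have "?P t \<Longrightarrow> t = s" for t
    by (rule seq_ext[of _ l]) (use s entry_eq in \<open>metis+\<close>)
  with s have "?P (seq_code l g)" unfolding seq_code_def by (rule theI[of ?P])
  then show "seq_of_length (seq_code l g) l" "i < l \<Longrightarrow> entry (seq_code l g) i = g i"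
    using entry_eq by blast+
qed

text \<open>The last entry contributes a pair with first component \<open>l - 1\<close>, and a code
  exceeds its members. The bound makes \<open>is_seq\<close> decidable.\<close>

lemma seq_length_leq: "seq_of_length s l \<Longrightarrow> l \<preceq> (s :: 'a)"
proof (cases "l = 0")
  case False
  assume s: "seq_of_length s l"
  obtain i where i: "l = i + 1"
    using False iota_ge_1[OF False] iota_diff[of 1 l] by (metis iota_simps(2,3) iota_eq diff_add_cancel)
  then have "i < l" by (simp add: less_S)
  then have "pr i (entry s i) < s" using entry_elem[OF s] elem_less by blast
  then have "i < s" using pr_ge1[of i "entry s i"] by (simp add: iota_iff)
  then show ?thesis unfolding i using S_le by (auto simp: leq_def)
qed simp

lemma seq_of_length_iff: "seq_of_length s l \<longleftrightarrow> fin_code s \<and>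
     (\<forall>z. z < s \<longrightarrow> elem z s \<longrightarrow> is_pair z \<and> p1 z < l) \<and>
     (\<forall>i. i < l \<longrightarrow> (\<exists>v. v < s \<and> elem (pr i v) s \<and> (\<forall>v'. v' < s \<longrightarrow> elem (pr i v') s \<longrightarrow> v' = v)))" for s l :: 'a
proof -
  have v: "v < s" if "elem (pr i v) s" for i v
    using elem_less[OF that] pr_ge2[of v i] by (simp add: iota_iff)
  have "(\<exists>i v. i < l \<and> z = pr i v) \<longleftrightarrow> is_pair z \<and> p1 z < l" for z
    by (auto simp: is_pair_def)
  moreover have "(\<exists>!v. elem (pr i v) s) \<longleftrightarrow> (\<exists>v. v < s \<and> elem (pr i v) s \<and> (\<forall>v'. v' < s \<longrightarrow> elem (pr i v') s \<longrightarrow> v' = v))" for i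
    using v by (auto simp: Ex1_def)
  moreover have "(\<forall>z. elem z s \<longrightarrow> P z) \<longleftrightarrow> (\<forall>z. z < s \<longrightarrow> elem z s \<longrightarrow> P z)" for P
    using elem_less by blast
  ultimately show ?thesis unfolding seq_of_length_def by simp
qed

lemma dec_seq_of_length [comp]:
  assumes "fn S f" "fn S g" shows "dec (\<lambda>x. seq_of_length (f x) (g x))"
  unfolding seq_of_length_iff by (intro comp fn_comp[OF assms(1)] fn_comp[OF assms(2)] assms)

lemma is_seq_iff: "is_seq s \<longleftrightarrow> (\<exists>l. l \<preceq> s \<and> seq_of_length s l)" for s :: 'a
  unfolding is_seq_def using seq_length_leq by blast

lemma dec_is_seq [comp]: assumes "fn S f" shows "dec (\<lambda>x. is_seq (f x))"
  unfolding is_seq_iff by (intro comp fn_comp[OF assms] assms)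

lemma is_seq_lh: "is_seq s \<Longrightarrow> seq_of_length s (lh (s :: 'a))"
  using lh_eq unfolding is_seq_def by blast

text \<open>Total variants of \<open>lh\<close> and \<open>entry\<close>, which are unspecified off
  sequences. With default \<open>0\<close> they become functions of \<open>S\<close>, and
  \<open>ent s\<close> is the extension of a sequence \<open>s\<close> by zeros.\<close>

definition len :: "'a \<Rightarrow> 'a" where "len s = (if is_seq s then lh s else 0)"
definition ent :: "'a \<Rightarrow> 'a \<Rightarrow> 'a" where "ent s i = (if i < len s then entry s i else 0)"

lemma fn_len [comp]: assumes "fn S f" shows "fn S (\<lambda>x. len (f x))"
proof -
  have *: "y = len x \<longleftrightarrow> (if is_seq x then seq_of_length x y else y = 0)" for x y
    unfolding len_def using is_seq_lh lh_eq by auto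
  have "fn S len" by (rule fnI) (unfold *, intro comp)
  then show ?thesis using assms by (rule fn_comp)
qed

lemma fn_ent [comp]: assumes "fn S f" "fn S g" shows "fn S (\<lambda>x. ent (f x) (g x))"
proof (rule fn_comp2[OF _ assms])
  have *: "y = ent s i \<longleftrightarrow> (if i < len s then elem (pr i y) s else y = 0)" for s i y
    unfolding ent_def len_def using entry_elem[OF is_seq_lh] entry_eq[OF is_seq_lh] not_less_0 by auto
  show "fn S (\<lambda>z. ent (p1 z) (p2 z))" by (rule fnI) (unfold *, intro comp)
qed

lemma seq_obtain:
  assumes "fn S g" shows "\<exists>s. is_seq s \<and> len s = l \<and> (\<forall>i. i < l \<longrightarrow> ent s i = g i)"
proof -
  have s: "seq_of_length (seq_code l g) l" using seq_code(1)[OF assms] .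
  then have "is_seq (seq_code l g)" by (auto simp: is_seq_def)
  moreover from this s have "len (seq_code l g) = l" by (simp add: len_def lh_eq)
  ultimately show ?thesis using seq_code(2)[OF assms] by (intro exI[of _ "seq_code l g"]) (simp add: ent_def)
qed

lemma ext0_ent: "is_seq s \<Longrightarrow> ext0 s = ent s" for s :: 'a
  by (auto simp: ext0_def ent_def len_def)

text \<open>The value at \<open>n\<close> is entry \<open>n\<close> of some code of the values up to
  \<open>n\<close>. Such codes exist by existential induction, are picked by minimization, and agree
  where they overlap by induction along the entries.\<close>

lemma prim_rec:
  assumes c: "fn S c" and H: "fn S (\<lambda>z. H (p1 z) (p1 (p2 z)) (p2 (p2 z)))"
  obtains F where "fn S (\<lambda>z. F (p1 z) (p2 z))" "\<And>x. F x 0 = c x" "\<And>x i. F x (i + 1) = H x i (F x i)"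
proof -
  define Q where "Q x n s \<longleftrightarrow> ent s 0 = c x \<and> (\<forall>i. i < n \<longrightarrow> ent s (i + 1) = H x i (ent s i))" for x n s
  have H': "fn S (\<lambda>y. H (f y) (g y) (h y))" if "fn S f" "fn S g" "fn S h" for f g h
    using fn_comp[OF H, of "\<lambda>y. pr (f y) (pr (g y) (h y))"] that by (simp add: comp)
  have dec_Q: "dec (\<lambda>z. Q (p1 (p1 z)) (p2 (p1 z)) (p2 z))"
    unfolding Q_def by (intro comp fn_comp[OF c] H')
  have ex: "\<exists>s. Q x n s" for x n
  proof (rule sigma1_induct[where n = n])
    show "dec (\<lambda>z. Q x (p1 z) (p2 z))"
      using dec_comp[OF dec_Q, of "\<lambda>z. pr (pr x (p1 z)) (p2 z)"] by (simp add: comp)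
    obtain s where "\<And>i. i < 1 \<Longrightarrow> ent s i = c x"
      using seq_obtain[OF fn_const[of "c x"], of 1] by metis
    moreover have "0 < (1 :: 'a)" by (simp add: iota_iff)
    ultimately show "\<exists>s. Q x 0 s" by (auto simp: Q_def not_less_0)
    fix n s assume Q: "Q x n s"
    have "fn S (\<lambda>i. if i \<preceq> n then ent s i else H x n (ent s n))" by (intro comp)
    from seq_obtain[OF this, of "n + 1 + 1"]
    obtain t where t: "\<And>i. i < n + 1 + 1 \<Longrightarrow> ent t i = (if i \<preceq> n then ent s i else H x n (ent s n))"
      by metis
    have "ent t (i + 1) = H x i (ent t i)" if i: "i < n + 1" for i
    proof (cases "i = n")
      case True
      then show ?thesis using t[of n] t[of "n + 1"] by (simp add: iota_leq iota_less)
    next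
      case False
      then have "i < n" using i by (simp add: less_S)
      then have "i + 1 \<preceq> n" "i \<preceq> n" "i < n + 1 + 1" "i + 1 < n + 1 + 1" using S_le by (auto simp: leq_def less_S)
      then show ?thesis using t[of i] t[of "i + 1"] Q \<open>i < n\<close> by (simp add: Q_def)
    qed
    moreover have "ent t 0 = c x" using t[of 0] Q iota_nonneg[of n] by (simp add: Q_def iota_iff add_nonneg_pos)
    ultimately show "\<exists>s. Q x (n + 1) s" unfolding Q_def by blast
  qed
  obtain \<sigma> where \<sigma>: "fn S \<sigma>" "\<And>z. Q (p1 z) (p2 z) (\<sigma> z)"
    using mu[OF dec_Q] ex by metis
  define F where "F x n = ent (\<sigma> (pr x n)) n" for x n
  have eq: "ent s n = ent t n" if "Q x k s" "Q x l t" "n \<preceq> k" "n \<preceq> l" for x k l s t n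
  proof -
    have "n \<preceq> k \<longrightarrow> n \<preceq> l \<longrightarrow> ent s n = ent t n"
    proof (rule dec_induct[where n = n])
      show "dec (\<lambda>n. n \<preceq> k \<longrightarrow> n \<preceq> l \<longrightarrow> ent s n = ent t n)" by (intro comp)
      show "0 \<preceq> k \<longrightarrow> 0 \<preceq> l \<longrightarrow> ent s 0 = ent t 0" using that by (simp add: Q_def)
      show "i + 1 \<preceq> k \<longrightarrow> i + 1 \<preceq> l \<longrightarrow> ent s (i + 1) = ent t (i + 1)"
        if "i \<preceq> k \<longrightarrow> i \<preceq> l \<longrightarrow> ent s i = ent t i" for i
      proof (intro impI)
        assume "i + 1 \<preceq> k" "i + 1 \<preceq> l"
        then have "i < k" "i < l" by (simp_all add: iota_iff)
        then show "ent s (i + 1) = ent t (i + 1)"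
          using that \<open>Q x k s\<close> \<open>Q x l t\<close> by (simp add: Q_def leq_def)
      qed
    qed
    then show ?thesis using that by blast
  qed
  have Q\<sigma>: "Q x n (\<sigma> (pr x n))" for x n using \<sigma>(2)[of "pr x n"] by simp
  have le: "n \<preceq> n + 1" for n :: 'a by (simp add: iota_iff)
  have "fn S (\<lambda>z. F (p1 z) (p2 z))" unfolding F_def by (intro comp fn_comp[OF \<sigma>(1)])
  moreover have "F x 0 = c x" for x using Q\<sigma>[of x 0] by (simp add: F_def Q_def)
  moreover have "F x (i + 1) = H x i (F x i)" for x i
  proof -
    have "F x (i + 1) = H x i (ent (\<sigma> (pr x (i + 1))) i)"
      using Q\<sigma>[of x "i + 1"] by (simp add: F_def Q_def less_S)
    also have "ent (\<sigma> (pr x (i + 1))) i = F x i"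
      unfolding F_def by (rule eq[OF Q\<sigma> Q\<sigma>]) (auto simp: le)
    finally show ?thesis .
  qed
  ultimately show ?thesis by (rule that)
qed

section \<open>Rationals and reals\<close>

lemma least: assumes "dec P" "P n" shows "\<exists>m. P m \<and> (\<forall>k. k < m \<longrightarrow> \<not> P k)"
  using dec_least[OF assms, where thesis = "\<exists>m. P m \<and> (\<forall>k. k < m \<longrightarrow> \<not> P k)"] by blast

lemma pow2: "fn S (pow2 S)" "pow2 S 0 = (1 :: 'a)" "pow2 S (i + 1) = pow2 S i + (pow2 S i :: 'a)"
proof -
  let ?P = "\<lambda>f. fn S f \<and> f 0 = (1::'a) \<and> (\<forall>i. f (i + 1) = f i + f i)"
  have "fn S (\<lambda>z::'a. p2 (p2 z) + p2 (p2 z))" by (intro comp)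
  then obtain F where F: "fn S (\<lambda>z. F (p1 z) (p2 z))" "\<And>x. F x 0 = (1::'a)" "\<And>x i. F x (i + 1) = F x i + F x i"
    using prim_rec[OF fn_const[of 1], of "\<lambda>x i v. v + v"] by metis
  have "fn S (F 0)" using fn_comp2[OF F(1) fn_const[of 0] fn_id] by simp
  then have ex: "?P (F 0)" using F by blast
  have "f = g" if fg: "?P f" "?P g" for f g
  proof
    fix i
    show "f i = g i"
    proof (rule dec_induct[where P = "\<lambda>i. f i = g i"])
      show "dec (\<lambda>i. f i = g i)" using fg by (intro comp) auto
    qed (use fg in auto)
  qed
  then have "?P (pow2 S)" unfolding pow2_def using ex by (intro theI[of ?P "F 0"]) blast+
  then show "fn S (pow2 S)" "pow2 S 0 = (1 :: 'a)" "pow2 S (i + 1) = pow2 S i + (pow2 S i :: 'a)" by blast+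
qed

lemma fn_pow2 [comp]: "fn S f \<Longrightarrow> fn S (\<lambda>x. pow2 S (f x))"
  by (rule fn_comp[OF pow2(1)])

lemma pow2_gt: "\<iota> i < \<iota> (pow2 S i :: 'a)"
proof -
  have "i < pow2 S i"
  proof (rule dec_induct[where P = "\<lambda>i. i < pow2 S i"])
    show "dec (\<lambda>i::'a. i < pow2 S i)" by (intro comp)
    show "(0::'a) < pow2 S 0" by (simp add: pow2 iota_iff)
    fix n :: 'a assume "n < pow2 S n"
    then have "\<iota> n + 1 \<le> \<iota> (pow2 S n)" by (simp add: iota_less iota_discrete)
    then show "n + 1 < pow2 S (n + 1)" using iota_nonneg[of n]
      unfolding pow2 iota_less iota_simps by linarith
  qed
  then show ?thesis by (simp add: iota_less)
qed

definition e :: "'a \<Rightarrow> 'a K" where "e i = 1 / \<iota> (pow2 S i)"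

lemma pow2_pos: "0 < \<iota> (pow2 S i :: 'a)"
  using pow2_gt[of i] iota_nonneg[of i] by linarith

lemma pow2_nz: "pow2 S i \<noteq> (0 :: 'a)"
  using pow2_pos[of i] by (auto simp: iota_eq)

lemma e_pos [simp]: "0 < e i" by (simp add: e_def pow2_pos)
lemma e_0: "e 0 = 1" by (simp add: e_def pow2)
lemma e_S: "e (i + 1) = e i / 2" by (simp add: e_def pow2)

lemma e_double: "e i = e (i + 1) + e (i + 1)"
  by (simp add: e_S)

lemma dec_arith_mono:
  assumes "i \<preceq> j" obtains d where "j = i + (d :: 'a)"
  using assms iota_diff[of i j] by (metis add_diff_cancel_left' iota_eq iota_leq iota_simps(3) diff_add_cancel add.commute)

lemma e_mono: assumes "i \<preceq> j" shows "e j \<le> e i"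
proof -
  obtain d where j: "j = i + d" using dec_arith_mono[OF assms] .
  have "pow2 S i \<preceq> pow2 S (i + d)"
  proof (rule dec_induct[where P = "\<lambda>d. pow2 S i \<preceq> pow2 S (i + d)"])
    show "dec (\<lambda>d. pow2 S i \<preceq> pow2 S (i + d))" by (intro comp)
    show "pow2 S i \<preceq> pow2 S (i + 0)" by (simp add: add_0)
    fix n assume "pow2 S i \<preceq> pow2 S (i + n)"
    then show "pow2 S i \<preceq> pow2 S (i + (n + 1))"
      using iota_nonneg[of "pow2 S (i + n)"] unfolding add_S pow2 iota_leq iota_simps(3)[of "pow2 S (i + n)"]
      by linarith
  qed
  then show ?thesis unfolding e_def j iota_leq by (intro divide_left_mono mult_pos_pos pow2_pos) auto
qed

lemma e_arch: assumes "0 < t" obtains i where "e i < t"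
proof -
  obtain i :: 'a where "1 / t < \<iota> i" by (rule K_arch)
  then have "1 / t < \<iota> (pow2 S i)" using pow2_gt[of i] by linarith
  then have "e i < t" using assms pow2_pos[of i] by (simp add: e_def field_simps)
  then show ?thesis by (rule that)
qed

section \<open>Coded rationals as elements of the field\<close>

fun fv :: "'a frac \<Rightarrow> 'a K" where "fv (p, n, k) = (\<iota> p - \<iota> n) / \<iota> k"

lemma iota_pos: "(k :: 'a) \<noteq> 0 \<Longrightarrow> 0 < \<iota> k"
  using iota_ge_1[of k] by linarith

lemma frac_iffs:
  assumes "k \<noteq> 0" "k' \<noteq> 0"
  shows "frac_le (p, n, k) (p', n', k') \<longleftrightarrow> fv (p, n, k) \<le> fv (p', n', k')"
    "frac_eq (p, n, k) (p', n', k') \<longleftrightarrow> fv (p, n, k) = fv (p', n', k')"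
  using iota_pos[OF assms(1)] iota_pos[OF assms(2)]
  by (auto simp: iota_leq iota_eq frac_le_eq divide_simps algebra_simps)

lemma fv_ops:
  assumes "k \<noteq> 0" "k' \<noteq> 0"
  shows "fv (frac_add (p, n, k) (p', n', k')) = fv (p, n, k) + fv (p', n', k')"
    "fv (frac_diff (p, n, k) (p', n', k')) = fv (p, n, k) - fv (p', n', k')"
    "k * k' \<noteq> 0"
  using iota_pos[OF assms(1)] iota_pos[OF assms(2)]
  by (auto simp: iota_eq field_simps)

definition fracq :: "'a \<Rightarrow> bool" where
  "fracq q \<longleftrightarrow> is_pair q \<and> is_pair (p1 q) \<and> p2 q \<noteq> 0"

definition fq :: "'a \<Rightarrow> 'a frac" where "fq q = (p1 (p1 q), p2 (p1 q), p2 q)"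

lemma frac_rep_iff: "frac_rep q u \<longleftrightarrow> fracq q \<and> u = fq q"
  by (cases u) (auto simp: fracq_def fq_def)

lemma frac_of_eq: "fracq q \<Longrightarrow> frac_of q = fq q"
  by (simp add: frac_of_def frac_rep_iff)

definition fval :: "'a \<Rightarrow> 'a K" where "fval q = fv (fq q)"

lemma fracq_pr [simp]: "fracq (pr (pr p n) k) \<longleftrightarrow> k \<noteq> 0" "fval (pr (pr p n) k) = (\<iota> p - \<iota> n) / \<iota> k"
  by (simp_all add: fracq_def fval_def fq_def)

lemma frac_eq_fval: "fracq q \<Longrightarrow> fracq q' \<Longrightarrow> frac_eq (fq q) (fq q') \<longleftrightarrow> fval q = fval q'"
  unfolding fval_def fq_def fracq_def by (rule frac_iffs) auto

lemma is_rat_iff: "is_rat q \<longleftrightarrow> fracq q \<and> \<not> (\<exists>q'. q' < q \<and> fracq q' \<and> fval q' = fval q)"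
  unfolding is_rat_def frac_rep_iff using frac_eq_fval by auto

definition val :: "'a \<Rightarrow> 'a K" where "val q = (if is_rat q then fval q else 0)"

lemma val_fv: "is_rat q \<Longrightarrow> fv (frac_of q) = val q"
  by (simp add: is_rat_iff val_def fval_def frac_of_eq)

lemma val_inj: "is_rat q \<Longrightarrow> is_rat q' \<Longrightarrow> val q = val q' \<Longrightarrow> q = q'"
  unfolding val_def is_rat_iff using less_linear' by auto

text \<open>After clearing denominators, comparison with a given fraction is an equation between
  numbers, hence decidable. This yields the least code of every field element.\<close>

lemma dec_fval_eq:
  assumes "k \<noteq> 0"
  shows "fracq q \<and> fval q = (\<iota> p - \<iota> n) / \<iota> k \<longleftrightarrow>
    fracq q \<and> p1 (p1 q) * k + n * p2 q = p * p2 q + p2 (p1 q) * k"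
proof (cases "fracq q")
  case True
  then show ?thesis using frac_iffs(2)[where k = "p2 q" and k' = k and p = "p1 (p1 q)" and n = "p2 (p1 q)" and p' = p and n' = n] assms
    by (simp add: fracq_def fval_def fq_def)
qed simp

lemma dec_fracq [comp]: assumes "fn S f" shows "dec (\<lambda>x. fracq (f x))"
  unfolding fracq_def by (intro comp fn_comp[OF assms] assms)

lemma rat_ex: "\<exists>q. is_rat q \<and> val q = t"
proof -
  obtain p n k :: 'a where k: "\<iota> k > 0" and t: "t = (\<iota> p - \<iota> n) / \<iota> k" by (rule K_cases)
  have "k \<noteq> 0" using k by auto
  have "dec (\<lambda>q. fracq q \<and> fval q = t)"
    unfolding t dec_fval_eq[OF \<open>k \<noteq> 0\<close>] by (intro comp)
  moreover have "fracq (pr (pr p n) k) \<and> fval (pr (pr p n) k) = t" using \<open>k \<noteq> 0\<close> by (simp add: t)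
  ultimately have "\<exists>q. (fracq q \<and> fval q = t) \<and> (\<forall>q'. q' < q \<longrightarrow> \<not> (fracq q' \<and> fval q' = t))"
    by (rule least)
  then obtain q where "fracq q \<and> fval q = t" "\<And>q'. q' < q \<Longrightarrow> \<not> (fracq q' \<and> fval q' = t)"
    by blast
  then show ?thesis by (intro exI[of _ q]) (auto simp: is_rat_iff val_def)
qed

text \<open>The inverse of \<open>val\<close>: coded rationals and field elements correspond one to
  one, so that operations on codes become arithmetic in the field.\<close>

definition rc :: "'a K \<Rightarrow> 'a" where "rc t = (THE q. is_rat q \<and> val q = t)"

lemma rc [simp]: "is_rat (rc t)" "val (rc t) = t"
proof -
  have "is_rat (rc t) \<and> val (rc t) = t"
  proof -
    have "\<exists>!q. is_rat q \<and> val q = t" using rat_ex[of t] val_inj by blast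
    then show ?thesis unfolding rc_def by (rule theI')
  qed
  then show "is_rat (rc t)" "val (rc t) = t" by blast+
qed

lemma rc_val [simp]: "is_rat q \<Longrightarrow> rc (val q) = q"
  by (rule val_inj) simp_all

lemma rc_eq_iff [simp]: "rc s = rc t \<longleftrightarrow> s = t"
  by (metis rc(2))

lemma eq_rc_iff: "y = rc t \<longleftrightarrow> is_rat y \<and> val y = t"
  by (metis rc rc_val)

lemma rat_code_eq: assumes "k \<noteq> 0" shows "rat_code (p, n, k) = rc (fv (p, n, k))"
proof -
  have "is_rat q \<and> frac_eq (frac_of q) (p, n, k) \<longleftrightarrow> is_rat q \<and> val q = fv (p, n, k)" for q
    using frac_iffs(2)[OF _ assms] val_fv[of q]
    by (auto simp: is_rat_iff frac_of_eq fq_def fracq_def simp del: frac_eq.simps fv.simps)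
  then show ?thesis by (simp add: rat_code_def rc_def)
qed

lemma one_nz [simp]: "(1 :: 'a) \<noteq> 0"
  using S_nz[of 0] by (simp add: zero_add)

lemma q_consts [simp]: "q0 = rc 0" "q1 = rc 1" "qpow S i = rc (e i)"
  by (simp_all add: q0_def q1_def qpow_def rat_code_eq pow2_nz e_def)

lemma frac_of_cases: assumes "is_rat (q :: 'a)" obtains p n k where "frac_of q = (p, n, k)" "k \<noteq> 0"
proof (rule that)
  have f: "fracq q" using assms unfolding is_rat_iff by blast
  show "frac_of q = (p1 (p1 q), p2 (p1 q), p2 q)" using frac_of_eq[OF f] unfolding fq_def .
  show "p2 q \<noteq> 0" using f unfolding fracq_def by blast
qed

lemma qle_iff [simp]: assumes "is_rat a" "is_rat b" shows "qle a b \<longleftrightarrow> val a \<le> val b"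
proof -
  obtain p n k where 1: "frac_of a = (p, n, k)" "k \<noteq> 0" using frac_of_cases[OF assms(1)] .
  obtain p' n' k' where 2: "frac_of b = (p', n', k')" "k' \<noteq> 0" using frac_of_cases[OF assms(2)] .
  show ?thesis using val_fv[OF assms(1)] val_fv[OF assms(2)] frac_iffs(1)[OF 1(2) 2(2), where p = p and n = n and p' = p' and n' = n']
    by (simp add: qle_def 1 2 del: fv.simps frac_le.simps)
qed

lemma qadd_eq [simp]: assumes "is_rat a" "is_rat b" shows "qadd a b = rc (val a + val b)"
proof -
  obtain p n k where 1: "frac_of a = (p, n, k)" "k \<noteq> 0" using frac_of_cases[OF assms(1)] .
  obtain p' n' k' where 2: "frac_of b = (p', n', k')" "k' \<noteq> 0" using frac_of_cases[OF assms(2)] .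
  show ?thesis using val_fv[OF assms(1)] val_fv[OF assms(2)] fv_ops(1,2)[OF 1(2) 2(2), where p = p and n = n and p' = p' and n' = n']
    rat_code_eq[OF fv_ops(3)[OF 1(2) 2(2)]]
    by (simp add: qadd_def 1 2 del: fv.simps)
qed

lemma qdist_eq [simp]: assumes "is_rat a" "is_rat b" shows "qdist a b = rc \<bar>val a - val b\<bar>"
proof -
  obtain p n k where 1: "frac_of a = (p, n, k)" "k \<noteq> 0" using frac_of_cases[OF assms(1)] .
  obtain p' n' k' where 2: "frac_of b = (p', n', k')" "k' \<noteq> 0" using frac_of_cases[OF assms(2)] .
  show ?thesis
    using val_fv[OF assms(1)] val_fv[OF assms(2)]
      fv_ops(1,2)[OF 1(2) 2(2), where p = p and n = n and p' = p' and n' = n'] fv_ops(1,2)[OF 2(2) 1(2), where p = p' and n = n' and p' = p and n' = n]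
      rat_code_eq[OF fv_ops(3)[OF 1(2) 2(2)]] rat_code_eq[OF fv_ops(3)[OF 2(2) 1(2)]]
      qle_iff[OF assms(2,1)]
    by (simp add: qdist_def 1 2 del: fv.simps)
qed

text \<open>Field elements lie outside the model; a function with such values is represented by the
  codes of its values. By \<open>kfnI\<close> and \<open>kfnE\<close> this amounts to computing
  numerators and denominators.\<close>

definition kfn :: "('a \<Rightarrow> 'a K) \<Rightarrow> bool" where "kfn F \<longleftrightarrow> fn S (\<lambda>x. rc (F x))"

lemma dec_is_rat [comp]: assumes "fn S f" shows "dec (\<lambda>x. is_rat (f x))"
proof -
  have *: "is_rat q \<longleftrightarrow> fracq q \<and> \<not> (\<exists>q'. q' < q \<and> fracq q' \<and>
      p1 (p1 q') * p2 q + p2 (p1 q) * p2 q' = p1 (p1 q) * p2 q' + p2 (p1 q') * p2 q)" for q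
  proof (cases "fracq q")
    case True
    then have "p2 q \<noteq> 0" "fval q = (\<iota> (p1 (p1 q)) - \<iota> (p2 (p1 q))) / \<iota> (p2 q)"
      by (simp_all add: fracq_def fval_def fq_def)
    then show ?thesis unfolding is_rat_iff by (simp add: dec_fval_eq)
  qed (simp add: is_rat_iff)
  show ?thesis unfolding * by (intro comp fn_comp[OF assms] assms)
qed

lemma kfnI:
  assumes "fn S p" "fn S n" "fn S k" "\<And>x. k x \<noteq> 0" "\<And>x. F x = (\<iota> (p x) - \<iota> (n x)) / \<iota> (k x)"
  shows "kfn F"
  unfolding kfn_def
proof (rule fnI)
  have *: "y = rc (F x) \<longleftrightarrow> is_rat y \<and>
    (fracq y \<and> p1 (p1 y) * k x + n x * p2 y = p x * p2 y + p2 (p1 y) * k x)" for x y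
    unfolding eq_rc_iff dec_fval_eq[OF assms(4), symmetric] assms(5) by (auto simp: val_def is_rat_iff)
  show "dec (\<lambda>z. p2 z = rc (F (p1 z)))"
    unfolding * by (intro comp fn_comp[OF assms(1)] fn_comp[OF assms(2)] fn_comp[OF assms(3)])
qed

lemma kfnE:
  assumes "kfn F"
  obtains p n k where "fn S p" "fn S n" "fn S k" "\<And>x. k x \<noteq> 0" "\<And>x. F x = (\<iota> (p x) - \<iota> (n x)) / \<iota> (k x)"
proof -
  let ?r = "\<lambda>x. rc (F x)"
  have r: "fn S ?r" using assms by (simp add: kfn_def)
  have "fracq (?r x)" for x using rc(1)[of "F x"] by (simp add: is_rat_iff)
  moreover have "F x = fval (?r x)" for x using rc[of "F x"] by (simp add: val_def)
  ultimately show ?thesis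
    using that[of "\<lambda>x. p1 (p1 (?r x))" "\<lambda>x. p2 (p1 (?r x))" "\<lambda>x. p2 (?r x)"] fn_p[OF r] fn_p[OF fn_p(1)[OF r]]
    by (simp add: fval_def fq_def fracq_def)
qed

lemma fn_rc [comp]: "kfn F \<Longrightarrow> fn S (\<lambda>x. rc (F x))" by (simp add: kfn_def)

lemma kfn_const [comp]: "kfn (\<lambda>_. t)" unfolding kfn_def by (rule fn_const)

lemma kfn_comp: "kfn F \<Longrightarrow> fn S g \<Longrightarrow> kfn (\<lambda>x. F (g x))" unfolding kfn_def by (rule fn_comp)

lemma kfn_comp2: "kfn (\<lambda>z. F (p1 z) (p2 z)) \<Longrightarrow> fn S f \<Longrightarrow> fn S g \<Longrightarrow> kfn (\<lambda>x. F (f x) (g x))"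
  using kfn_comp[OF _ fn_pair, of "\<lambda>z. F (p1 z) (p2 z)" f g] by simp

lemma kfn_iota [comp]: "fn S f \<Longrightarrow> kfn (\<lambda>x. \<iota> (f x))"
  by (rule kfnI[of f "\<lambda>_. 0" "\<lambda>_. 1"]) (auto simp: comp iota_eq)

lemma kfn_add [comp]: assumes "kfn F" "kfn G" shows "kfn (\<lambda>x. F x + G x)"
proof -
  obtain p n k where F: "fn S p" "fn S n" "fn S k" "\<And>x. k x \<noteq> 0" "\<And>x. F x = (\<iota> (p x) - \<iota> (n x)) / \<iota> (k x)"
    using kfnE[OF assms(1)] by blast
  obtain p' n' k' where G: "fn S p'" "fn S n'" "fn S k'" "\<And>x. k' x \<noteq> 0" "\<And>x. G x = (\<iota> (p' x) - \<iota> (n' x)) / \<iota> (k' x)"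
    using kfnE[OF assms(2)] by blast
  show ?thesis
  proof (rule kfnI)
    show "fn S (\<lambda>x. p x * k' x + p' x * k x)" "fn S (\<lambda>x. n x * k' x + n' x * k x)" "fn S (\<lambda>x. k x * k' x)"
      by (intro comp F G)+
    show "k x * k' x \<noteq> 0" for x using fv_ops(3)[OF F(4) G(4)] .
    show "F x + G x = (\<iota> (p x * k' x + p' x * k x) - \<iota> (n x * k' x + n' x * k x)) / \<iota> (k x * k' x)" for x
      using fv_ops(1)[OF F(4)[of x] G(4)[of x], where p = "p x" and n = "n x" and p' = "p' x" and n' = "n' x"] by (simp add: F(5) G(5))
  qed
qed

lemma kfn_minus [comp]: assumes "kfn F" shows "kfn (\<lambda>x. - F x)"
proof -
  obtain p n k where F: "fn S p" "fn S n" "fn S k" "\<And>x. k x \<noteq> 0" "\<And>x. F x = (\<iota> (p x) - \<iota> (n x)) / \<iota> (k x)"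
    using kfnE[OF assms(1)] by blast
  show ?thesis by (rule kfnI[of n p k]) (use F in \<open>auto simp: minus_divide_left\<close>)
qed

lemma kfn_diff [comp]: "kfn F \<Longrightarrow> kfn G \<Longrightarrow> kfn (\<lambda>x. F x - G x)"
  using kfn_add[OF _ kfn_minus, of F G] by simp

lemma kfn_mult [comp]: assumes "kfn F" "kfn G" shows "kfn (\<lambda>x. F x * G x)"
proof -
  obtain p n k where F: "fn S p" "fn S n" "fn S k" "\<And>x. k x \<noteq> 0" "\<And>x. F x = (\<iota> (p x) - \<iota> (n x)) / \<iota> (k x)"
    using kfnE[OF assms(1)] by blast
  obtain p' n' k' where G: "fn S p'" "fn S n'" "fn S k'" "\<And>x. k' x \<noteq> 0" "\<And>x. G x = (\<iota> (p' x) - \<iota> (n' x)) / \<iota> (k' x)"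
    using kfnE[OF assms(2)] by blast
  show ?thesis
  proof (rule kfnI)
    show "fn S (\<lambda>x. p x * p' x + n x * n' x)" "fn S (\<lambda>x. p x * n' x + n x * p' x)" "fn S (\<lambda>x. k x * k' x)"
      by (intro comp F G)+
    show "k x * k' x \<noteq> 0" for x using fv_ops(3)[OF F(4) G(4)] .
    show "F x * G x = (\<iota> (p x * p' x + n x * n' x) - \<iota> (p x * n' x + n x * p' x)) / \<iota> (k x * k' x)" for x
      by (simp add: F(5) G(5) algebra_simps)
  qed
qed

lemma dec_kle [comp]: assumes "kfn F" "kfn G" shows "dec (\<lambda>x. F x \<le> G x)"
proof -
  obtain p n k where F: "fn S p" "fn S n" "fn S k" "\<And>x. k x \<noteq> 0" "\<And>x. F x = (\<iota> (p x) - \<iota> (n x)) / \<iota> (k x)"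
    using kfnE[OF assms(1)] by blast
  obtain p' n' k' where G: "fn S p'" "fn S n'" "fn S k'" "\<And>x. k' x \<noteq> 0" "\<And>x. G x = (\<iota> (p' x) - \<iota> (n' x)) / \<iota> (k' x)"
    using kfnE[OF assms(2)] by blast
  have *: "F x \<le> G x \<longleftrightarrow> p x * k' x + n' x * k x \<preceq> p' x * k x + n x * k' x" for x
    using frac_iffs(1)[OF F(4)[of x] G(4)[of x], where p = "p x" and n = "n x" and p' = "p' x" and n' = "n' x"] by (simp add: F(5) G(5))
  show ?thesis unfolding * by (intro comp F G)
qed

lemma dec_kless [comp]: "kfn F \<Longrightarrow> kfn G \<Longrightarrow> dec (\<lambda>x. F x < G x)"
  unfolding not_le[symmetric] by (intro comp)

lemma dec_keq [comp]: "kfn F \<Longrightarrow> kfn G \<Longrightarrow> dec (\<lambda>x. F x = G x)"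
  unfolding eq_iff by (intro comp)

lemma kfn_if [comp]: "dec P \<Longrightarrow> kfn F \<Longrightarrow> kfn G \<Longrightarrow> kfn (\<lambda>x. if P x then F x else G x)"
  using fn_if[of P "\<lambda>x. rc (F x)" "\<lambda>x. rc (G x)"] by (simp only: kfn_def if_distrib)

lemma kfn_abs [comp]: "kfn F \<Longrightarrow> kfn (\<lambda>x. \<bar>F x\<bar>)"
  unfolding abs_if by (intro comp)

lemma kfn_max [comp]: "kfn F \<Longrightarrow> kfn G \<Longrightarrow> kfn (\<lambda>x. max (F x) (G x))"
  unfolding max_def by (intro comp)

lemma kfn_min [comp]: "kfn F \<Longrightarrow> kfn G \<Longrightarrow> kfn (\<lambda>x. min (F x) (G x))"
  unfolding min_def by (intro comp)

lemma kfn_val [comp]: assumes "fn S f" shows "kfn (\<lambda>x. val (f x))"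
proof -
  have "rc (val q) = (if is_rat q then q else rc 0)" for q
    using rc_val[of q] by (cases "is_rat q") (simp_all add: val_def)
  then show ?thesis unfolding kfn_def by (simp only:) (intro comp assms)
qed

lemma kfn_e [comp]: assumes "fn S f" shows "kfn (\<lambda>x. e (f x))"
  by (rule kfnI[of "\<lambda>_. 1" "\<lambda>_. 0" "\<lambda>x. pow2 S (f x)"]) (use assms in \<open>auto simp: comp pow2_nz e_def\<close>)

lemma kprim_rec:
  assumes c: "kfn c" and H: "kfn (\<lambda>z. H (p1 z) (p1 (p2 z)) (val (p2 (p2 z))))"
  obtains F where "kfn (\<lambda>z. F (p1 z) (p2 z))" "\<And>x. F x 0 = c x" "\<And>x i. F x (i + 1) = H x i (F x i)"
proof -
  obtain G where G: "fn S (\<lambda>z. G (p1 z) (p2 z))" "\<And>x. G x 0 = rc (c x)" "\<And>x i. G x (i + 1) = rc (H x i (val (G x i)))"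
    using prim_rec[of "\<lambda>x. rc (c x)" "\<lambda>x i v. rc (H x i (val v))"] c H unfolding kfn_def by metis
  show ?thesis
    by (rule that[of "\<lambda>x i. val (G x i)"]) (auto intro!: comp G(1) simp: G)
qed

section \<open>Coded reals as elements of the completion\<close>

definition un :: "'a nn \<Rightarrow> 'a" where "un i = (THE a. nI a = i)"

lemma un_nI [simp]: "un (nI a) = a"
  by (simp add: un_def nI_simps[OF good])

lemma nI_leq: "nI a \<le> nI b \<longleftrightarrow> a \<preceq> (b :: 'a)"
  by (simp add: less_eq_nn_def nI_simps[OF good] leq_def)

definition creal :: "('a \<Rightarrow> 'a K) \<Rightarrow> bool" where
  "creal f \<longleftrightarrow> (\<forall>i j. i \<preceq> j \<longrightarrow> \<bar>f i - f j\<bar> \<le> e i)"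

definition rl :: "('a \<Rightarrow> 'a K) \<Rightarrow> 'a R" where "rl f = cl (\<lambda>i. f (un i))"

lemma creal_cauchy: assumes "creal f" shows "cauchy (\<lambda>i. f (un i))"
proof (rule cauchyI)
  fix t :: "'a K" assume "t > 0"
  then obtain k where k: "e k < t" by (rule e_arch)
  have "\<bar>f (un n) - f (un (nI k))\<bar> < t" if n: "n \<ge> nI k" for n
  proof -
    obtain m where m: "n = nI m" using nI_cases[OF good] by blast
    then have "k \<preceq> m" using n by (simp add: nI_leq)
    then have "\<bar>f k - f m\<bar> \<le> e k" using assms by (simp add: creal_def)
    then show ?thesis unfolding m un_nI using k by (simp add: abs_minus_commute)
  qed
  then show "\<exists>N. evt (\<lambda>n. \<bar>f (un n) - f (un N)\<bar> < t)" unfolding evt_def by blast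
qed

lemma rl_approx: assumes "creal f" shows "\<bar>rl f - kr (f i)\<bar> \<le> kr (e i)"
proof -
  have "\<bar>cl (\<lambda>i. f (un i)) - kr (f (un (nI i)))\<bar> \<le> kr (e i)"
  proof (rule cl_approx[OF creal_cauchy[OF assms]])
    fix n assume n: "n \<ge> nI i"
    obtain m where m: "n = nI m" using nI_cases[OF good] by blast
    then have "i \<preceq> m" using n by (simp add: nI_leq)
    then show "\<bar>f (un n) - f (un (nI i))\<bar> \<le> e i"
      using assms by (simp add: m creal_def abs_minus_commute)
  qed
  then show ?thesis by (simp add: rl_def)
qed

lemma R_arch: assumes "(0 :: 'a R) < r" obtains i where "kr (e i) < r"
proof -
  obtain t where t: "0 < (kr t :: 'a R)" "kr t < r" using kr_dense[OF assms] by blast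
  have "kr 0 < (kr t :: 'a R)" using t(1) by (simp only: kr_simps)
  then have "0 < t" by (simp only: kr_less)
  then obtain i where "e i < t" by (rule e_arch)
  then have "kr (e i) < (kr t :: 'a R)" by simp
  then show ?thesis using t that less_trans by blast
qed

lemma K_mult_e: obtains j where "t * e j \<le> e i"
proof (cases "t \<le> 0")
  case True
  then have "t * e i \<le> 0" by (simp add: mult_le_0_iff less_imp_le)
  then show ?thesis using that[of i] e_pos[of i] by linarith
next
  case False
  then have "0 < e i / t" by simp
  then obtain j where "e j < e i / t" by (rule e_arch)
  then show ?thesis using that[of j] False by (simp add: field_simps)
qed

text \<open>The free constant \<open>c\<close> lets each estimate collect its own number of error
  terms; \<open>K_mult_e\<close> absorbs it. This is the standard way below to prove an inequality
  of reals.\<close>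

lemma R_leI: assumes "\<And>i. r \<le> s + kr (c * e i)" shows "r \<le> (s :: 'a R)"
proof (rule ccontr)
  assume "\<not> r \<le> s"
  then have "0 < r - s" by simp
  then obtain i where i: "kr (e i) < r - s" by (rule R_arch)
  obtain j where "c * e j \<le> e i" by (rule K_mult_e)
  then have "kr (c * e j) \<le> (kr (e i) :: 'a R)" by (simp only: kr_le)
  then show False using assms[of j] i by linarith
qed

lemma R_eqI: assumes "\<And>i. \<bar>r - s\<bar> \<le> kr (c * e i)" shows "r = (s :: 'a R)"
proof (rule antisym)
  have "r \<le> s + kr (c * e i)" "s \<le> r + kr (c * e i)" for i using assms[of i] unfolding abs_le_iff by linarith+
  then show "r \<le> s" "s \<le> r" using R_leI by metis+
qed

lemma kr_mono: "s \<le> t \<Longrightarrow> kr s \<le> (kr t :: 'a R)" by simp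

definition rv :: "('a \<Rightarrow> 'a) \<Rightarrow> 'a R" where "rv x = rl (\<lambda>i. val (x i))"

lemma is_real_iff: "is_real S x \<longleftrightarrow> fn S x \<and> (\<forall>i. is_rat (x i)) \<and> creal (\<lambda>i. val (x i))"
  unfolding is_real_def creal_def by (auto simp del: e_pos) 

lemma rv_approx: "is_real S x \<Longrightarrow> \<bar>rv x - kr (val (x i))\<bar> \<le> kr (e i)"
  unfolding rv_def by (rule rl_approx) (simp add: is_real_iff)

text \<open>Each entry is within \<open>e k\<close> of the value, so the tolerance
  \<open>e k + e k\<close> in the coded comparison is just what \<open>rv x \<le> rv y\<close>
  yields. Conversely it leaves an error of \<open>4 * e k\<close>, which becomes arbitrarily
  small.\<close>

lemma rle_iff: assumes "is_real S x" "is_real S y" shows "rle S x y \<longleftrightarrow> rv x \<le> rv y"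
proof -
  have rat: "is_rat (x k)" "is_rat (y k)" for k using assms by (simp_all add: is_real_iff)
  have eq: "rle S x y \<longleftrightarrow> (\<forall>k. val (x k) \<le> val (y k) + (e k + e k))"
    unfolding rle_def by (simp add: rat)
  show ?thesis
  proof
    assume *: "rle S x y"
    show "rv x \<le> rv y"
    proof (rule R_leI)
      fix k
      have "kr (val (x k)) \<le> (kr (val (y k) + (e k + e k)) :: 'a R)" using * by (simp only: eq kr_le)
      then show "rv x \<le> rv y + kr (4 * e k)"
        using rv_approx[OF assms(1), of k] rv_approx[OF assms(2), of k]
        unfolding abs_le_iff kr_simps kr_numeral by linarith
    qed
  next
    assume *: "rv x \<le> rv y"
    show "rle S x y" unfolding eq
    proof
      fix k
      have "kr (val (x k)) \<le> (kr (val (y k) + (e k + e k)) :: 'a R)"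
        using * rv_approx[OF assms(1), of k] rv_approx[OF assms(2), of k]
        unfolding abs_le_iff kr_simps by linarith
      then show "val (x k) \<le> val (y k) + (e k + e k)" by (simp only: kr_le)
    qed
  qed
qed

lemma rlt_iff: "is_real S x \<Longrightarrow> is_real S y \<Longrightarrow> rlt S x y \<longleftrightarrow> rv x < rv y"
  by (simp add: rlt_def rle_iff not_le)

lemma req_iff: "is_real S x \<Longrightarrow> is_real S y \<Longrightarrow> req S x y \<longleftrightarrow> rv x = rv y"
  by (auto simp: req_def rle_iff)

lemma rv_eqI:
  assumes "is_real S x" "\<And>k. \<bar>r - kr (val (x k))\<bar> \<le> kr (c * e k)"
  shows "rv x = r"
proof (rule R_eqI[where c = "c + 1"])
  fix k show "\<bar>rv x - r\<bar> \<le> kr ((c + 1) * e k)"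
    using rv_approx[OF assms(1), of k] assms(2)[of k] unfolding abs_le_iff distrib_right kr_simps by simp
qed

lemma rconst: assumes "is_rat q" shows "is_real S (rconst q)" "rv (rconst q) = kr (val q)"
proof -
  show *: "is_real S (rconst q)"
    using assms by (auto simp: is_real_iff rconst_def creal_def comp less_imp_le)
  show "rv (rconst q) = kr (val q)"
    by (rule rv_eqI[OF *, where c = 1]) (simp add: rconst_def less_imp_le flip: kr_simps(1))
qed

lemma radd: assumes "is_real S x" "is_real S y" shows "is_real S (radd x y)" "rv (radd x y) = rv x + rv y"
proof -
  have rat: "is_rat (x k)" "is_rat (y k)" for k using assms by (simp_all add: is_real_iff)
  have r: "radd x y = (\<lambda>k. rc (val (x (k + 1)) + val (y (k + 1))))" by (simp add: radd_def rat)
  have f: "fn S x" "fn S y" using assms by (simp_all add: is_real_iff)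
  show *: "is_real S (radd x y)" unfolding is_real_iff
  proof (intro conjI allI)
    show "fn S (radd x y)" unfolding r by (intro comp fn_comp[OF f(1)] fn_comp[OF f(2)])
    show "is_rat (radd x y i)" for i by (simp add: r)
    show "creal (\<lambda>i. val (radd x y i))" unfolding creal_def
    proof (intro allI impI)
      fix i j :: 'a assume "i \<preceq> j"
      then have "i + 1 \<preceq> j + 1" by (simp add: iota_leq)
      then have "\<bar>val (x (i + 1)) - val (x (j + 1))\<bar> \<le> e (i + 1)" "\<bar>val (y (i + 1)) - val (y (j + 1))\<bar> \<le> e (i + 1)"
        using assms by (auto simp: is_real_iff creal_def)
      then show "\<bar>val (radd x y i) - val (radd x y j)\<bar> \<le> e i" using e_double[of i] by (simp add: r)
    qed
  qed
  show "rv (radd x y) = rv x + rv y"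
  proof (rule rv_eqI[OF *, where c = 1])
    fix k show "\<bar>rv x + rv y - kr (val (radd x y k))\<bar> \<le> kr (1 * e k)"
      using rv_approx[OF assms(1), of "k + 1"] rv_approx[OF assms(2), of "k + 1"] e_double[of k]
      unfolding abs_le_iff by (simp add: r)
  qed
qed

end

section \<open>Complete separable metric spaces\<close>

locale cspace = rca0 S for S :: "'a::l2_sig set set" +
  fixes X :: "'a space"
  assumes coded: "coded_space S X"
begin

definition dd :: "'a \<Rightarrow> 'a \<Rightarrow> 'a R" where "dd a b = rv (met X a b)"
definition DX :: "('a \<Rightarrow> 'a) \<Rightarrow> ('a \<Rightarrow> 'a) \<Rightarrow> 'a R" where "DX x y = rv (pdist X x y)"

lemma dense_S: "dense X \<in> S" and dense_ne: "dense X \<noteq> {}"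
  using coded by (auto simp: coded_space_def)

lemma dec_dense [comp]: assumes "fn S f" shows "dec (\<lambda>x. f x \<in> dense X)"
  by (rule dec_comp[OF dec_mem[OF dense_S] assms])

lemma met_real: "a \<in> dense X \<Longrightarrow> b \<in> dense X \<Longrightarrow> is_real S (met X a b)"
  using coded by (auto simp: coded_space_def)

lemma met_code: "\<exists>D. fn S D \<and> (\<forall>a\<in>dense X. \<forall>b\<in>dense X. \<forall>k. D (pr (pr a b) k) = met X a b k)"
  using coded unfolding coded_space_def by blast

lemma rat0: "is_rat (rc 0)" by simp

lemma dd_refl: assumes "a \<in> dense X" shows "dd a a = 0"
proof -
  have "req S (met X a a) (rconst q0)" using coded assms by (auto simp: coded_space_def)
  then show ?thesis using rconst[OF rat0] by (simp add: req_iff met_real assms dd_def)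
qed

lemma dd_sym: assumes "a \<in> dense X" "b \<in> dense X" shows "dd a b = dd b a"
proof -
  have "req S (met X a b) (met X b a)" using coded assms by (auto simp: coded_space_def)
  then show ?thesis by (simp add: req_iff met_real assms dd_def)
qed

lemma dd_nonneg: assumes "a \<in> dense X" "b \<in> dense X" shows "0 \<le> dd a b"
proof -
  have "rle S (rconst q0) (met X a b)" using coded assms by (auto simp: coded_space_def)
  then show ?thesis using rconst[OF rat0] by (simp add: rle_iff met_real assms dd_def)
qed

lemma dd_tri: assumes "a \<in> dense X" "b \<in> dense X" "c \<in> dense X" shows "dd a c \<le> dd a b + dd b c"
proof -
  have "rle S (met X a c) (radd (met X a b) (met X b c))" using coded assms by (auto simp: coded_space_def)
  then show ?thesis using radd[of "met X a b" "met X b c"] by (simp add: rle_iff met_real assms dd_def)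
qed

lemma dd_diff:
  assumes "a \<in> dense X" "b \<in> dense X" "a' \<in> dense X" "b' \<in> dense X"
  shows "\<bar>dd a b - dd a' b'\<bar> \<le> dd a a' + dd b b'"
  using dd_tri[of a a' b] dd_tri[of a' b' b] dd_tri[of a' a b'] dd_tri[of a b b']
    dd_sym[of a a'] dd_sym[of b b'] assms unfolding abs_le_iff by simp

lemma point_iff: "point S X x \<longleftrightarrow> fn S x \<and> (\<forall>i. x i \<in> dense X) \<and> (\<forall>i j. i \<preceq> j \<longrightarrow> dd (x i) (x j) \<le> kr (e i))"
proof -
  have "rle S (met X a b) (rconst (qpow S i)) \<longleftrightarrow> dd a b \<le> kr (e i)" if "a \<in> dense X" "b \<in> dense X" for a b i
    using rconst[of "rc (e i)"] met_real[OF that] by (simp add: rle_iff dd_def)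
  then show ?thesis unfolding point_def by blast
qed

lemma point_const: "a \<in> dense X \<Longrightarrow> point S X (\<lambda>_. a)"
  by (auto simp: point_iff comp dd_refl less_imp_le simp flip: kr_simps(1))

lemma pointD: "point S X x \<Longrightarrow> x i \<in> dense X" "point S X x \<Longrightarrow> fn S x"
  "point S X x \<Longrightarrow> i \<preceq> j \<Longrightarrow> dd (x i) (x j) \<le> kr (e i)"
  by (auto simp: point_iff)

lemma pdist_real: assumes "point S X x" "point S X y" shows "is_real S (pdist X x y)"
proof -
  obtain D where D: "fn S D"
    "\<And>a b k. a \<in> dense X \<Longrightarrow> b \<in> dense X \<Longrightarrow> D (pr (pr a b) k) = met X a b k" using met_code by metis
  note [simp] = pointD(1)[OF assms(1)] pointD(1)[OF assms(2)]
  have eq: "pdist X x y = (\<lambda>k. D (pr (pr (x (k + 1 + 1)) (y (k + 1 + 1))) (k + 1 + 1)))"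
    by (simp add: pdist_def D(2))
  show ?thesis unfolding is_real_iff
  proof (intro conjI allI)
    show "fn S (pdist X x y)" unfolding eq
      by (intro comp fn_comp[OF D(1)] fn_comp[OF pointD(2)[OF assms(1)]] fn_comp[OF pointD(2)[OF assms(2)]])
    show "is_rat (pdist X x y i)" for i
      using met_real[of "x (i + 1 + 1)" "y (i + 1 + 1)"] by (simp add: pdist_def is_real_iff)
    show "creal (\<lambda>i. val (pdist X x y i))" unfolding creal_def
    proof (intro allI impI)
      fix i j :: 'a assume ij: "i \<preceq> j"
      \<comment> \<open>The shift by two in \<open>pdist\<close>: the distances of the two pairs of
        entries differ by at most two errors of size \<open>e ?i\<close>, their rational
        approximations add two more, and four of them make \<open>e i\<close>.\<close>
      let ?i = "i + 1 + 1" and ?j = "j + 1 + 1"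
      have ij2: "?i \<preceq> ?j" using ij by (simp add: iota_leq)
      have "\<bar>dd (x ?i) (y ?i) - dd (x ?j) (y ?j)\<bar> \<le> kr (e ?i) + kr (e ?i)"
        using dd_diff[of "x ?i" "y ?i" "x ?j" "y ?j"] pointD(3)[OF assms(1) ij2] pointD(3)[OF assms(2) ij2] by simp
      moreover have "\<bar>dd (x ?i) (y ?i) - kr (val (pdist X x y i))\<bar> \<le> kr (e ?i)"
        "\<bar>dd (x ?j) (y ?j) - kr (val (pdist X x y j))\<bar> \<le> kr (e ?j)"
        unfolding dd_def pdist_def by (rule rv_approx; simp add: met_real)+
      moreover have "kr (e ?j) \<le> (kr (e ?i) :: 'a R)" using e_mono[OF ij2] by simp
      moreover have "e i = 4 * e ?i" by (simp add: e_S)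
      then have "(kr (e i) :: 'a R) = 4 * kr (e ?i)" by simp
      ultimately have "kr \<bar>val (pdist X x y i) - val (pdist X x y j)\<bar> \<le> (kr (e i) :: 'a R)"
        unfolding kr_abs kr_diff abs_le_iff by linarith
      then show "\<bar>val (pdist X x y i) - val (pdist X x y j)\<bar> \<le> e i" by (simp only: kr_le)
    qed
  qed
qed

lemma DX_approx: assumes "point S X x" "point S X y" shows "\<bar>DX x y - dd (x k) (y k)\<bar> \<le> 2 * kr (e k)"
proof -
  note [simp] = pointD(1)[OF assms(1)] pointD(1)[OF assms(2)]
  have *: "\<bar>DX x y - dd (x k) (y k)\<bar> \<le> 2 * kr (e k) + kr (2 * e m)" if km: "k \<preceq> m" for m
  proof -
    let ?m = "m + 1 + 1"
    have k: "k \<preceq> ?m" and mm: "m \<preceq> ?m" using km by (simp_all add: iota_leq)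
    have "\<bar>dd (x k) (y k) - dd (x ?m) (y ?m)\<bar> \<le> kr (e k) + kr (e k)"
      using dd_diff[of "x k" "y k" "x ?m" "y ?m"] pointD(3)[OF assms(1) k] pointD(3)[OF assms(2) k] by simp
    moreover have "\<bar>dd (x ?m) (y ?m) - kr (val (pdist X x y m))\<bar> \<le> kr (e ?m)"
      unfolding dd_def pdist_def by (rule rv_approx; simp add: met_real)
    moreover have "\<bar>DX x y - kr (val (pdist X x y m))\<bar> \<le> kr (e m)"
      unfolding DX_def by (rule rv_approx[OF pdist_real[OF assms]])
    moreover have "kr (e ?m) \<le> (kr (e m) :: 'a R)" using e_mono[OF mm] by simp
    ultimately show ?thesis unfolding abs_le_iff kr_simps kr_numeral by linarith
  qed
  show ?thesis
  proof (rule R_leI[where c = 2])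
    fix i
    have k: "k \<preceq> k + i" "i \<preceq> k + i" by (simp_all add: iota_leq)
    have "(kr (2 * e (k + i)) :: 'a R) \<le> kr (2 * e i)" using e_mono[OF k(2)] by simp
    then show "\<bar>DX x y - dd (x k) (y k)\<bar> \<le> 2 * kr (e k) + kr (2 * e i)" using *[OF k(1)] by linarith
  qed
qed

lemma DX_const [simp]: "a \<in> dense X \<Longrightarrow> b \<in> dense X \<Longrightarrow> DX (\<lambda>_. a) (\<lambda>_. b) = dd a b"
  by (rule R_eqI[where c = 2]) (use DX_approx[OF point_const point_const] in simp)

lemma DX_refl [simp]: "point S X x \<Longrightarrow> DX x x = 0"
  by (rule R_eqI[where c = 2]) (use DX_approx[of x x] in \<open>simp add: dd_refl pointD\<close>)

lemma DX_nonneg: assumes "point S X x" "point S X y" shows "0 \<le> DX x y"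
proof (rule R_leI[where c = 2])
  fix i show "0 \<le> DX x y + kr (2 * e i)"
    using DX_approx[OF assms, of i] dd_nonneg[OF pointD(1)[OF assms(1)] pointD(1)[OF assms(2)], of i i]
    unfolding abs_le_iff kr_simps kr_numeral by linarith
qed

lemma DX_sym: assumes "point S X x" "point S X y" shows "DX x y = DX y x"
proof (rule R_eqI[where c = 4])
  fix i show "\<bar>DX x y - DX y x\<bar> \<le> kr (4 * e i)"
    using DX_approx[OF assms, of i] DX_approx[OF assms(2,1), of i]
      dd_sym[OF pointD(1)[OF assms(1)] pointD(1)[OF assms(2)], of i i]
    unfolding abs_le_iff kr_simps kr_numeral by linarith
qed

lemma DX_tri: assumes "point S X x" "point S X y" "point S X z" shows "DX x z \<le> DX x y + DX y z"
proof (rule R_leI[where c = 6])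
  fix i show "DX x z \<le> DX x y + DX y z + kr (6 * e i)"
    using DX_approx[OF assms(1,3), of i] DX_approx[OF assms(1,2), of i] DX_approx[OF assms(2,3), of i]
      dd_tri[OF pointD(1)[OF assms(1)] pointD(1)[OF assms(2)] pointD(1)[OF assms(3)], of i i i]
    unfolding abs_le_iff kr_simps kr_numeral by linarith
qed

lemma DX_self: assumes "point S X x" shows "DX x (\<lambda>_. x k) \<le> kr (e k)"
proof (rule R_leI[where c = 2])
  fix i
  have k: "k \<preceq> k + i" "i \<preceq> k + i" by (simp_all add: iota_leq)
  note c = point_const[OF pointD(1)[OF assms]]
  have "dd (x (k + i)) (x k) \<le> kr (e k)"
    using pointD(3)[OF assms k(1)] dd_sym[OF pointD(1)[OF assms] pointD(1)[OF assms]] by metis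
  moreover have "(kr (2 * e (k + i)) :: 'a R) \<le> kr (2 * e i)" using e_mono[OF k(2)] by simp
  ultimately show "DX x (\<lambda>_. x k) \<le> kr (e k) + kr (2 * e i)"
    using DX_approx[OF assms c[of k], of "k + i"] unfolding abs_le_iff kr_simps kr_numeral by linarith
qed

lemma peq_iff: "point S X x \<Longrightarrow> point S X y \<Longrightarrow> peq S X x y \<longleftrightarrow> DX x y = 0"
  using rconst[OF rat0] by (simp add: peq_def req_iff pdist_real DX_def)

lemma rlt_pdist: "point S X x \<Longrightarrow> point S X y \<Longrightarrow> rlt S (pdist X x y) (rconst (qpow S k)) \<longleftrightarrow> DX x y < kr (e k)"
  using rconst[of "rc (e k)"] by (simp add: rlt_iff pdist_real DX_def)

lemma in_ball_iff:
  "point S X x \<Longrightarrow> a \<in> dense X \<Longrightarrow> is_rat r \<Longrightarrow> in_ball S X (pr a r) x \<longleftrightarrow> DX x (\<lambda>_. a) < kr (val r)"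
  using rconst[of r] by (simp add: in_ball_def rlt_iff pdist_real point_const DX_def)

lemma rat_ball_iff: "rat_ball X (pr a r) \<longleftrightarrow> a \<in> dense X \<and> is_rat r \<and> 0 < val r"
  unfolding rat_ball_def using qle_iff[of r "rc 0"] by auto

lemma rat_ballE: assumes "rat_ball X B" obtains a r where "B = pr a r" "a \<in> dense X" "is_rat r" "0 < val r"
  using assms rat_ball_iff unfolding rat_ball_def by metis

text \<open>Lets points known only one by one be traded for representatives whose entries are chosen
  by a function of \<open>S\<close>. Two entries are compared through \<open>p\<close>, hence the
  index \<open>i + 1\<close> in the error.\<close>

lemma point_limit:
  assumes "fn S x" "\<And>i. x i \<in> dense X" "\<And>i. DX p (\<lambda>_. x i) \<le> kr (e (i + 1))" "point S X p"
  shows "point S X x" "DX p x = 0"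
proof -
  show x: "point S X x" unfolding point_iff
  proof (intro conjI allI impI)
    fix i j :: 'a assume ij: "i \<preceq> j"
    then have "i + 1 \<preceq> j + 1" by (simp add: iota_leq)
    then have "kr (e (j + 1)) \<le> (kr (e (i + 1)) :: 'a R)" using e_mono by simp
    moreover have "(kr (e i) :: 'a R) = 2 * kr (e (i + 1))" using e_double[of i] by simp
    moreover have "DX (\<lambda>_. x i) (\<lambda>_. x j) \<le> DX p (\<lambda>_. x i) + DX p (\<lambda>_. x j)"
      using DX_tri[OF point_const assms(4) point_const] DX_sym[OF assms(4) point_const] assms(2) by metis
    moreover have "DX (\<lambda>_. x i) (\<lambda>_. x j) = dd (x i) (x j)" using assms(2) by simp
    ultimately show "dd (x i) (x j) \<le> kr (e i)" using assms(3)[of i] assms(3)[of j] by linarith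
  qed (use assms in auto)
  show "DX p x = 0"
  proof (rule R_eqI[where c = 2])
    fix i
    have "e (i + 1) \<le> e i" using e_double[of i] e_pos[of "i + 1"] by linarith
    then have "kr (e (i + 1)) \<le> (kr (e i) :: 'a R)" by simp
    then have "DX p x \<le> 2 * kr (e i)"
      using DX_tri[OF assms(4) point_const[OF assms(2)] x, of i] DX_self[OF x, of i]
        DX_sym[OF x point_const[OF assms(2)], of i] assms(3)[of i] by linarith
    then show "\<bar>DX p x - 0\<bar> \<le> kr (2 * e i)" using DX_nonneg[OF assms(4) x] by simp
  qed
qed

lemma DX_zero_cong: assumes "point S X x" "point S X y" "point S X z" "DX x y = 0" shows "DX x z = DX y z"
  using DX_tri[OF assms(1,2,3)] DX_tri[OF assms(2,1,3)] DX_sym[OF assms(1,2)] assms(4) by simp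

end

section \<open>Spaces of rationals\<close>

text \<open>Common setting for \<open>half_line\<close> and \<open>unit_interval\<close>: points
  become coded reals with entries in \<open>A\<close>, and distance becomes the absolute difference
  of values.\<close>

locale qspace = rca0 S for S :: "'a::l2_sig set set" +
  fixes A :: "'a set"
  assumes A: "A \<in> S" "A \<noteq> {}" "\<And>q. q \<in> A \<Longrightarrow> is_rat q"
begin

abbreviation "QX \<equiv> \<lparr>dense = A, met = (\<lambda>a b. rconst (qdist a b))\<rparr>"

lemma coded_space_QX: "coded_space S QX"
proof -
  have m: "is_real S (rconst (qdist a b))" "rv (rconst (qdist a b)) = \<bar>kr (val a) - kr (val b)\<bar>"
    if "a \<in> A" "b \<in> A" for a b
    using rconst[of "rc \<bar>val a - val b\<bar>"] A(3)[OF that(1)] A(3)[OF that(2)] by simp_all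
  have D: "fn S (\<lambda>z. rc \<bar>val (p1 (p1 z)) - val (p2 (p1 z))\<bar>)" by (intro comp)
  have r0: "rv (rconst (rc 0)) = 0" "is_real S (rconst (rc 0))" using rconst[of "rc 0"] by simp_all
  show ?thesis unfolding coded_space_def
  proof (intro conjI ballI)
    show "dense QX \<in> S" "dense QX \<noteq> {}" using A by simp_all
    show "\<exists>D. fn S D \<and> (\<forall>a\<in>dense QX. \<forall>b\<in>dense QX. \<forall>k. D (pr (pr a b) k) = met QX a b k)"
      using A(3) by (intro exI[of _ "\<lambda>z. rc \<bar>val (p1 (p1 z)) - val (p2 (p1 z))\<bar>"] conjI D) (simp add: rconst_def)
    fix a b c assume "a \<in> dense QX" "b \<in> dense QX" "c \<in> dense QX"
    then have abc: "a \<in> A" "b \<in> A" "c \<in> A" by simp_all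
    show "is_real S (met QX a b)" "rle S (rconst q0) (met QX a b)" "req S (met QX a b) (met QX b a)"
      using m[OF abc(1,2)] m[OF abc(2,1)] r0 by (simp_all add: rle_iff req_iff abs_minus_commute del: qdist_eq)
    show "rle S (met QX a c) (radd (met QX a b) (met QX b c))"
      using m[OF abc(1,3)] m[OF abc(1,2)] m[OF abc(2,3)] radd[OF m(1)[OF abc(1,2)] m(1)[OF abc(2,3)]]
      by (simp add: rle_iff del: qdist_eq)
  next
    fix a assume "a \<in> dense QX"
    then show "req S (met QX a a) (rconst q0)" using m[of a a] r0 by (simp add: req_iff del: qdist_eq)
  qed
qed

sublocale Q: cspace S QX
  by unfold_locales (rule coded_space_QX)

lemma Q_dd: assumes "a \<in> A" "b \<in> A" shows "Q.dd a b = \<bar>kr (val a) - kr (val b)\<bar>"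
  using rconst[of "rc \<bar>val a - val b\<bar>"] A(3)[OF assms(1)] A(3)[OF assms(2)] by (simp add: Q.dd_def)

lemma Q_point: "point S QX x \<longleftrightarrow> is_real S x \<and> (\<forall>i. x i \<in> A)"
proof -
  have "\<bar>kr (val a) - kr (val b)\<bar> \<le> (kr (e i) :: 'a R) \<longleftrightarrow> \<bar>val a - val b\<bar> \<le> e i" for a b i
    by (simp only: kr_le flip: kr_diff kr_abs)
  then show ?thesis unfolding Q.point_iff is_real_iff creal_def using A(3) by (auto simp: Q_dd)
qed

lemma Q_DX: assumes "point S QX x" "point S QX y" shows "Q.DX x y = \<bar>rv x - rv y\<bar>"
proof (rule R_eqI[where c = 4])
  fix i
  have "is_real S x" "is_real S y" "x i \<in> A" "y i \<in> A" using assms by (auto simp: Q_point)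
  then show "\<bar>Q.DX x y - \<bar>rv x - rv y\<bar>\<bar> \<le> kr (4 * e i)"
    using rv_approx[of x i] rv_approx[of y i] Q.DX_approx[OF assms, of i] Q_dd[of "x i" "y i"]
    unfolding kr_simps kr_numeral by linarith
qed

end

context rca0
begin

lemma half_line_qspace: "qspace S {q :: 'a. is_rat q \<and> qle q0 q}"
proof -
  have eq: "{q :: 'a. is_rat q \<and> qle q0 q} = {q. is_rat q \<and> 0 \<le> val q}" using qle_iff[of "rc 0"] by auto
  have "dec (\<lambda>q. is_rat q \<and> 0 \<le> val q)" by (intro comp)
  then show ?thesis unfolding eq by unfold_locales (auto simp: dec_def intro!: exI[of _ "rc 0"])
qed

sublocale H: qspace S "{q :: 'a. is_rat q \<and> qle q0 q}"
  by (rule half_line_qspace)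

lemma unit_interval_qspace: "qspace S {q :: 'a. is_rat q \<and> qle q0 q \<and> qle q q1}"
proof -
  have eq: "{q :: 'a. is_rat q \<and> qle q0 q \<and> qle q q1} = {q. is_rat q \<and> 0 \<le> val q \<and> val q \<le> 1}"
    using qle_iff[of "rc 0"] qle_iff[of _ "rc 1"] by auto
  have "dec (\<lambda>q. is_rat q \<and> 0 \<le> val q \<and> val q \<le> 1)" by (intro comp)
  then show ?thesis unfolding eq by unfold_locales (auto simp: dec_def intro!: exI[of _ "rc 0"])
qed

sublocale U: qspace S "{q :: 'a. is_rat q \<and> qle q0 q \<and> qle q q1}"
  by (rule unit_interval_qspace)

end

section \<open>Continuous functions\<close>

locale cspace2 = rca0 S + X: cspace S X + Y: cspace S Y
  for S :: "'a::l2_sig set set" and X Y :: "'a space"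
begin

lemma in_openI: "pr n B \<in> U \<Longrightarrow> in_ball S X B x \<Longrightarrow> in_open S X U x"
  by (auto simp: in_open_def)

lemma in_openE:
  assumes "in_open S X U x" "open_code S X U" "point S X x"
  shows "\<exists>n a r. pr n (pr a r) \<in> U \<and> a \<in> dense X \<and> is_rat r \<and> X.DX x (\<lambda>_. a) < kr (val r)"
proof -
  obtain n B where B: "pr n B \<in> U" "in_ball S X B x" using assms(1) by (auto simp: in_open_def)
  then obtain n' B' where "pr n B = pr n' B'" "rat_ball X B'" using assms(2) by (auto simp: open_code_def)
  then have "rat_ball X B" by simp
  then obtain a r where "B = pr a r" "a \<in> dense X" "is_rat r" by (rule X.rat_ballE)
  then show ?thesis using B X.in_ball_iff[OF assms(3)] by blast
qed

lemma cont_val_point: "cont_val S X Y U x y \<Longrightarrow> point S Y y"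
  by (simp add: cont_val_def preimage_val_def Let_def)

lemma cont_val_open:
  assumes "cont_val S X Y U x y" "a \<in> dense Y" "is_rat r" "Y.DX y (\<lambda>_. a) < kr (val r)"
  shows "in_open S X (sect U (pr a r)) x"
proof -
  have y: "point S Y y" by (rule cont_val_point[OF assms(1)])
  have "0 \<le> Y.DX y (\<lambda>_. a)" by (intro Y.DX_nonneg y Y.point_const assms)
  then have "kr 0 < (kr (val r) :: 'a R)" using assms(4) by simp
  then have "0 < val r" by (simp only: kr_less)
  then have "rat_ball Y (pr a r)" using assms by (simp add: Y.rat_ball_iff)
  moreover have "in_ball S Y (pr a r) y" using Y.in_ball_iff[OF y assms(2,3)] assms(4) by blast
  ultimately show ?thesis using assms(1) by (auto simp: cont_val_def preimage_val_def Let_def)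
qed

lemma cont_val_unique: assumes "cont_val S X Y U x y" "cont_val S X Y U x z" shows "Y.DX y z = 0"
proof -
  have p: "point S Y y" "point S Y z" using assms cont_val_point by blast+
  have "peq S Y z y"
    using assms unfolding cont_val_def preimage_val_def Let_def by metis
  then show ?thesis using p Y.DX_sym by (simp add: Y.peq_iff)
qed

lemma preimage_val_peq:
  assumes "preimage_val S Y P x y" "point S Y z" "Y.DX y z = 0"
  shows "preimage_val S Y P x z"
proof -
  have y: "point S Y y" using assms by (simp add: preimage_val_def Let_def)
  have c: "Y.DX w y = Y.DX w z" if "point S Y w" for w
    using Y.DX_zero_cong[OF y assms(2) that assms(3)] Y.DX_sym[OF that] y assms(2) by simp
  have "in_ball S Y B y" if "rat_ball Y B" "in_ball S Y B z" for B
  proof -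
    obtain a r where B: "B = pr a r" "a \<in> dense Y" "is_rat r" using \<open>rat_ball Y B\<close> by (rule Y.rat_ballE)
    show ?thesis using that(2) Y.DX_zero_cong[OF y assms(2) Y.point_const[OF B(2)] assms(3)]
      Y.in_ball_iff[OF y B(2,3)] Y.in_ball_iff[OF assms(2) B(2,3)] B(1) by simp
  qed
  moreover have "peq S Y w z" if "point S Y w" "peq S Y w y" for w
    using that c[OF that(1)] by (simp add: Y.peq_iff y assms(2))
  ultimately show ?thesis using assms(1,2) by (auto simp: preimage_val_def Let_def)
qed

lemma cont_val_peq: "cont_val S X Y U x y \<Longrightarrow> point S Y z \<Longrightarrow> Y.DX y z = 0 \<Longrightarrow> cont_val S X Y U x z"
  unfolding cont_val_def by (rule preimage_val_peq)

text \<open>A code may assign \<open>x\<close> to a ball although its value lies on the boundary,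
  hence only a weak inequality. If \<open>y\<close> were farther away, a small ball around
  \<open>y\<close> would be disjoint from the given one, against the condition on disjoint
  balls.\<close>

lemma cont_val_closed:
  assumes "cont_code S X Y U" "point S X x" "cont_val S X Y U x y"
    "a \<in> dense Y" "is_rat r" "0 < val r" "in_open S X (sect U (pr a r)) x"
  shows "Y.DX y (\<lambda>_. a) \<le> kr (val r)"
proof (rule ccontr)
  assume "\<not> ?thesis"
  then have "0 < Y.DX y (\<lambda>_. a) - kr (val r)" by simp
  then obtain k where k: "kr (e k) < Y.DX y (\<lambda>_. a) - kr (val r)" by (rule R_arch)
  have y: "point S Y y" by (rule cont_val_point[OF assms(3)])
  define b where "b = y (k + 1 + 1)"
  have b: "b \<in> dense Y" using Y.pointD[OF y] by (simp add: b_def)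
  have yb: "Y.DX y (\<lambda>_. b) \<le> kr (e (k + 1 + 1))" unfolding b_def by (rule Y.DX_self[OF y])
  have e: "(kr (e (k + 1)) :: 'a R) = 2 * kr (e (k + 1 + 1))" "(kr (e k) :: 'a R) = 2 * kr (e (k + 1))"
    "0 < (kr (e (k + 1 + 1)) :: 'a R)"
    using e_double[of "k + 1"] e_double[of k] kr_less[of 0 "e (k + 1 + 1)"] by (auto simp del: kr_less)
  have ball: "rat_ball Y (pr b (rc (e (k + 1))))" using b by (simp add: Y.rat_ball_iff)
  have "in_open S X (sect U (pr b (rc (e (k + 1))))) x"
    by (rule cont_val_open[OF assms(3) b]) (use yb e in auto)
  moreover have "\<not> (\<exists>z. point S Y z \<and> in_ball S Y (pr a r) z \<and> in_ball S Y (pr b (rc (e (k + 1)))) z)"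
  proof
    assume "\<exists>z. point S Y z \<and> in_ball S Y (pr a r) z \<and> in_ball S Y (pr b (rc (e (k + 1)))) z"
    then obtain z where z: "point S Y z" "in_ball S Y (pr a r) z" "in_ball S Y (pr b (rc (e (k + 1)))) z" by blast
    then have "Y.DX z (\<lambda>_. a) < kr (val r)" "Y.DX z (\<lambda>_. b) < kr (e (k + 1))"
      using Y.in_ball_iff[OF z(1)] assms b by simp_all
    then show False
      using Y.DX_tri[OF y z(1) Y.point_const[OF assms(4)]] Y.DX_tri[OF y Y.point_const[OF b] z(1)]
        Y.DX_sym[OF z(1) Y.point_const[OF b]] yb e k by linarith
  qed
  moreover have "rat_ball Y (pr a r)" using assms by (simp add: Y.rat_ball_iff)
  ultimately show False using assms(1,2,7) ball unfolding cont_code_def coherent_def by blast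
qed

lemma cont_code_open: "cont_code S X Y U \<Longrightarrow> a \<in> dense Y \<Longrightarrow> is_rat r \<Longrightarrow> 0 < val r \<Longrightarrow> open_code S X (sect U (pr a r))"
  by (simp add: cont_code_def Y.rat_ball_iff)

lemma cont_cont:
  assumes "cont_code S X Y U" "point S X x" "cont_val S X Y U x y"
  shows "\<exists>j. \<forall>x' y'. point S X x' \<and> X.DX x x' < kr (e j) \<and> cont_val S X Y U x' y' \<longrightarrow> Y.DX y y' \<le> kr (e k)"
proof -
  have y: "point S Y y" by (rule cont_val_point[OF assms(3)])
  define b where "b = y (k + 1 + 1)"
  have b: "b \<in> dense Y" using Y.pointD[OF y] by (simp add: b_def)
  have yb: "Y.DX y (\<lambda>_. b) \<le> kr (e (k + 1 + 1))" unfolding b_def by (rule Y.DX_self[OF y])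
  have e: "(kr (e (k + 1)) :: 'a R) = 2 * kr (e (k + 1 + 1))" "(kr (e k) :: 'a R) = 2 * kr (e (k + 1))"
    "0 < (kr (e (k + 1 + 1)) :: 'a R)"
    using e_double[of "k + 1"] e_double[of k] kr_less[of 0 "e (k + 1 + 1)"] by (auto simp del: kr_less)
  have "in_open S X (sect U (pr b (rc (e (k + 1))))) x"
    by (rule cont_val_open[OF assms(3) b]) (use yb e in auto)
  then obtain n c t where C: "pr n (pr c t) \<in> sect U (pr b (rc (e (k + 1))))" "c \<in> dense X" "is_rat t"
      "X.DX x (\<lambda>_. c) < kr (val t)"
    using in_openE[OF _ cont_code_open[OF assms(1) b] assms(2)] by fastforce
  have "0 < kr (val t) - X.DX x (\<lambda>_. c)" using C by simp
  then obtain j where j: "kr (e j) < kr (val t) - X.DX x (\<lambda>_. c)" by (rule R_arch)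
  have "Y.DX y y' \<le> kr (e k)" if x': "point S X x'" "X.DX x x' < kr (e j)" "cont_val S X Y U x' y'" for x' y'
  proof -
    have y': "point S Y y'" by (rule cont_val_point[OF x'(3)])
    have "X.DX x' (\<lambda>_. c) < kr (val t)"
      using X.DX_tri[OF x'(1) assms(2) X.point_const[OF C(2)]] X.DX_sym[OF x'(1) assms(2)] j x'(2) by linarith
    then have "in_open S X (sect U (pr b (rc (e (k + 1))))) x'"
      using in_openI[OF C(1)] X.in_ball_iff[OF x'(1) C(2,3)] by blast
    then have "Y.DX y' (\<lambda>_. b) \<le> kr (e (k + 1))"
      using cont_val_closed[OF assms(1) x'(1,3) b, of "rc (e (k + 1))"] by simp
    then show ?thesis
      using Y.DX_tri[OF y Y.point_const[OF b] y'] Y.DX_sym[OF y' Y.point_const[OF b]] yb e by linarith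
  qed
  then show ?thesis by blast
qed

lemma rlt_Y: "point S Y z \<Longrightarrow> point S Y y \<Longrightarrow> rlt S (pdist Y z y) (rconst (qpow S k)) \<longleftrightarrow> Y.DX z y < kr (e k)"
  by (rule Y.rlt_pdist)

text \<open>The arguments below produce a value at distance 0 from \<open>x\<close>. Since values
  are determined only up to equality of points, \<open>x\<close> itself is then a value at
  \<open>x\<close>.\<close>

lemma fun_val_peq:
  assumes "fun_val S X Y F x y" "point S Y z" "Y.DX y z = 0" "is_fun_code S X Y F"
  shows "fun_val S X Y F x z"
proof (cases F)
  case (Continuous U)
  then show ?thesis using assms cont_val_peq by simp
next
  case (Borel U)
  then show ?thesis using assms preimage_val_peq by (simp add: borel_val_def)
next
  case (Baire T L)
  then obtain h where y: "point S Y y" and h: "baire_eval S X Y T L x h" "peq S Y (\<lambda>k. h (pr nil k)) y"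
    using assms(1) unfolding Baire fun_val.simps baire_val_def by blast
  have "nil \<in> T" using assms(4) Baire by (simp add: baire_code_def)
  then have hp: "point S Y (\<lambda>k. h (pr nil k))" using h(1) by (simp add: baire_eval_def Let_def)
  have "peq S Y (\<lambda>k. h (pr nil k)) z"
    using Y.DX_zero_cong[OF y assms(2) hp assms(3)] h(2) hp y assms(2)
      Y.DX_sym[OF hp y] Y.DX_sym[OF hp assms(2)] by (simp add: Y.peq_iff)
  then have "baire_val S X Y T L x z" unfolding baire_val_def using assms(2) h(1) by blast
  then show ?thesis using Baire by simp
next
  case (Baire1 W)
  then have y: "point S Y y" and ex: "\<forall>n. \<exists>w. cont_val S X Y (sect W n) x w"
    and lim: "\<And>k. \<exists>N. \<forall>n w. N \<preceq> n \<and> cont_val S X Y (sect W n) x w \<longrightarrow> rlt S (pdist Y w y) (rconst (qpow S k))"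
    using assms(1) unfolding Baire1 fun_val.simps limit_val_def by blast+
  have "rlt S (pdist Y w y) (rconst (qpow S k)) = rlt S (pdist Y w z) (rconst (qpow S k))"
    if "cont_val S X Y (sect W n) x w" for w k n
  proof -
    have w: "point S Y w" by (rule cont_val_point[OF that])
    show ?thesis using Y.DX_zero_cong[OF y assms(2) w assms(3)] Y.DX_sym[OF w y] Y.DX_sym[OF w assms(2)]
      by (simp only: rlt_Y[OF w y] rlt_Y[OF w assms(2)])
  qed
  then have "\<exists>N. \<forall>n w. N \<preceq> n \<and> cont_val S X Y (sect W n) x w \<longrightarrow> rlt S (pdist Y w z) (rconst (qpow S k))" for k
    using lim[of k] by blast
  then show ?thesis unfolding Baire1 fun_val.simps limit_val_def using assms(2) ex by blast
qed

end

section \<open>Arithmetical comprehension\<close>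

locale aca0 = rca0 S for S :: "'a::l2_sig set set" +
  assumes aca0: "ACA0 S"
begin

lemma dec_ex [comp]: assumes "dec (\<lambda>z. P (p1 z) (p2 z))" shows "dec (\<lambda>x. \<exists>y. P x y)"
proof -
  have *: "\<forall>\<phi> E e i. range E \<subseteq> S \<longrightarrow> {n. sat E (e(i := n)) \<phi>} \<in> S"
    using aca0 unfolding ACA0_def by iprover
  have "{n. sat (\<lambda>_. {z. P (p1 z) (p2 z)}) ((\<lambda>_. 0)(0 := n)) (Exis 1 (Mem (TPr (V 0) (V 1)) 0))} \<in> S"
    by (rule *[rule_format]) (use assms in \<open>auto simp: dec_def\<close>)
  then show ?thesis by (simp add: dec_def flip: pr_def)
qed

lemma dec_all [comp]: assumes "dec (\<lambda>z. P (p1 z) (p2 z))" shows "dec (\<lambda>x. \<forall>y. P x y)"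
  using dec_not[OF dec_ex[OF dec_not[OF assms]]] by simp

text \<open>Elements of the completion are external, so a family of them is called arithmetical
  through its lower cuts, which must form a set of \<open>S\<close>. Forming a supremum then costs
  just one more number quantifier.\<close>

definition rdec :: "('a \<Rightarrow> 'a R) \<Rightarrow> bool" where
  "rdec F \<longleftrightarrow> dec (\<lambda>z. kr (val (p2 z)) < F (p1 z))"

lemma rdec_less: assumes "rdec F" "kfn t" shows "dec (\<lambda>x. kr (t x) < F x)"
proof -
  have "dec (\<lambda>x. kr (val (rc (t x))) < F x)"
    by (rule dec_comp2[where P = "\<lambda>x q. kr (val q) < F x", OF assms(1)[unfolded rdec_def] fn_id fn_rc[OF assms(2)]])
  then show ?thesis by simp
qed

lemma rdec_comp: assumes "rdec F" "fn S g" shows "rdec (\<lambda>x. F (g x))"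
  unfolding rdec_def
  by (rule dec_comp2[where P = "\<lambda>x q. kr (val q) < F x", OF assms(1)[unfolded rdec_def] fn_comp[OF assms(2) fn_p1] fn_p2])

lemma rdec_comp2: "rdec (\<lambda>z. F (p1 z) (p2 z)) \<Longrightarrow> fn S f \<Longrightarrow> fn S g \<Longrightarrow> rdec (\<lambda>x. F (f x) (g x))"
  using rdec_comp[OF _ fn_pair, of "\<lambda>z. F (p1 z) (p2 z)" f g] by simp

lemma rdec_rv:
  assumes "fn S (\<lambda>z. f (p1 z) (p2 z))" "\<And>x. is_real S (f x)"
  shows "rdec (\<lambda>x. rv (f x))"
proof -
  have *: "kr t < rv y \<longleftrightarrow> (\<exists>k. t + e k < val (y k))" if "is_real S y" for t y
  proof
    assume "kr t < rv y"
    then have "0 < rv y - kr t" by simp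
    then obtain k where "kr (e k) < rv y - kr t" by (rule R_arch)
    moreover have "\<bar>rv y - kr (val (y (k + 1)))\<bar> \<le> kr (e (k + 1))" by (rule rv_approx[OF that])
    moreover have "(kr (e k) :: 'a R) = 2 * kr (e (k + 1))" using e_double[of k] by simp
    ultimately have "kr (t + e (k + 1)) < (kr (val (y (k + 1))) :: 'a R)"
      unfolding kr_simps abs_le_iff by linarith
    then show "\<exists>k. t + e k < val (y k)" unfolding kr_less by blast
  next
    assume "\<exists>k. t + e k < val (y k)"
    then obtain k where "t + e k < val (y k)" by blast
    then have "kr (t + e k) < (kr (val (y k)) :: 'a R)" by (simp only: kr_less)
    then show "kr t < rv y" using rv_approx[OF that, of k] unfolding kr_simps abs_le_iff by linarith
  qed
  show ?thesis unfolding rdec_def *[OF assms(2)] by (intro comp fn_comp2[OF assms(1)])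
qed

lemma K_val: obtains q where "t = val q"
  using rc(2) that by metis

lemma kr_between: assumes "(x :: 'a R) < y" obtains q where "x < kr (val q)" "kr (val q) < y"
  using kr_dense[OF assms] K_val by metis

lemma rdec_kr [comp]: assumes "kfn t" shows "rdec (\<lambda>x. kr (t x))"
  unfolding rdec_def kr_less by (intro comp kfn_comp[OF assms])

lemma dec_rless [comp]: assumes "rdec F" "rdec G" shows "dec (\<lambda>x. F x < G x)"
proof -
  have *: "F x < G x \<longleftrightarrow> (\<exists>q. \<not> kr (val q) < F x \<and> kr (val q) < G x)" for x
  proof
    assume "F x < G x"
    then obtain q where "F x < kr (val q)" "kr (val q) < G x" by (rule kr_between)
    then show "\<exists>q. \<not> kr (val q) < F x \<and> kr (val q) < G x" using less_asym by blast
  qed (auto simp: not_less)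
  show ?thesis unfolding * by (intro comp rdec_less rdec_comp[OF assms(1)] rdec_comp[OF assms(2)])
qed

lemma dec_rle [comp]: "rdec F \<Longrightarrow> rdec G \<Longrightarrow> dec (\<lambda>x. F x \<le> G x)"
  unfolding not_less[symmetric] by (intro comp)

lemma rdec_add [comp]: assumes "rdec F" "rdec G" shows "rdec (\<lambda>x. F x + G x)"
proof -
  have *: "kr t < F x + G x \<longleftrightarrow> (\<exists>q. kr (val q) < F x \<and> kr (t - val q) < G x)" for x t
  proof
    assume "kr t < F x + G x"
    then have "kr t - G x < F x" by (simp add: algebra_simps)
    then obtain q where "kr t - G x < kr (val q)" "kr (val q) < F x" by (rule kr_between)
    then show "\<exists>q. kr (val q) < F x \<and> kr (t - val q) < G x" by (intro exI[of _ q]) (simp add: algebra_simps)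
  next
    assume "\<exists>q. kr (val q) < F x \<and> kr (t - val q) < G x"
    then obtain q where "kr (val q) < F x" "kr (t - val q) < G x" by blast
    then show "kr t < F x + G x" unfolding kr_diff by linarith
  qed
  show ?thesis unfolding rdec_def * by (intro comp rdec_less rdec_comp[OF assms(1)] rdec_comp[OF assms(2)])
qed

lemma rdec_diff [comp]: assumes "rdec F" "rdec G" shows "rdec (\<lambda>x. F x - G x)"
proof -
  have *: "kr t < F x - G x \<longleftrightarrow> (\<exists>q. \<not> kr (val q) < G x \<and> kr (t + val q) < F x)" for x t
  proof
    assume "kr t < F x - G x"
    then have "G x < F x - kr t" by (simp add: algebra_simps)
    then obtain q where "G x < kr (val q)" "kr (val q) < F x - kr t" by (rule kr_between)
    then show "\<exists>q. \<not> kr (val q) < G x \<and> kr (t + val q) < F x" by (intro exI[of _ q]) (simp add: algebra_simps)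
  next
    assume "\<exists>q. \<not> kr (val q) < G x \<and> kr (t + val q) < F x"
    then obtain q where "\<not> kr (val q) < G x" "kr (t + val q) < F x" by blast
    then show "kr t < F x - G x" unfolding kr_simps by linarith
  qed
  show ?thesis unfolding rdec_def * by (intro comp rdec_less rdec_comp[OF assms(1)] rdec_comp[OF assms(2)])
qed

lemma rdec_scale [comp]: assumes "kfn c" "\<And>x. 0 < c x" "rdec F" shows "rdec (\<lambda>x. kr (c x) * F x)"
proof -
  have *: "kr t < kr (c x) * F x \<longleftrightarrow> (\<exists>q. kr (val q) < F x \<and> t \<le> c x * val q)" for x t
  proof
    assume t: "kr t < kr (c x) * F x"
    have c: "c x * (t / c x) = t" using assms(2)[of x] by simp
    have pos: "0 < (kr (c x) :: 'a R)" using kr_less[of 0 "c x"] assms(2)[of x] by (simp del: kr_less)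
    have "kr (c x) * (kr (t / c x) :: 'a R) = kr t" using c kr_simps(4) by metis
    then have "kr (c x) * kr (t / c x) < kr (c x) * F x" using t by simp
    then have "kr (t / c x) < F x" using pos by (simp only: mult_less_cancel_left_pos)
    then obtain q where q: "kr (t / c x) < (kr (val q) :: 'a R)" "kr (val q) < F x" by (rule kr_between)
    then have "t \<le> c x * val q" using assms(2)[of x] by (simp add: divide_less_eq mult.commute)
    then show "\<exists>q. kr (val q) < F x \<and> t \<le> c x * val q" using q by blast
  next
    assume "\<exists>q. kr (val q) < F x \<and> t \<le> c x * val q"
    then obtain q where q: "kr (val q) < F x" "t \<le> c x * val q" by blast
    have pos: "0 < (kr (c x) :: 'a R)" using kr_less[of 0 "c x"] assms(2)[of x] by (simp del: kr_less)
    have "kr t \<le> (kr (c x * val q) :: 'a R)" using q(2) by (simp only: kr_le)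
    also have "\<dots> = kr (c x) * kr (val q)" by simp
    also have "\<dots> < kr (c x) * F x" using q(1) pos by (rule mult_strict_left_mono)
    finally show "kr t < kr (c x) * F x" .
  qed
  show ?thesis unfolding rdec_def * by (intro comp rdec_less rdec_comp[OF assms(3)] kfn_comp[OF assms(1)])
qed

lemma R_bounded: obtains t where "r < (kr t :: 'a R)"
  using kr_dense[of r "r + 1"] by auto

text \<open>Infima are avoided: the least \<open>m\<close> for which some value is at most
  \<open>m * t\<close> locates the infimum up to \<open>t\<close>.\<close>

lemma approx_min:
  assumes "dec Q" "Q y0" "rdec v" "\<And>y. Q y \<Longrightarrow> 0 \<le> v y" "0 < t"
  shows "\<exists>y. Q y \<and> (\<forall>y'. Q y' \<longrightarrow> v y \<le> v y' + kr t)"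
proof -
  have "dec (\<lambda>m. \<exists>y. Q y \<and> v y \<le> kr (\<iota> m * t))"
    by (intro comp dec_comp[OF assms(1)] rdec_comp[OF assms(3)])
  moreover have "\<exists>m. \<exists>y. Q y \<and> v y \<le> kr (\<iota> m * t)"
  proof -
    obtain r where r: "v y0 < kr r" by (rule R_bounded)
    obtain m :: 'a where "r / t < \<iota> m" by (rule K_arch)
    then have "r < \<iota> m * t" using assms(5) by (simp add: divide_less_eq)
    then have "kr r < (kr (\<iota> m * t) :: 'a R)" by (simp only: kr_less)
    then show ?thesis using r assms(2) less_imp_le less_trans by metis
  qed
  ultimately obtain m where m: "\<exists>y. Q y \<and> v y \<le> kr (\<iota> m * t)" "\<And>l. l < m \<Longrightarrow> \<not> (\<exists>y. Q y \<and> v y \<le> kr (\<iota> l * t))"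
    using least[of "\<lambda>m. \<exists>y. Q y \<and> v y \<le> kr (\<iota> m * t)"] by blast
  then obtain y where y: "Q y" "v y \<le> kr (\<iota> m * t)" by blast
  have "v y \<le> v y' + kr t" if y': "Q y'" for y'
  proof (cases "m = 0")
    case True
    then have "v y \<le> 0" using y(2) by simp
    moreover have "0 \<le> v y'" by (rule assms(4)[OF y'])
    moreover have "0 \<le> (kr t :: 'a R)" using kr_le[of 0 t] assms(5) by (simp del: kr_le)
    ultimately show ?thesis by linarith
  next
    case False
    then obtain l where l: "\<iota> l = \<iota> m - \<iota> 1" using iota_diff[of 1 m] iota_ge_1 by auto
    then have "l < m" by (simp add: iota_less)
    then have "kr (\<iota> l * t) < v y'" using m(2) y' not_le by blast
    then show ?thesis using y(2) l by (simp add: algebra_simps)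
  qed
  then show ?thesis using y(1) by blast
qed

end

section \<open>Metric spaces under arithmetical comprehension\<close>

lemma (in rca0) choice:
  assumes "dec (\<lambda>z. P (p1 z) (p2 z))" "\<And>x. \<exists>y. P x y"
  shows "\<exists>f. fn S f \<and> (\<forall>x. P x (f x))"
  using mu[OF assms, where thesis = "\<exists>f. fn S f \<and> (\<forall>x. P x (f x))"] by blast

locale aspace = aca0 S + cspace S X for S :: "'a::l2_sig set set" and X :: "'a space"
begin

definition a0 :: 'a where "a0 = (SOME a. a \<in> dense X)"

lemma a0: "a0 \<in> dense X"
  unfolding a0_def using dense_ne by (meson ex_in_conv someI_ex)

text \<open>\<open>rdec\<close> concerns all arguments, so the distance is extended by
  \<open>0\<close> off the dense set. For the same reason \<open>dc\<close> below replaces arguments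
  outside it by \<open>a0\<close>.\<close>

definition dt :: "'a \<Rightarrow> 'a \<Rightarrow> 'a R" where
  "dt a b = (if a \<in> dense X \<and> b \<in> dense X then dd a b else 0)"

lemma dt_dd [simp]: "a \<in> dense X \<Longrightarrow> b \<in> dense X \<Longrightarrow> dt a b = dd a b"
  by (simp add: dt_def)

lemma rdec_dt0: "rdec (\<lambda>z. dt (p1 z) (p2 z))"
proof -
  obtain D where D: "fn S D"
    "\<And>a b k. a \<in> dense X \<Longrightarrow> b \<in> dense X \<Longrightarrow> D (pr (pr a b) k) = met X a b k" using met_code by metis
  let ?f = "\<lambda>z k. if p1 z \<in> dense X \<and> p2 z \<in> dense X then D (pr (pr (p1 z) (p2 z)) k) else rc 0"
  have eq: "?f z = (if p1 z \<in> dense X \<and> p2 z \<in> dense X then met X (p1 z) (p2 z) else rconst (rc 0))" for z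
    by (auto simp: D(2) rconst_def fun_eq_iff)
  have "rdec (\<lambda>z. rv (?f z))"
  proof (rule rdec_rv)
    show "fn S (\<lambda>z. ?f (p1 z) (p2 z))" by (intro comp fn_comp[OF D(1)])
    show "is_real S (?f z)" for z
      unfolding eq using met_real[of "p1 z" "p2 z"] rconst(1)[of "rc 0"] by simp
  qed
  then show ?thesis unfolding eq dt_def dd_def using rconst(2)[of "rc 0"] by (simp add: if_distrib cong: if_cong)
qed

lemma rdec_dt [comp]: "fn S f \<Longrightarrow> fn S g \<Longrightarrow> rdec (\<lambda>x. dt (f x) (g x))"
  by (rule rdec_comp2[OF rdec_dt0])

text \<open>The family as a whole is one function of \<open>S\<close>, which is stronger than having
  each member in \<open>S\<close>. Only such families may occur in comprehension.\<close>

definition pf :: "('a \<Rightarrow> 'a \<Rightarrow> 'a) \<Rightarrow> bool" where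
  "pf P \<longleftrightarrow> fn S (\<lambda>z. P (p1 z) (p2 z)) \<and> (\<forall>p. point S X (P p))"

lemma pf_point: "pf P \<Longrightarrow> point S X (P p)"
  by (simp add: pf_def)

lemma rdec_DX: assumes "pf P" "pf Q" shows "rdec (\<lambda>p. DX (P p) (Q p))"
proof -
  obtain D where D: "fn S D"
    "\<And>a b k. a \<in> dense X \<Longrightarrow> b \<in> dense X \<Longrightarrow> D (pr (pr a b) k) = met X a b k" using met_code by metis
  have eq: "pdist X (P p) (Q p) = (\<lambda>k. D (pr (pr (P p (k + 1 + 1)) (Q p (k + 1 + 1))) (k + 1 + 1)))" for p
    using pointD(1)[OF pf_point[OF assms(1)]] pointD(1)[OF pf_point[OF assms(2)]] by (simp add: pdist_def D(2))
  have fP: "fn S (\<lambda>z. P (p1 z) (p2 z))" and fQ: "fn S (\<lambda>z. Q (p1 z) (p2 z))"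
    using assms by (auto simp: pf_def)
  show ?thesis unfolding DX_def
  proof (rule rdec_rv)
    show "fn S (\<lambda>z. pdist X (P (p1 z)) (Q (p1 z)) (p2 z))"
      unfolding eq by (intro comp fn_comp[OF D(1)] fn_comp2[OF fP] fn_comp2[OF fQ])
    show "is_real S (pdist X (P p) (Q p))" for p
      using assms by (intro pdist_real) (auto simp: pf_def)
  qed
qed

definition dc :: "('a \<Rightarrow> 'a) \<Rightarrow> 'a \<Rightarrow> 'a R" where
  "dc x a = DX x (\<lambda>_. if a \<in> dense X then a else a0)"

lemma dc_DX [simp]: "a \<in> dense X \<Longrightarrow> dc x a = DX x (\<lambda>_. a)"
  by (simp add: dc_def)

lemma pf_comp: assumes "pf P" "fn S g" shows "pf (\<lambda>p. P (g p))"
  using assms fn_comp2[of "P" "\<lambda>z. g (p1 z)" p2] fn_comp[OF assms(2) fn_p1] fn_p2 by (auto simp: pf_def)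

lemma rdec_dc [comp]: assumes "pf P" "fn S g" "fn S f" shows "rdec (\<lambda>x. dc (P (g x)) (f x))"
proof -
  have "pf (\<lambda>z _. if p2 z \<in> dense X then p2 z else a0)"
    unfolding pf_def by (intro conjI comp allI point_const) (simp_all add: a0 comp)
  then have "rdec (\<lambda>z. dc (P (p1 z)) (p2 z))"
    unfolding dc_def using pf_comp[OF assms(1) fn_p1] by (rule rdec_DX[rotated])
  from rdec_comp2[OF this assms(2,3)] show ?thesis .
qed

text \<open>Restates \<open>in_open\<close> with number quantifiers over balls and the total
  distance \<open>dc\<close>, a form that the rules \<open>comp\<close> recognize as
  arithmetical.\<close>

definition opn :: "'a set \<Rightarrow> ('a \<Rightarrow> 'a) \<Rightarrow> bool" where
  "opn U x \<longleftrightarrow> (\<exists>n a r. pr n (pr a r) \<in> U \<and> a \<in> dense X \<and> is_rat r \<and> dc x a < kr (val r))"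

lemma opn_iff: assumes "open_code S X U" "point S X x" shows "in_open S X U x \<longleftrightarrow> opn U x"
proof
  assume "in_open S X U x"
  then obtain n B where B: "pr n B \<in> U" "in_ball S X B x" by (auto simp: in_open_def)
  then have "rat_ball X B" using assms(1) by (fastforce simp: open_code_def)
  then obtain a r where "B = pr a r" "a \<in> dense X" "is_rat r" by (rule rat_ballE)
  then show "opn U x" unfolding opn_def using B in_ball_iff[OF assms(2)]
    by (intro exI[of _ n] exI[of _ a] exI[of _ r]) simp
next
  assume "opn U x"
  then obtain n a r where "pr n (pr a r) \<in> U" "a \<in> dense X" "is_rat r" "dc x a < kr (val r)"
    unfolding opn_def by blast
  then show "in_open S X U x"
    unfolding in_open_def using in_ball_iff[OF assms(2)] by (intro exI[of _ n] exI[of _ "pr a r"]) simp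
qed

lemma dec_opn [comp]:
  assumes "W \<in> S" "pf P" "fn S u" "fn S b" "fn S g"
  shows "dec (\<lambda>z. opn (sect (sect W (u z)) (b z)) (P (g z)))"
  unfolding opn_def sect_def mem_Collect_eq
  by (intro comp dec_comp[OF dec_mem[OF assms(1)]] fn_comp[OF assms(3)] fn_comp[OF assms(4)] fn_comp[OF assms(5)] assms(2))

lemma uniform_point:
  assumes A: "dec (\<lambda>z. A (p1 z) (p1 (p2 z)) (p2 (p2 z)))"
    and q: "\<And>p. point S X (q p)" "\<And>p k. \<exists>a. A p k a"
      "\<And>p k a. A p k a \<Longrightarrow> a \<in> dense X \<and> DX (q p) (\<lambda>_. a) \<le> kr (e (k + 1))"
  shows "\<exists>Q. pf Q \<and> (\<forall>p. DX (q p) (Q p) = 0)"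
proof -
  have "dec (\<lambda>z. A (p1 (p1 z)) (p2 (p1 z)) (p2 z))"
    using dec_comp[OF A, of "\<lambda>z. pr (p1 (p1 z)) (pr (p2 (p1 z)) (p2 z))"] by (simp add: comp)
  from choice[of "\<lambda>z a. A (p1 z) (p2 z) a", OF this q(2)]
  obtain f where f: "fn S f" "\<And>z. A (p1 z) (p2 z) (f z)" by blast
  define Q where "Q p k = f (pr p k)" for p k
  have Q: "A p k (Q p k)" for p k using f(2)[of "pr p k"] by (simp add: Q_def)
  have *: "point S X (Q p) \<and> DX (q p) (Q p) = 0" for p
  proof -
    have "fn S (Q p)" unfolding Q_def by (intro fn_comp[OF f(1)] comp)
    then show ?thesis using point_limit[of "Q p" "q p"] q(1) q(3)[OF Q] by blast
  qed
  moreover have "fn S (\<lambda>z. Q (p1 z) (p2 z))" unfolding Q_def by (intro comp fn_comp[OF f(1)])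
  ultimately show ?thesis unfolding pf_def by blast
qed

text \<open>No rate of convergence is given: arithmetical choice supplies the modulus
  \<open>N\<close>, and reading the sequence at \<open>N (k + 1)\<close> gives the rate demanded of
  points.\<close>

lemma cauchy_limit:
  assumes "fn S a" "\<And>n. a n \<in> dense X" "\<And>k. \<exists>N. \<forall>m. N \<preceq> m \<longrightarrow> dd (a N) (a m) \<le> kr (e k)"
  shows "\<exists>x. point S X x \<and> (\<forall>k. \<exists>N. \<forall>m. N \<preceq> m \<longrightarrow> DX x (\<lambda>_. a m) \<le> kr (e k))"
proof -
  have "dec (\<lambda>z. \<forall>m. p2 z \<preceq> m \<longrightarrow> dt (a (p2 z)) (a m) \<le> kr (e (p1 z)))"
    by (intro comp fn_comp[OF assms(1)])
  moreover have "\<exists>N. \<forall>m. N \<preceq> m \<longrightarrow> dt (a N) (a m) \<le> kr (e k)" for k using assms(2,3) by simp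
  ultimately have "\<exists>N. fn S N \<and> (\<forall>k. \<forall>m. N k \<preceq> m \<longrightarrow> dt (a (N k)) (a m) \<le> kr (e k))"
    by (rule choice)
  then obtain N where N: "fn S N" "\<And>k. \<forall>m. N k \<preceq> m \<longrightarrow> dt (a (N k)) (a m) \<le> kr (e k)"
    by blast
  have N': "dd (a (N k)) (a m) \<le> kr (e k)" if "N k \<preceq> m" for k m using N(2) that assms(2) by simp
  define x where "x k = a (N (k + 1))" for k
  have e2: "(kr (e k) :: 'a R) = 2 * kr (e (k + 1))" for k using e_double[of k] by simp
  have x: "point S X x" unfolding point_iff
  proof (intro conjI allI impI)
    show "fn S x" unfolding x_def by (intro comp fn_comp[OF assms(1)] fn_comp[OF N(1)])
    show "x i \<in> dense X" for i using assms(2) by (simp add: x_def)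
    fix i j :: 'a assume ij: "i \<preceq> j"
    define m where "m = N (i + 1) + N (j + 1)"
    have m: "N (i + 1) \<preceq> m" "N (j + 1) \<preceq> m" by (simp_all add: m_def iota_leq)
    have "kr (e (j + 1)) \<le> (kr (e (i + 1)) :: 'a R)" using e_mono[of "i + 1" "j + 1"] ij by (simp add: iota_leq)
    then show "dd (x i) (x j) \<le> kr (e i)"
      using dd_tri[OF assms(2)[of "N (i + 1)"] assms(2)[of m] assms(2)[of "N (j + 1)"]]
        dd_sym[OF assms(2)[of m] assms(2)[of "N (j + 1)"]] N'[OF m(1)] N'[OF m(2)] e2[of i]
      unfolding x_def by linarith
  qed
  have "DX x (\<lambda>_. a m) \<le> kr (e k)" if "N (k + 1 + 1) \<preceq> m" for k m
  proof -
    have "DX x (\<lambda>_. x (k + 1)) \<le> kr (e (k + 1))" by (rule DX_self[OF x])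
    moreover have "dd (x (k + 1)) (a m) \<le> kr (e (k + 1 + 1))" unfolding x_def by (rule N'[OF that])
    moreover have "0 < (kr (e (k + 1 + 1)) :: 'a R)" using kr_less[of 0 "e (k + 1 + 1)"] by (simp del: kr_less)
    ultimately show ?thesis
      using DX_tri[OF x point_const[OF pointD(1)[OF x, of "k + 1"]] point_const[OF assms(2)[of m]]]
        DX_const[OF pointD(1)[OF x, of "k + 1"] assms(2)[of m]] e2[of k] e2[of "k + 1"] by linarith
  qed
  then show ?thesis using x by blast
qed

lemma kr_pos: "0 < t \<Longrightarrow> 0 < (kr t :: 'a R)"
  using kr_less[of 0 t] by (simp del: kr_less)

lemma half_less: "e (n + 1) \<le> 1 / 2"
  using e_mono[of 0 n] by (simp add: e_S e_0)

text \<open>\<open>G n b y\<close> says that \<open>y\<close> is reachable from \<open>b\<close>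
  with slope \<open>1 - e (n + 1)\<close>. Each step goes to a reachable point whose value is
  minimal up to \<open>e n\<close>; since these conditions are arithmetical, one function of
  \<open>S\<close> makes all choices.\<close>

lemma ekeland_seq:
  assumes v: "rdec v" "\<And>y. y \<in> dense X \<Longrightarrow> 0 \<le> v y"
  shows "\<exists>a. fn S a \<and> (\<forall>n. a n \<in> dense X) \<and>
    (\<forall>n. kr (1 - e (n + 1)) * dd (a n) (a (n + 1)) \<le> v (a n) - v (a (n + 1))) \<and>
    (\<forall>n. \<forall>y\<in>dense X. kr (1 - e (n + 1)) * dd (a n) y \<le> v (a n) - v y \<longrightarrow> v (a (n + 1)) \<le> v y + kr (e n))"
proof -
  have pos: "0 < 1 - e (n + 1)" for n using half_less[of n] by linarith
  define G where "G n b y \<longleftrightarrow> y \<in> dense X \<and> kr (1 - e (n + 1)) * dt b y \<le> v b - v y" for n b y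
  define M where "M z y \<longleftrightarrow> (p2 z \<in> dense X \<longrightarrow> G (p1 z) (p2 z) y \<and> (\<forall>y'. G (p1 z) (p2 z) y' \<longrightarrow> v y \<le> v y' + kr (e (p1 z))))" for z y
  have dec_G: "dec (\<lambda>x. G (f x) (g x) (h x))" if "fn S f" "fn S g" "fn S h" for f g h
    unfolding G_def by (intro comp that rdec_comp[OF v(1)] fn_comp[OF that(1)] pos)
  have dec_M: "dec (\<lambda>z. M (p1 z) (p2 z))"
    unfolding M_def by (intro comp dec_G rdec_comp[OF v(1)])
  have ex: "\<exists>y. M z y" for z
  proof (cases "p2 z \<in> dense X")
    case True
    have "\<exists>y. G (p1 z) (p2 z) y \<and> (\<forall>y'. G (p1 z) (p2 z) y' \<longrightarrow> v y \<le> v y' + kr (e (p1 z)))"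
    proof (rule approx_min)
      show "dec (G (p1 z) (p2 z))" by (intro dec_G comp)
      show "G (p1 z) (p2 z) (p2 z)" using True by (simp add: G_def dd_refl)
    qed (use v in \<open>auto simp: G_def\<close>)
    then show ?thesis by (simp add: M_def)
  qed (simp add: M_def)
  from choice[OF dec_M ex] obtain h where h: "fn S h" "\<And>z. M z (h z)" by blast
  have "fn S (\<lambda>z. h (pr (p1 (p2 z)) (p2 (p2 z))))" by (intro comp fn_comp[OF h(1)])
  then obtain F where F: "fn S (\<lambda>z. F (p1 z) (p2 z))" "\<And>x. F x 0 = a0" "\<And>x i. F x (i + 1) = h (pr i (F x i))"
    using prim_rec[OF fn_const[of a0], of "\<lambda>x i b. h (pr i b)"] by metis
  define a where "a = F 0"
  have fa: "fn S a" unfolding a_def by (rule fn_comp2[OF F(1) fn_const fn_id])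
  have aM: "M (pr i (a i)) (a (i + 1))" for i using h(2) by (simp add: a_def F)
  have aD: "a n \<in> dense X" for n
  proof (rule dec_induct[where P = "\<lambda>n. a n \<in> dense X"])
    show "dec (\<lambda>n. a n \<in> dense X)" by (intro comp fa)
    show "a 0 \<in> dense X" by (simp add: a_def F a0)
    show "a (n + 1) \<in> dense X" if "a n \<in> dense X" for n using aM[of n] that by (simp add: M_def G_def)
  qed
  have "kr (1 - e (n + 1)) * dd (a n) (a (n + 1)) \<le> v (a n) - v (a (n + 1))" for n
    using aM[of n] aD by (simp add: M_def G_def del: kr_diff)
  moreover have "v (a (n + 1)) \<le> v y + kr (e n)"
    if "y \<in> dense X" "kr (1 - e (n + 1)) * dd (a n) y \<le> v (a n) - v y" for n y
    using aM[of n] aD that by (simp add: M_def G_def del: kr_diff)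
  ultimately show ?thesis using fa aD by blast
qed

text \<open>The slopes increase with \<open>n\<close>, so later steps also satisfy the earlier
  inequalities, and these add up along the sequence. All slopes are at least 1/2, so distances are
  at most twice the drop of \<open>v\<close>; starting near the infimum makes the drop
  small.\<close>

lemma ekeland_limit:
  assumes v: "rdec v" "\<And>y. y \<in> dense X \<Longrightarrow> 0 \<le> v y"
    and a: "fn S a" "\<And>n. a n \<in> dense X" "\<And>n. kr (1 - e (n + 1)) * dd (a n) (a (n + 1)) \<le> v (a n) - v (a (n + 1))"
  shows "n \<preceq> m \<Longrightarrow> kr (1 - e (n + 1)) * dd (a n) (a m) \<le> v (a n) - v (a m)"
    "\<exists>x. point S X x \<and> (\<forall>k. \<exists>N. \<forall>m. N \<preceq> m \<longrightarrow> DX x (\<lambda>_. a m) \<le> kr (e k))"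
proof -
  have pos: "0 < 1 - e (n + 1)" for n using half_less[of n] by linarith
  have chain: "kr (1 - e (n + 1)) * dt (a n) (a (n + d)) \<le> v (a n) - v (a (n + d))" for n d
  proof (rule dec_induct[where P = "\<lambda>d. kr (1 - e (n + 1)) * dt (a n) (a (n + d)) \<le> v (a n) - v (a (n + d))"])
    show "dec (\<lambda>d. kr (1 - e (n + 1)) * dt (a n) (a (n + d)) \<le> v (a n) - v (a (n + d)))"
      by (intro comp rdec_comp[OF v(1)] fn_comp[OF a(1)] pos)
    show "kr (1 - e (n + 1)) * dt (a n) (a (n + 0)) \<le> v (a n) - v (a (n + 0))"
      using a(2) by (simp add: add_0 dd_refl)
    fix d assume IH: "kr (1 - e (n + 1)) * dt (a n) (a (n + d)) \<le> v (a n) - v (a (n + d))"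
    let ?m = "n + d"
    have "n + 1 \<preceq> ?m + 1" by (simp add: iota_leq)
    then have "1 - e (n + 1) \<le> 1 - e (?m + 1)" using e_mono by simp
    then have "kr (1 - e (n + 1)) * dd (a ?m) (a (?m + 1)) \<le> kr (1 - e (?m + 1)) * dd (a ?m) (a (?m + 1))"
      by (intro mult_right_mono dd_nonneg a) (simp only: kr_le)
    moreover have "kr (1 - e (n + 1)) * dd (a n) (a (?m + 1)) \<le> kr (1 - e (n + 1)) * (dd (a n) (a ?m) + dd (a ?m) (a (?m + 1)))"
      by (intro mult_left_mono dd_tri a less_imp_le kr_pos pos)
    ultimately have "kr (1 - e (n + 1)) * dd (a n) (a (?m + 1)) \<le> v (a n) - v (a (?m + 1))"
      using a(3)[of ?m] IH a(2) by (simp only: dt_dd distrib_left)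
    then show "kr (1 - e (n + 1)) * dt (a n) (a (n + (d + 1))) \<le> v (a n) - v (a (n + (d + 1)))"
      using a(2) by (simp only: add_S dt_dd)
  qed
  show ch: "kr (1 - e (n + 1)) * dd (a n) (a m) \<le> v (a n) - v (a m)" if nm: "n \<preceq> m" for n m
  proof -
    obtain d where "m = n + d" using dec_arith_mono[OF nm] .
    then show ?thesis using chain[of n d] a(2) by (simp only: dt_dd)
  qed
  show "\<exists>x. point S X x \<and> (\<forall>k. \<exists>N. \<forall>m. N \<preceq> m \<longrightarrow> DX x (\<lambda>_. a m) \<le> kr (e k))"
  proof (rule cauchy_limit[OF a(1,2)])
    fix k
    have "\<exists>y. True \<and> (\<forall>y'. True \<longrightarrow> v (a y) \<le> v (a y') + kr (e (k + 1)))"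
      by (rule approx_min) (auto intro!: comp rdec_comp[OF v(1) a(1)] v(2) a(2))
    then obtain N where N: "\<And>m. v (a N) \<le> v (a m) + kr (e (k + 1))" by blast
    have "dd (a N) (a m) \<le> kr (e k)" if m: "N \<preceq> m" for m
    proof -
      have "1 / 2 \<le> 1 - e (N + 1)" using half_less[of N] by linarith
      then have "kr (1 / 2) * dd (a N) (a m) \<le> kr (1 - e (N + 1)) * dd (a N) (a m)"
        by (intro mult_right_mono dd_nonneg a) (simp only: kr_le)
      moreover have "2 * (kr (1 / 2) * dd (a N) (a m)) = kr (2 * (1 / 2)) * dd (a N) (a m)"
        unfolding kr_simps(4) kr_numeral by (simp only: mult.assoc)
      moreover have "kr (2 * (1 / 2)) * dd (a N) (a m) = dd (a N) (a m)" by simp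
      moreover have "(kr (e k) :: 'a R) = 2 * kr (e (k + 1))" using e_double[of k] by simp
      ultimately show ?thesis using ch[OF m] N[of m] by linarith
    qed
    then show "\<exists>N. \<forall>m. N \<preceq> m \<longrightarrow> dd (a N) (a m) \<le> kr (e k)" by blast
  qed
qed

end

locale aspace2 = aca0 S + cspace2 S X Y for S :: "'a::l2_sig set set" and X Y :: "'a space"
begin

sublocale AX: aspace S X by unfold_locales
sublocale AY: aspace S Y by unfold_locales

text \<open>Having a value at each point does not provide a family in \<open>S\<close>, so the
  values are rebuilt: \<open>b\<close> is an admissible approximation if \<open>P p\<close> lies in
  the coded preimage of the ball of radius \<open>e (k + 1)\<close> around \<open>b\<close>, and
  this is arithmetical.\<close>

lemma uniform_value:
  assumes W: "W \<in> S" and u: "fn S u" and P: "AX.pf P"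
    and c: "\<And>p. cont_code S X Y (sect W (u p))" "\<And>p. \<exists>y. cont_val S X Y (sect W (u p)) (P p) y"
  shows "\<exists>Q. AY.pf Q \<and> (\<forall>p. cont_val S X Y (sect W (u p)) (P p) (Q p))"
proof -
  obtain q where q: "\<And>p. cont_val S X Y (sect W (u p)) (P p) (q p)" using c(2) by metis
  have qp: "point S Y (q p)" for p using q by (rule cont_val_point)
  have Pp: "point S X (P p)" for p using P by (rule AX.pf_point)
  define A where "A p k b \<longleftrightarrow> b \<in> dense Y \<and> AX.opn (sect (sect W (u p)) (pr b (rc (e (k + 1))))) (P p)" for p k b
  have io: "in_open S X (sect (sect W (u p)) (pr b (rc (e k)))) (P p) \<longleftrightarrow> AX.opn (sect (sect W (u p)) (pr b (rc (e k)))) (P p)"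
    if "b \<in> dense Y" for p b k
    by (rule AX.opn_iff[OF cont_code_open[OF c(1) that] Pp]) auto
  have "\<exists>Q. AY.pf Q \<and> (\<forall>p. Y.DX (q p) (Q p) = 0)"
  proof (rule AY.uniform_point)
    show "dec (\<lambda>z. A (p1 z) (p1 (p2 z)) (p2 (p2 z)))"
      unfolding A_def by (intro comp AX.dec_opn[OF W P] Y.dec_dense fn_comp[OF u])
    show "point S Y (q p)" for p by (rule qp)
    show "\<exists>b. A p k b" for p k
    proof -
      define b where "b = q p (k + 1 + 1)"
      have b: "b \<in> dense Y" using Y.pointD[OF qp] by (simp add: b_def)
      have "Y.DX (q p) (\<lambda>_. b) \<le> kr (e (k + 1 + 1))" unfolding b_def by (rule Y.DX_self[OF qp])
      also have "kr (e (k + 1 + 1)) < (kr (e (k + 1)) :: 'a R)"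
        using e_double[of "k + 1"] e_pos[of "k + 1 + 1"] by (simp only: kr_less)
      finally have "in_open S X (sect (sect W (u p)) (pr b (rc (e (k + 1))))) (P p)"
        by (intro cont_val_open[OF q b]) auto
      then show ?thesis using io[OF b] b unfolding A_def by blast
    qed
    show "b \<in> dense Y \<and> Y.DX (q p) (\<lambda>_. b) \<le> kr (e (k + 1))" if "A p k b" for p k b
      using that cont_val_closed[OF c(1) Pp q, of b "rc (e (k + 1))"] io[of b p "k + 1"] by (simp add: A_def)
  qed
  then obtain Q where "AY.pf Q" "\<And>p. Y.DX (q p) (Q p) = 0" by blast
  then show ?thesis using cont_val_peq[OF q AY.pf_point] by blast
qed

end

section \<open>The fixed point theorem from arithmetical comprehension\<close>

context rca0
begin

lemma half_line_coded: "coded_space S half_line"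
  unfolding half_line_def by (rule H.coded_space_QX)

lemma half_line_point: "point S half_line v \<longleftrightarrow> is_real S v \<and> (\<forall>i. 0 \<le> val (v i))"
  unfolding half_line_def H.Q_point using qle_iff[of "rc 0"] by (auto simp: is_real_iff)

lemma half_line_DX: "point S half_line v \<Longrightarrow> point S half_line w \<Longrightarrow> cspace.DX half_line v w = \<bar>rv v - rv w\<bar>"
  unfolding half_line_def by (rule H.Q_DX)

lemma half_line_nonneg: assumes "point S half_line v" shows "0 \<le> rv v"
proof (rule R_leI[where c = 1])
  fix i
  have "is_real S v" "0 \<le> val (v i)" using assms by (auto simp: half_line_point)
  then have "kr 0 \<le> (kr (val (v i)) :: 'a R)" by (simp only: kr_le)
  then show "0 \<le> rv v + kr (1 * e i)" using rv_approx[OF \<open>is_real S v\<close>, of i] by (simp add: abs_le_iff)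
qed

end

section \<open>Caristi systems, and the case of a continuous potential\<close>

lemma (in cspace2) fun_val_point: "fun_val S X Y F x y \<Longrightarrow> point S Y y"
  by (cases F) (auto simp: cont_val_def borel_val_def preimage_val_def limit_val_def baire_val_def Let_def)

locale asys = aspace S X for S :: "'a::l2_sig set set" and X :: "'a space" +
  fixes F G :: "'a fun_code"
  assumes sys: "caristi_system S X F G"
begin

sublocale V: aspace2 S X half_line
  by unfold_locales (rule half_line_coded)

sublocale XX: cspace2 S X X
  by unfold_locales

lemma VDX [simp]: "point S half_line v \<Longrightarrow> point S half_line w \<Longrightarrow> V.Y.DX v w = \<bar>rv v - rv w\<bar>"
  by (rule half_line_DX)

lemma F_ex: assumes "point S X x" shows "\<exists>y. fun_val S X X F x y \<and> point S X y"
  using sys assms XX.fun_val_point unfolding caristi_system_def total_fun_def by blast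

lemma G_ex: assumes "point S X x" shows "\<exists>v. fun_val S X half_line G x v \<and> point S half_line v"
  using sys assms V.fun_val_point unfolding caristi_system_def potential_def total_fun_def by blast

lemma caristi:
  assumes "point S X x" "fun_val S X X F x y" "fun_val S X half_line G x v" "fun_val S X half_line G y w"
  shows "DX x y \<le> rv v - rv w"
proof -
  have p: "point S X y" "point S half_line v" "point S half_line w"
    using assms XX.fun_val_point V.fun_val_point by blast+
  then have r: "is_real S v" "is_real S w" "is_real S (pdist X x y)"
    using pdist_real[OF assms(1)] by (auto simp: half_line_point)
  have "rle S (radd (pdist X x y) w) v" using sys assms unfolding caristi_system_def by blast
  then show ?thesis using r radd[OF r(3,2)] by (simp add: rle_iff DX_def)
qed

lemma fixedI: assumes "point S X x" "fun_val S X X F x y" "DX x y \<le> 0" shows "fun_val S X X F x x"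
proof -
  have y: "point S X y" using assms(2) by (rule XX.fun_val_point)
  have "DX y x = 0" using assms DX_nonneg[OF assms(1) y] DX_sym[OF assms(1) y] by simp
  moreover have "is_fun_code S X X F" using sys by (simp add: caristi_system_def total_fun_def)
  ultimately show ?thesis using XX.fun_val_peq assms(1,2) by blast
qed

definition cpt :: "'a \<Rightarrow> 'a \<Rightarrow> 'a" where "cpt p = (\<lambda>_. if p \<in> dense X then p else a0)"

lemma pf_cpt: "pf cpt"
  unfolding pf_def cpt_def by (intro conjI comp allI point_const) (simp add: a0)

lemma const_section: assumes "U \<in> S" shows "\<exists>W. W \<in> S \<and> (\<forall>n. sect W n = U)"
proof -
  have "dec (\<lambda>z. is_pair z \<and> p1 z \<in> U)" by (intro comp dec_comp[OF dec_mem[OF assms]])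
  then show ?thesis by (intro exI[of _ "{z. is_pair z \<and> p1 z \<in> U}"]) (auto simp: dec_def sect_def)
qed

lemma rdec_value: assumes "V.AY.pf Q" shows "rdec (\<lambda>p. rv (Q p))"
  by (rule rdec_rv) (use assms in \<open>auto simp: V.AY.pf_def half_line_point\<close>)

text \<open>Brings both presentations of a potential into one form, a nondecreasing sequence of
  continuous codes with the potential as its limit; a continuous code gives the constant
  sequence.\<close>

lemma G_seq:
  "\<exists>W. W \<in> S \<and> (\<forall>n. cont_total_code S X half_line (sect W n)) \<and>
    (\<forall>n m x v w. n \<preceq> m \<longrightarrow> point S X x \<longrightarrow> cont_val S X half_line (sect W n) x v \<longrightarrow>
      cont_val S X half_line (sect W m) x w \<longrightarrow> rv v \<le> rv w) \<and>
    (\<forall>x y. point S X x \<longrightarrow> fun_val S X half_line G x y \<longrightarrow> limit_val S X half_line W x y)"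
proof (cases "is_continuous G")
  case True
  then obtain U where G: "G = Continuous U" by (auto simp: is_continuous_def)
  have U: "cont_total_code S X half_line U"
    using sys unfolding caristi_system_def potential_def total_fun_def G cont_total_code_def by simp
  then have "U \<in> S" by (simp add: cont_total_code_def cont_code_def)
  then obtain W where W: "W \<in> S" "\<And>n. sect W n = U" using const_section by blast
  have "rlt S (pdist half_line z y) (rconst (qpow S k))"
    if "cont_val S X half_line U x y" "cont_val S X half_line U x z" for x y z k
    using V.cont_val_unique[OF that(2,1)] V.cont_val_point[OF that(1)] V.cont_val_point[OF that(2)]
    by (simp only: V.rlt_Y) (simp add: kr_pos)
  then have "limit_val S X half_line W x y" if "cont_val S X half_line U x y" for x y
    using that V.cont_val_point[OF that] unfolding limit_val_def W(2) by blast
  moreover have "rv v \<le> rv w" if "cont_val S X half_line U x v" "cont_val S X half_line U x w" for x v w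
    using V.cont_val_unique[OF that] V.cont_val_point[OF that(1)] V.cont_val_point[OF that(2)] by simp
  ultimately show ?thesis using W U unfolding G by (intro exI[of _ W]) (simp add: W(2))
next
  case False
  then obtain W where G: "G = Baire1 W" and mono: "\<And>n m x v w. n \<preceq> m \<and> point S X x \<and>
       cont_val S X half_line (sect W n) x v \<and> cont_val S X half_line (sect W m) x w \<Longrightarrow> rle S v w"
    using sys unfolding caristi_system_def potential_def by blast
  have W: "W \<in> S" "\<And>n. cont_total_code S X half_line (sect W n)"
    using sys unfolding caristi_system_def potential_def total_fun_def G by simp_all
  have "rv v \<le> rv w" if "n \<preceq> m" "point S X x" "cont_val S X half_line (sect W n) x v"
    "cont_val S X half_line (sect W m) x w" for n m x v w
    using mono[of n m x v w] that V.cont_val_point[OF that(3)] V.cont_val_point[OF that(4)]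
    by (simp add: half_line_point rle_iff)
  then show ?thesis using W unfolding G fun_val.simps by blast
qed

lemma limit_sup:
  assumes W: "\<And>n m x v w. n \<preceq> m \<Longrightarrow> point S X x \<Longrightarrow> cont_val S X half_line (sect W n) x v \<Longrightarrow>
      cont_val S X half_line (sect W m) x w \<Longrightarrow> rv v \<le> rv w"
    and x: "point S X x" "limit_val S X half_line W x y"
  shows "cont_val S X half_line (sect W n) x v \<Longrightarrow> rv v \<le> rv y"
    "\<exists>n. \<forall>v. cont_val S X half_line (sect W n) x v \<longrightarrow> rv y \<le> rv v + kr (e k)"
proof -
  have y: "point S half_line y" and ex: "\<And>n. \<exists>z. cont_val S X half_line (sect W n) x z"
    and lim: "\<And>k. \<exists>N. \<forall>n z. N \<preceq> n \<and> cont_val S X half_line (sect W n) x z \<longrightarrow>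
        rlt S (pdist half_line z y) (rconst (qpow S k))"
    using x(2) unfolding limit_val_def by blast+
  have lim': "\<exists>N. \<forall>n z. N \<preceq> n \<longrightarrow> cont_val S X half_line (sect W n) x z \<longrightarrow> \<bar>rv z - rv y\<bar> < kr (e k)" for k
  proof -
    obtain N where N: "\<And>n z. N \<preceq> n \<and> cont_val S X half_line (sect W n) x z \<Longrightarrow>
        rlt S (pdist half_line z y) (rconst (qpow S k))" using lim by blast
    have "\<bar>rv z - rv y\<bar> < kr (e k)" if "N \<preceq> n" "cont_val S X half_line (sect W n) x z" for n z
      using N[of n z] that V.rlt_Y[OF V.cont_val_point[OF that(2)] y] VDX[OF V.cont_val_point[OF that(2)] y]
      by simp
    then show ?thesis by blast
  qed
  show "rv v \<le> rv y" if v: "cont_val S X half_line (sect W n) x v"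
  proof (rule R_leI[where c = 1])
    fix i
    obtain N where N: "\<And>n z. N \<preceq> n \<Longrightarrow> cont_val S X half_line (sect W n) x z \<Longrightarrow> \<bar>rv z - rv y\<bar> < kr (e i)"
      using lim' by blast
    obtain z where z: "cont_val S X half_line (sect W (N + n)) x z" using ex by blast
    have "N \<preceq> N + n" "n \<preceq> N + n" by (simp_all add: iota_leq)
    then have "\<bar>rv z - rv y\<bar> < kr (e i)" "rv v \<le> rv z" using N z W[OF _ x(1) v z] by blast+
    then show "rv v \<le> rv y + kr (1 * e i)" by (simp add: abs_less_iff)
  qed
  obtain N where N: "\<And>n z. N \<preceq> n \<Longrightarrow> cont_val S X half_line (sect W n) x z \<Longrightarrow> \<bar>rv z - rv y\<bar> < kr (e k)"
    using lim' by blast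
  have "rv y \<le> rv v + kr (e k)" if "cont_val S X half_line (sect W N) x v" for v
    using N[OF leq_refl that] by linarith
  then show "\<exists>n. \<forall>v. cont_val S X half_line (sect W n) x v \<longrightarrow> rv y \<le> rv v + kr (e k)" by blast
qed

lemma cont_close:
  assumes "cont_code S X half_line U" "point S X x" "cont_val S X half_line U x w"
  shows "\<exists>j. \<forall>x' w'. point S X x' \<longrightarrow> DX x x' < kr (e j) \<longrightarrow> cont_val S X half_line U x' w' \<longrightarrow> \<bar>rv w - rv w'\<bar> \<le> kr (e k)"
proof -
  obtain j where j: "\<And>x' y'. point S X x' \<and> DX x x' < kr (e j) \<and> cont_val S X half_line U x' y' \<Longrightarrow> V.Y.DX w y' \<le> kr (e k)"
    using V.cont_cont[OF assms, of k] by blast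
  have "\<bar>rv w - rv w'\<bar> \<le> kr (e k)" if "point S X x'" "DX x x' < kr (e j)" "cont_val S X half_line U x' w'" for x' w'
    using j[of x' w'] that VDX[OF V.cont_val_point[OF assms(3)] V.cont_val_point[OF that(3)]] by simp
  then show ?thesis by blast
qed

theorem fixed_point_cont_potential:
  assumes "is_continuous G"
  shows "\<exists>x. point S X x \<and> fun_val S X X F x x"
proof -
  obtain U where G: "G = Continuous U" using assms by (auto simp: is_continuous_def)
  have U: "cont_code S X half_line U" "\<And>x. point S X x \<Longrightarrow> \<exists>v. cont_val S X half_line U x v"
    using sys unfolding caristi_system_def potential_def total_fun_def G by simp_all
  then have "U \<in> S" by (simp add: cont_code_def)
  then obtain W where W: "W \<in> S" "\<And>n. sect W n = U" using const_section by blast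
  have "\<exists>Q. V.AY.pf Q \<and> (\<forall>p. cont_val S X half_line (sect W 0) (cpt p) (Q p))"
    by (rule V.uniform_value[OF W(1) fn_const]) (auto simp: W(2) U(1) pf_cpt intro!: U(2) pf_point)
  then obtain Q where Q: "V.AY.pf Q" "\<And>p. cont_val S X half_line U (cpt p) (Q p)" unfolding W(2) by blast
  define v where "v p = rv (Q p)" for p
  have v: "rdec v" "0 \<le> v y" for y
    using rdec_value[OF Q(1)] half_line_nonneg[OF V.AY.pf_point[OF Q(1)]] by (auto simp: v_def[abs_def])
  have Qv: "cont_val S X half_line U (\<lambda>_. a) (Q a)" if "a \<in> dense X" for a
    using Q(2)[of a] that by (simp add: cpt_def)
  obtain a where a: "fn S a" "\<And>n. a n \<in> dense X"
    "\<And>n. kr (1 - e (n + 1)) * dd (a n) (a (n + 1)) \<le> v (a n) - v (a (n + 1))"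
    and least: "\<And>n y. y \<in> dense X \<Longrightarrow> kr (1 - e (n + 1)) * dd (a n) y \<le> v (a n) - v y \<Longrightarrow> v (a (n + 1)) \<le> v y + kr (e n)"
    using ekeland_seq[OF v] by blast
  note chain = ekeland_limit(1)[OF v a]
  obtain x where x: "point S X x" and lim: "\<And>k. \<exists>N. \<forall>m. N \<preceq> m \<longrightarrow> DX x (\<lambda>_. a m) \<le> kr (e k)"
    using ekeland_limit(2)[OF v a] by blast
  obtain y where y: "fun_val S X X F x y" "point S X y" using F_ex[OF x] by blast
  obtain w where w: "cont_val S X half_line U x w" using U(2)[OF x] by blast
  obtain u where u: "cont_val S X half_line U y u" using U(2)[OF y(2)] by blast
  have d: "DX x y \<le> rv w - rv u" using caristi[OF x y(1)] w u unfolding G by simp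
  have pos: "0 < (kr (1 - e (n + 1)) :: 'a R)" "(kr (1 - e (n + 1)) :: 'a R) \<le> 1" for n
  proof -
    show "0 < (kr (1 - e (n + 1)) :: 'a R)" using half_less[of n] by (intro kr_pos) linarith
    have "1 - e (n + 1) \<le> 1" using e_pos[of "n + 1"] by linarith
    then have "kr (1 - e (n + 1)) \<le> (kr 1 :: 'a R)" by (simp only: kr_le)
    then show "(kr (1 - e (n + 1)) :: 'a R) \<le> 1" by (simp only: kr_simps)
  qed
  \<comment> \<open>Continuity compares the value \<open>w\<close> at the limit with
    \<open>v (a m)\<close> for large \<open>m\<close>, and \<open>v (a m)\<close> is at most
    \<open>v (a n)\<close> by \<open>chain\<close>.\<close>
  have w_le: "rv w \<le> v (a n)" for n
  proof (rule R_leI[where c = 1])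
    fix k
    obtain j where j: "\<And>x' w'. point S X x' \<Longrightarrow> DX x x' < kr (e j) \<Longrightarrow> cont_val S X half_line U x' w' \<Longrightarrow> \<bar>rv w - rv w'\<bar> \<le> kr (e k)"
      using cont_close[OF U(1) x w] by blast
    obtain N where N: "\<And>m. N \<preceq> m \<Longrightarrow> DX x (\<lambda>_. a m) \<le> kr (e (j + 1))" using lim by blast
    define m where "m = N + n"
    have m: "N \<preceq> m" "n \<preceq> m" by (simp_all add: m_def iota_leq)
    have "kr (e (j + 1)) < (kr (e j) :: 'a R)" using e_double[of j] e_pos[of "j + 1"] by (simp only: kr_less)
    then have "\<bar>rv w - rv (Q (a m))\<bar> \<le> kr (e k)"
      using j[OF point_const[OF a(2)] _ Qv[OF a(2)], of m] N[OF m(1)] by linarith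
    moreover have "0 \<le> kr (1 - e (n + 1)) * dd (a n) (a m)"
      using pos[of n] dd_nonneg[OF a(2) a(2)] by (intro mult_nonneg_nonneg) auto
    ultimately show "rv w \<le> v (a n) + kr (1 * e k)"
      using chain[OF m(2)] unfolding v_def abs_le_iff by simp
  qed
  have near: "kr (1 - e (n + 1)) * DX (\<lambda>_. a n) x \<le> v (a n) - rv w" for n
  proof (rule R_leI[where c = 1])
    fix k
    obtain N where N: "\<And>m. N \<preceq> m \<Longrightarrow> DX x (\<lambda>_. a m) \<le> kr (e k)" using lim by blast
    define m where "m = N + n"
    have m: "N \<preceq> m" "n \<preceq> m" by (simp_all add: m_def iota_leq)
    have "DX (\<lambda>_. a n) x \<le> dd (a n) (a m) + kr (e k)"
      using DX_tri[OF point_const[OF a(2)[of n]] point_const[OF a(2)[of m]] x] N[OF m(1)]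
        DX_sym[OF x point_const[OF a(2)[of m]]] DX_const[OF a(2)[of n] a(2)[of m]] by linarith
    then have "kr (1 - e (n + 1)) * DX (\<lambda>_. a n) x \<le> kr (1 - e (n + 1)) * (dd (a n) (a m) + kr (e k))"
      using pos(1)[of n] by (intro mult_left_mono) auto
    also have "\<dots> \<le> kr (1 - e (n + 1)) * dd (a n) (a m) + kr (e k)"
      using mult_right_mono[OF pos(2)[of n], of "kr (e k)"] kr_pos[OF e_pos[of k]] by (simp add: distrib_left del: kr_diff)
    finally show "kr (1 - e (n + 1)) * DX (\<lambda>_. a n) x \<le> v (a n) - rv w + kr (1 * e k)"
      using chain[OF m(2)] w_le[of m] by simp
  qed
  have "DX x y \<le> 0"
  proof (rule ccontr)
    assume "\<not> DX x y \<le> 0"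
    then have dpos: "0 < DX x y" by simp
    have "rv w \<le> rv u"
    proof (rule R_leI[where c = 2])
      fix n
      \<comment> \<open>The slack: with slope \<open>1 - e (n + 1)\<close> the way from
        \<open>x\<close> to \<open>y\<close> is charged \<open>g\<close> less than
        \<open>DX x y\<close>. This pays for replacing \<open>y\<close> by a dense point
        \<open>b\<close>.\<close>
      define g where "g = kr (e (n + 1)) * DX x y"
      have "0 < g" unfolding g_def by (intro mult_pos_pos dpos kr_pos e_pos)
      then obtain k0 where k0: "kr (e k0) < g" by (rule R_arch)
      define k where "k = k0 + n"
      have k: "kr (e k) < g" "kr (e k) \<le> (kr (e n) :: 'a R)"
      proof -
        have "k0 \<preceq> k" "n \<preceq> k" by (simp_all add: k_def iota_leq)
        then have "kr (e k) \<le> (kr (e k0) :: 'a R)" "kr (e k) \<le> (kr (e n) :: 'a R)" by (simp_all add: e_mono)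
        then show "kr (e k) < g" "kr (e k) \<le> (kr (e n) :: 'a R)" using k0 by linarith+
      qed
      have e2: "(kr (e k) :: 'a R) = 2 * kr (e (k + 1))" using e_double[of k] by simp
      obtain j0 where j0: "\<And>x' w'. point S X x' \<Longrightarrow> DX y x' < kr (e j0) \<Longrightarrow> cont_val S X half_line U x' w' \<Longrightarrow> \<bar>rv u - rv w'\<bar> \<le> kr (e (k + 1))"
        using cont_close[OF U(1) y(2) u] by blast
      define j where "j = j0 + 1 + (k + 1)"
      have j: "e j \<le> e (j0 + 1)" "e j \<le> e (k + 1)" by (rule e_mono; simp add: j_def iota_leq)+
      define b where "b = y j"
      have b: "b \<in> dense X" using pointD(1)[OF y(2)] by (simp add: b_def)
      have yb: "DX y (\<lambda>_. b) \<le> kr (e j)" unfolding b_def by (rule DX_self[OF y(2)])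
      have "kr (e j) < (kr (e j0) :: 'a R)" using e_double[of j0] e_pos[of "j0 + 1"] j(1) by (simp only: kr_less)
      then have vb: "\<bar>rv u - v b\<bar> \<le> kr (e (k + 1))"
        using j0[OF point_const[OF b] _ Qv[OF b]] yb unfolding v_def by linarith
      have yb': "DX y (\<lambda>_. b) \<le> kr (e (k + 1))" using yb kr_le[of "e j" "e (k + 1)"] j(2) by (meson order_trans)
      have "dd (a n) b \<le> DX (\<lambda>_. a n) x + DX x y + kr (e (k + 1))"
        using DX_tri[OF point_const[OF a(2)[of n]] x y(2)] DX_tri[OF point_const[OF a(2)[of n]] y(2) point_const[OF b]]
          DX_const[OF a(2)[of n] b] yb' by linarith
      then have "kr (1 - e (n + 1)) * dd (a n) b \<le> kr (1 - e (n + 1)) * (DX (\<lambda>_. a n) x + DX x y + kr (e (k + 1)))"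
        using pos(1)[of n] by (intro mult_left_mono) auto
      also have "\<dots> = kr (1 - e (n + 1)) * DX (\<lambda>_. a n) x + (DX x y - g) + kr (1 - e (n + 1)) * kr (e (k + 1))"
        by (simp add: g_def algebra_simps)
      also have "\<dots> \<le> v (a n) - rv w + (DX x y - g) + kr (e (k + 1))"
        using near[of n] mult_right_mono[OF pos(2)[of n] less_imp_le[OF kr_pos[OF e_pos[of "k + 1"]]]]
        unfolding mult_1_left by linarith
      also have "\<dots> \<le> v (a n) - v b" using d k(1) e2 vb unfolding abs_le_iff by linarith
      \<comment> \<open>So \<open>b\<close> is reachable from \<open>a n\<close>, and the
        near-minimality of \<open>a (n + 1)\<close> applies. Letting \<open>n\<close> grow gives
        \<open>rv w \<le> rv u\<close>, against a drop of at least
        \<open>DX x y > 0\<close>.\<close>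
      finally have "v (a (n + 1)) \<le> v b + kr (e n)" by (rule least[OF b])
      then show "rv w \<le> rv u + kr (2 * e n)"
        using w_le[of "n + 1"] vb k(2) e2 kr_pos[OF e_pos[of "k + 1"]] unfolding abs_le_iff kr_simps kr_numeral by linarith
    qed
    then show False using d dpos by linarith
  qed
  then show ?thesis using fixedI[OF x y(1)] x by blast
qed

end

section \<open>Cluster points in compact spaces\<close>

context aspace
begin

text \<open>Nested balls in the manner of Bolzano and Weierstrass. That a ball contains terms with
  arbitrarily large index is arithmetical (\<open>I\<close> below), so the next centre is chosen by
  a function of \<open>S\<close>, and the centres are obtained by primitive recursion.\<close>

lemma cluster:
  assumes cpct: "is_compact S X" and a: "fn S a" "\<And>n. a n \<in> dense X"
  shows "\<exists>x. point S X x \<and> (\<forall>k N. \<exists>m. N \<preceq> m \<and> DX x (\<lambda>_. a m) < kr (e k))"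
proof -
  obtain n P where nP: "fn S n" "fn S P" "\<And>i j. i \<preceq> n j \<Longrightarrow> point S X (\<lambda>k. P (pr (pr i j) k))"
    and cov: "\<And>x j. point S X x \<Longrightarrow> \<exists>i. i \<preceq> n j \<and> rlt S (pdist X (\<lambda>k. P (pr (pr i j) k)) x) (rconst (qpow S j))"
    using cpct unfolding is_compact_def by blast
  define pt where "pt z k = (if p1 z \<preceq> n (p2 z) then P (pr (pr (p1 z) (p2 z)) k) else a0)" for z k
  have pt_eq: "pt (pr i j) = (\<lambda>k. P (pr (pr i j) k))" if "i \<preceq> n j" for i j
    using that by (simp add: pt_def fun_eq_iff)
  have pf_pt: "pf pt" unfolding pf_def
  proof (intro conjI allI)
    show "fn S (\<lambda>z. pt (p1 z) (p2 z))"
      unfolding pt_def by (intro comp fn_comp[OF nP(1)] fn_comp[OF nP(2)])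
    show "point S X (pt z)" for z
      using nP(3)[of "p1 z" "p2 z"] point_const[OF a0] by (cases "p1 z \<preceq> n (p2 z)") (simp_all add: pt_def[abs_def])
  qed
  have cov': "\<exists>i. i \<preceq> n j \<and> dc (pt (pr i j)) b < kr (e j)" if b: "b \<in> dense X" for b j
  proof -
    obtain i where i: "i \<preceq> n j" "rlt S (pdist X (pt (pr i j)) (\<lambda>_. b)) (rconst (qpow S j))"
      using cov[OF point_const[OF b], of j] pt_eq by metis
    have "DX (pt (pr i j)) (\<lambda>_. b) < kr (e j)"
      using i(2) unfolding rlt_pdist[OF pf_point[OF pf_pt] point_const[OF b]] .
    then show ?thesis using i(1) b by (intro exI[of _ i]) simp
  qed
  have pigeon: "\<exists>b. b \<in> dense X \<and> (\<forall>N. \<exists>m. N \<preceq> m \<and> C m \<and> dt (a m) b < kr (e j))"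
    if C: "dec C" "\<And>N. \<exists>m. N \<preceq> m \<and> C m" for C j
  proof -
    \<comment> \<open>One level finer: the centre supplied by compactness is replaced by its dense
      entry \<open>b\<close>, and the two errors \<open>e J\<close> add up to
      \<open>e j\<close>.\<close>
    define J where "J = j + 1"
    have "\<exists>i. i \<preceq> n J \<and> (\<forall>N. \<exists>m. N \<preceq> m \<and> C m \<and> dc (pt (pr i J)) (a m) < kr (e J))"
    proof (rule ccontr)
      assume neg: "\<not> ?thesis"
      \<comment> \<open>Infinite pigeonhole for the indices \<open>i \<preceq> n J\<close>: if each
        ball catches only terms below some \<open>f i\<close>, then a common bound of the
        \<open>f i\<close> leaves a later term uncovered.\<close>
      have "\<exists>f. fn S f \<and> (\<forall>i. i \<preceq> n J \<longrightarrow> (\<forall>m. f i \<preceq> m \<longrightarrow> \<not> (C m \<and> dc (pt (pr i J)) (a m) < kr (e J))))"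
      proof (rule choice)
        show "dec (\<lambda>z. p1 z \<preceq> n J \<longrightarrow> (\<forall>m. p2 z \<preceq> m \<longrightarrow> \<not> (C m \<and> dc (pt (pr (p1 z) J)) (a m) < kr (e J))))"
          by (intro comp dec_comp[OF C(1)] fn_comp[OF a(1)] pf_pt)
        show "\<exists>N. i \<preceq> n J \<longrightarrow> (\<forall>m. N \<preceq> m \<longrightarrow> \<not> (C m \<and> dc (pt (pr i J)) (a m) < kr (e J)))" for i
          using neg by blast
      qed
      then obtain f where f: "fn S f" "\<And>i m. i \<preceq> n J \<Longrightarrow> f i \<preceq> m \<Longrightarrow> \<not> (C m \<and> dc (pt (pr i J)) (a m) < kr (e J))"
        by blast
      obtain B where B: "\<And>i. i < n J + 1 \<Longrightarrow> f i < B" using bound_fn[OF f(1)] by blast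
      obtain m where m: "B \<preceq> m" "C m" using C(2) by blast
      obtain i where i: "i \<preceq> n J" "dc (pt (pr i J)) (a m) < kr (e J)" using cov'[OF a(2)] by blast
      have "f i \<preceq> m" using B[of i] i(1) m(1) by (simp add: less_S_leq iota_iff)
      then show False using f(2)[OF i(1)] m(2) i(2) by blast
    qed
    then obtain i where i: "\<And>N. \<exists>m. N \<preceq> m \<and> C m \<and> dc (pt (pr i J)) (a m) < kr (e J)" by blast
    define b where "b = pt (pr i J) J"
    have pti: "point S X (pt (pr i J))" by (rule pf_point[OF pf_pt])
    have b: "b \<in> dense X" using pointD(1)[OF pti] by (simp add: b_def)
    have "dt (a m) b < kr (e j)" if "dc (pt (pr i J)) (a m) < kr (e J)" for m
    proof -
      have "DX (pt (pr i J)) (\<lambda>_. b) \<le> kr (e J)" unfolding b_def by (rule DX_self[OF pti])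
      moreover have "(kr (e j) :: 'a R) = 2 * kr (e J)" using e_double[of j] by (simp add: J_def)
      ultimately show ?thesis
        using that DX_tri[OF point_const[OF a(2)[of m]] pti point_const[OF b]] DX_sym[OF pti point_const[OF a(2)[of m]]]
          DX_const[OF a(2)[of m] b] dc_DX[OF a(2)[of m]] dt_dd[OF a(2)[of m] b] by simp
    qed
    then show ?thesis using i b by blast
  qed
  define I where "I j b \<longleftrightarrow> b \<in> dense X \<and> (\<forall>N. \<exists>m. N \<preceq> m \<and> dt (a m) b < kr (e j))" for j b
  have dec_I: "dec (\<lambda>z. I (f z) (g z))" if "fn S f" "fn S g" for f g
    unfolding I_def by (intro comp that fn_comp[OF that(1)] fn_comp[OF that(2)] fn_comp[OF a(1)])
  have "\<exists>b. b \<in> dense X \<and> (\<forall>N. \<exists>m. N \<preceq> m \<and> True \<and> dt (a m) b < kr (e 0))"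
    by (rule pigeon) (auto intro: comp leq_refl)
  then obtain b0 where b0: "I 0 b0" unfolding I_def by blast
  have step: "\<exists>c. I j b \<longrightarrow> I (j + 1) c \<and> dt b c \<le> kr (2 * e j)" for j b
  proof (cases "I j b")
    case True
    then have b: "b \<in> dense X" by (simp add: I_def)
    \<comment> \<open>The pigeonhole is applied only to the terms near \<open>b\<close>, so some
      term is close to both centres, and the new centre is close to the old one.\<close>
    have "\<exists>c. c \<in> dense X \<and> (\<forall>N. \<exists>m. N \<preceq> m \<and> dt (a m) b < kr (e j) \<and> dt (a m) c < kr (e (j + 1)))"
      by (rule pigeon) (use True in \<open>auto simp: I_def intro!: comp a(1)\<close>)
    then obtain c where c: "c \<in> dense X" "\<And>N. \<exists>m. N \<preceq> m \<and> dt (a m) b < kr (e j) \<and> dt (a m) c < kr (e (j + 1))" by blast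
    then obtain m where m: "dt (a m) b < kr (e j)" "dt (a m) c < kr (e (j + 1))" by blast
    have "kr (e (j + 1)) < (kr (e j) :: 'a R)" using e_double[of j] e_pos[of "j + 1"] by (simp only: kr_less)
    then have "dt b c \<le> kr (2 * e j)"
      using m dd_tri[OF b a(2)[of m] c(1)] dd_sym[OF b a(2)[of m]]
        dt_dd[OF a(2)[of m] b] dt_dd[OF a(2)[of m] c(1)] dt_dd[OF b c(1)]
      unfolding kr_simps kr_numeral by linarith
    moreover have "I (j + 1) c" unfolding I_def using c by blast
    ultimately show ?thesis by blast
  qed simp
  have "\<exists>h. fn S h \<and> (\<forall>z. I (p1 z) (p2 z) \<longrightarrow> I (p1 z + 1) (h z) \<and> dt (p2 z) (h z) \<le> kr (2 * e (p1 z)))"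
    by (rule choice) (intro comp dec_I, rule step)
  then obtain h where h: "fn S h" "\<And>z. I (p1 z) (p2 z) \<Longrightarrow> I (p1 z + 1) (h z) \<and> dt (p2 z) (h z) \<le> kr (2 * e (p1 z))"
    by blast
  have "fn S (\<lambda>z. h (pr (p1 (p2 z)) (p2 (p2 z))))" by (intro comp fn_comp[OF h(1)])
  then obtain F where F: "fn S (\<lambda>z. F (p1 z) (p2 z))" "\<And>x. F x 0 = b0" "\<And>x i. F x (i + 1) = h (pr i (F x i))"
    using prim_rec[OF fn_const[of b0], of "\<lambda>x i b. h (pr i b)"] by metis
  define b where "b = F 0"
  have fb: "fn S b" unfolding b_def by (rule fn_comp2[OF F(1) fn_const fn_id])
  have Ib: "I i (b i)" for i
  proof (rule dec_induct[where P = "\<lambda>i. I i (b i)"])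
    show "dec (\<lambda>i. I i (b i))" by (intro dec_I comp fb)
    show "I 0 (b 0)" by (simp add: b_def F b0)
    show "I (i + 1) (b (i + 1))" if "I i (b i)" for i using h(2)[of "pr i (b i)"] that by (simp add: b_def F)
  qed
  have bD: "b i \<in> dense X" for i using Ib[of i] by (simp add: I_def)
  have bstep: "dd (b i) (b (i + 1)) \<le> kr (2 * e i)" for i
    using h(2)[of "pr i (b i)"] Ib[of i] bD[of i] bD[of "i + 1"] by (simp add: b_def F)
  have bdist: "dt (b i) (b (i + d)) \<le> kr (4 * e i - 4 * e (i + d))" for i d
  proof (rule dec_induct[where P = "\<lambda>d. dt (b i) (b (i + d)) \<le> kr (4 * e i - 4 * e (i + d))"])
    show "dec (\<lambda>d. dt (b i) (b (i + d)) \<le> kr (4 * e i - 4 * e (i + d)))"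
      by (intro comp fn_comp[OF fb])
    show "dt (b i) (b (i + 0)) \<le> kr (4 * e i - 4 * e (i + 0))" using bD by (simp add: add_0 dd_refl)
    fix d assume IH: "dt (b i) (b (i + d)) \<le> kr (4 * e i - 4 * e (i + d))"
    have "dd (b i) (b (i + d + 1)) \<le> kr (4 * e i - 4 * e (i + d)) + kr (2 * e (i + d))"
      using IH bstep[of "i + d"] dd_tri[OF bD[of i] bD[of "i + d"] bD[of "i + d + 1"]] dt_dd[OF bD[of i] bD[of "i + d"]]
      by linarith
    also have "\<dots> = kr (4 * e i - 4 * e (i + d + 1))"
      unfolding kr_simps(3)[symmetric] kr_eq by (simp add: e_S)
    finally show "dt (b i) (b (i + (d + 1))) \<le> kr (4 * e i - 4 * e (i + (d + 1)))"
      using bD by (simp only: add_S dt_dd)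
  qed
  \<comment> \<open>The distance from \<open>b i\<close> to any later centre is at most
    \<open>4 * e i\<close>, so a shift by two gives the rate of a point.\<close>
  define x where "x k = b (k + 1 + 1)" for k
  have x: "point S X x" unfolding point_iff
  proof (intro conjI allI impI)
    show "fn S x" unfolding x_def by (intro comp fn_comp[OF fb])
    show "x i \<in> dense X" for i by (simp add: x_def bD)
    fix i j :: 'a assume "i \<preceq> j"
    then have "i + 1 + 1 \<preceq> j + 1 + 1" by (simp add: iota_leq)
    then obtain d where d: "j + 1 + 1 = i + 1 + 1 + d" by (rule dec_arith_mono)
    have "dd (x i) (x j) \<le> kr (4 * e (i + 1 + 1) - 4 * e (j + 1 + 1))"
      using bdist[of "i + 1 + 1" d] bD unfolding x_def d[symmetric] by (simp only: dt_dd)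
    also have "\<dots> \<le> kr (e i)"
      unfolding kr_le using e_pos[of j] by (simp add: e_S less_imp_le)
    finally show "dd (x i) (x j) \<le> kr (e i)" .
  qed
  have "\<exists>m. N \<preceq> m \<and> DX x (\<lambda>_. a m) < kr (e k)" for k N
  proof -
    have "I (k + 1 + 1 + 1) (x (k + 1))" unfolding x_def by (rule Ib)
    then obtain m where m: "N \<preceq> m" "dt (a m) (x (k + 1)) < kr (e (k + 1 + 1 + 1))"
      unfolding I_def by blast
    have xk: "x (k + 1) \<in> dense X" using pointD(1)[OF x] .
    have "kr (e (k + 1 + 1 + 1)) \<le> (kr (e (k + 1)) :: 'a R)" by (intro kr_mono e_mono) (simp add: iota_leq)
    moreover have "DX x (\<lambda>_. x (k + 1)) \<le> kr (e (k + 1))" by (rule DX_self[OF x])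
    moreover have "(kr (e k) :: 'a R) = 2 * kr (e (k + 1))" using e_double[of k] by simp
    ultimately have "DX x (\<lambda>_. a m) < kr (e k)"
      using m(2) DX_tri[OF x point_const[OF xk] point_const[OF a(2)[of m]]] DX_const[OF xk a(2)[of m]]
        dd_sym[OF a(2)[of m] xk] dt_dd[OF a(2)[of m] xk] by linarith
    then show ?thesis using m(1) by blast
  qed
  then show ?thesis using x by blast
qed

end

context asys
begin

theorem fixed_point_compact:
  assumes "is_compact S X"
  shows "\<exists>x. point S X x \<and> fun_val S X X F x x"
proof -
  obtain W where W: "W \<in> S" "\<And>n. cont_total_code S X half_line (sect W n)"
    and mono: "\<And>n m x v w. n \<preceq> m \<Longrightarrow> point S X x \<Longrightarrow> cont_val S X half_line (sect W n) x v \<Longrightarrow>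
      cont_val S X half_line (sect W m) x w \<Longrightarrow> rv v \<le> rv w"
    and lim: "\<And>x y. point S X x \<Longrightarrow> fun_val S X half_line G x y \<Longrightarrow> limit_val S X half_line W x y"
    using G_seq by blast
  note sup = limit_sup[OF mono]
  have Wc: "cont_code S X half_line (sect W n)" "point S X x \<Longrightarrow> \<exists>v. cont_val S X half_line (sect W n) x v" for n x
    using W(2)[of n] by (auto simp: cont_total_code_def)
  have "\<exists>Q. V.AY.pf Q \<and> (\<forall>p. cont_val S X half_line (sect W (p1 p)) (cpt (p2 p)) (Q p))"
    by (rule V.uniform_value[OF W(1) fn_p1])
      (auto simp: Wc(1) intro!: pf_comp[OF pf_cpt] fn_p2 Wc(2) pf_point[OF pf_cpt])
  then obtain Q where Q: "V.AY.pf Q" "\<And>p. cont_val S X half_line (sect W (p1 p)) (cpt (p2 p)) (Q p)" by blast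
  define v where "v n a = rv (Q (pr n a))" for n a
  have v0: "0 \<le> v n a" for n a using half_line_nonneg[OF V.AY.pf_point[OF Q(1)]] by (simp add: v_def)
  have vr: "rdec (\<lambda>z. v (f z) (g z))" if "fn S f" "fn S g" for f g
    unfolding v_def by (intro rdec_comp[OF rdec_value[OF Q(1)]] comp that)
  have Qv: "cont_val S X half_line (sect W n) (\<lambda>_. a) (Q (pr n a))" if "a \<in> dense X" for n a
    using Q(2)[of "pr n a"] that by (simp add: cpt_def)
  have "\<exists>a. fn S a \<and> (\<forall>n. a n \<in> dense X \<and> (\<forall>b. b \<in> dense X \<longrightarrow> v n (a n) \<le> v n b + kr (e n)))"
  proof (rule choice)
    show "dec (\<lambda>z. p2 z \<in> dense X \<and> (\<forall>b. b \<in> dense X \<longrightarrow> v (p1 z) (p2 z) \<le> v (p1 z) b + kr (e (p1 z))))"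
      by (intro comp vr)
    show "\<exists>y. y \<in> dense X \<and> (\<forall>b. b \<in> dense X \<longrightarrow> v n y \<le> v n b + kr (e n))" for n
      by (rule approx_min[where Q = "\<lambda>y. y \<in> dense X" and v = "v n"]) (auto intro!: comp vr v0 a0)
  qed
  then obtain a where a: "fn S a" "\<And>n. a n \<in> dense X" "\<And>n b. b \<in> dense X \<Longrightarrow> v n (a n) \<le> v n b + kr (e n)" by blast
  obtain x where x: "point S X x" and cl: "\<And>k N. \<exists>m. N \<preceq> m \<and> DX x (\<lambda>_. a m) < kr (e k)"
    using cluster[OF assms a(1,2)] by blast
  obtain y where y: "fun_val S X X F x y" "point S X y" using F_ex[OF x] by blast
  obtain s where s: "fun_val S X half_line G x s" using G_ex[OF x] by blast
  obtain t where t: "fun_val S X half_line G y t" using G_ex[OF y(2)] by blast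
  \<comment> \<open>Write V_k for the functions with supremum V. Near \<open>x\<close>, V_k(x) is
    close to V_k(a m), which is at most V_m(a m); by the choice of \<open>a m\<close> this is at
    most V_m(y) up to small errors, hence at most V(y) up to small errors. The supremum over k then
    gives V(x) at most V(y).\<close>
  have claim: "rv z \<le> rv t" if z: "cont_val S X half_line (sect W k) x z" for k z
  proof (rule R_leI[where c = 3])
    fix i
    obtain j where j: "\<And>x' w'. point S X x' \<Longrightarrow> DX x x' < kr (e j) \<Longrightarrow> cont_val S X half_line (sect W k) x' w' \<Longrightarrow> \<bar>rv z - rv w'\<bar> \<le> kr (e i)"
      using cont_close[OF Wc(1) x z] by blast
    obtain m where m: "k + i \<preceq> m" "DX x (\<lambda>_. a m) < kr (e j)" using cl by blast
    have km: "k \<preceq> m" "i \<preceq> m" using m(1) iota_nonneg[of k] iota_nonneg[of i] unfolding iota_leq iota_simps by linarith+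
    have 1: "\<bar>rv z - v k (a m)\<bar> \<le> kr (e i)" using j[OF point_const[OF a(2)] m(2) Qv[OF a(2)]] by (simp add: v_def)
    have 2: "v k (a m) \<le> v m (a m)" unfolding v_def by (rule mono[OF km(1) point_const[OF a(2)] Qv[OF a(2)] Qv[OF a(2)]])
    obtain z' where z': "cont_val S X half_line (sect W m) y z'" using Wc(2)[OF y(2)] by blast
    obtain j' where j': "\<And>x' w'. point S X x' \<Longrightarrow> DX y x' < kr (e j') \<Longrightarrow> cont_val S X half_line (sect W m) x' w' \<Longrightarrow> \<bar>rv z' - rv w'\<bar> \<le> kr (e i)"
      using cont_close[OF Wc(1) y(2) z'] by blast
    define b where "b = y (j' + 1)"
    have b: "b \<in> dense X" using pointD(1)[OF y(2)] by (simp add: b_def)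
    have "DX y (\<lambda>_. b) \<le> kr (e (j' + 1))" unfolding b_def by (rule DX_self[OF y(2)])
    also have "\<dots> < kr (e j')" using e_double[of j'] e_pos[of "j' + 1"] by (simp only: kr_less)
    finally have 3: "\<bar>rv z' - v m b\<bar> \<le> kr (e i)" using j'[OF point_const[OF b] _ Qv[OF b]] by (simp add: v_def)
    have 4: "v m (a m) \<le> v m b + kr (e m)" by (rule a(3)[OF b])
    have 5: "kr (e m) \<le> (kr (e i) :: 'a R)" by (intro kr_mono e_mono km)
    have 6: "rv z' \<le> rv t" by (rule sup(1)[OF _ _ _ _ y(2) lim[OF y(2) t] z']) 
    show "rv z \<le> rv t + kr (3 * e i)"
      using 1 2 3 4 5 6 unfolding abs_le_iff kr_simps kr_numeral by linarith
  qed
  have "rv s \<le> rv t"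
  proof (rule R_leI[where c = 1])
    fix k
    have "\<exists>n. \<forall>v. cont_val S X half_line (sect W n) x v \<longrightarrow> rv s \<le> rv v + kr (e k)"
      by (rule sup(2)[OF _ _ _ _ x lim[OF x s]])
    then obtain n where n: "\<And>v. cont_val S X half_line (sect W n) x v \<Longrightarrow> rv s \<le> rv v + kr (e k)" by blast
    obtain z where z: "cont_val S X half_line (sect W n) x z" using Wc(2)[OF x] by blast
    show "rv s \<le> rv t + kr (1 * e k)" using n[OF z] claim[OF z] by simp
  qed
  then have "DX x y \<le> 0" using caristi[OF x y(1) s t] by linarith
  then show ?thesis using fixedI[OF x y(1)] x by blast
qed

end

section \<open>Iterates of a continuous function\<close>

context aspace
begin

text \<open>Expresses the distance from a point through its dense entries. Such conditions make
  sense, and are arithmetical, before the members of a family are known to be points.\<close>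

lemma DX_le_iff: assumes "point S X p" "a \<in> dense X"
  shows "DX p (\<lambda>_. a) \<le> r \<longleftrightarrow> (\<forall>k. dt (p k) a \<le> r + kr (e k))"
    and "DX p (\<lambda>_. a) < r \<longleftrightarrow> (\<exists>k. dt (p k) a + kr (e k) < r)"
proof -
  have c: "point S X (\<lambda>_. p k)" "p k \<in> dense X" for k using pointD(1)[OF assms(1)] point_const by blast+
  have 1: "dd (p k) a \<le> DX p (\<lambda>_. a) + kr (e k)" "DX p (\<lambda>_. a) \<le> dd (p k) a + kr (e k)" for k
    using DX_tri[OF c(1)[of k] assms(1) point_const[OF assms(2)]] DX_tri[OF assms(1) c(1)[of k] point_const[OF assms(2)]]
      DX_self[OF assms(1), of k] DX_sym[OF assms(1) c(1)[of k]] DX_const[OF c(2)[of k] assms(2)] by linarith+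
  show "DX p (\<lambda>_. a) \<le> r \<longleftrightarrow> (\<forall>k. dt (p k) a \<le> r + kr (e k))"
  proof
    assume *: "DX p (\<lambda>_. a) \<le> r"
    show "\<forall>k. dt (p k) a \<le> r + kr (e k)"
    proof
      fix k show "dt (p k) a \<le> r + kr (e k)" using * 1(1)[of k] dt_dd[OF c(2)[of k] assms(2)] by linarith
    qed
  next
    assume *: "\<forall>k. dt (p k) a \<le> r + kr (e k)"
    show "DX p (\<lambda>_. a) \<le> r"
    proof (rule R_leI[where c = 2])
      fix k show "DX p (\<lambda>_. a) \<le> r + kr (2 * e k)"
        using *[rule_format, of k] 1(2)[of k] dt_dd[OF c(2)[of k] assms(2)] unfolding kr_simps kr_numeral by linarith
    qed
  qed
  show "DX p (\<lambda>_. a) < r \<longleftrightarrow> (\<exists>k. dt (p k) a + kr (e k) < r)"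
  proof
    assume "DX p (\<lambda>_. a) < r"
    then have "0 < r - DX p (\<lambda>_. a)" by simp
    then obtain k where k: "kr (e k) < r - DX p (\<lambda>_. a)" by (rule R_arch)
    have "(kr (e k) :: 'a R) = 2 * kr (e (k + 1))" using e_double[of k] by simp
    then show "\<exists>k. dt (p k) a + kr (e k) < r"
      using k 1(1)[of "k + 1"] dt_dd[OF c(2)[of "k + 1"] assms(2)] by (intro exI[of _ "k + 1"]) linarith
  next
    assume "\<exists>k. dt (p k) a + kr (e k) < r"
    then obtain k where "dt (p k) a + kr (e k) < r" by blast
    then show "DX p (\<lambda>_. a) < r" using 1(2)[of k] dt_dd[OF c(2)[of k] assms(2)] by linarith
  qed
qed

text \<open>The iterates of a continuous function are approximated by chains of balls, each of which is
  mapped into the next one.\<close>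

lemma iterate:
  assumes U: "cont_total_code S X X U" and x0: "point S X x0"
  shows "\<exists>P. pf P \<and> (\<forall>n. cont_val S X X U (P n) (P (n + 1)))"
proof -
  interpret XX: cspace2 S X X by unfold_locales
  have Uc: "cont_code S X X U" and Ut: "\<And>x. point S X x \<Longrightarrow> \<exists>y. cont_val S X X U x y" and US: "U \<in> S"
    using U by (auto simp: cont_total_code_def cont_code_def)
  define gb where "gb B \<longleftrightarrow> is_pair B \<and> p1 B \<in> dense X \<and> is_rat (p2 B) \<and> 0 < val (p2 B)" for B
  have gb_pr: "gb (pr a r) \<longleftrightarrow> a \<in> dense X \<and> is_rat r \<and> 0 < val r" for a r by (simp add: gb_def)
  \<comment> \<open>\<open>B'\<close> lies well inside a ball that \<open>U\<close> enumerates for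
    \<open>B\<close>. Comparing centres and radii keeps the condition arithmetical, and it forces
    the function to map \<open>B'\<close> into the closed ball belonging to
    \<open>B\<close>.\<close>
  define St where "St B' B \<longleftrightarrow> (\<exists>m c t. c \<in> dense X \<and> is_rat t \<and> pr (pr m (pr c t)) B \<in> U \<and>
    dt (p1 B') c + kr (val (p2 B')) < kr (val t))" for B' B
  have dec_gb: "dec (\<lambda>x. gb (f x))" if "fn S f" for f unfolding gb_def by (intro comp that)
  have dec_St: "dec (\<lambda>x. St (f x) (g x))" if "fn S f" "fn S g" for f g
    unfolding St_def by (intro comp dec_comp[OF dec_mem[OF US]] fn_comp[OF that(1)] fn_comp[OF that(2)])
  define N where "N n B \<longleftrightarrow> (\<exists>s. gb (ent s 0) \<and> dc x0 (p1 (ent s 0)) < kr (val (p2 (ent s 0))) \<and>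
    (\<forall>i. i < n \<longrightarrow> St (ent s i) (ent s (i + 1)) \<and> gb (ent s (i + 1))) \<and> ent s n = B)" for n B
  have pf0: "pf (\<lambda>_. x0)" unfolding pf_def using x0 pointD(2)[OF x0] by (auto intro: fn_comp[OF _ fn_p2])
  have dec_N: "dec (\<lambda>x. N (f x) (g x))" if "fn S f" "fn S g" for f g
    unfolding N_def by (intro comp dec_St dec_gb rdec_dc[OF pf0 fn_id] fn_comp[OF that(1)] fn_comp[OF that(2)])
  have N_gb: "gb B" if "N n B" for n B
  proof (cases "n = 0")
    case False
    then obtain i where i: "\<iota> i = \<iota> n - \<iota> 1" using iota_diff[of 1 n] iota_ge_1 by auto
    then have "n = i + 1" "i < n" by (simp_all add: iota_eq iota_less)
    then show ?thesis using that unfolding N_def by metis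
  qed (use that in \<open>auto simp: N_def\<close>)
  have N0: "N 0 B \<longleftrightarrow> gb B \<and> dc x0 (p1 B) < kr (val (p2 B))" for B
  proof
    assume B: "gb B \<and> dc x0 (p1 B) < kr (val (p2 B))"
    obtain s where "\<And>i. i < 1 \<Longrightarrow> ent s i = B" using seq_obtain[OF fn_const[of B], of 1] by blast
    then have "ent s 0 = B" by (simp add: iota_iff)
    then show "N 0 B" unfolding N_def using B not_less_0 by metis
  qed (auto simp: N_def)
  have NS: "N (n + 1) B \<longleftrightarrow> gb B \<and> (\<exists>B'. N n B' \<and> St B' B)" for n B
  proof
    assume "N (n + 1) B"
    then obtain s where s: "gb (ent s 0)" "dc x0 (p1 (ent s 0)) < kr (val (p2 (ent s 0)))"
      "\<And>i. i < n + 1 \<Longrightarrow> St (ent s i) (ent s (i + 1)) \<and> gb (ent s (i + 1))" "ent s (n + 1) = B"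
      unfolding N_def by blast
    have "N n (ent s n)" unfolding N_def using s(1-3) less_S by blast
    moreover have "St (ent s n) B" "gb B" using s(3)[of n] s(4) less_S by auto
    ultimately show "gb B \<and> (\<exists>B'. N n B' \<and> St B' B)" by blast
  next
    assume "gb B \<and> (\<exists>B'. N n B' \<and> St B' B)"
    then obtain B' where B: "gb B" "N n B'" "St B' B" by blast
    then obtain s where s: "gb (ent s 0)" "dc x0 (p1 (ent s 0)) < kr (val (p2 (ent s 0)))"
      "\<And>i. i < n \<Longrightarrow> St (ent s i) (ent s (i + 1)) \<and> gb (ent s (i + 1))" "ent s n = B'"
      unfolding N_def by blast
    have "fn S (\<lambda>i. if i \<preceq> n then ent s i else B)" by (intro comp)
    from seq_obtain[OF this, of "n + 1 + 1"]
    obtain u where u: "\<And>i. i < n + 1 + 1 \<Longrightarrow> ent u i = (if i \<preceq> n then ent s i else B)" by blast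
    have u0: "ent u 0 = ent s 0" using u[of 0] iota_nonneg[of n] by (simp add: iota_iff add_nonneg_pos)
    have un: "ent u (n + 1) = B" using u[of "n + 1"] by (simp add: iota_iff)
    have ui: "ent u i = ent s i" if "i \<preceq> n" for i using u[of i] that by (auto simp: less_S leq_def)
    have "St (ent u i) (ent u (i + 1)) \<and> gb (ent u (i + 1))" if i: "i < n + 1" for i
    proof (cases "i = n")
      case True
      then show ?thesis using un ui[of n] s(4) B by simp
    next
      case False
      then have "i < n" using i by (simp add: less_S)
      moreover from this have "i \<preceq> n" "i + 1 \<preceq> n" using S_le by (auto simp: leq_def)
      ultimately show ?thesis using s(3)[of i] ui by simp
    qed
    then show "N (n + 1) B" unfolding N_def using s(1,2) u0 un by metis
  qed
  \<comment> \<open>Membership of a ball in \<open>N n\<close> leaves the boundary undecided, as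
    codes of continuous functions do. The two implications still determine \<open>p\<close>, since
    balls of every radius are available.\<close>
  define good_at where "good_at p n \<longleftrightarrow> (\<forall>a r. gb (pr a r) \<longrightarrow> (N n (pr a r) \<longrightarrow> DX p (\<lambda>_. a) \<le> kr (val r)) \<and>
    (DX p (\<lambda>_. a) < kr (val r) \<longrightarrow> N n (pr a r)))" for p n
  have "\<exists>f. fn S f \<and> (\<forall>z. (\<exists>b. b \<in> dense X \<and> N (p1 z) (pr b (rc (e (p2 z + 1))))) \<longrightarrow>
      f z \<in> dense X \<and> N (p1 z) (pr (f z) (rc (e (p2 z + 1)))))"
    by (rule choice) (intro comp dec_N, blast)
  then obtain f where f: "fn S f" "\<And>z b. b \<in> dense X \<Longrightarrow> N (p1 z) (pr b (rc (e (p2 z + 1)))) \<Longrightarrow>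
      f z \<in> dense X \<and> N (p1 z) (pr (f z) (rc (e (p2 z + 1))))" by blast
  define P where "P n k = f (pr n k)" for n k
  have P_good: "point S X (P n) \<and> DX p (P n) = 0" if p: "point S X p" "good_at p n" for p n
  proof -
    have 1: "P n k \<in> dense X \<and> N n (pr (P n k) (rc (e (k + 1))))" for k
    proof -
      define b where "b = p (k + 1 + 1)"
      have b: "b \<in> dense X" using pointD(1)[OF p(1)] by (simp add: b_def)
      have "DX p (\<lambda>_. b) \<le> kr (e (k + 1 + 1))" unfolding b_def by (rule DX_self[OF p(1)])
      also have "\<dots> < kr (e (k + 1))" using e_double[of "k + 1"] e_pos[of "k + 1 + 1"] by (simp only: kr_less)
      finally have "N n (pr b (rc (e (k + 1))))" using p(2) b unfolding good_at_def gb_pr by simp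
      then show ?thesis using f(2)[of b "pr n k"] b by (simp add: P_def)
    qed
    have "DX p (\<lambda>_. P n k) \<le> kr (e (k + 1))" for k
      using p(2)[unfolded good_at_def gb_pr, THEN spec, THEN spec, of "P n k" "rc (e (k + 1))"] 1[of k] by simp
    moreover have "fn S (P n)" unfolding P_def by (intro fn_comp[OF f(1)] comp)
    ultimately show ?thesis using point_limit[of "P n" p] 1 p(1) by blast
  qed
  have good_P: "good_at (P n) n" if p: "point S X p" "good_at p n" for p n
    using p(2) P_good[OF p] DX_zero_cong[OF p(1) _ point_const] unfolding good_at_def gb_pr by metis
  have step: "\<exists>y. cont_val S X X U (P n) y \<and> good_at y (n + 1)" if p: "point S X (P n)" "good_at (P n) n" for n
  proof -
    obtain y where y: "cont_val S X X U (P n) y" using Ut[OF p(1)] by blast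
    have yp: "point S X y" by (rule XX.cont_val_point[OF y])
    have "good_at y (n + 1)" unfolding good_at_def
    proof (intro allI impI conjI)
      fix a r assume g: "gb (pr a r)"
      then have ar: "a \<in> dense X" "is_rat r" "0 < val r" by (simp_all add: gb_pr)
      show "DX y (\<lambda>_. a) \<le> kr (val r)" if nn: "N (n + 1) (pr a r)"
      proof -
        obtain B' where B': "N n B'" "St B' (pr a r)" using NS[of n "pr a r"] nn by blast
        have "is_pair B'" using N_gb[OF B'(1)] by (simp add: gb_def)
        then obtain b q where bq0: "B' = pr b q" by (rule is_pairE)
        then have b: "B' = pr b q" "gb (pr b q)" using N_gb[OF B'(1)] by simp_all
        then have bq: "b \<in> dense X" "is_rat q" "0 < val q" by (simp_all add: gb_pr)
        have "DX (P n) (\<lambda>_. b) \<le> kr (val q)" using p(2) B'(1) b unfolding good_at_def by blast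
        moreover obtain m c t where c: "c \<in> dense X" "is_rat t" "pr (pr m (pr c t)) (pr a r) \<in> U"
          "dt b c + kr (val q) < kr (val t)" using B'(2) unfolding St_def b(1) p_pr by blast
        moreover have "DX (P n) (\<lambda>_. c) \<le> DX (P n) (\<lambda>_. b) + dt b c"
          using DX_tri[OF p(1) point_const[OF bq(1)] point_const[OF c(1)]] bq(1) c(1) by simp
        ultimately have "DX (P n) (\<lambda>_. c) < kr (val t)" by linarith
        then have "in_open S X (sect U (pr a r)) (P n)"
          using c(3) in_ball_iff[OF p(1) c(1,2)] unfolding in_open_def sect_def by blast
        then show ?thesis using XX.cont_val_closed[OF Uc p(1) y ar] by blast
      qed
      show "N (n + 1) (pr a r)" if "DX y (\<lambda>_. a) < kr (val r)"
      proof -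
        have "in_open S X (sect U (pr a r)) (P n)" using XX.cont_val_open[OF y ar(1,2) that] .
        then obtain m c t where c: "pr m (pr c t) \<in> sect U (pr a r)" "c \<in> dense X" "is_rat t" "DX (P n) (\<lambda>_. c) < kr (val t)"
          using XX.in_openE[OF _ XX.cont_code_open[OF Uc ar] p(1)] by blast
        have "0 < kr (val t) - DX (P n) (\<lambda>_. c)" using c(4) by simp
        then obtain k where k: "kr (e k) < kr (val t) - DX (P n) (\<lambda>_. c)" by (rule R_arch)
        have ek: "(kr (e k) :: 'a R) = 2 * kr (e (k + 1))" using e_double[of k] by simp
        define b where "b = P n (k + 1 + 1)"
        have b: "b \<in> dense X" using pointD(1)[OF p(1)] by (simp add: b_def)
        have nb: "DX (P n) (\<lambda>_. b) \<le> kr (e (k + 1 + 1))" unfolding b_def by (rule DX_self[OF p(1)])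
        have lt: "kr (e (k + 1 + 1)) < (kr (e (k + 1)) :: 'a R)" using e_double[of "k + 1"] e_pos[of "k + 1 + 1"] by (simp only: kr_less)
        have "DX (P n) (\<lambda>_. b) < kr (e (k + 1))" using nb lt by (rule le_less_trans)
        then have "N n (pr b (rc (e (k + 1))))" using p(2) b unfolding good_at_def gb_pr by simp
        moreover have "dt b c + kr (e (k + 1)) < kr (val t)"
          using DX_tri[OF point_const[OF b] p(1) point_const[OF c(2)]] DX_sym[OF p(1) point_const[OF b]]
            DX_const[OF b c(2)] dt_dd[OF b c(2)] nb lt k ek by linarith
        then have "St (pr b (rc (e (k + 1)))) (pr a r)"
          unfolding St_def using c(1-3) by (auto simp: sect_def)
        ultimately show ?thesis using NS g by blast
      qed
    qed
    then show ?thesis using y by blast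
  qed
  have all: "point S X (P n) \<and> good_at (P n) n" for n
  proof -
    \<comment> \<open>Induction needs a predicate in \<open>dec\<close>, but \<open>point\<close>
      and \<open>DX\<close> speak about functions. \<open>T\<close> unfolds them into conditions on
      the entries \<open>P n k\<close>.\<close>
    define T where "T n \<longleftrightarrow> (\<forall>i. P n i \<in> dense X) \<and> (\<forall>i j. i \<preceq> j \<longrightarrow> dt (P n i) (P n j) \<le> kr (e i)) \<and>
      (\<forall>a r. gb (pr a r) \<longrightarrow> (N n (pr a r) \<longrightarrow> (\<forall>k. dt (P n k) a \<le> kr (val r) + kr (e k))) \<and>
        ((\<exists>k. dt (P n k) a + kr (e k) < kr (val r)) \<longrightarrow> N n (pr a r)))" for n
    have "fn S (P n)" for n unfolding P_def by (intro fn_comp[OF f(1)] comp)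
    then have pt: "point S X (P n) \<longleftrightarrow> (\<forall>i. P n i \<in> dense X) \<and> (\<forall>i j. i \<preceq> j \<longrightarrow> dt (P n i) (P n j) \<le> kr (e i))" for n
      unfolding point_iff by (metis dt_dd)
    have T: "T n \<longleftrightarrow> point S X (P n) \<and> good_at (P n) n" for n
      using DX_le_iff[of "P n"] unfolding T_def good_at_def gb_pr pt[symmetric] conj_assoc[symmetric] by blast
    have "T n"
    proof (rule dec_induct[where P = T])
      show "dec T" unfolding T_def P_def by (intro comp dec_gb dec_N fn_comp[OF f(1)])
      have "good_at x0 0" unfolding good_at_def N0 gb_pr by (auto simp: gb_pr)
      then show "T 0" unfolding T using P_good[OF x0] good_P[OF x0] by blast
      show "T (n + 1)" if "T n" for n
      proof -
        obtain y where y: "cont_val S X X U (P n) y" "good_at y (n + 1)" using step \<open>T n\<close> unfolding T by blast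
        then show ?thesis unfolding T using P_good good_P XX.cont_val_point by blast
      qed
    qed
    then show ?thesis by (simp add: T)
  qed
  have "cont_val S X X U (P n) (P (n + 1))" for n
  proof -
    obtain y where y: "cont_val S X X U (P n) y" "good_at y (n + 1)" using step all by blast
    then show ?thesis using XX.cont_val_peq[OF y(1)] P_good[OF XX.cont_val_point[OF y(1)] y(2)] by blast
  qed
  moreover have "pf P" unfolding pf_def
  proof (intro conjI allI)
    show "fn S (\<lambda>z. P (p1 z) (p2 z))" unfolding P_def by (intro comp fn_comp[OF f(1)])
    show "point S X (P n)" for n using all by blast
  qed
  ultimately show ?thesis by blast
qed

end

context asys
begin

theorem fixed_point_cont_function:
  assumes "is_continuous F"
  shows "\<exists>x. point S X x \<and> fun_val S X X F x x"
proof -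
  obtain U where F: "F = Continuous U" using assms by (auto simp: is_continuous_def)
  have U: "cont_code S X X U" "cont_total_code S X X U"
    using sys unfolding caristi_system_def total_fun_def F cont_total_code_def by simp_all
  obtain P where P: "pf P" "\<And>n. cont_val S X X U (P n) (P (n + 1))"
    using iterate[OF U(2) point_const[OF a0]] by blast
  have Pp: "point S X (P n)" for n by (rule pf_point[OF P(1)])
  obtain W where W: "W \<in> S" "\<And>n. cont_total_code S X half_line (sect W n)"
    and mono: "\<And>n m x v w. n \<preceq> m \<Longrightarrow> point S X x \<Longrightarrow> cont_val S X half_line (sect W n) x v \<Longrightarrow>
      cont_val S X half_line (sect W m) x w \<Longrightarrow> rv v \<le> rv w"
    and lim: "\<And>x y. point S X x \<Longrightarrow> fun_val S X half_line G x y \<Longrightarrow> limit_val S X half_line W x y"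
    using G_seq by blast
  note sup = limit_sup[OF mono]
  have Wc: "cont_code S X half_line (sect W n)" "point S X x \<Longrightarrow> \<exists>v. cont_val S X half_line (sect W n) x v" for n x
    using W(2)[of n] by (auto simp: cont_total_code_def)
  have "\<exists>Q. V.AY.pf Q \<and> (\<forall>p. cont_val S X half_line (sect W (p1 p)) (P (p2 p)) (Q p))"
    by (rule V.uniform_value[OF W(1) fn_p1])
      (auto simp: Wc(1) intro!: pf_comp[OF P(1)] fn_p2 Wc(2) Pp)
  then obtain Q where Q: "V.AY.pf Q" "\<And>p. cont_val S X half_line (sect W (p1 p)) (P (p2 p)) (Q p)" by blast
  have "\<exists>t. fun_val S X half_line G (P n) t" for n using G_ex[OF Pp] by blast
  then obtain t where t: "\<And>n. fun_val S X half_line G (P n) (t n)" by metis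
  define s where "s n = rv (t n)" for n
  \<comment> \<open>The potential is only a limit, but along the orbit it is a supremum of values
    that form a family in \<open>S\<close>. Hence its lower cuts are arithmetical.\<close>
  have s_iff: "kr q < s n \<longleftrightarrow> (\<exists>m. kr q < rv (Q (pr m n)))" for q n
  proof
    have Qv: "cont_val S X half_line (sect W m) (P n) (Q (pr m n))" for m using Q(2)[of "pr m n"] by simp
    show "kr q < s n" if "\<exists>m. kr q < rv (Q (pr m n))"
    proof -
      obtain m where "kr q < rv (Q (pr m n))" using \<open>\<exists>m. kr q < rv (Q (pr m n))\<close> by blast
      moreover have "rv (Q (pr m n)) \<le> s n"
        unfolding s_def by (rule sup(1)[OF _ _ _ _ Pp lim[OF Pp t] Qv])
      ultimately show ?thesis by linarith
    qed
    assume "kr q < s n"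
    then have "0 < s n - kr q" by simp
    then obtain k where k: "kr (e k) < s n - kr q" by (rule R_arch)
    have "\<exists>m. \<forall>v. cont_val S X half_line (sect W m) (P n) v \<longrightarrow> rv (t n) \<le> rv v + kr (e k)"
      by (rule sup(2)[OF _ _ _ _ Pp lim[OF Pp t]])
    then obtain m where "rv (t n) \<le> rv (Q (pr m n)) + kr (e k)" using Qv by blast
    then show "\<exists>m. kr q < rv (Q (pr m n))" using k unfolding s_def by (intro exI[of _ m]) linarith
  qed
  have rs: "rdec s" unfolding rdec_def s_iff
    by (intro comp rdec_comp[OF rdec_value[OF Q(1)]])
  have s0: "0 \<le> s n" for n unfolding s_def using half_line_nonneg[OF V.fun_val_point[OF t]] .
  have sstep: "DX (P n) (P (n + 1)) \<le> s n - s (n + 1)" for n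
    unfolding s_def by (rule caristi[OF Pp _ t t]) (simp add: F P(2))
  have chain: "DX (P n) (P (n + d)) \<le> s n - s (n + d)" for n d
  proof (rule dec_induct[where P = "\<lambda>d. DX (P n) (P (n + d)) \<le> s n - s (n + d)"])
    show "dec (\<lambda>d. DX (P n) (P (n + d)) \<le> s n - s (n + d))"
      by (intro dec_rle rdec_diff rdec_DX pf_comp[OF P(1)] rdec_comp[OF rs] comp)
    show "DX (P n) (P (n + 0)) \<le> s n - s (n + 0)" using Pp by (simp add: add_0)
    show "DX (P n) (P (n + (d + 1))) \<le> s n - s (n + (d + 1))" if "DX (P n) (P (n + d)) \<le> s n - s (n + d)" for d
      using that DX_tri[OF Pp[of n] Pp[of "n + d"] Pp[of "n + d + 1"]] sstep[of "n + d"] unfolding add_S by linarith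
  qed
  define a where "a n = P n n" for n
  have aD: "a n \<in> dense X" for n using pointD(1)[OF Pp] by (simp add: a_def)
  have "fn S (\<lambda>z. P (p1 z) (p2 z))" using P(1) by (simp add: pf_def)
  then have fa: "fn S a" unfolding a_def by (rule fn_comp2[OF _ fn_id fn_id])
  have Pa: "DX (P n) (\<lambda>_. a n) \<le> kr (e n)" for n unfolding a_def by (rule DX_self[OF Pp])
  have "\<exists>x. point S X x \<and> (\<forall>k. \<exists>N. \<forall>m. N \<preceq> m \<longrightarrow> DX x (\<lambda>_. a m) \<le> kr (e k))"
  proof (rule cauchy_limit[OF fa aD])
    fix k :: 'a
    let ?k = "k + 1 + 1"
    have "\<exists>y. True \<and> (\<forall>y'. True \<longrightarrow> s y \<le> s y' + kr (e ?k))"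
      by (rule approx_min) (auto intro!: comp rs s0)
    then obtain N0 where N0: "\<And>m. s N0 \<le> s m + kr (e ?k)" by blast
    have near: "DX (P N0) (P m) \<le> kr (e ?k)" if m: "N0 \<preceq> m" for m
    proof -
      obtain d where "m = N0 + d" using dec_arith_mono[OF m] .
      then show ?thesis using chain[of N0 d] N0[of m] by simp
    qed
    define N where "N = N0 + ?k"
    have "dd (a N) (a m) \<le> kr (e k)" if "N \<preceq> m" for m
    proof -
      have le: "N0 \<preceq> N" "?k \<preceq> N" by (simp_all add: N_def iota_leq)
      then have le': "N0 \<preceq> m" "?k \<preceq> m" using that leq_trans by blast+
      have "kr (e N) \<le> (kr (e ?k) :: 'a R)" "kr (e m) \<le> (kr (e ?k) :: 'a R)"
        by (intro kr_mono e_mono le le')+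
      moreover have "e k = 4 * e ?k" by (simp add: e_S)
      then have "(kr (e k) :: 'a R) = 4 * kr (e ?k)" by simp
      ultimately show ?thesis
        using near[OF le(1)] near[OF le'(1)] Pa[of N] Pa[of m]
          DX_tri[OF point_const[OF aD[of N]] Pp[of N] point_const[OF aD[of m]]]
          DX_tri[OF Pp[of N] Pp[of N0] point_const[OF aD[of m]]]
          DX_tri[OF Pp[of N0] Pp[of m] point_const[OF aD[of m]]]
          DX_sym[OF Pp[of N] Pp[of N0]] DX_sym[OF Pp[of N] point_const[OF aD[of N]]]
          DX_const[OF aD[of N] aD[of m]] by linarith
    qed
    then show "\<exists>N. \<forall>m. N \<preceq> m \<longrightarrow> dd (a N) (a m) \<le> kr (e k)" by blast
  qed
  then obtain x where x: "point S X x" and xl: "\<And>k. \<exists>N. \<forall>m. N \<preceq> m \<longrightarrow> DX x (\<lambda>_. a m) \<le> kr (e k)" by blast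
  have xP: "\<exists>N. \<forall>m. N \<preceq> m \<longrightarrow> DX x (P m) \<le> kr (e k)" for k
  proof -
    obtain N where N: "\<And>m. N \<preceq> m \<Longrightarrow> DX x (\<lambda>_. a m) \<le> kr (e (k + 1))" using xl by blast
    have "DX x (P m) \<le> kr (e k)" if "N + (k + 1) \<preceq> m" for m
    proof -
      have le: "N \<preceq> m" "k + 1 \<preceq> m" using that iota_nonneg[of N] iota_nonneg[of k] unfolding iota_leq iota_simps by linarith+
      have "kr (e m) \<le> (kr (e (k + 1)) :: 'a R)" by (intro kr_mono e_mono le)
      moreover have "(kr (e k) :: 'a R) = 2 * kr (e (k + 1))" using e_double[of k] by simp
      ultimately show ?thesis
        using N[OF le(1)] Pa[of m] DX_tri[OF x point_const[OF aD[of m]] Pp[of m]] DX_sym[OF Pp[of m] point_const[OF aD[of m]]]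
        by linarith
    qed
    then show ?thesis by blast
  qed
  obtain y where y: "fun_val S X X F x y" "point S X y" using F_ex[OF x] by blast
  have yU: "cont_val S X X U x y" using y(1) by (simp add: F)
  have "DX x y \<le> 0"
  proof (rule R_leI[where c = 2])
    fix k
    obtain j where j: "\<And>x' y'. point S X x' \<and> DX x x' < kr (e j) \<and> cont_val S X X U x' y' \<Longrightarrow> DX y y' \<le> kr (e k)"
      using XX.cont_cont[OF U(1) x yU] by blast
    obtain N where N: "\<And>m. N \<preceq> m \<Longrightarrow> DX x (P m) \<le> kr (e (j + 1))" using xP by blast
    obtain M where M: "\<And>m. M \<preceq> m \<Longrightarrow> DX x (P m) \<le> kr (e k)" using xP by blast
    define m where "m = N + M"
    have m: "N \<preceq> m" "M \<preceq> m + 1" by (simp_all add: m_def iota_leq add_increasing)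
    have "kr (e (j + 1)) < (kr (e j) :: 'a R)" using e_double[of j] e_pos[of "j + 1"] by (simp only: kr_less)
    then have "DX x (P m) < kr (e j)" using N[OF m(1)] by linarith
    then have "DX y (P (m + 1)) \<le> kr (e k)" using j Pp P(2) by blast
    then show "DX x y \<le> 0 + kr (2 * e k)"
      using M[OF m(2)] DX_tri[OF x Pp[of "m + 1"] y(2)] DX_sym[OF y(2) Pp[of "m + 1"]]
      unfolding kr_simps kr_numeral by linarith
  qed
  then show ?thesis using fixedI[OF x y(1)] x by blast
qed

end

section \<open>A criterion for arithmetical comprehension\<close>

context rca0
begin

lemma fn_tval: "(\<And>i. fn S (g i)) \<Longrightarrow> fn S (\<lambda>x. tval (\<lambda>i. g i x) t)"
  by (induction t) (auto intro!: comp)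

text \<open>The assignment is a family of functions of \<open>x\<close>. Below a quantifier the
  argument becomes a pair whose second component feeds the bound variable, and \<open>proj\<close>
  then removes the quantifier.\<close>

lemma dec_sat:
  assumes proj: "\<And>Z. Z \<in> S \<Longrightarrow> {n. \<exists>m. pr n m \<in> Z} \<in> S" and E: "range E \<subseteq> S"
  shows "(\<And>i. fn S (g i)) \<Longrightarrow> dec (\<lambda>x. sat E (\<lambda>i. g i x) \<phi>)"
proof (induction \<phi> arbitrary: g)
  case (Equal s t)
  then show ?case by (auto intro!: dec_eq fn_tval)
next
  case (Less s t)
  then show ?case by (auto intro!: dec_less fn_tval)
next
  case (Mem t j)
  have "E j \<in> S" using E by auto
  then show ?case using dec_comp[OF dec_mem fn_tval[OF Mem]] by simp
next
  case (Neg \<phi>)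
  then show ?case using dec_not[OF Neg.IH[OF Neg.prems]] by simp
next
  case (Conj \<phi> \<psi>)
  then show ?case using dec_conj[OF Conj.IH(1)[OF Conj.prems] Conj.IH(2)[OF Conj.prems]] by simp
next
  case (Exis j \<phi>)
  define g' where "g' i z = (if i = j then p2 z else g i (p1 z))" for i z
  have "fn S (g' i)" for i
    unfolding g'_def by (cases "i = j") (auto intro!: comp fn_comp[OF Exis.prems])
  then have "dec (\<lambda>z. sat E (\<lambda>i. g' i z) \<phi>)" by (rule Exis.IH)
  then have "{n. \<exists>m. pr n m \<in> {z. sat E (\<lambda>i. g' i z) \<phi>}} \<in> S" by (intro proj) (simp add: dec_def)
  moreover have "(\<lambda>i. g' i (pr x a)) = (\<lambda>i. g i x)(j := a)" for x a
    by (auto simp: g'_def)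
  ultimately show ?case by (simp add: dec_def)
qed

lemma aca0I:
  assumes "\<And>Z. Z \<in> S \<Longrightarrow> {n. \<exists>m. pr n m \<in> Z} \<in> S"
  shows "ACA0 S"
  unfolding ACA0_def
proof (intro conjI allI impI ballI)
  show "basic_axioms TYPE('a)" "S \<noteq> {}" using rca0 by (auto simp: RCA0_def)
  show "n \<in> X" if "X \<in> S" "0 \<in> X \<and> (\<forall>n. n \<in> X \<longrightarrow> n + 1 \<in> X)" for X n
    by (rule dec_induct[where P = "\<lambda>n. n \<in> X"]) (use that dec_mem in auto)
  show "{n. sat E (e(i := n)) \<phi>} \<in> S" if "range E \<subseteq> S" for \<phi> E e i
  proof -
    have "fn S (\<lambda>x. (e(i := x)) j)" for j by (cases "j = i") (auto intro: comp)
    from dec_sat[OF assms that, of "\<lambda>j x. (e(i := x)) j", OF _ this] show ?thesis by (simp add: dec_def fun_upd_def)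
  qed
qed

end

text \<open>When preimages are exact, boundaries included, both coherence conditions become
  statements about balls of \<open>Y\<close>. The value is unique because a small ball around an
  entry of a competitor also contains \<open>f x\<close>.\<close>

lemma (in cspace2) exact_code:
  assumes U: "U \<in> S" "\<And>B. rat_ball Y B \<Longrightarrow> open_code S X (sect U B)"
    and f: "\<And>x. point S X x \<Longrightarrow> point S Y (f x)"
      "\<And>x a r. point S X x \<Longrightarrow> a \<in> dense Y \<Longrightarrow> is_rat r \<Longrightarrow> 0 < val r \<Longrightarrow>
        in_open S X (sect U (pr a r)) x \<longleftrightarrow> Y.DX (f x) (\<lambda>_. a) < kr (val r)"
  shows "cont_total_code S X Y U" "point S X x \<Longrightarrow> cont_val S X Y U x (f x)"
proof -
  have eq: "in_open S X (sect U B) x \<longleftrightarrow> in_ball S Y B (f x)" if "rat_ball Y B" "point S X x" for B x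
  proof -
    obtain a r where "B = pr a r" "a \<in> dense Y" "is_rat r" "0 < val r" using \<open>rat_ball Y B\<close> by (rule Y.rat_ballE)
    then show ?thesis using f(2)[OF \<open>point S X x\<close>] Y.in_ball_iff[OF f(1)[OF \<open>point S X x\<close>]] by simp
  qed
  have "coherent S X Y (\<lambda>B. in_open S X (sect U B))"
    unfolding coherent_def using eq f(1) by blast
  then have "cont_code S X Y U" using U by (simp add: cont_code_def)
  moreover show val: "cont_val S X Y U x (f x)" if x: "point S X x" for x
  proof -
    have "peq S Y y (f x)" if y: "point S Y y" "\<And>B. rat_ball Y B \<Longrightarrow> in_ball S Y B y \<Longrightarrow> in_open S X (sect U B) x" for y
    proof -
      have "Y.DX y (f x) = 0"
      proof (rule R_eqI[where c = 2])
        fix k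
        define b where "b = y (k + 1)"
        have b: "b \<in> dense Y" using Y.pointD[OF y(1)] by (simp add: b_def)
        have yb: "Y.DX y (\<lambda>_. b) \<le> kr (e (k + 1))" unfolding b_def by (rule Y.DX_self[OF y(1)])
        have lt: "kr (e (k + 1)) < (kr (e k) :: 'a R)" using e_double[of k] e_pos[of "k + 1"] by (simp only: kr_less)
        have "in_ball S Y (pr b (rc (e k))) y"
          using le_less_trans[OF yb lt] Y.in_ball_iff[OF y(1) b, of "rc (e k)"] by simp
        moreover have "rat_ball Y (pr b (rc (e k)))" using b by (simp add: Y.rat_ball_iff)
        ultimately have "in_ball S Y (pr b (rc (e k))) (f x)" using y(2) eq x by blast
        then have "Y.DX (f x) (\<lambda>_. b) < kr (e k)" using Y.in_ball_iff[OF f(1)[OF x] b, of "rc (e k)"] by simp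
        then have "Y.DX y (f x) \<le> 2 * kr (e k)"
          using yb lt Y.DX_tri[OF y(1) Y.point_const[OF b] f(1)[OF x]] Y.DX_sym[OF f(1)[OF x] Y.point_const[OF b]] by linarith
        then show "\<bar>Y.DX y (f x) - 0\<bar> \<le> kr (2 * e k)" using Y.DX_nonneg[OF y(1) f(1)[OF x]] by simp
      qed
      then show ?thesis using Y.peq_iff[OF y(1) f(1)[OF x]] by simp
    qed
    then show ?thesis unfolding cont_val_def preimage_val_def Let_def using f(1)[OF x] eq x by blast
  qed
  ultimately show "cont_total_code S X Y U" unfolding cont_total_code_def by blast
qed

section \<open>A set that is enumerable but not computable\<close>

locale gap = rca0 S for S :: "'a::l2_sig set set" +
  fixes Z :: "'a set"
  assumes Z: "Z \<in> S" and gap: "{n. \<exists>m. pr n m \<in> Z} \<notin> S"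
begin

text \<open>The events \<open>pr n m\<close>, with \<open>m\<close> the least witness for \<open>n\<close>, also serve as the stages at which the
  \<open>n\<close> enter the set.\<close>

definition ev :: "'a \<Rightarrow> bool" where
  "ev j \<longleftrightarrow> is_pair j \<and> j \<in> Z \<and> (\<forall>m. m < p2 j \<longrightarrow> pr (p1 j) m \<notin> Z)"

definition inA :: "'a \<Rightarrow> 'a \<Rightarrow> bool" where "inA i n \<longleftrightarrow> (\<exists>j. j < i \<and> ev j \<and> p1 j = n)"

lemma dec_ev [comp]: assumes "fn S f" shows "dec (\<lambda>x. ev (f x))"
  unfolding ev_def by (intro comp dec_comp[OF dec_mem[OF Z]] fn_comp[OF assms] assms)

lemma dec_inA [comp]: assumes "fn S f" "fn S g" shows "dec (\<lambda>x. inA (f x) (g x))"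
  unfolding inA_def by (intro comp fn_comp[OF assms(1)] fn_comp[OF assms(2)] assms)

lemma ev_unique: "ev i \<Longrightarrow> ev j \<Longrightarrow> p1 i = p1 j \<Longrightarrow> i = j"
  unfolding ev_def using less_linear' pr_p by metis

lemma ev_ex: assumes "pr n m \<in> Z" shows "\<exists>m. ev (pr n m) \<and> pr n m \<in> Z"
proof -
  have "\<exists>m. pr n m \<in> Z \<and> (\<forall>k. k < m \<longrightarrow> \<not> pr n k \<in> Z)"
    by (rule least[where P = "\<lambda>m. pr n m \<in> Z", OF _ assms]) (intro comp dec_comp[OF dec_mem[OF Z]])
  then show ?thesis by (auto simp: ev_def)
qed

lemma inA_mono: "inA i n \<Longrightarrow> i \<preceq> i' \<Longrightarrow> inA i' n"
  unfolding inA_def by (auto simp: iota_iff intro: less_le_trans)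

lemma inA_less: assumes "inA i n" shows "n < i"
proof -
  obtain j where "j < i" "p1 j = n" using assms by (auto simp: inA_def)
  then show ?thesis using p_le(1)[of j] by (simp add: iota_iff)
qed

text \<open>A correct list would bound the search: \<open>n\<close> belongs to the enumerated set
  iff some \<open>m < l n\<close> is a witness. The shift by one makes this bound strict.\<close>

lemma not_computable: assumes "fn S l" shows "\<exists>j. ev j \<and> l (p1 j) \<noteq> p2 j + 1"
proof (rule ccontr)
  assume *: "\<not> ?thesis"
  have "(\<exists>m. pr n m \<in> Z) \<longleftrightarrow> (\<exists>m. m < l n \<and> pr n m \<in> Z)" for n
  proof
    assume "\<exists>m. pr n m \<in> Z"
    then obtain m where m: "ev (pr n m)" "pr n m \<in> Z" using ev_ex by blast
    then have "l n = m + 1" using * p_pr by metis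
    then show "\<exists>m. m < l n \<and> pr n m \<in> Z" using m(2) less_S by auto
  qed blast
  moreover have "dec (\<lambda>n. \<exists>m. m < l n \<and> pr n m \<in> Z)"
    by (intro comp dec_comp[OF dec_mem[OF Z]] assms)
  ultimately show False using gap by (simp add: dec_def)
qed

lemma (in rca0) kprim_rec_ex:
  assumes "kfn c" "kfn (\<lambda>z. H (p1 z) (p1 (p2 z)) (val (p2 (p2 z))))"
  shows "\<exists>F. kfn (\<lambda>z. F (p1 z) (p2 z)) \<and> (\<forall>x. F x 0 = c x) \<and> (\<forall>x i. F x (i + 1) = H x i (F x i))"
proof (rule kprim_rec[OF assms])
  fix F assume "kfn (\<lambda>z. F (p1 z) (p2 z))" "\<And>x. F x 0 = c x" "\<And>x i. F x (i + 1) = H x i (F x i)"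
  then show ?thesis by (intro exI[of _ F]) simp
qed

text \<open>The sum of 2^-(k+1) over those \<open>k < n\<close> that have entered before stage
  \<open>i\<close>. It is selected from the functions solving the recursion, because recursion along
  the model's numbers takes place inside \<open>S\<close>.\<close>

definition T :: "'a \<Rightarrow> 'a \<Rightarrow> 'a K" where
  "T = (SOME F. kfn (\<lambda>z. F (p1 z) (p2 z)) \<and> (\<forall>i. F i 0 = 0) \<and>
     (\<forall>i n. F i (n + 1) = F i n + (if inA i n then e (n + 1) else 0)))"

lemma T: "kfn (\<lambda>z. T (p1 z) (p2 z))" "T i 0 = 0" "T i (n + 1) = T i n + (if inA i n then e (n + 1) else 0)"
proof -
  have "kfn (\<lambda>z. val (p2 (p2 z)) + (if inA (p1 z) (p1 (p2 z)) then e (p1 (p2 z) + 1) else 0))"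
    by (intro comp)
  then have "\<exists>F. kfn (\<lambda>z. F (p1 z) (p2 z)) \<and> (\<forall>i. F i 0 = 0) \<and>
     (\<forall>i n. F i (n + 1) = F i n + (if inA i n then e (n + 1) else 0))"
    by (rule kprim_rec_ex[OF kfn_const])
  from someI_ex[OF this] show "kfn (\<lambda>z. T (p1 z) (p2 z))" "T i 0 = 0"
    "T i (n + 1) = T i n + (if inA i n then e (n + 1) else 0)"
    unfolding T_def by blast+
qed

lemma kfn_T [comp]: "fn S f \<Longrightarrow> fn S g \<Longrightarrow> kfn (\<lambda>x. T (f x) (g x))"
  by (rule kfn_comp2[OF T(1)])

lemma T_mono:
  assumes "i \<preceq> i'" "k \<preceq> j" shows "T i' k - T i k \<le> T i' j - T i j"
proof -
  obtain d where j: "j = k + d" using dec_arith_mono[OF assms(2)] .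
  show ?thesis unfolding j
  proof (rule dec_induct[where P = "\<lambda>d. T i' k - T i k \<le> T i' (k + d) - T i (k + d)"])
    show "dec (\<lambda>d. T i' k - T i k \<le> T i' (k + d) - T i (k + d))" by (intro comp)
    show "T i' k - T i k \<le> T i' (k + 0) - T i (k + 0)" by (simp add: add_0)
    fix d assume "T i' k - T i k \<le> T i' (k + d) - T i (k + d)"
    then show "T i' k - T i k \<le> T i' (k + (d + 1)) - T i (k + (d + 1))"
      using inA_mono[OF _ assms(1), of "k + d"] e_pos[of "k + d + 1"] unfolding add_S T(3)
      by (auto simp del: e_pos)
  qed
qed

lemma T_le: "i \<preceq> i' \<Longrightarrow> T i k \<le> T i' k"
  using T_mono[of i i' 0 k] by (simp add: T(2))

lemma T_new:
  assumes "i \<preceq> i'" "inA i' n" "\<not> inA i n" "n < L" shows "T i L + e (n + 1) \<le> T i' L"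
proof -
  have "n + 1 \<preceq> L" using S_le[OF assms(4)] by (auto simp: leq_def)
  from T_mono[OF assms(1) this] show ?thesis
    using T_le[OF assms(1), of n] assms(2,3) by (simp add: T(3))
qed

lemma T_bounds: "0 \<le> T i L" "T i L \<le> 1 - e L"
proof -
  have "0 \<le> T i L \<and> T i L \<le> 1 - e L"
  proof (rule dec_induct[where P = "\<lambda>L. 0 \<le> T i L \<and> T i L \<le> 1 - e L"])
    show "dec (\<lambda>L. 0 \<le> T i L \<and> T i L \<le> 1 - e L)" by (intro comp)
    show "0 \<le> T i 0 \<and> T i 0 \<le> 1 - e 0" by (simp add: T e_0)
    show "0 \<le> T i (L + 1) \<and> T i (L + 1) \<le> 1 - e (L + 1)" if "0 \<le> T i L \<and> T i L \<le> 1 - e L" for L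
      using that[THEN conjunct1] that[THEN conjunct2] e_double[of L] e_pos[of "L + 1"] unfolding T(3)
      by (cases "inA i L"; simp only: if_True if_False; intro conjI; linarith)
  qed
  then show "0 \<le> T i L" "T i L \<le> 1 - e L" by auto
qed

text \<open>The places from \<open>L\<close> up to \<open>L'\<close> contribute at most
  \<open>e L - e L'\<close>, the full geometric sum.\<close>

lemma T_tail: assumes "L \<preceq> L'" shows "T i L \<le> T i L'" "T i L' + e L' \<le> T i L + e L"
proof -
  obtain d where L': "L' = L + d" using dec_arith_mono[OF assms] .
  have "T i L \<le> T i (L + d) \<and> T i (L + d) + e (L + d) \<le> T i L + e L"
  proof (rule dec_induct[where P = "\<lambda>d. T i L \<le> T i (L + d) \<and> T i (L + d) + e (L + d) \<le> T i L + e L"])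
    show "dec (\<lambda>d. T i L \<le> T i (L + d) \<and> T i (L + d) + e (L + d) \<le> T i L + e L)" by (intro comp)
    show "T i L \<le> T i (L + 0) \<and> T i (L + 0) + e (L + 0) \<le> T i L + e L" by (simp add: add_0)
    show "T i L \<le> T i (L + (d + 1)) \<and> T i (L + (d + 1)) + e (L + (d + 1)) \<le> T i L + e L"
      if "T i L \<le> T i (L + d) \<and> T i (L + d) + e (L + d) \<le> T i L + e L" for d
      using that[THEN conjunct1] that[THEN conjunct2] e_double[of "L + d"] e_pos[of "L + d + 1"] unfolding add_S T(3)
      by (cases "inA i (L + d)"; simp only: if_True if_False; intro conjI; linarith)
  qed
  then show "T i L \<le> T i L'" "T i L' + e L' \<le> T i L + e L" unfolding L' by auto
qed

lemma T_eq:
  assumes "\<And>m. m < L \<Longrightarrow> inA i m \<longleftrightarrow> inA i' m" shows "T i L = T i' L"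
proof -
  have "k \<preceq> L \<longrightarrow> T i k = T i' k" for k
  proof (rule dec_induct[where P = "\<lambda>k. k \<preceq> L \<longrightarrow> T i k = T i' k"])
    show "dec (\<lambda>k. k \<preceq> L \<longrightarrow> T i k = T i' k)" by (intro comp)
    show "0 \<preceq> L \<longrightarrow> T i 0 = T i' 0" by (simp add: T)
    show "k + 1 \<preceq> L \<longrightarrow> T i (k + 1) = T i' (k + 1)" if "k \<preceq> L \<longrightarrow> T i k = T i' k" for k
      using that assms[of k] by (auto simp: T(3) iota_iff)
  qed
  then show ?thesis by simp
qed

lemma T_stable: assumes "i \<preceq> L" shows "T i L = T i i"
proof -
  obtain d where L: "L = i + d" using dec_arith_mono[OF assms] .
  show ?thesis unfolding L
  proof (rule dec_induct[where P = "\<lambda>d. T i (i + d) = T i i"])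
    show "dec (\<lambda>d. T i (i + d) = T i i)" by (intro comp)
    have "\<not> inA i (i + d)" for d
      using inA_less[of i "i + d"] iota_nonneg[of d] unfolding iota_less iota_simps by linarith
    then show "T i (i + (d + 1)) = T i i" if "T i (i + d) = T i i" for d using that by (simp only: add_S T(3)) simp
  qed (simp add: add_0)
qed

text \<open>Only numbers below \<open>i\<close> have entered by stage \<open>i\<close>
  (\<open>inA_less\<close>), so \<open>i\<close> places already give the whole sum at that
  stage.\<close>

definition c :: "'a \<Rightarrow> 'a K" where "c i = T i i"

lemma kfn_c [comp]: "fn S f \<Longrightarrow> kfn (\<lambda>x. c (f x))"
  unfolding c_def by (intro comp)

lemma c_mono: "i \<preceq> i' \<Longrightarrow> c i \<le> c i'"
  unfolding c_def using T_stable[of i i'] T_le[of i i' i'] by simp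

lemma c_bounds: "0 \<le> c i" "c i < 1"
  unfolding c_def using T_bounds[of i i] e_pos[of i] by linarith+

lemma c_new: assumes "inA i' n" "\<not> inA i n" shows "c i + e (n + 1) \<le> c i'"
proof -
  have "i \<preceq> i'" using inA_mono[OF assms(1), of i] assms(2) linear[of "\<iota> i" "\<iota> i'"] by (auto simp: iota_leq)
  then show ?thesis unfolding c_def
    using T_new[OF _ assms inA_less[OF assms(1)]] T_stable[of i i'] by simp
qed

lemma c_le: "c i \<le> T i k + e k"
proof (cases "i \<preceq> k")
  case True
  then show ?thesis using T_stable[OF True] e_pos[of k] unfolding c_def by linarith
next
  case False
  then have "k \<preceq> i" by (simp add: iota_leq)
  then show ?thesis unfolding c_def using T_tail(2)[of k i i] e_pos[of i] by linarith
qed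

text \<open>Every change of \<open>T n j\<close> is caused by some \<open>l < j\<close> that enters
  and raises the sum by at least \<open>e j\<close>. Unboundedly many changes, counted by an
  existential induction, would exceed the bound \<open>1\<close>. The same stage then serves all
  \<open>k \<preceq> j\<close>, since increments grow with the number of places.\<close>

lemma T_limit: "\<exists>N. \<forall>n k. N \<preceq> n \<longrightarrow> k \<preceq> j \<longrightarrow> T n k = T N k"
proof -
  have "\<exists>N. \<forall>n. N \<preceq> n \<longrightarrow> T n j = T N j"
  proof (rule ccontr)
    assume *: "\<not> ?thesis"
    have "\<exists>N. \<iota> m * e j \<le> T N j" for m
    proof (rule sigma1_induct[where P = "\<lambda>m N. \<iota> m * e j \<le> T N j"])
      show "dec (\<lambda>z. \<iota> (p1 z) * e j \<le> T (p2 z) j)" by (intro comp)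
      show "\<exists>N. \<iota> 0 * e j \<le> T N j" using T_bounds by auto
      fix m N assume mN: "\<iota> m * e j \<le> T N j"
      obtain n where n: "N \<preceq> n" "T n j \<noteq> T N j" using * by blast
      then obtain l where l: "l < j" "inA n l" "\<not> inA N l" using T_eq[of j n N] inA_mono by blast
      have "l + 1 \<preceq> j" using S_le[OF l(1)] by (auto simp: leq_def)
      then have "e j \<le> e (l + 1)" by (rule e_mono)
      then have "\<iota> (m + 1) * e j \<le> T n j" using T_new[OF n(1) l(2,3,1)] mN by (simp add: distrib_right)
      then show "\<exists>N. \<iota> (m + 1) * e j \<le> T N j" by blast
    qed
    moreover obtain m :: 'a where "1 / e j < \<iota> m" by (rule K_arch)
    then have "1 < \<iota> m * e j" by (simp add: divide_less_eq)
    moreover have "T N j < 1" for N using T_bounds(2)[of N j] e_pos[of j] by linarith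
    ultimately show False by (meson less_le_trans not_less_iff_gr_or_eq less_trans)
  qed
  then obtain N where N: "\<And>n. N \<preceq> n \<Longrightarrow> T n j = T N j" by blast
  have "T n k = T N k" if "N \<preceq> n" "k \<preceq> j" for n k
    using T_mono[OF that] N[OF that(1)] T_le[OF that(1), of k] by linarith
  then show ?thesis by blast
qed

end

section \<open>Baire space\<close>

context rca0
begin

definition agree :: "('a \<Rightarrow> 'a) \<Rightarrow> ('a \<Rightarrow> 'a) \<Rightarrow> 'a \<Rightarrow> bool" where
  "agree f g i \<longleftrightarrow> (\<forall>m. m < i \<longrightarrow> f m = g m)"

definition bd :: "'a \<Rightarrow> 'a \<Rightarrow> 'a K" where
  "bd s t = (if ent s = ent t then 0 else e (THE n. ent s n \<noteq> ent t n \<and> agree (ent s) (ent t) n))"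

lemma ent_beyond: "\<not> i < len s \<Longrightarrow> ent s i = 0"
  by (simp add: ent_def)

lemma first_diff: assumes "ent s \<noteq> ent t"
  obtains n where "ent s n \<noteq> ent t n" "agree (ent s) (ent t) n" "bd s t = e n" "n < len s + len t"
proof -
  obtain k where "ent s k \<noteq> ent t k" using assms by blast
  moreover have "dec (\<lambda>k. ent s k \<noteq> ent t k)" by (intro comp)
  ultimately have "\<exists>n. ent s n \<noteq> ent t n \<and> (\<forall>k. k < n \<longrightarrow> \<not> ent s k \<noteq> ent t k)" by (intro least)
  then obtain n where n: "ent s n \<noteq> ent t n" "agree (ent s) (ent t) n" by (auto simp: agree_def)
  have "(THE n. ent s n \<noteq> ent t n \<and> agree (ent s) (ent t) n) = n"
    using n less_linear' unfolding agree_def by (intro the_equality) blast+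
  then have "bd s t = e n" using assms by (simp add: bd_def)
  moreover have "n < len s + len t"
  proof (rule ccontr)
    assume *: "\<not> ?thesis"
    then have "\<not> n < len s" "\<not> n < len t"
      using iota_nonneg[of "len s"] iota_nonneg[of "len t"] unfolding iota_less iota_simps by linarith+
    then show False using n(1) ent_beyond by simp
  qed
  ultimately show ?thesis using that n by blast
qed

text \<open>Nonzero distances in Baire space are powers 2^-n, so a distance below
  \<open>2 * e i\<close> is at most \<open>e i\<close>. This makes cylinders into rational
  balls.\<close>

lemma e_less_iff: "e n \<le> e i \<longleftrightarrow> i \<preceq> n" "e n < 2 * e i \<longleftrightarrow> i \<preceq> n"
proof -
  have *: "2 * e i \<le> e n" if "n < i"
  proof -
    have "n + 1 \<preceq> i" using S_le[OF that] by (auto simp: leq_def)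
    then have "e i \<le> e (n + 1)" by (rule e_mono)
    then show ?thesis using e_double[of n] by linarith
  qed
  have lt: "n < i" if "\<not> i \<preceq> n" using that by (simp add: iota_iff)
  show "e n \<le> e i \<longleftrightarrow> i \<preceq> n" using *[OF lt] e_mono[of i n] e_pos[of i] by (cases "i \<preceq> n") linarith+
  show "e n < 2 * e i \<longleftrightarrow> i \<preceq> n" using *[OF lt] e_mono[of i n] e_pos[of i] by (cases "i \<preceq> n") linarith+
qed

lemma bd_le: "bd s t \<le> e i \<longleftrightarrow> agree (ent s) (ent t) i" "bd s t < 2 * e i \<longleftrightarrow> agree (ent s) (ent t) i"
proof -
  have "(bd s t \<le> e i \<longleftrightarrow> agree (ent s) (ent t) i) \<and> (bd s t < 2 * e i \<longleftrightarrow> agree (ent s) (ent t) i)"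
  proof (cases "ent s = ent t")
    case True
    then show ?thesis using e_pos[of i] by (auto simp: bd_def agree_def less_imp_le)
  next
    case False
    then obtain n where n: "ent s n \<noteq> ent t n" "agree (ent s) (ent t) n" "bd s t = e n" by (rule first_diff)
    have "agree (ent s) (ent t) i \<longleftrightarrow> i \<preceq> n"
      using n(1,2) less_linear' less_trans' unfolding agree_def leq_def by blast
    then show ?thesis using n(3) e_less_iff by simp
  qed
  then show "bd s t \<le> e i \<longleftrightarrow> agree (ent s) (ent t) i" "bd s t < 2 * e i \<longleftrightarrow> agree (ent s) (ent t) i" by auto
qed

lemma bd_ge: "ent s m \<noteq> ent t m \<Longrightarrow> e m \<le> bd s t"
  using bd_le(2)[of s t "m + 1"] e_double[of m] less_S by (fastforce simp: agree_def)

lemma bd_nonneg: "0 \<le> bd s t"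
  by (cases "ent s = ent t") (auto elim: first_diff simp: bd_def less_imp_le)

lemma bd_sym: "bd s t = bd t s"
proof -
  have "(\<lambda>n. ent s n \<noteq> ent t n \<and> agree (ent s) (ent t) n) = (\<lambda>n. ent t n \<noteq> ent s n \<and> agree (ent t) (ent s) n)"
    by (auto simp: agree_def fun_eq_iff)
  then show ?thesis unfolding bd_def by (simp only: eq_commute[of "ent s" "ent t"])
qed

lemma bd_tri: "bd r t \<le> bd r s + bd s t"
proof (cases "ent r = ent t")
  case True
  then show ?thesis using bd_nonneg[of r s] bd_nonneg[of s t] by (simp add: bd_def)
next
  case False
  then obtain n where n: "ent r n \<noteq> ent t n" "bd r t = e n" by (rule first_diff)
  then have "ent r n \<noteq> ent s n \<or> ent s n \<noteq> ent t n" by auto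
  then show ?thesis using bd_ge[of r n s] bd_ge[of s n t] bd_nonneg[of r s] bd_nonneg[of s t] n(2) by fastforce
qed

lemma baire_met: assumes "is_seq s" "is_seq t" shows "met (baire_space S) s t = rconst (rc (bd s t))"
proof -
  have "(\<forall>i. ent s i = ent t i) \<longleftrightarrow> ent s = ent t" by auto
  then show ?thesis unfolding baire_space_def by (simp add: ext0_ent assms bd_def agree_def)
qed

lemma kfn_bd: "kfn (\<lambda>z. bd (p1 z) (p2 z))"
  unfolding kfn_def
proof (rule fnI)
  have *: "y = rc (bd s t) \<longleftrightarrow> (\<exists>n. n < len s + len t \<and> (ent s n \<noteq> ent t n \<and> (\<forall>m. m < n \<longrightarrow> ent s m = ent t m)) \<and> y = rc (e n)) \<or>
     (\<forall>n. n < len s + len t \<longrightarrow> ent s n = ent t n) \<and> y = rc 0" for y s t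
  proof (cases "ent s = ent t")
    case True
    then show ?thesis by (simp add: bd_def)
  next
    case False
    then obtain n where n: "ent s n \<noteq> ent t n" "agree (ent s) (ent t) n" "bd s t = e n" "n < len s + len t"
      by (rule first_diff)
    have P: "(ent s m \<noteq> ent t m \<and> (\<forall>k. k < m \<longrightarrow> ent s k = ent t k)) \<longleftrightarrow> m = n" for m
      using n(1,2) less_linear'[of m n] unfolding agree_def by metis
    show ?thesis unfolding P using n(1,3,4) by auto
  qed
  show "dec (\<lambda>z. p2 z = rc (bd (p1 (p1 z)) (p2 (p1 z))))" unfolding * by (intro comp)
qed

lemma baire_coded: "coded_space S (baire_space S)"
proof -
  have d: "dense (baire_space S) = {s. is_seq s}" by (simp add: baire_space_def)
  note m = baire_met
  have r: "is_real S (rconst (rc t))" "rv (rconst (rc t)) = kr t" for t using rconst[of "rc t"] by simp_all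
  obtain s :: 'a where s: "is_seq s" using seq_obtain[OF fn_id, of 0] by blast
  have D: "fn S (\<lambda>z. rc (bd (p1 (p1 z)) (p2 (p1 z))))" by (intro comp kfn_comp2[OF kfn_bd])
  show ?thesis unfolding coded_space_def d
  proof (intro conjI ballI)
    show "{s. is_seq s} \<in> S" using dec_is_seq[OF fn_id] by (simp add: dec_def)
    show "{s::'a. is_seq s} \<noteq> {}" using s by blast
    show "\<exists>D. fn S D \<and> (\<forall>a\<in>{s. is_seq s}. \<forall>b\<in>{s. is_seq s}. \<forall>k. D (pr (pr a b) k) = met (baire_space S) a b k)"
      by (intro exI[of _ "\<lambda>z. rc (bd (p1 (p1 z)) (p2 (p1 z)))"] conjI D) (simp add: m rconst_def)
    fix a b c :: 'a assume "a \<in> {s. is_seq s}" "b \<in> {s. is_seq s}" "c \<in> {s. is_seq s}"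
    then have abc: "is_seq a" "is_seq b" "is_seq c" by simp_all
    show "is_real S (met (baire_space S) a b)" "req S (met (baire_space S) a b) (met (baire_space S) b a)"
      using abc r by (simp_all add: m req_iff bd_sym)
    show "rle S (rconst q0) (met (baire_space S) a b)"
      using abc r(1) r(2)[of 0] r(2)[of "bd a b"] kr_le[of 0 "bd a b"] bd_nonneg[of a b] by (simp add: m rle_iff)
    show "rle S (met (baire_space S) a c) (radd (met (baire_space S) a b) (met (baire_space S) b c))"
      using radd[OF r(1) r(1), of "bd a b" "bd b c"] r kr_mono[OF bd_tri[of a c b]] abc by (simp add: m rle_iff)
  next
    fix a :: 'a assume "a \<in> {s. is_seq s}"
    then show "req S (met (baire_space S) a a) (rconst q0)" using r by (simp add: m req_iff bd_def)
  qed
qed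

sublocale B: cspace S "baire_space S"
  by unfold_locales (rule baire_coded)

lemma B_dense [simp]: "s \<in> dense (baire_space S) \<longleftrightarrow> is_seq s"
  by (simp add: baire_space_def)

lemma B_dd: "is_seq s \<Longrightarrow> is_seq t \<Longrightarrow> B.dd s t = kr (bd s t)"
  using rconst(2)[of "rc (bd s t)"] by (simp add: B.dd_def baire_met)

lemma B_point: "point S (baire_space S) x \<longleftrightarrow> fn S x \<and> (\<forall>i. is_seq (x i)) \<and> (\<forall>i j. i \<preceq> j \<longrightarrow> agree (ent (x i)) (ent (x j)) i)"
  unfolding B.point_iff using bd_le(1) by (auto simp: B_dd)

text \<open>The function represented by a point. Entry \<open>n\<close> is read from
  \<open>x (n + 1)\<close>, whose first \<open>n + 1\<close> entries are final.\<close>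

definition lam :: "('a \<Rightarrow> 'a) \<Rightarrow> 'a \<Rightarrow> 'a" where "lam x n = ent (x (n + 1)) n"

lemma fn_lam: assumes "point S (baire_space S) x" shows "fn S (lam x)"
proof -
  have "fn S x" using assms by (simp add: B_point)
  show ?thesis unfolding lam_def by (intro comp fn_comp[OF \<open>fn S x\<close>])
qed

lemma lam_agree: assumes "point S (baire_space S) x" shows "agree (lam x) (ent (x k)) k"
  unfolding agree_def lam_def
proof (intro allI impI)
  fix m assume "m < k"
  then have "m + 1 \<preceq> k" using S_le by (auto simp: leq_def)
  then have "agree (ent (x (m + 1))) (ent (x k)) (m + 1)" using assms by (simp add: B_point)
  then show "ent (x (m + 1)) m = ent (x k) m" by (simp add: agree_def less_S)
qed

lemma B_ge: assumes "point S (baire_space S) x" "is_seq s" "lam x m \<noteq> ent s m" shows "kr (e m) \<le> B.DX x (\<lambda>_. s)"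
proof (rule R_leI[where c = 2])
  fix k
  let ?k = "m + 1 + k"
  have "m < ?k" "k \<preceq> ?k" using iota_nonneg[of m] iota_nonneg[of k] unfolding iota_less iota_leq iota_simps by linarith+
  then have "ent (x ?k) m \<noteq> ent s m" using lam_agree[OF assms(1), of ?k] assms(3) by (simp add: agree_def)
  then have "kr (e m) \<le> (kr (bd (x ?k) s) :: 'a R)" by (intro kr_mono bd_ge)
  moreover have "is_seq (x ?k)" using assms(1) by (simp add: B_point)
  ultimately have "kr (e m) \<le> B.dd (x ?k) s" using assms(2) by (simp only: B_dd)
  moreover have "kr (e ?k) \<le> (kr (e k) :: 'a R)" by (intro kr_mono e_mono \<open>k \<preceq> ?k\<close>)
  ultimately show "kr (e m) \<le> B.DX x (\<lambda>_. s) + kr (2 * e k)"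
    using B.DX_approx[OF assms(1) B.point_const[OF B_dense[THEN iffD2, OF assms(2)]], of ?k]
    unfolding abs_le_iff kr_simps kr_numeral by linarith
qed

lemma B_le: assumes "point S (baire_space S) x" "is_seq s" "agree (lam x) (ent s) i" shows "B.DX x (\<lambda>_. s) \<le> kr (e i)"
proof (rule R_leI[where c = 2])
  fix k
  let ?k = "i + k"
  have le: "i \<preceq> ?k" "k \<preceq> ?k" by (simp_all add: iota_leq)
  have "m < ?k" if "m < i" for m using that le(1) unfolding iota_less iota_leq by (rule less_le_trans)
  then have "agree (ent (x ?k)) (ent s) i"
    using lam_agree[OF assms(1), of ?k] assms(3) unfolding agree_def by metis
  then have "kr (bd (x ?k) s) \<le> (kr (e i) :: 'a R)" by (intro kr_mono) (simp add: bd_le)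
  moreover have "is_seq (x ?k)" using assms(1) by (simp add: B_point)
  ultimately have "B.dd (x ?k) s \<le> kr (e i)" using assms(2) by (simp only: B_dd)
  moreover have "kr (e ?k) \<le> (kr (e k) :: 'a R)" by (intro kr_mono e_mono le)
  ultimately show "B.DX x (\<lambda>_. s) \<le> kr (e i) + kr (2 * e k)"
    using B.DX_approx[OF assms(1) B.point_const[OF B_dense[THEN iffD2, OF assms(2)]], of ?k]
    unfolding abs_le_iff kr_simps kr_numeral by linarith
qed

lemma B_ball:
  assumes "point S (baire_space S) x" "is_seq s" "0 < t"
  shows "B.DX x (\<lambda>_. s) < kr t \<longleftrightarrow> (\<exists>i. e i < t \<and> agree (lam x) (ent s) i)"
proof
  assume "\<exists>i. e i < t \<and> agree (lam x) (ent s) i"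
  then obtain i where "e i < t" "agree (lam x) (ent s) i" by blast
  moreover from this have "kr (e i) < (kr t :: 'a R)" by simp
  ultimately show "B.DX x (\<lambda>_. s) < kr t" using B_le[OF assms(1,2)] le_less_trans by blast
next
  assume lt: "B.DX x (\<lambda>_. s) < kr t"
  obtain i0 where "e i0 < t" using e_arch[OF assms(3)] .
  then have "\<exists>i. e i < t \<and> (\<forall>k. k < i \<longrightarrow> \<not> e k < t)" by (intro least comp)
  then obtain i where i: "e i < t" "\<And>k. k < i \<Longrightarrow> t \<le> e k" by (auto simp: not_less)
  have "agree (lam x) (ent s) i" unfolding agree_def
  proof (intro allI impI)
    fix m assume "m < i"
    then have "kr t \<le> (kr (e m) :: 'a R)" using i(2) by simp
    then show "lam x m = ent s m" using B_ge[OF assms(1,2), of m] lt by (meson le_less_trans not_less)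
  qed
  then show "\<exists>i. e i < t \<and> agree (lam x) (ent s) i" using i(1) by blast
qed

lemma B_of_fun: assumes "fn S l" shows "\<exists>x. point S (baire_space S) x \<and> lam x = l"
proof -
  have "\<exists>x. fn S x \<and> (\<forall>k. is_seq (x k) \<and> len (x k) = k \<and> (\<forall>i. i < k \<longrightarrow> ent (x k) i = l i))"
  proof (rule choice)
    show "dec (\<lambda>z. is_seq (p2 z) \<and> len (p2 z) = p1 z \<and> (\<forall>i. i < p1 z \<longrightarrow> ent (p2 z) i = l i))"
      by (intro comp fn_comp[OF assms])
    show "\<exists>s. is_seq s \<and> len s = k \<and> (\<forall>i. i < k \<longrightarrow> ent s i = l i)" for k
      by (rule seq_obtain[OF assms])
  qed
  then obtain x where x: "fn S x" "\<And>k. is_seq (x k)" "\<And>k i. i < k \<Longrightarrow> ent (x k) i = l i" by blast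
  have "i < j" if "i < k" "k \<preceq> j" for i j k :: 'a using that by (simp add: iota_iff)
  then have "point S (baire_space S) x" unfolding B_point agree_def using x by simp
  moreover have "lam x = l" using x(3) less_S by (auto simp: lam_def)
  ultimately show ?thesis by blast
qed

lemma B_DX_zero: assumes "point S (baire_space S) x" "point S (baire_space S) y" "B.DX x y = 0" shows "lam x = lam y"
proof
  fix n
  have yk: "is_seq (y (n + 1))" using assms(2) by (simp add: B_point)
  have "B.DX y (\<lambda>_. y (n + 1)) \<le> kr (e (n + 1))" by (rule B.DX_self[OF assms(2)])
  then have "B.DX x (\<lambda>_. y (n + 1)) \<le> kr (e (n + 1))"
    using B.DX_zero_cong[OF assms(1,2) B.point_const assms(3)] yk by simp
  also have "\<dots> < kr (e n)" using e_double[of n] e_pos[of "n + 1"] by (simp only: kr_less)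
  finally have "\<not> kr (e n) \<le> B.DX x (\<lambda>_. y (n + 1))" by simp
  then have "lam x n = ent (y (n + 1)) n" using B_ge[OF assms(1) yk] by blast
  then show "lam x n = lam y n" by (simp add: lam_def)
qed

text \<open>With radius \<open>2 * e (len s)\<close> the ball around \<open>s\<close> is the
  cylinder of all functions that begin with \<open>s\<close>, so a preimage may be listed by finite
  prefixes.\<close>

lemma B_code:
  assumes "dec (\<lambda>z. C (p1 z) (p2 z))"
  shows "\<exists>U. U \<in> S \<and> (\<forall>b. open_code S (baire_space S) (sect U b)) \<and>
    (\<forall>b x. point S (baire_space S) x \<longrightarrow> (in_open S (baire_space S) (sect U b) x \<longleftrightarrow>
      (\<exists>s. is_seq s \<and> C s b \<and> agree (lam x) (ent s) (len s))))"
proof -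
  define Q where "Q z \<longleftrightarrow> is_pair z \<and> is_pair (p2 z) \<and> is_seq (p1 (p2 z)) \<and> p2 (p2 z) = rc (2 * e (len (p1 (p2 z))))" for z
  have dQ: "dec (\<lambda>x. Q (f x))" if "fn S f" for f unfolding Q_def by (intro comp that)
  define U where "U = {w. Q (p1 w) \<and> is_pair w \<and> C (p1 (p2 (p1 w))) (p2 w)}"
  have "dec (\<lambda>w. Q (p1 w) \<and> is_pair w \<and> C (p1 (p2 (p1 w))) (p2 w))"
    by (intro comp dQ dec_comp2[OF assms])
  then have "U \<in> S" by (simp add: dec_def U_def)
  moreover have mem: "z \<in> sect U b \<longleftrightarrow> (\<exists>n s. z = pr n (pr s (rc (2 * e (len s)))) \<and> is_seq s \<and> C s b)" for z b
    by (auto simp: sect_def U_def Q_def is_pair_def)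
  then have "open_code S (baire_space S) (sect U b)" for b
    unfolding open_code_def
  proof (intro conjI ballI)
    show "sect U b \<in> S"
      using dec_comp[OF dec_mem[OF \<open>U \<in> S\<close>], of "\<lambda>m. pr m b"] by (simp add: dec_def sect_def comp)
    fix z assume "z \<in> sect U b"
    then obtain n s where "z = pr n (pr s (rc (2 * e (len s))))" "is_seq s" using mem by blast
    then show "\<exists>n B. z = pr n B \<and> rat_ball (baire_space S) B"
      using e_pos[of "len s"] by (auto simp: B.rat_ball_iff)
  qed
  moreover have "in_open S (baire_space S) (sect U b) x \<longleftrightarrow> (\<exists>s. is_seq s \<and> C s b \<and> agree (lam x) (ent s) (len s))"
    if x: "point S (baire_space S) x" for b x
  proof -
    have ball: "in_ball S (baire_space S) (pr s (rc (2 * e (len s)))) x \<longleftrightarrow> agree (lam x) (ent s) (len s)" if "is_seq s" for s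
    proof -
      have "in_ball S (baire_space S) (pr s (rc (2 * e (len s)))) x \<longleftrightarrow> B.DX x (\<lambda>_. s) < kr (2 * e (len s))"
        using B.in_ball_iff[OF x, of s "rc (2 * e (len s))"] that by simp
      also have "\<dots> \<longleftrightarrow> (\<exists>i. len s \<preceq> i \<and> agree (lam x) (ent s) i)"
        using B_ball[OF x that, of "2 * e (len s)"] e_pos[of "len s"] by (simp add: e_less_iff)
      also have "\<dots> \<longleftrightarrow> agree (lam x) (ent s) (len s)"
        unfolding agree_def using leq_refl by (auto simp: iota_iff intro: less_le_trans)
      finally show ?thesis .
    qed
    show ?thesis unfolding in_open_def using mem ball by auto
  qed
  ultimately show ?thesis by blast
qed

end

section \<open>A continuous system without fixed point on Baire space\<close>

context gap
begin

text \<open>A point of Baire space is read as an attempt to list the least witnesses, shifted by one.  The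
  system below corrects the first error; every point has one by \<open>not_computable\<close>.\<close>

definition err :: "('a \<Rightarrow> 'a) \<Rightarrow> 'a \<Rightarrow> bool" where
  "err l j \<longleftrightarrow> ev j \<and> l (p1 j) \<noteq> p2 j + 1 \<and> (\<forall>i. i < j \<longrightarrow> ev i \<longrightarrow> l (p1 i) = p2 i + 1)"

definition new :: "('a \<Rightarrow> 'a) \<Rightarrow> 'a \<Rightarrow> 'a \<Rightarrow> 'a" where
  "new l j m = (if m = p1 j then p2 j + 1 else l m)"

lemma err_ex: assumes "fn S l" shows "\<exists>j. err l j"
proof -
  obtain j where j: "ev j \<and> l (p1 j) \<noteq> p2 j + 1" using not_computable[OF assms] by blast
  have "\<exists>j. (ev j \<and> l (p1 j) \<noteq> p2 j + 1) \<and> (\<forall>i. i < j \<longrightarrow> \<not> (ev i \<and> l (p1 i) \<noteq> p2 i + 1))"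
    by (rule least[where P = "\<lambda>j. ev j \<and> l (p1 j) \<noteq> p2 j + 1", OF _ j]) (intro comp fn_comp[OF assms])
  then show ?thesis unfolding err_def by blast
qed

lemma err_unique: "err l i \<Longrightarrow> err l j \<Longrightarrow> i = j"
  unfolding err_def using less_linear' by blast

text \<open>Since \<open>p1 i \<preceq> i\<close>, whether \<open>j\<close> is the first error
  depends only on entries up to place \<open>j\<close>. This makes the correction and the potential
  continuous.\<close>

lemma err_agree:
  assumes "agree f g L" "j < L" shows "err f j \<longleftrightarrow> err g j"
proof -
  have "f (p1 i) = g (p1 i)" if "i \<preceq> j" for i
    using assms that p_le(1)[of i] unfolding agree_def iota_iff by (metis le_less_trans order_trans)
  then show ?thesis unfolding err_def by (auto simp: leq_def)
qed

text \<open>A number has only one event, so correcting its entry leaves the earlier events correct;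
  the first error moves strictly on.\<close>

lemma err_new: assumes "err l i" "err (new l i) j" shows "i < j"
proof -
  have "l (p1 k) = p2 k + 1" if "k < i" "ev k" for k using assms(1) that by (simp add: err_def)
  then have "new l i (p1 k) = p2 k + 1" if "k \<preceq> i" "ev k" for k
    using that ev_unique[of k i] assms(1) by (auto simp: new_def leq_def err_def)
  then have "\<not> j \<preceq> i" using assms(2) by (auto simp: err_def)
  then show ?thesis by (simp add: iota_iff)
qed

lemma prefix_ex: assumes "fn S l" shows "\<exists>s. is_seq s \<and> len s = L \<and> agree l (ent s) L"
  using seq_obtain[OF assms, of L] unfolding agree_def by auto

text \<open>The number \<open>p1 i\<close> enters at event \<open>i\<close>, after stage
  \<open>i\<close> and before stage \<open>j\<close>. So the sum gains at least
  \<open>e (p1 i + 1)\<close>, half the bound \<open>e (p1 i)\<close> on the distance by which the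
  correction moves the point.\<close>

lemma c_step: assumes "err l i" "err (new l i) j" shows "e (p1 i) \<le> 2 * c j - 2 * c i"
proof -
  have ij: "i < j" by (rule err_new[OF assms])
  have ei: "ev i" using assms(1) by (simp add: err_def)
  have "\<not> inA i (p1 i)" unfolding inA_def using ev_unique[OF _ ei] less_irrefl' by blast
  moreover have "inA j (p1 i)" unfolding inA_def using ij ei by blast
  ultimately have "c i + e (p1 i + 1) \<le> c j" by (intro c_new)
  then show ?thesis using e_double[of "p1 i"] by linarith
qed

theorem not_CFP_baire: "\<not> CFP S (\<lambda>X F V. X = baire_space S \<and> is_continuous F \<and> is_continuous V)"
proof -
  let ?X = "baire_space S"
  interpret BB: cspace2 S ?X ?X by unfold_locales
  interpret BH: cspace2 S ?X half_line by unfold_locales (rule half_line_coded)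
  have dec_err: "dec (\<lambda>z. err (ent (f z)) (g z))" if "fn S f" "fn S g" for f g
    unfolding err_def by (intro comp fn_comp[OF that(1)] fn_comp[OF that(2)] that)
  \<comment> \<open>A prefix \<open>s\<close> reveals the first error \<open>j\<close> if it is
    longer than \<open>j\<close>. The bound \<open>i\<close> counts places in which agreement of the
    corrected prefix with the centre ensures a distance below the radius.\<close>
  define C where "C s b \<longleftrightarrow> (\<exists>j. j < len s \<and> err (ent s) j \<and>
    (\<exists>i. i \<preceq> len s \<and> e i < val (p2 b) \<and> (\<forall>m. m < i \<longrightarrow> new (ent s) j m = ent (p1 b) m)))" for s b
  define D where "D s b \<longleftrightarrow> (\<exists>j. j < len s \<and> err (ent s) j \<and> \<bar>(2 - 2 * c j) - val (p1 b)\<bar> < val (p2 b))" for s b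
  have "dec (\<lambda>z. C (p1 z) (p2 z))" unfolding C_def new_def by (intro comp dec_err)
  then obtain U where U: "U \<in> S" "\<And>b. open_code S ?X (sect U b)"
    "\<And>b x. point S ?X x \<Longrightarrow> in_open S ?X (sect U b) x \<longleftrightarrow> (\<exists>s. is_seq s \<and> C s b \<and> agree (lam x) (ent s) (len s))"
    using B_code[of C] by blast
  have "dec (\<lambda>z. D (p1 z) (p2 z))" unfolding D_def by (intro comp dec_err)
  then obtain W where W: "W \<in> S" "\<And>b. open_code S ?X (sect W b)"
    "\<And>b x. point S ?X x \<Longrightarrow> in_open S ?X (sect W b) x \<longleftrightarrow> (\<exists>s. is_seq s \<and> D s b \<and> agree (lam x) (ent s) (len s))"
    using B_code[of D] by blast
  define idx where "idx x = (THE j. err (lam x) j)" for x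
  have idx: "err (lam x) (idx x)" if x: "point S ?X x" for x
  proof -
    obtain j where "err (lam x) j" using err_ex[OF fn_lam[OF x]] by blast
    then show ?thesis unfolding idx_def using err_unique by (metis theI)
  qed
  have "\<exists>y. point S ?X x \<longrightarrow> point S ?X y \<and> lam y = new (lam x) (idx x)" for x
  proof (cases "point S ?X x")
    case True
    have "fn S (new (lam x) (idx x))" unfolding new_def by (intro comp fn_comp[OF fn_lam[OF True]] fn_lam[OF True])
    then show ?thesis using B_of_fun by blast
  qed simp
  then obtain f where f: "\<And>x. point S ?X x \<Longrightarrow> point S ?X (f x)" "\<And>x. point S ?X x \<Longrightarrow> lam (f x) = new (lam x) (idx x)"
    by metis
  have f_open: "in_open S ?X (sect U (pr a r)) x \<longleftrightarrow> B.DX (f x) (\<lambda>_. a) < kr (val r)"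
    if x: "point S ?X x" and a: "a \<in> dense ?X" "is_rat r" "0 < val r" for x a r
  proof -
    have "B.DX (f x) (\<lambda>_. a) < kr (val r) \<longleftrightarrow> (\<exists>i. e i < val r \<and> agree (new (lam x) (idx x)) (ent a) i)"
      using B_ball[OF f(1)[OF x] _ a(3), of a] a(1) f(2)[OF x] by simp
    moreover have "(\<exists>s. is_seq s \<and> C s (pr a r) \<and> agree (lam x) (ent s) (len s)) \<longleftrightarrow>
      (\<exists>i. e i < val r \<and> agree (new (lam x) (idx x)) (ent a) i)"
    proof
      assume "\<exists>s. is_seq s \<and> C s (pr a r) \<and> agree (lam x) (ent s) (len s)"
      then obtain s j i where s: "agree (lam x) (ent s) (len s)" "j < len s" "err (ent s) j"
        "i \<preceq> len s" "e i < val r" "\<And>m. m < i \<Longrightarrow> new (ent s) j m = ent a m"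
        unfolding C_def by auto
      have "err (lam x) j" using err_agree[OF s(1,2)] s(3) by blast
      then have j: "j = idx x" using err_unique idx[OF x] by blast
      have "new (lam x) j m = ent a m" if "m < i" for m
      proof -
        have "m < len s" using that s(4) by (simp add: iota_iff)
        then have "lam x m = ent s m" using s(1) by (simp add: agree_def)
        then show ?thesis using s(6)[OF that] unfolding j by (simp only: new_def)
      qed
      then show "\<exists>i. e i < val r \<and> agree (new (lam x) (idx x)) (ent a) i"
        using s(5) unfolding j agree_def by blast
    next
      assume "\<exists>i. e i < val r \<and> agree (new (lam x) (idx x)) (ent a) i"
      then obtain i where i: "e i < val r" "agree (new (lam x) (idx x)) (ent a) i" by blast
      \<comment> \<open>Long enough both to reveal the first error and to contain the
        \<open>i\<close> places to be compared.\<close>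
      obtain s where s: "is_seq s" "len s = idx x + 1 + i" "agree (lam x) (ent s) (idx x + 1 + i)"
        using prefix_ex[OF fn_lam[OF x]] by blast
      have le: "idx x < len s" "i \<preceq> len s"
        using iota_nonneg[of i] iota_nonneg[of "idx x"] unfolding s(2) iota_less iota_leq iota_simps by linarith+
      have "err (ent s) (idx x)" using err_agree[OF s(3)[folded s(2)] le(1)] idx[OF x] by blast
      moreover have "new (ent s) (idx x) m = ent a m" if "m < i" for m
      proof -
        have "m < len s" using that le(2) by (simp add: iota_iff)
        then have "lam x m = ent s m" using s(3)[folded s(2)] by (simp add: agree_def)
        moreover have "new (lam x) (idx x) m = ent a m" using i(2) that by (simp add: agree_def)
        ultimately show ?thesis by (simp only: new_def)
      qed
      ultimately have "C s (pr a r)" unfolding C_def using le i(1) by auto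
      then show "\<exists>s. is_seq s \<and> C s (pr a r) \<and> agree (lam x) (ent s) (len s)" using s by auto
    qed
    ultimately show ?thesis using U(3)[OF x] by simp
  qed
  have h_point: "point S half_line (\<lambda>_. rc (2 - 2 * c j))" for j
    using rconst(1)[of "rc (2 - 2 * c j)"] c_bounds[of j] by (simp add: half_line_point rconst_def)
  have h_val: "rv (\<lambda>_. rc (2 - 2 * c j)) = kr (2 - 2 * c j)" for j
    using rconst(2)[of "rc (2 - 2 * c j)"] unfolding rconst_def by (simp only: rc)
  have h_open: "in_open S ?X (sect W (pr a r)) x \<longleftrightarrow> BH.Y.DX (\<lambda>_. rc (2 - 2 * c (idx x))) (\<lambda>_. a) < kr (val r)"
    if x: "point S ?X x" and a: "a \<in> dense half_line" "is_rat r" "0 < val r" for x a r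
  proof -
    have ra: "is_rat a" using a(1) by (simp add: half_line_def)
    have "BH.Y.DX (\<lambda>_. rc (2 - 2 * c (idx x))) (\<lambda>_. a) = \<bar>kr (2 - 2 * c (idx x)) - kr (val a)\<bar>"
      using half_line_DX[OF h_point BH.Y.point_const[OF a(1)]] h_val rconst(2)[OF ra] unfolding rconst_def by metis
    also have "\<dots> = kr \<bar>(2 - 2 * c (idx x)) - val a\<bar>" by (simp only: kr_abs kr_diff)
    finally have "BH.Y.DX (\<lambda>_. rc (2 - 2 * c (idx x))) (\<lambda>_. a) < kr (val r) \<longleftrightarrow> \<bar>(2 - 2 * c (idx x)) - val a\<bar> < val r"
      by (simp only: kr_less)
    moreover have "(\<exists>s. is_seq s \<and> D s (pr a r) \<and> agree (lam x) (ent s) (len s)) \<longleftrightarrow> \<bar>(2 - 2 * c (idx x)) - val a\<bar> < val r"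
    proof
      assume "\<exists>s. is_seq s \<and> D s (pr a r) \<and> agree (lam x) (ent s) (len s)"
      then obtain s j where s: "agree (lam x) (ent s) (len s)" "j < len s" "err (ent s) j" "\<bar>(2 - 2 * c j) - val a\<bar> < val r"
        unfolding D_def by auto
      have "err (lam x) j" using err_agree[OF s(1,2)] s(3) by blast
      then have "j = idx x" using err_unique idx[OF x] by blast
      then show "\<bar>(2 - 2 * c (idx x)) - val a\<bar> < val r" using s(4) by simp
    next
      assume lt: "\<bar>(2 - 2 * c (idx x)) - val a\<bar> < val r"
      obtain s where s: "is_seq s" "len s = idx x + 1" "agree (lam x) (ent s) (idx x + 1)"
        using prefix_ex[OF fn_lam[OF x]] by blast
      have le: "idx x < len s" by (simp add: s(2) less_S)
      have "err (ent s) (idx x)" using err_agree[OF s(3)[folded s(2)] le] idx[OF x] by blast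
      then have "D s (pr a r)" unfolding D_def using le lt by auto
      then show "\<exists>s. is_seq s \<and> D s (pr a r) \<and> agree (lam x) (ent s) (len s)" using s by auto
    qed
    ultimately show ?thesis using W(3)[OF x] by simp
  qed
  have fU: "cont_total_code S ?X ?X U" "\<And>x. point S ?X x \<Longrightarrow> cont_val S ?X ?X U x (f x)"
    using BB.exact_code[of U f] U(1,2) f(1) f_open by blast+
  have hW: "cont_total_code S ?X half_line W" "\<And>x. point S ?X x \<Longrightarrow> cont_val S ?X half_line W x (\<lambda>_. rc (2 - 2 * c (idx x)))"
    using BH.exact_code[of W "\<lambda>x _. rc (2 - 2 * c (idx x))"] W(1,2) h_point h_open by blast+
  have "caristi_system S ?X (Continuous U) (Continuous W)"
    unfolding caristi_system_def potential_def total_fun_def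
  proof (intro conjI allI impI)
    show "coded_space S ?X" by (rule baire_coded)
    show "is_fun_code S ?X ?X (Continuous U)" "is_fun_code S ?X half_line (Continuous W)"
      using fU(1) hW(1) by (simp_all add: cont_total_code_def)
    show "\<exists>y. fun_val S ?X ?X (Continuous U) x y" "\<exists>y. fun_val S ?X half_line (Continuous W) x y" if "point S ?X x" for x
      using fU(2)[OF that] hW(2)[OF that] by auto
    show "is_continuous (Continuous W) \<or> (\<exists>W'. Continuous W = Baire1 W' \<and>
         (\<forall>n m x v w. n \<preceq> m \<and> point S ?X x \<and> cont_val S ?X half_line (sect W' n) x v \<and>
            cont_val S ?X half_line (sect W' m) x w \<longrightarrow> rle S v w))"
      by (simp add: is_continuous_def)
    fix x y v w
    assume "point S ?X x \<and> fun_val S ?X ?X (Continuous U) x y \<and>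
      fun_val S ?X half_line (Continuous W) x v \<and> fun_val S ?X half_line (Continuous W) y w"
    then have x: "point S ?X x" and y: "cont_val S ?X ?X U x y" and v: "cont_val S ?X half_line W x v"
      and w: "cont_val S ?X half_line W y w" by simp_all
    have p: "point S ?X y" "point S half_line v" "point S half_line w"
      using y v w BB.cont_val_point BH.cont_val_point by blast+
    have yf: "B.DX y (f x) = 0" by (rule BB.cont_val_unique[OF y fU(2)[OF x]])
    have ly: "lam y = new (lam x) (idx x)" using B_DX_zero[OF p(1) f(1)[OF x] yf] f(2)[OF x] by simp
    have "BH.Y.DX v (\<lambda>_. rc (2 - 2 * c (idx x))) = 0" by (rule BH.cont_val_unique[OF v hW(2)[OF x]])
    then have rvv: "rv v = kr (2 - 2 * c (idx x))" unfolding half_line_DX[OF p(2) h_point] h_val by simp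
    have "BH.Y.DX w (\<lambda>_. rc (2 - 2 * c (idx y))) = 0" by (rule BH.cont_val_unique[OF w hW(2)[OF p(1)]])
    then have rvw: "rv w = kr (2 - 2 * c (idx y))" unfolding half_line_DX[OF p(3) h_point] h_val by simp
    \<comment> \<open>\<open>x\<close> and its image agree below place \<open>p1 (idx x)\<close>, so
      a dense point close to \<open>y\<close> is within the required distance of
      \<open>x\<close>.\<close>
    have "B.DX x y \<le> kr (e (p1 (idx x)))"
    proof (rule R_leI[where c = 1])
      fix k
      define s where "s = y (p1 (idx x) + k)"
      have le: "p1 (idx x) \<preceq> p1 (idx x) + k" "k \<preceq> p1 (idx x) + k" by (simp_all add: iota_leq)
      have s: "is_seq s" using p(1) by (simp add: s_def B_point)
      have "agree (lam y) (ent s) (p1 (idx x) + k)" unfolding s_def by (rule lam_agree[OF p(1)])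
      then have "lam y m = ent s m" if "m < p1 (idx x)" for m
        using that le(1) unfolding agree_def iota_less iota_leq by (meson less_le_trans)
      then have "agree (lam x) (ent s) (p1 (idx x))"
        unfolding agree_def ly new_def using less_irrefl' by metis
      then have "B.DX x (\<lambda>_. s) \<le> kr (e (p1 (idx x)))" by (rule B_le[OF x s])
      moreover have "B.DX y (\<lambda>_. s) \<le> kr (e (p1 (idx x) + k))" unfolding s_def by (rule B.DX_self[OF p(1)])
      moreover have "kr (e (p1 (idx x) + k)) \<le> (kr (e k) :: 'a R)" by (intro kr_mono e_mono le)
      moreover have ps: "point S ?X (\<lambda>_. s)" using s by (intro B.point_const) simp
      ultimately show "B.DX x y \<le> kr (e (p1 (idx x))) + kr (1 * e k)"
        using B.DX_tri[OF x ps p(1)] B.DX_sym[OF p(1) ps] unfolding mult_1_left by linarith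
    qed
    also have "\<dots> \<le> kr (2 * c (idx y) - 2 * c (idx x))"
      using c_step[OF idx[OF x]] idx[OF p(1)] ly by (intro kr_mono) simp
    also have "\<dots> = rv v - rv w" unfolding rvv rvw kr_diff by simp
    finally have "B.DX x y + rv w \<le> rv v" by simp
    moreover have "is_real S (pdist ?X x y)" "is_real S v" "is_real S w"
      using B.pdist_real[OF x p(1)] p(2,3) by (auto simp: half_line_point)
    ultimately show "rle S (radd (pdist ?X x y) w) v"
      using radd[of "pdist ?X x y" w] by (simp add: rle_iff B.DX_def)
  qed
  moreover have "\<not> fun_val S ?X ?X (Continuous U) x x" if x: "point S ?X x" for x
  proof
    assume "fun_val S ?X ?X (Continuous U) x x"
    then have "B.DX x (f x) = 0" using BB.cont_val_unique[OF _ fU(2)[OF x]] by simp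
    then have "lam x = new (lam x) (idx x)" using B_DX_zero[OF x f(1)[OF x]] f(2)[OF x] by simp
    then have "lam x (p1 (idx x)) = p2 (idx x) + 1" by (metis new_def)
    then show False using idx[OF x] by (simp add: err_def)
  qed
  ultimately show ?thesis unfolding CFP_def is_continuous_def by blast
qed

end

section \<open>The unit interval\<close>

context rca0
begin

lemma unit_interval_coded: "coded_space S unit_interval"
  unfolding unit_interval_def by (rule U.coded_space_QX)

lemma unit_interval_dense: "a \<in> dense unit_interval \<longleftrightarrow> is_rat a \<and> 0 \<le> val a \<and> val a \<le> 1"
  unfolding unit_interval_def using qle_iff[of "rc 0" a] qle_iff[of a "rc 1"] by auto

lemma unit_interval_point: "point S unit_interval x \<longleftrightarrow> is_real S x \<and> (\<forall>i. 0 \<le> val (x i) \<and> val (x i) \<le> 1)"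
  using U.Q_point[of x, folded unit_interval_def] qle_iff[of "rc 0" "x _"] qle_iff[of "x _" "rc 1"]
  by (auto simp: is_real_iff)

lemma unit_interval_DX:
  "point S unit_interval x \<Longrightarrow> point S unit_interval y \<Longrightarrow> cspace.DX unit_interval x y = \<bar>rv x - rv y\<bar>"
  unfolding unit_interval_def by (rule U.Q_DX)

sublocale I: cspace S unit_interval
  by unfold_locales (rule unit_interval_coded)

text \<open>Base case: \<open>m\<close> is below 2^m. Thus reading a sequence \<open>m\<close>
  places later compensates a Lipschitz constant \<open>m\<close>.\<close>

lemma e_mult: "\<iota> m * e (m + k) \<le> e k"
proof (rule dec_induct[where P = "\<lambda>k. \<iota> m * e (m + k) \<le> e k"])
  show "dec (\<lambda>k. \<iota> m * e (m + k) \<le> e k)" by (intro comp)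
  show "\<iota> m * e (m + 0) \<le> e 0"
    using pow2_gt[of m] pow2_pos[of m] unfolding add_0 e_0 by (simp add: e_def)
  show "\<iota> m * e (m + (k + 1)) \<le> e (k + 1)" if "\<iota> m * e (m + k) \<le> e k" for k
    using that unfolding add_S e_S by simp
qed

end

text \<open>A sequence of Lipschitz functions given on rationals extends to continuous codes: the ball of
  radius \<open>r\<close> around \<open>c\<close> is mapped into the ball of radius \<open>q\<close> around \<open>a\<close> if
  \<open>\<bar>\<phi> c - a\<bar> + M r < q\<close>.\<close>

lemma (in qspace) lipschitz_codes:
  fixes \<phi> :: "'a \<Rightarrow> 'a K \<Rightarrow> 'a K"
  assumes \<phi>: "kfn (\<lambda>z. \<phi> (p1 z) (val (p2 z)))" and M: "fn S M"
    and lip: "\<And>n s t. 0 \<le> s \<Longrightarrow> s \<le> 1 \<Longrightarrow> 0 \<le> t \<Longrightarrow> t \<le> 1 \<Longrightarrow> \<bar>\<phi> n s - \<phi> n t\<bar> \<le> \<iota> (M n) * \<bar>s - t\<bar>"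
    and rng: "\<And>n t. 0 \<le> t \<Longrightarrow> t \<le> 1 \<Longrightarrow> rc (\<phi> n t) \<in> A"
  shows "\<exists>W. W \<in> S \<and> (\<forall>n. cont_total_code S unit_interval QX (sect W n)) \<and>
    (\<forall>n x y k. point S unit_interval x \<longrightarrow> cont_val S unit_interval QX (sect W n) x y \<longrightarrow>
      \<bar>rv y - kr (\<phi> n (val (x k)))\<bar> \<le> kr (\<iota> (M n) * e k))"
proof -
  interpret C: cspace2 S unit_interval QX by unfold_locales
  define D where "D n b \<rho> \<longleftrightarrow> is_pair \<rho> \<and> is_rat (p1 \<rho>) \<and> 0 \<le> val (p1 \<rho>) \<and> val (p1 \<rho>) \<le> 1 \<and>
    is_rat (p2 \<rho>) \<and> 0 < val (p2 \<rho>) \<and> \<bar>\<phi> n (val (p1 \<rho>)) - val (p1 b)\<bar> + \<iota> (M n) * val (p2 \<rho>) < val (p2 b)" for n b \<rho>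
  define W where "W = {w. is_pair w \<and> is_pair (p1 w) \<and> is_pair (p1 (p1 w)) \<and> D (p2 w) (p2 (p1 w)) (p2 (p1 (p1 w)))}"
  have "dec (\<lambda>w. is_pair w \<and> is_pair (p1 w) \<and> is_pair (p1 (p1 w)) \<and> D (p2 w) (p2 (p1 w)) (p2 (p1 (p1 w))))"
    unfolding D_def by (intro comp kfn_comp2[OF \<phi>] fn_comp[OF M])
  then have W: "W \<in> S" by (simp add: W_def dec_def)
  have sect_S: "sect Z n \<in> S" if "Z \<in> S" for Z n
    using dec_comp[OF dec_mem[OF that], of "\<lambda>m. pr m n"] by (simp add: dec_def sect_def comp)
  have mem: "z \<in> sect (sect W n) b \<longleftrightarrow> (\<exists>i c r. z = pr i (pr c r) \<and> D n b (pr c r))" for z n b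
    by (auto simp: sect_def W_def D_def is_pair_def)
  have open_W: "open_code S unit_interval (sect (sect W n) b)" for n b
    unfolding open_code_def
  proof (intro conjI ballI)
    show "sect (sect W n) b \<in> S" by (intro sect_S W)
    fix z assume "z \<in> sect (sect W n) b"
    then obtain i c r where "z = pr i (pr c r)" "D n b (pr c r)" using mem by blast
    then show "\<exists>i B. z = pr i B \<and> rat_ball unit_interval B"
      by (auto simp: I.rat_ball_iff D_def unit_interval_dense)
  qed
  \<comment> \<open>Reading \<open>x\<close> at \<open>M n + k\<close> instead of \<open>k\<close>
    compensates the Lipschitz constant, so the values converge at the rate of a real.\<close>
  define f where "f n x k = rc (\<phi> n (val (x (M n + k))))" for n x k
  have x01: "0 \<le> val (x k)" "val (x k) \<le> 1" "is_rat (x k)" "\<And>i j. i \<preceq> j \<Longrightarrow> \<bar>val (x i) - val (x j)\<bar> \<le> e i"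
    if "point S unit_interval x" for x k
    using that by (auto simp: unit_interval_point is_real_iff creal_def)
  have lip_e: "\<bar>\<phi> n (val (x i)) - \<phi> n (val (x j))\<bar> \<le> \<iota> (M n) * e i" if "point S unit_interval x" "i \<preceq> j" for n x i j
    using lip[OF x01(1,2)[OF that(1)] x01(1,2)[OF that(1)]] mult_left_mono[OF x01(4)[OF that] iota_nonneg]
    by (rule order_trans)
  have f_point: "point S QX (f n x)" if x: "point S unit_interval x" for n x
    unfolding Q_point is_real_iff
  proof (intro conjI allI)
    have fx: "fn S x" using x by (simp add: I.point_iff)
    then show "fn S (f n x)" unfolding f_def by (intro comp kfn_comp2[OF \<phi>] fn_comp[OF fx] fn_comp[OF M])
    show "f n x i \<in> A" for i unfolding f_def by (intro rng x01 x)
    show "is_rat (f n x i)" for i by (simp add: f_def)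
    show "creal (\<lambda>i. val (f n x i))" unfolding creal_def
    proof (intro allI impI)
      fix i j :: 'a assume "i \<preceq> j"
      then have "M n + i \<preceq> M n + j" by (simp add: iota_leq)
      from order_trans[OF lip_e[OF x this] e_mult] show "\<bar>val (f n x i) - val (f n x j)\<bar> \<le> e i"
        by (simp add: f_def)
    qed
  qed
  have f_real: "is_real S (f n x)" if "point S unit_interval x" for n x
    using f_point[OF that] by (simp add: Q_point)
  have f_approx: "\<bar>rv (f n x) - kr (\<phi> n (val (x k)))\<bar> \<le> kr (\<iota> (M n) * e k)" if x: "point S unit_interval x" for n x k
  proof (rule R_leI[where c = 1])
    fix j
    have "k \<preceq> M n + (k + j)" using iota_nonneg[of "M n"] iota_nonneg[of j] by (simp add: iota_leq)
    from kr_mono[OF lip_e[OF x this]]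
    have "\<bar>kr (\<phi> n (val (x k))) - kr (\<phi> n (val (x (M n + (k + j)))))\<bar> \<le> (kr (\<iota> (M n) * e k) :: 'a R)"
      by (simp only: kr_abs kr_diff)
    moreover have "\<bar>rv (f n x) - kr (\<phi> n (val (x (M n + (k + j)))))\<bar> \<le> kr (e (k + j))"
      using rv_approx[OF f_real[OF x], of n "k + j"] by (simp add: f_def)
    moreover have "j \<preceq> k + j" by (simp add: iota_leq)
    from kr_mono[OF e_mono[OF this]] have "kr (e (k + j)) \<le> (kr (1 * e j) :: 'a R)" by (simp only: mult_1_left)
    ultimately show "\<bar>rv (f n x) - kr (\<phi> n (val (x k)))\<bar> \<le> kr (\<iota> (M n) * e k) + kr (1 * e j)"
      unfolding abs_le_iff by linarith
  qed
  have f_open: "in_open S unit_interval (sect (sect W n) (pr a q)) x \<longleftrightarrow> Q.DX (f n x) (\<lambda>_. a) < kr (val q)"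
    if x: "point S unit_interval x" and a: "a \<in> A" "is_rat q" "0 < val q" for x a q n
  proof -
    have ra: "is_rat a" using a(1) A(3) by blast
    have DX: "Q.DX (f n x) (\<lambda>_. a) = \<bar>rv (f n x) - kr (val a)\<bar>"
      using Q_DX[OF f_point[OF x] Q.point_const, of a] a(1) rconst(2)[OF ra] by (simp add: rconst_def)
    have ball: "in_ball S unit_interval (pr c r) x \<longleftrightarrow> \<bar>rv x - kr (val c)\<bar> < kr (val r)"
      if "is_rat c" "0 \<le> val c" "val c \<le> 1" "is_rat r" for c r
    proof -
      have c: "c \<in> dense unit_interval" using that by (simp add: unit_interval_dense)
      have "I.DX x (\<lambda>_. c) = \<bar>rv x - kr (val c)\<bar>"
        using unit_interval_DX[OF x I.point_const[OF c]] rconst(2)[OF that(1)] by (simp add: rconst_def)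
      then show ?thesis using I.in_ball_iff[OF x c that(4)] by simp
    qed
    have rx: "is_real S x" using x by (simp add: unit_interval_point)
    show ?thesis
    proof
      assume "in_open S unit_interval (sect (sect W n) (pr a q)) x"
      then obtain i B where B: "pr i B \<in> sect (sect W n) (pr a q)" "in_ball S unit_interval B x"
        by (auto simp: in_open_def)
      then obtain c r where cr: "B = pr c r" "D n (pr a q) (pr c r)" using mem by auto
      then have c: "is_rat c" "0 \<le> val c" "val c \<le> 1" "is_rat r"
        and lt: "\<bar>\<phi> n (val c) - val a\<bar> + \<iota> (M n) * val r < val q" by (simp_all add: D_def)
      have near: "\<bar>rv x - kr (val c)\<bar> < kr (val r)" using B(2) ball[OF c] cr(1) by simp
      have "\<bar>rv (f n x) - kr (\<phi> n (val c))\<bar> \<le> kr (\<iota> (M n) * val r)"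
      proof (rule R_leI[where c = "2 * \<iota> (M n)"])
        fix k
        have "kr \<bar>val (x k) - val c\<bar> \<le> (kr (val r + e k) :: 'a R)"
          using near rv_approx[OF rx, of k] unfolding kr_abs kr_diff kr_simps abs_le_iff abs_less_iff by linarith
        then have "\<bar>val (x k) - val c\<bar> \<le> val r + e k" by (simp only: kr_le)
        from order_trans[OF lip[OF x01(1,2)[OF x] c(2,3)] mult_left_mono[OF this iota_nonneg]]
        have "\<bar>\<phi> n (val (x k)) - \<phi> n (val c)\<bar> \<le> \<iota> (M n) * val r + \<iota> (M n) * e k" by (simp only: distrib_left)
        from kr_mono[OF this]
        have "\<bar>kr (\<phi> n (val (x k))) - kr (\<phi> n (val c))\<bar> \<le> (kr (\<iota> (M n) * val r) + kr (\<iota> (M n) * e k) :: 'a R)"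
          by (simp only: kr_abs kr_diff kr_simps(3))
        moreover have "kr (2 * \<iota> (M n) * e k) = (kr (\<iota> (M n) * e k) + kr (\<iota> (M n) * e k) :: 'a R)"
          unfolding kr_simps(3)[symmetric] by (rule arg_cong[where f = kr]) (simp add: algebra_simps)
        ultimately show "\<bar>rv (f n x) - kr (\<phi> n (val c))\<bar> \<le> kr (\<iota> (M n) * val r) + kr (2 * \<iota> (M n) * e k)"
          using f_approx[OF x, of n k] unfolding abs_le_iff by linarith
      qed
      moreover have "\<bar>kr (\<phi> n (val c)) - kr (val a)\<bar> + kr (\<iota> (M n) * val r) < (kr (val q) :: 'a R)"
        using lt by (simp only: kr_less flip: kr_abs kr_diff kr_simps(3))
      ultimately show "Q.DX (f n x) (\<lambda>_. a) < kr (val q)" unfolding DX abs_le_iff by linarith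
    next
      assume "Q.DX (f n x) (\<lambda>_. a) < kr (val q)"
      then obtain t where t: "\<bar>rv (f n x) - kr (val a)\<bar> < kr t" "kr t < (kr (val q) :: 'a R)"
        unfolding DX using kr_dense by blast
      then have "t < val q" by (simp only: kr_less)
      then obtain i where i: "e i < val q - t" using e_arch[of "val q - t"] by auto
      \<comment> \<open>Three Lipschitz errors: one for replacing the value at \<open>x\<close> by
        that at its entry \<open>x k\<close>, two for the radius \<open>2 * e k\<close> of the ball
        around that entry.\<close>
      obtain k where k: "(3 * \<iota> (M n)) * e k \<le> e i" by (rule K_mult_e)
      have "kr \<bar>\<phi> n (val (x k)) - val a\<bar> \<le> (kr (t + \<iota> (M n) * e k) :: 'a R)"
        using f_approx[OF x, of n k] t(1) unfolding kr_abs kr_diff kr_simps(3) abs_le_iff abs_less_iff by linarith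
      then have "\<bar>\<phi> n (val (x k)) - val a\<bar> \<le> t + \<iota> (M n) * e k" by (simp only: kr_le)
      then have "D n (pr a q) (pr (x k) (rc (2 * e k)))"
        using x01(1-3)[OF x, of k] i k by (simp add: D_def algebra_simps)
      then have "pr 0 (pr (x k) (rc (2 * e k))) \<in> sect (sect W n) (pr a q)" using mem by blast
      moreover have "e k < 2 * e k" by simp
      then have "kr (e k) < (kr (2 * e k) :: 'a R)" by (simp only: kr_less)
      from le_less_trans[OF rv_approx[OF rx, of k] this]
      have "in_ball S unit_interval (pr (x k) (rc (2 * e k))) x"
        using ball[OF x01(3,1,2)[OF x], of "rc (2 * e k)" k] by (simp only: rc)
      ultimately show "in_open S unit_interval (sect (sect W n) (pr a q)) x" by (rule C.in_openI)
    qed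
  qed
  have code: "cont_total_code S unit_interval QX (sect W n)"
    "\<And>x. point S unit_interval x \<Longrightarrow> cont_val S unit_interval QX (sect W n) x (f n x)" for n
    using C.exact_code[of "sect W n" "f n"] sect_S[OF W] open_W f_point f_open[of _ _ _ n] by simp_all
  have "\<bar>rv y - kr (\<phi> n (val (x k)))\<bar> \<le> kr (\<iota> (M n) * e k)"
    if "point S unit_interval x" "cont_val S unit_interval QX (sect W n) x y" for n x y k
    using C.cont_val_unique[OF that(2) code(2)[OF that(1)]] Q_DX[OF C.cont_val_point[OF that(2)] f_point[OF that(1)]]
      f_approx[OF that(1)] by simp
  then show ?thesis using W code(1) by blast
qed

text \<open>The sequences used on the unit interval have constant values from some index on at each
  point. Their limits are then settled without any rate of convergence.\<close>

lemma (in qspace) limit_val_iff: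
  assumes ex: "\<And>n. \<exists>z. cont_val S X QX (sect W n) x z"
    and "\<forall>n z. N \<preceq> n \<longrightarrow> cont_val S X QX (sect W n) x z \<longrightarrow> rv z = r"
  shows "limit_val S X QX W x y \<longleftrightarrow> point S QX y \<and> rv y = r" "\<exists>y. limit_val S X QX W x y"
proof -
  have ev: "rv z = r" if "N \<preceq> n" "cont_val S X QX (sect W n) x z" for n z using assms(2) that by blast
  have pz: "point S QX z" if "cont_val S X QX (sect W n) x z" for n z
    using that by (simp add: cont_val_def preimage_val_def Let_def)
  have iff: "rlt S (pdist QX z y) (rconst (qpow S k)) \<longleftrightarrow> \<bar>r - rv y\<bar> < kr (e k)"
    if "N \<preceq> n" "cont_val S X QX (sect W n) x z" "point S QX y" for n z y k
    using Q.rlt_pdist[OF pz[OF that(2)] that(3)] Q_DX[OF pz[OF that(2)] that(3)] ev[OF that(1,2)] by simp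
  show *: "limit_val S X QX W x y \<longleftrightarrow> point S QX y \<and> rv y = r" for y
  proof
    assume l: "limit_val S X QX W x y"
    then have y: "point S QX y" by (simp add: limit_val_def)
    have "r = rv y"
    proof (rule R_eqI[where c = 1])
      fix k
      obtain N' where N': "\<And>n z. N' \<preceq> n \<Longrightarrow> cont_val S X QX (sect W n) x z \<Longrightarrow>
        rlt S (pdist QX z y) (rconst (qpow S k))" using l unfolding limit_val_def by blast
      obtain z where z: "cont_val S X QX (sect W (N + N')) x z" using ex by blast
      have "N \<preceq> N + N'" "N' \<preceq> N + N'" by (simp_all add: iota_leq)
      then have "\<bar>r - rv y\<bar> < kr (e k)" using N'[OF _ z] iff[OF _ z y] by blast
      then show "\<bar>r - rv y\<bar> \<le> kr (1 * e k)" unfolding mult_1_left by (rule less_imp_le)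
    qed
    then show "point S QX y \<and> rv y = r" using y by simp
  next
    assume y: "point S QX y \<and> rv y = r"
    have "0 < e k" for k by simp
    then have "kr 0 < (kr (e k) :: 'a R)" for k by (simp only: kr_less)
    then have "\<bar>r - rv y\<bar> < kr (e k)" for k using y by simp
    then show "limit_val S X QX W x y" unfolding limit_val_def using y ex iff by blast
  qed
  obtain z where "cont_val S X QX (sect W N) x z" using ex by blast
  then show "\<exists>y. limit_val S X QX W x y" using * pz ev leq_refl by blast
qed

context rca0
begin

text \<open>Carries an estimate on rational approximations over to the real \<open>r\<close>.
  Approximation and estimate may have different constants, and the indices before \<open>K\<close>
  may be ignored.\<close>

lemma lim_le:
  assumes "\<And>k. \<bar>r - kr (g k)\<bar> \<le> kr (C * e k)" "\<And>k. K \<preceq> k \<Longrightarrow> kr (g k) \<le> s + kr (D * e k)" "0 \<le> C" "0 \<le> D"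
  shows "r \<le> (s :: 'a R)"
proof (rule R_leI[where c = "C + D"])
  fix k
  have *: "K \<preceq> K + k" "k \<preceq> K + k" by (simp_all add: iota_leq)
  have "kr (C * e (K + k)) + kr (D * e (K + k)) \<le> (kr ((C + D) * e k) :: 'a R)"
    unfolding kr_simps(3)[symmetric] kr_le using mult_left_mono[OF e_mono[OF *(2)], of "C + D"] assms(3,4)
    by (simp add: distrib_right)
  then show "r \<le> s + kr ((C + D) * e k)"
    using assms(1)[of "K + k"] assms(2)[OF *(1)] unfolding abs_le_iff by linarith
qed

lemma lim_ge:
  assumes "\<And>k. \<bar>r - kr (g k)\<bar> \<le> kr (C * e k)" "\<And>k. K \<preceq> k \<Longrightarrow> s \<le> kr (g k) + kr (D * e k)" "0 \<le> C" "0 \<le> D"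
  shows "(s :: 'a R) \<le> r"
proof -
  have "- r \<le> - s"
  proof (rule lim_le[where g = "\<lambda>k. - g k", OF _ _ assms(3,4)])
    show "\<bar>- r - kr (- g k)\<bar> \<le> kr (C * e k)" for k using assms(1)[of k] unfolding kr_simps(5) by linarith
    show "kr (- g k) \<le> - s + kr (D * e k)" if "K \<preceq> k" for k using assms(2)[OF that] unfolding kr_simps(5) by linarith
  qed
  then show ?thesis by simp
qed

lemma pow2_mono: "i \<preceq> j \<Longrightarrow> \<iota> (pow2 S i) \<le> \<iota> (pow2 S j :: 'a)"
  using e_mono[of i j] pow2_pos[of i] pow2_pos[of j] by (simp add: e_def field_simps)

end

section \<open>A Baire class 1 system without fixed point on the unit interval\<close>

context gap
begin

text \<open>For \<open>t\<close> above all \<open>c i\<close>, \<open>t - T n k - e k\<close> bounds from below how far \<open>t\<close> may be decreased.  The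
  cut-off at \<open>e k\<close> makes the maximum over \<open>k\<close> depend on finitely many \<open>k\<close> only.\<close>

definition step :: "'a \<Rightarrow> 'a \<Rightarrow> 'a K \<Rightarrow> 'a K" where
  "step n k t = min (e k) (max 0 (t - (T n k + e k)))"

lemma step_max_ex:
  "\<exists>h. kfn (\<lambda>z. h (p1 z) (val (p2 z))) \<and> (\<forall>n k t. k \<preceq> n \<longrightarrow> step n k t \<le> h n t) \<and>
    (\<forall>n t. \<exists>k. k \<preceq> n \<and> h n t = step n k t)"
proof -
  have "kfn (\<lambda>x. step (p1 x) 0 (val (p2 x)))"
    "kfn (\<lambda>z. max (val (p2 (p2 z))) (step (p1 (p1 z)) (p1 (p2 z) + 1) (val (p2 (p1 z)))))"
    unfolding step_def by (intro comp)+
  then have "\<exists>G. kfn (\<lambda>z. G (p1 z) (p2 z)) \<and> (\<forall>x. G x 0 = step (p1 x) 0 (val (p2 x))) \<and>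
    (\<forall>x i. G x (i + 1) = max (G x i) (step (p1 x) (i + 1) (val (p2 x))))"
    by (rule kprim_rec_ex)
  then obtain G where G: "kfn (\<lambda>z. G (p1 z) (p2 z))" "\<And>x. G x 0 = step (p1 x) 0 (val (p2 x))"
    "\<And>x i. G x (i + 1) = max (G x i) (step (p1 x) (i + 1) (val (p2 x)))" by blast
  note dG = kfn_comp2[OF G(1)]
  have ds: "kfn (\<lambda>x. step (f x) (g x) t)" if "fn S f" "fn S g" for f g t
    unfolding step_def by (intro comp that)
  have le: "k \<preceq> m \<longrightarrow> step n k t \<le> G (pr n (rc t)) m" for n k t m
  proof (rule dec_induct[where P = "\<lambda>m. k \<preceq> m \<longrightarrow> step n k t \<le> G (pr n (rc t)) m"])
    show "dec (\<lambda>m. k \<preceq> m \<longrightarrow> step n k t \<le> G (pr n (rc t)) m)" by (intro comp dG)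
    have "k = 0" if "k \<preceq> 0" using that iota_nonneg[of k] by (simp add: iota_iff)
    then show "k \<preceq> 0 \<longrightarrow> step n k t \<le> G (pr n (rc t)) 0" by (auto simp: G(2))
    fix m assume IH: "k \<preceq> m \<longrightarrow> step n k t \<le> G (pr n (rc t)) m"
    have "k \<preceq> m \<or> k = m + 1" if "k \<preceq> m + 1" using that less_S[of k m] by (auto simp: leq_def)
    then show "k \<preceq> m + 1 \<longrightarrow> step n k t \<le> G (pr n (rc t)) (m + 1)" using IH by (auto simp: G(3) le_max_iff_disj)
  qed
  have att: "\<exists>k. k \<preceq> m \<and> G (pr n (rc t)) m = step n k t" for n t m
  proof (rule dec_induct[where P = "\<lambda>m. \<exists>k. k \<preceq> m \<and> G (pr n (rc t)) m = step n k t"])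
    show "dec (\<lambda>m. \<exists>k. k \<preceq> m \<and> G (pr n (rc t)) m = step n k t)" by (intro comp dG ds)
    show "\<exists>k. k \<preceq> 0 \<and> G (pr n (rc t)) 0 = step n k t" by (intro exI[of _ 0]) (simp add: G(2) leq_refl)
    fix m assume "\<exists>k. k \<preceq> m \<and> G (pr n (rc t)) m = step n k t"
    then obtain k where "k \<preceq> m" "G (pr n (rc t)) m = step n k t" by blast
    then have "k \<preceq> m + 1" "G (pr n (rc t)) m = step n k t" by (simp_all add: iota_leq)
    moreover have "G (pr n (rc t)) (m + 1) = G (pr n (rc t)) m \<or> G (pr n (rc t)) (m + 1) = step n (m + 1) t"
      by (simp add: G(3) max_def)
    ultimately show "\<exists>k. k \<preceq> m + 1 \<and> G (pr n (rc t)) (m + 1) = step n k t" using leq_refl by metis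
  qed
  have "kfn (\<lambda>z. G (pr (p1 z) (rc (val (p2 z)))) (p1 z))" by (intro comp dG)
  then show ?thesis using le att by (intro exI[of _ "\<lambda>n t. G (pr n (rc t)) n"]) simp
qed

definition h :: "'a \<Rightarrow> 'a K \<Rightarrow> 'a K" where
  "h = (SOME h. kfn (\<lambda>z. h (p1 z) (val (p2 z))) \<and> (\<forall>n k t. k \<preceq> n \<longrightarrow> step n k t \<le> h n t) \<and>
    (\<forall>n t. \<exists>k. k \<preceq> n \<and> h n t = step n k t))"

lemma h: "kfn (\<lambda>z. h (p1 z) (val (p2 z)))" "k \<preceq> n \<Longrightarrow> step n k t \<le> h n t" "\<exists>k. k \<preceq> n \<and> h n t = step n k t"
  using someI_ex[OF step_max_ex] unfolding h_def[symmetric] by blast+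

lemma step_lip: "\<bar>step n k s - step n k t\<bar> \<le> \<bar>s - t\<bar>"
  unfolding step_def by (auto simp: min_def max_def abs_if)

lemma h_lip: "\<bar>h n s - h n t\<bar> \<le> \<bar>s - t\<bar>"
proof -
  have "h n s \<le> h n t + \<bar>s - t\<bar>" for s t
  proof -
    obtain k where "k \<preceq> n" "h n s = step n k s" using h(3) by blast
    then show ?thesis using h(2)[of k n t] step_lip[of n k s t] by linarith
  qed
  from this[of s t] this[of t s] show ?thesis by (simp add: abs_le_iff abs_minus_commute)
qed

text \<open>By \<open>c_le\<close> every \<open>T n k + e k\<close> is at least \<open>c n\<close>,
  so subtracting any of the steps from \<open>t\<close> does not lead below the smaller of
  \<open>t\<close> and \<open>c n\<close>.\<close>

lemma h_bounds: assumes "0 \<le> t" shows "0 \<le> h n t" "h n t \<le> t" "min t (c n) \<le> t - h n t"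
proof -
  obtain k where k: "k \<preceq> n" "h n t = step n k t" using h(3) by blast
  have "0 \<le> T n k + e k" using T_bounds(1)[of n k] e_pos[of k] by linarith
  then show "0 \<le> h n t" "h n t \<le> t" "min t (c n) \<le> t - h n t"
    using assms c_le[of n k] less_imp_le[OF e_pos[of k]] unfolding k(2) step_def by (auto simp: min_def max_def)
qed

text \<open>The step for \<open>k = j\<close> is at least \<open>e (j + 1)\<close>, while steps for
  larger \<open>k\<close> are cut off at that value. So the maximum is attained among the indices up
  to \<open>j\<close>.\<close>

lemma h_large:
  assumes "j \<preceq> n" "T n j + e j + e (j + 1) \<le> t"
  shows "e (j + 1) \<le> h n t" "\<exists>k. k \<preceq> j \<and> h n t = step n k t"
proof -
  have "e (j + 1) \<le> step n j t"
    using assms(2) e_double[of j] e_pos[of "j + 1"] unfolding step_def by (simp add: le_max_iff_disj)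
  then show ge: "e (j + 1) \<le> h n t" using h(2)[OF assms(1), of t] by linarith
  obtain k where k: "k \<preceq> n" "h n t = step n k t" using h(3) by blast
  show "\<exists>k. k \<preceq> j \<and> h n t = step n k t"
  proof (cases "k \<preceq> j")
    case True
    then show ?thesis using k by blast
  next
    case False
    then have "j + 1 \<preceq> k" using S_le[of j k] by (auto simp: leq_def iota_iff)
    then have "step n k t \<le> e (j + 1)" using e_mono unfolding step_def by (simp add: min_le_iff_disj)
    then have "h n t = step n j t" using k(2) h(2)[OF assms(1), of t] \<open>e (j + 1) \<le> step n j t\<close> by linarith
    then show ?thesis using leq_refl by blast
  qed
qed

text \<open>By \<open>h_large\<close> both maxima are attained at indices up to \<open>j\<close>,
  where the steps coincide. Together with \<open>T_limit\<close> this makes \<open>h n t\<close>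
  independent of \<open>n\<close> from some index on.\<close>

lemma h_stable:
  assumes "j \<preceq> n" "j \<preceq> m" "T n j + e j + e (j + 1) \<le> t" "\<And>k. k \<preceq> j \<Longrightarrow> T n k = T m k"
  shows "h n t = h m t"
proof -
  have eq: "step n k t = step m k t" if "k \<preceq> j" for k using assms(4)[OF that] by (simp add: step_def)
  have le: "k \<preceq> n" "k \<preceq> m" if "k \<preceq> j" for k using that assms(1,2) by (auto simp: iota_leq)
  have "T m j + e j + e (j + 1) \<le> t" using assms(3,4) leq_refl by simp
  then obtain k k' where "k \<preceq> j" "h n t = step n k t" "k' \<preceq> j" "h m t = step m k' t"
    using h_large(2)[OF assms(1,3)] h_large(2)[OF assms(2)] by blast
  then show ?thesis using h(2)[OF le(1), of k' t] h(2)[OF le(2), of k t] eq by fastforce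
qed

text \<open>Detects points below some \<open>c i\<close>: there the factor 2^n makes the bump exceed
  1 for large \<open>n\<close>, while it vanishes at points above all \<open>c i\<close>. Both
  factors are nondecreasing in \<open>n\<close>, as the potential demands.\<close>

definition bump :: "'a \<Rightarrow> 'a K \<Rightarrow> 'a K" where "bump n t = \<iota> (pow2 S n) * max 0 (c n - t)"

definition phi :: "'a \<Rightarrow> 'a K \<Rightarrow> 'a K" where "phi n t = max (t - h n t) (min 1 (bump n t))"
text \<open>The cap 2 is the potential 1 at the target of the jump plus 1 for the largest possible
  distance.\<close>

definition psi :: "'a \<Rightarrow> 'a K \<Rightarrow> 'a K" where "psi n t = max t (min 2 (2 * bump n t))"

lemma kfn_phi: "kfn (\<lambda>z. phi (p1 z) (val (p2 z)))"
  unfolding phi_def bump_def by (intro comp h(1))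

lemma kfn_psi: "kfn (\<lambda>z. psi (p1 z) (val (p2 z)))"
  unfolding psi_def bump_def by (intro comp)

lemma bump_lip: "\<bar>bump n s - bump n t\<bar> \<le> \<iota> (pow2 S n) * \<bar>s - t\<bar>"
proof -
  have "\<bar>max 0 (c n - s) - max 0 (c n - t)\<bar> \<le> \<bar>s - t\<bar>" by (auto simp: max_def abs_if)
  from mult_left_mono[OF this iota_nonneg, of "pow2 S n"] show ?thesis
    by (simp add: bump_def abs_mult iota_nonneg flip: right_diff_distrib)
qed

lemma abs_max_diff_le: "\<bar>a - a'\<bar> \<le> d \<Longrightarrow> \<bar>b - b'\<bar> \<le> d \<Longrightarrow> \<bar>max a b - max a' b'\<bar> \<le> d" for d :: "'a K"
  by (simp add: max_def abs_le_iff)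

lemma abs_min_diff_le: "\<bar>min u a - min u b\<bar> \<le> \<bar>a - b\<bar>" for u :: "'a K"
  by (auto simp: min_def abs_if)

lemma phi_lip: "\<bar>phi n s - phi n t\<bar> \<le> \<iota> (pow2 S n + 1 + 1) * \<bar>s - t\<bar>"
proof -
  define d where "d = \<bar>s - t\<bar>"
  have d: "\<iota> (pow2 S n + 1 + 1) * d = \<iota> (pow2 S n) * d + 2 * d" "0 \<le> d" "0 \<le> \<iota> (pow2 S n) * d"
    by (simp_all add: distrib_right d_def iota_nonneg)
  have "\<bar>(s - h n s) - (t - h n t)\<bar> \<le> d + d"
    using h_lip[of n s t, folded d_def] abs_ge_self[of "s - t", folded d_def] abs_ge_minus_self[of "s - t", folded d_def]
    unfolding abs_le_iff by linarith
  moreover have "\<bar>min 1 (bump n s) - min 1 (bump n t)\<bar> \<le> \<iota> (pow2 S n) * d"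
    using abs_min_diff_le bump_lip[of n s t, folded d_def] by (rule order_trans)
  ultimately show ?thesis unfolding phi_def d_def[symmetric] d(1)
    using d(2,3) by (intro abs_max_diff_le) linarith+
qed

lemma psi_lip: "\<bar>psi n s - psi n t\<bar> \<le> \<iota> (pow2 S n + pow2 S n + 1) * \<bar>s - t\<bar>"
proof -
  define d where "d = \<bar>s - t\<bar>"
  have d: "\<iota> (pow2 S n + pow2 S n + 1) * d = 2 * (\<iota> (pow2 S n) * d) + d" "0 \<le> d" "0 \<le> \<iota> (pow2 S n) * d"
    by (simp_all add: distrib_right d_def iota_nonneg)
  have "\<bar>2 * bump n s - 2 * bump n t\<bar> \<le> 2 * (\<iota> (pow2 S n) * d)"
    using bump_lip[of n s t, folded d_def] unfolding abs_le_iff by linarith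
  with abs_min_diff_le have "\<bar>min 2 (2 * bump n s) - min 2 (2 * bump n t)\<bar> \<le> 2 * (\<iota> (pow2 S n) * d)"
    by (rule order_trans)
  then show ?thesis unfolding psi_def d_def[symmetric] d(1)
    using d(2,3) by (intro abs_max_diff_le) (linarith | simp add: d_def)+
qed

lemma phi_range: "0 \<le> t \<Longrightarrow> t \<le> 1 \<Longrightarrow> 0 \<le> phi n t \<and> phi n t \<le> 1"
  using h_bounds[of t n] by (simp add: phi_def le_max_iff_disj)

lemma psi_mono: assumes "n \<preceq> m" shows "psi n t \<le> psi m t"
proof -
  have "bump n t \<le> bump m t"
    unfolding bump_def using pow2_mono[OF assms] c_mono[OF assms] by (intro mult_mono iota_nonneg) auto
  then show ?thesis by (auto simp: psi_def min_def max_def)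
qed

text \<open>At a point above all \<open>c i\<close> but not bounded away from the \<open>T n j + e j\<close>, one could compute how
  long to wait for \<open>n\<close> to enter the set.\<close>

lemma bounded_away:
  assumes x: "point S unit_interval x" and above: "\<And>n. kr (c n) \<le> rv x"
  shows "\<exists>j. \<forall>n. kr (T n j + 2 * e j) \<le> rv x"
proof (rule ccontr)
  assume neg: "\<not> ?thesis"
  have rx: "is_real S x" using x by (simp add: unit_interval_point)
  have fx: "fn S x" using rx by (simp add: is_real_iff)
  \<comment> \<open>At stage \<open>i n\<close> the sum is so close to \<open>x\<close> that a later
    entry of \<open>n\<close>, worth \<open>e (n + 1)\<close>, would lift it above \<open>x\<close>.
    Hence stage \<open>i n\<close> already tells whether \<open>n\<close> ever enters.\<close>
  have "\<exists>i. fn S i \<and> (\<forall>n. val (x (n + 1 + 1 + 1)) < c (i n) + e (n + 1 + 1))"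
  proof (rule choice)
    show "dec (\<lambda>z. val (x (p1 z + 1 + 1 + 1)) < c (p2 z) + e (p1 z + 1 + 1))" by (intro comp fn_comp[OF fx])
    fix n
    let ?k = "n + 1 + 1 + 1 :: 'a"
    obtain i where i: "rv x < kr (T i (?k + 1) + 2 * e (?k + 1))" using neg not_le by blast
    have "T i (?k + 1) \<le> c i"
    proof (cases "i \<preceq> ?k + 1")
      case True
      then show ?thesis unfolding c_def by (simp only: T_stable)
    next
      case False
      then have "?k + 1 \<preceq> i" by (simp add: iota_leq)
      then show ?thesis unfolding c_def by (rule T_tail)
    qed
    then have "T i (?k + 1) + 2 * e (?k + 1) \<le> c i + e ?k" using e_double[of ?k] by linarith
    then have "kr (T i (?k + 1) + 2 * e (?k + 1)) \<le> (kr (c i + e ?k) :: 'a R)" by (rule kr_mono)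
    then have "kr (val (x ?k)) < (kr (c i + e ?k + e ?k) :: 'a R)"
      using i rv_approx[OF rx, of ?k] unfolding abs_le_iff kr_simps(3)[of "c i + e ?k"] by linarith
    then have "val (x ?k) < c i + e ?k + e ?k" by (simp only: kr_less)
    then show "\<exists>i. val (x ?k) < c i + e (n + 1 + 1)" using e_double[of "n + 1 + 1"] by (intro exI[of _ i]) linarith
  qed
  then obtain i where i: "fn S i" "\<And>n. val (x (n + 1 + 1 + 1)) < c (i n) + e (n + 1 + 1)" by blast
  have "inA (i n) n" if "inA m n" for m n
  proof (rule ccontr)
    assume "\<not> inA (i n) n"
    then have "c (i n) + e (n + 1) \<le> c m" using c_new that by blast
    moreover have "e (n + 1) = e (n + 1 + 1) + (e (n + 1 + 1 + 1) + e (n + 1 + 1 + 1))"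
      using e_double[of "n + 1"] e_double[of "n + 1 + 1"] by linarith
    ultimately have "val (x (n + 1 + 1 + 1)) + e (n + 1 + 1 + 1) < c m" using i(2)[of n] e_pos[of "n + 1 + 1 + 1"] by linarith
    then have "kr (val (x (n + 1 + 1 + 1)) + e (n + 1 + 1 + 1)) < (kr (c m) :: 'a R)" by (simp only: kr_less)
    then show False using above[of m] rv_approx[OF rx, of "n + 1 + 1 + 1"] unfolding abs_le_iff kr_simps by linarith
  qed
  moreover have "(\<exists>m. pr n m \<in> Z) \<longleftrightarrow> (\<exists>m. inA m n)" for n
  proof
    assume "\<exists>m. pr n m \<in> Z"
    then obtain m where "ev (pr n m)" using ev_ex by blast
    then have "inA (pr n m + 1) n" unfolding inA_def using less_S by (intro exI[of _ "pr n m"]) simp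
    then show "\<exists>m. inA m n" by blast
  next
    assume "\<exists>m. inA m n"
    then show "\<exists>m. pr n m \<in> Z" unfolding inA_def ev_def is_pair_def by fastforce
  qed
  ultimately have "(\<exists>m. pr n m \<in> Z) \<longleftrightarrow> inA (i n) n" for n by blast
  moreover have "dec (\<lambda>n. inA (i n) n)" by (intro comp i)
  ultimately show False using gap by (simp add: dec_def)
qed

lemma above_approx:
  assumes "point S unit_interval x" "\<And>n. kr (c n) \<le> rv x"
  shows "c n - val (x k) \<le> e k" "0 \<le> val (x k)" "bump n (val (x k)) \<le> \<iota> (pow2 S n) * e k"
proof -
  have "is_real S x" using assms(1) by (simp add: unit_interval_point)
  then have "kr (c n - val (x k)) \<le> (kr (e k) :: 'a R)"
    using assms(2)[of n] rv_approx[of x k] unfolding kr_diff abs_le_iff by linarith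
  then show 1: "c n - val (x k) \<le> e k" by (simp only: kr_le)
  then show "bump n (val (x k)) \<le> \<iota> (pow2 S n) * e k"
    unfolding bump_def by (intro mult_left_mono iota_nonneg) (simp add: less_imp_le)
  show "0 \<le> val (x k)" using assms(1) by (simp add: unit_interval_point)
qed

lemma bump_ge_1: assumes "rv x < kr (c m)" "is_real S x"
  shows "\<exists>N. \<forall>n. N \<preceq> n \<longrightarrow> (\<exists>K. \<forall>k. K \<preceq> k \<longrightarrow> 1 \<le> bump n (val (x k)))"
proof -
  obtain t where t: "rv x < kr t" "kr t < (kr (c m) :: 'a R)" using kr_dense[OF assms(1)] by blast
  then have "t < c m" by (simp only: kr_less)
  then obtain i where i: "e i < c m - t" using e_arch[of "c m - t"] by auto
  obtain K where K: "kr (e K) < kr t - rv x" using R_arch[of "kr t - rv x"] t(1) by auto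
  have "1 \<le> bump n (val (x k))" if n: "m + i \<preceq> n" and k: "K \<preceq> k" for n k
  proof -
    have le: "m \<preceq> n" "i \<preceq> n" using n iota_nonneg[of m] iota_nonneg[of i] unfolding iota_leq iota_simps by linarith+
    have "kr (e k) \<le> (kr (e K) :: 'a R)" by (intro kr_mono e_mono k)
    then have "kr (val (x k)) \<le> (kr t :: 'a R)" using rv_approx[OF assms(2), of k] K unfolding abs_le_iff by linarith
    then have "val (x k) \<le> t" by (simp only: kr_le)
    then have "e n \<le> max 0 (c n - val (x k))" using i e_mono[OF le(2)] c_mono[OF le(1)] by (simp add: le_max_iff_disj)
    from mult_left_mono[OF this, of "\<iota> (pow2 S n)"] show ?thesis
      using pow2_pos[of n] by (simp add: bump_def e_def)
  qed
  then show ?thesis by blast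
qed

lemma kr_c_less_1: "kr (c n) < (1 :: 'a R)"
proof -
  have "kr (c n) < (kr 1 :: 'a R)" using c_bounds(2) by (simp only: kr_less)
  then show ?thesis by (simp only: kr_simps)
qed

theorem not_CFP_unit_interval: "\<not> CFP S (\<lambda>X F V. X = unit_interval \<and> is_baire_class_1 F)"
proof -
  interpret II: cspace2 S unit_interval unit_interval by unfold_locales
  interpret IH: cspace2 S unit_interval half_line by unfold_locales (rule half_line_coded)
  define M where "M n = pow2 S n + 1 + (1 :: 'a)" for n :: 'a
  define L where "L n = pow2 S n + pow2 S n + (1 :: 'a)" for n :: 'a
  have M: "fn S M" "fn S L" unfolding M_def L_def by (intro comp)+
  have "rc (phi n t) \<in> {q. is_rat q \<and> qle q0 q \<and> qle q q1}" if "0 \<le> t" "t \<le> 1" for n t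
    using phi_range[OF that] by simp
  then obtain W where W: "W \<in> S" "\<And>n. cont_total_code S unit_interval unit_interval (sect W n)"
    "\<And>n x y k. point S unit_interval x \<Longrightarrow> cont_val S unit_interval unit_interval (sect W n) x y \<Longrightarrow>
      \<bar>rv y - kr (phi n (val (x k)))\<bar> \<le> kr (\<iota> (M n) * e k)"
    using U.lipschitz_codes[OF kfn_phi M(1), folded unit_interval_def] phi_lip unfolding M_def by blast
  have "rc (psi n t) \<in> {q. is_rat q \<and> qle q0 q}" if "0 \<le> t" "t \<le> 1" for n t
    using that by (simp add: psi_def le_max_iff_disj)
  then obtain P where P: "P \<in> S" "\<And>n. cont_total_code S unit_interval half_line (sect P n)"
    "\<And>n x y k. point S unit_interval x \<Longrightarrow> cont_val S unit_interval half_line (sect P n) x y \<Longrightarrow>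
      \<bar>rv y - kr (psi n (val (x k)))\<bar> \<le> kr (\<iota> (L n) * e k)"
    using H.lipschitz_codes[OF kfn_psi M(2), folded half_line_def] psi_lip unfolding L_def by blast
  have W_ex: "\<exists>y. cont_val S unit_interval unit_interval (sect W n) x y" if "point S unit_interval x" for n x
    using W(2) that unfolding cont_total_code_def by blast
  have P_ex: "\<exists>y. cont_val S unit_interval half_line (sect P n) x y" if "point S unit_interval x" for n x
    using P(2) that unfolding cont_total_code_def by blast
  have real: "is_real S x" "0 \<le> val (x k)" "val (x k) \<le> 1" if "point S unit_interval x" for x k
    using that by (auto simp: unit_interval_point)

  have F: "(\<exists>y. limit_val S unit_interval unit_interval W x y) \<and>
      (\<forall>y. limit_val S unit_interval unit_interval W x y \<longrightarrow> point S unit_interval y \<and>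
        (rv x < kr (c m) \<and> rv y = 1 \<or> (\<forall>n. kr (c n) \<le> rv x) \<and> rv y < rv x \<and> (\<forall>n. kr (c n) \<le> rv y)))"
    if x: "point S unit_interval x" and m: "rv x < kr (c m) \<or> (\<forall>n. kr (c n) \<le> rv x)" for x m
  proof (cases "rv x < kr (c m)")
    case True
    obtain N where N: "\<And>n. N \<preceq> n \<Longrightarrow> \<exists>K. \<forall>k. K \<preceq> k \<longrightarrow> 1 \<le> bump n (val (x k))"
      using bump_ge_1[OF True real(1)[OF x]] by blast
    have "rv y = 1" if n: "N \<preceq> n" and y: "cont_val S unit_interval unit_interval (sect W n) x y" for n y
    proof -
      obtain K where K: "\<And>k. K \<preceq> k \<Longrightarrow> 1 \<le> bump n (val (x k))" using N[OF n] by blast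
      have eq: "phi n (val (x k)) = 1" if "K \<preceq> k" for k
        using K[OF that] real(2,3)[OF x, of k] h_bounds(1)[of "val (x k)" n] by (simp add: phi_def)
      have "kr (phi n (val (x k))) = (1 :: 'a R)" if "K \<preceq> k" for k using eq[OF that] by simp
      then show ?thesis
        using lim_le[OF W(3)[OF x y], of K 1 0] lim_ge[OF W(3)[OF x y], of K 1 0] iota_nonneg by simp
    qed
    then have "\<forall>n y. N \<preceq> n \<longrightarrow> cont_val S unit_interval unit_interval (sect W n) x y \<longrightarrow> rv y = 1" by blast
    from U.limit_val_iff[folded unit_interval_def, OF W_ex[OF x] this] show ?thesis using True by blast
  next
    case False
    then have above: "\<And>n. kr (c n) \<le> rv x" using m by blast
    obtain j where j: "\<And>n. kr (T n j + 2 * e j) \<le> rv x" using bounded_away[OF x above] by blast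
    obtain N where N: "\<And>n k. N \<preceq> n \<Longrightarrow> k \<preceq> j \<Longrightarrow> T n k = T N k" using T_limit by blast
    note ap = above_approx[OF x above]
    have large: "T n j + e j + e (j + 1) \<le> val (x k)" if "j + 1 \<preceq> k" for n k
    proof -
      have "kr (e k) \<le> (kr (e (j + 1)) :: 'a R)" by (intro kr_mono e_mono that)
      then have "kr (T n j + 2 * e j) \<le> (kr (val (x k) + e (j + 1)) :: 'a R)"
        using j[of n] rv_approx[OF real(1)[OF x], of k] unfolding kr_simps(3)[of "val (x k)"] abs_le_iff by linarith
      then have "T n j + 2 * e j \<le> val (x k) + e (j + 1)" by (simp only: kr_le)
      then show ?thesis using e_double[of j] by linarith
    qed
    have phi_near: "val (x k) - h n (val (x k)) \<le> phi n (val (x k)) \<and>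
      phi n (val (x k)) \<le> val (x k) - h n (val (x k)) + \<iota> (pow2 S n) * e k" for n k
    proof -
      have "0 \<le> val (x k) - h n (val (x k))" "0 \<le> \<iota> (pow2 S n) * e k"
        using h_bounds(2)[OF ap(2)[of k], of n] by (simp_all add: iota_nonneg less_imp_le)
      then show ?thesis using ap(3)[of n k] unfolding phi_def by (simp add: min_le_iff_disj)
    qed
    define n0 where "n0 = N + j"
    have n0: "N \<preceq> n0" "j \<preceq> n0" using iota_nonneg[of N] iota_nonneg[of j] by (simp_all add: n0_def iota_leq)
    obtain z where z: "cont_val S unit_interval unit_interval (sect W n0) x z" using W_ex[OF x] by blast
    \<comment> \<open>From \<open>n0\<close> on, \<open>h_stable\<close> makes \<open>h\<close>
      independent of \<open>n\<close> at the entries of \<open>x\<close>, and there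
      \<open>bump\<close> is at most a multiple of \<open>e k\<close>. Letting \<open>k\<close>
      grow, the values agree exactly; the drop below \<open>x\<close> is at least
      \<open>e (j + 1)\<close>.\<close>
    have val: "rv y = rv z \<and> rv y < rv x \<and> kr (c n) \<le> rv y"
      if n: "n0 \<preceq> n" and y: "cont_val S unit_interval unit_interval (sect W n) x y" for n y
    proof -
      have le: "N \<preceq> n" "j \<preceq> n" using n n0 by (auto simp: iota_leq)
      have eq: "h n (val (x k)) = h n0 (val (x k))" if "j + 1 \<preceq> k" for k
        by (rule h_stable[OF le(2) n0(2) large[OF that]]) (simp only: N[OF le(1)] N[OF n0(1)])
      have "kr (phi n (val (x k))) \<le> rv z + kr ((\<iota> (pow2 S n) + \<iota> (M n0)) * e k)" if k: "j + 1 \<preceq> k" for k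
      proof -
        have "phi n (val (x k)) \<le> phi n0 (val (x k)) + \<iota> (pow2 S n) * e k"
          using phi_near[of k n] phi_near[of k n0] eq[OF k] by linarith
        from kr_mono[OF this] show ?thesis using W(3)[OF x z, of k]
          unfolding distrib_right kr_simps(3) abs_le_iff by linarith
      qed
      from lim_le[OF W(3)[OF x y] this] have "rv y \<le> rv z" by (simp add: iota_nonneg)
      moreover have "rv z \<le> kr (phi n (val (x k))) + kr ((\<iota> (pow2 S n0) + \<iota> (M n0)) * e k)" if k: "j + 1 \<preceq> k" for k
      proof -
        have "phi n0 (val (x k)) \<le> phi n (val (x k)) + \<iota> (pow2 S n0) * e k"
          using phi_near[of k n0] phi_near[of k n] eq[OF k] by linarith
        from kr_mono[OF this] show ?thesis using W(3)[OF x z, of k]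
          unfolding distrib_right kr_simps(3) abs_le_iff by linarith
      qed
      from lim_ge[OF W(3)[OF x y] this] have "rv z \<le> rv y" by (simp add: iota_nonneg)
      moreover have "kr (phi n (val (x k))) \<le> (rv x - kr (e (j + 1))) + kr ((\<iota> (pow2 S n) + 1) * e k)" if k: "j + 1 \<preceq> k" for k
      proof -
        have "phi n (val (x k)) + e (j + 1) \<le> val (x k) + \<iota> (pow2 S n) * e k"
          using phi_near[of k n] h_large(1)[OF le(2) large[OF k]] by linarith
        from kr_mono[OF this] show ?thesis using rv_approx[OF real(1)[OF x], of k]
          unfolding distrib_right mult_1_left kr_simps(3) abs_le_iff by linarith
      qed
      from lim_le[OF W(3)[OF x y] this] have "rv y \<le> rv x - kr (e (j + 1))" by (simp add: iota_nonneg)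
      moreover have "kr 0 < (kr (e (j + 1)) :: 'a R)" by (simp only: kr_less e_pos)
      moreover have "kr (c n) \<le> (kr (phi n (val (x k))) + kr (1 * e k) :: 'a R)" for k
      proof -
        have "c n \<le> phi n (val (x k)) + 1 * e k"
          using phi_near[of k n] h_bounds(3)[OF ap(2)[of k], of n] ap(1)[of n k] e_pos[of k]
          unfolding min_def mult_1_left by (cases "val (x k) \<le> c n") (simp_all only: if_True if_False, linarith+)
        from kr_mono[OF this] show ?thesis by (simp only: kr_simps(3))
      qed
      from lim_ge[OF W(3)[OF x y] this] have "kr (c n) \<le> rv y" by (simp add: iota_nonneg)
      ultimately show ?thesis by simp
    qed
    have "kr (c n) \<le> rv z" for n
    proof -
      have le: "n \<preceq> n0 + n" "n0 \<preceq> n0 + n" using iota_nonneg[of n0] iota_nonneg[of n] by (simp_all add: iota_leq)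
      obtain y where "cont_val S unit_interval unit_interval (sect W (n0 + n)) x y" using W_ex[OF x] by blast
      then have "kr (c (n0 + n)) \<le> rv z" using val[OF le(2)] by metis
      moreover have "kr (c n) \<le> (kr (c (n0 + n)) :: 'a R)" by (intro kr_mono c_mono le)
      ultimately show ?thesis by (rule order_trans[rotated])
    qed
    moreover have "rv z < rv x" using val[OF leq_refl z] by blast
    moreover have "\<forall>n y. n0 \<preceq> n \<longrightarrow> cont_val S unit_interval unit_interval (sect W n) x y \<longrightarrow> rv y = rv z"
      using val by blast
    from U.limit_val_iff[folded unit_interval_def, OF W_ex[OF x] this]
    have "\<exists>y. limit_val S unit_interval unit_interval W x y"
      "\<And>y. limit_val S unit_interval unit_interval W x y \<longleftrightarrow> point S unit_interval y \<and> rv y = rv z" by blast+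
    ultimately show ?thesis using above by simp
  qed

  have V: "(\<exists>y. limit_val S unit_interval half_line P x y) \<and>
      (\<forall>y. limit_val S unit_interval half_line P x y \<longrightarrow> point S half_line y \<and>
        (rv x < kr (c m) \<and> rv y = 2 \<or> (\<forall>n. kr (c n) \<le> rv x) \<and> rv y = rv x))"
    if x: "point S unit_interval x" and m: "rv x < kr (c m) \<or> (\<forall>n. kr (c n) \<le> rv x)" for x m
  proof (cases "rv x < kr (c m)")
    case True
    obtain N where N: "\<And>n. N \<preceq> n \<Longrightarrow> \<exists>K. \<forall>k. K \<preceq> k \<longrightarrow> 1 \<le> bump n (val (x k))"
      using bump_ge_1[OF True real(1)[OF x]] by blast
    have "rv y = 2" if n: "N \<preceq> n" and y: "cont_val S unit_interval half_line (sect P n) x y" for n y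
    proof -
      obtain K where K: "\<And>k. K \<preceq> k \<Longrightarrow> 1 \<le> bump n (val (x k))" using N[OF n] by blast
      have eq: "psi n (val (x k)) = 2" if "K \<preceq> k" for k
        using K[OF that] real(2,3)[OF x, of k] by (simp add: psi_def)
      have "kr (psi n (val (x k))) = (2 :: 'a R)" if "K \<preceq> k" for k using eq[OF that] by simp
      then show ?thesis
        using lim_le[OF P(3)[OF x y], of K 2 0] lim_ge[OF P(3)[OF x y], of K 2 0] iota_nonneg by simp
    qed
    then have "\<forall>n y. N \<preceq> n \<longrightarrow> cont_val S unit_interval half_line (sect P n) x y \<longrightarrow> rv y = 2" by blast
    from H.limit_val_iff[folded half_line_def, OF P_ex[OF x] this] show ?thesis using True by blast
  next
    case False
    then have above: "\<And>n. kr (c n) \<le> rv x" using m by blast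
    note ap = above_approx[OF x above]
    have "rv y = rv x" if y: "cont_val S unit_interval half_line (sect P n) x y" for n y
    proof (rule antisym)
      have near: "val (x k) \<le> psi n (val (x k))" "psi n (val (x k)) \<le> val (x k) + 2 * \<iota> (pow2 S n) * e k" for k
      proof -
        have "0 \<le> 2 * \<iota> (pow2 S n) * e k" by (simp add: iota_nonneg less_imp_le)
        then show "val (x k) \<le> psi n (val (x k))" "psi n (val (x k)) \<le> val (x k) + 2 * \<iota> (pow2 S n) * e k"
          using ap(2)[of k] ap(3)[of n k] by (simp_all add: psi_def min_le_iff_disj)
      qed
      have "kr (psi n (val (x k))) \<le> rv x + kr ((2 * \<iota> (pow2 S n) + 1) * e k)" for k
        using kr_mono[OF near(2)[of k]] rv_approx[OF real(1)[OF x], of k]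
        unfolding distrib_right mult_1_left kr_simps(3) abs_le_iff by linarith
      from lim_le[OF P(3)[OF x y] this] show "rv y \<le> rv x" by (simp add: iota_nonneg)
      have "rv x \<le> kr (psi n (val (x k))) + kr (1 * e k)" for k
        using kr_mono[OF near(1)[of k]] rv_approx[OF real(1)[OF x], of k]
        unfolding mult_1_left abs_le_iff by linarith
      from lim_ge[OF P(3)[OF x y] this] show "rv x \<le> rv y" by (simp add: iota_nonneg)
    qed
    then have "\<forall>n y. 0 \<preceq> n \<longrightarrow> cont_val S unit_interval half_line (sect P n) x y \<longrightarrow> rv y = rv x" by blast
    from H.limit_val_iff[folded half_line_def, OF P_ex[OF x] this] show ?thesis using above by blast
  qed
  have cases: "\<exists>m. rv x < kr (c m) \<or> (\<forall>n. kr (c n) \<le> rv x)" for x :: "'a \<Rightarrow> 'a"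
    using not_le by blast

  have "caristi_system S unit_interval (Baire1 W) (Baire1 P)"
    unfolding caristi_system_def potential_def total_fun_def
  proof (intro conjI allI impI disjI2)
    show "coded_space S unit_interval" by (rule unit_interval_coded)
    show "is_fun_code S unit_interval unit_interval (Baire1 W)" "is_fun_code S unit_interval half_line (Baire1 P)"
      using W P by simp_all
    show "\<exists>y. fun_val S unit_interval unit_interval (Baire1 W) x y" "\<exists>y. fun_val S unit_interval half_line (Baire1 P) x y"
      if "point S unit_interval x" for x
      using F[OF that] V[OF that] cases[of x] by auto
    have mono: "rle S v w" if le: "n \<preceq> m" and x: "point S unit_interval x"
      and v: "cont_val S unit_interval half_line (sect P n) x v"
      and w: "cont_val S unit_interval half_line (sect P m) x w" for n m x v w
    proof -
      have "kr (psi n (val (x k))) \<le> rv w + kr (\<iota> (L m) * e k)" for k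
        using kr_mono[OF psi_mono[OF le, of "val (x k)"]] P(3)[OF x w, of k] unfolding abs_le_iff by linarith
      from lim_le[OF P(3)[OF x v] this] have "rv v \<le> rv w" by (simp add: iota_nonneg)
      then show ?thesis using IH.cont_val_point[OF v] IH.cont_val_point[OF w] by (simp add: half_line_point rle_iff)
    qed
    show "\<exists>W'. Baire1 P = Baire1 W' \<and> (\<forall>n m x v w. n \<preceq> m \<and> point S unit_interval x \<and>
        cont_val S unit_interval half_line (sect W' n) x v \<and> cont_val S unit_interval half_line (sect W' m) x w \<longrightarrow>
        rle S v w)"
      by (intro exI[of _ P] conjI refl allI impI, elim conjE, rule mono)
    fix x y v w
    assume *: "point S unit_interval x \<and> fun_val S unit_interval unit_interval (Baire1 W) x y \<and>
      fun_val S unit_interval half_line (Baire1 P) x v \<and> fun_val S unit_interval half_line (Baire1 P) y w"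
    then have x: "point S unit_interval x" and Fx: "limit_val S unit_interval unit_interval W x y"
      and Vx: "limit_val S unit_interval half_line P x v" and Vy: "limit_val S unit_interval half_line P y w" by simp_all
    obtain m where m: "rv x < kr (c m) \<or> (\<forall>n. kr (c n) \<le> rv x)" using cases by blast
    have y: "point S unit_interval y" and Fc: "rv x < kr (c m) \<and> rv y = 1 \<or>
        (\<forall>n. kr (c n) \<le> rv x) \<and> rv y < rv x \<and> (\<forall>n. kr (c n) \<le> rv y)"
      using F[OF x m] Fx by blast+
    have v: "point S half_line v" and Vc: "rv x < kr (c m) \<and> rv v = 2 \<or> (\<forall>n. kr (c n) \<le> rv x) \<and> rv v = rv x"
      using V[OF x m] Vx by blast+
    \<comment> \<open>In both cases the image lies above all \<open>c i\<close>, where the potential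
      is the identity.\<close>
    have ya: "\<forall>n. kr (c n) \<le> rv y" using Fc less_imp_le[OF kr_c_less_1] by metis
    have w: "point S half_line w" "rv w = rv y" using V[OF y disjI2[OF ya], of 0] Vy ya not_le by blast+
    have x0: "0 \<le> rv x"
    proof (rule R_leI[where c = 1])
      fix k
      have "kr 0 \<le> (kr (val (x k)) :: 'a R)" by (intro kr_mono real(2) x)
      then show "0 \<le> rv x + kr (1 * e k)" using rv_approx[OF real(1)[OF x], of k]
        unfolding mult_1_left kr_simps(1) abs_le_iff by linarith
    qed
    have "\<bar>rv x - rv y\<bar> + rv w \<le> rv v"
    proof (cases "rv x < kr (c m)")
      case True
      then show ?thesis using Fc Vc w(2) x0 kr_c_less_1[of m] not_le by auto
    next
      case False
      then show ?thesis using Fc Vc w(2) by auto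
    qed
    moreover have "is_real S (pdist unit_interval x y)" "is_real S v" "is_real S w"
      using I.pdist_real[OF x y] v w(1) by (auto simp: half_line_point)
    ultimately show "rle S (radd (pdist unit_interval x y) w) v"
      using radd[of "pdist unit_interval x y" w] unit_interval_DX[OF x y] by (simp add: rle_iff I.DX_def)
  qed
  moreover have "\<not> fun_val S unit_interval unit_interval (Baire1 W) x x" if x: "point S unit_interval x" for x
  proof
    assume "fun_val S unit_interval unit_interval (Baire1 W) x x"
    moreover obtain m where m: "rv x < kr (c m) \<or> (\<forall>n. kr (c n) \<le> rv x)" using cases by blast
    ultimately have "rv x < kr (c m) \<and> rv x = 1" using F[OF x m] by auto
    then show False using kr_c_less_1[of m] by simp
  qed
  ultimately show ?thesis unfolding CFP_def is_baire_class_1_def by blast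
qed

end

text \<open>The net for \<open>j\<close> has mesh \<open>e (j + 1)\<close>. A least-number search
  finds the grid point just below the rational approximation of \<open>x\<close>, whose own error
  \<open>e (j + 1 + 1)\<close> still keeps the total below \<open>e j\<close>.\<close>

lemma (in rca0) unit_interval_compact: "is_compact S unit_interval"
proof -
  let ?P = "\<lambda>z. rc (min 1 (\<iota> (p1 (p1 z)) * e (p2 (p1 z) + 1)))"
  have fn: "fn S (\<lambda>j. pow2 S (j + 1))" "fn S ?P" by (intro comp)+
  have eq: "(\<lambda>k. ?P (pr (pr i j) k)) = (\<lambda>_. rc (min 1 (\<iota> i * e (j + 1))))" for i j by simp
  have dense: "rc (min 1 (\<iota> i * e (j + 1))) \<in> dense unit_interval" for i j
    by (simp add: unit_interval_dense iota_nonneg less_imp_le)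
  have pt: "point S unit_interval (\<lambda>k. ?P (pr (pr i j) k))" for i j
    unfolding eq by (intro I.point_const dense)
  have near: "\<exists>i. i \<preceq> pow2 S (j + 1) \<and> rlt S (pdist unit_interval (\<lambda>k. ?P (pr (pr i j) k)) x) (rconst (qpow S j))"
    if x: "point S unit_interval x" for x j
  proof -
    define q where "q = val (x (j + 1 + 1))"
    have q: "0 \<le> q" "q \<le> 1" "\<bar>rv x - kr q\<bar> \<le> kr (e (j + 1 + 1))"
      using x rv_approx[of x "j + 1 + 1"] by (simp_all add: q_def unit_interval_point)
    obtain i0 :: 'a where "q / e (j + 1) < \<iota> i0" by (rule K_arch)
    then have "q < \<iota> i0 * e (j + 1)" by (simp add: divide_less_eq)
    then have "q < \<iota> (i0 + 1) * e (j + 1)"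
      using e_pos[of "j + 1"] unfolding iota_simps distrib_right mult_1_left by linarith
    then have "\<exists>i. q < \<iota> (i + 1) * e (j + 1) \<and> (\<forall>k. k < i \<longrightarrow> \<not> q < \<iota> (k + 1) * e (j + 1))"
      by (intro least comp)
    then obtain i where i: "q < \<iota> (i + 1) * e (j + 1)" "\<And>k. k < i \<Longrightarrow> \<not> q < \<iota> (k + 1) * e (j + 1)" by blast
    have lower: "\<iota> i * e (j + 1) \<le> q"
    proof (cases "i = 0")
      case False
      then have "\<iota> 1 \<le> \<iota> i" using iota_ge_1 by simp
      then obtain k where k: "\<iota> k = \<iota> i - \<iota> 1" by (rule iota_diff)
      then have "k < i" by (simp add: iota_less)
      then have "\<not> q < \<iota> (k + 1) * e (j + 1)" by (rule i(2))
      then show ?thesis using k by (simp add: not_less)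
    qed (use q(1) in simp)
    have "\<iota> i \<le> \<iota> (pow2 S (j + 1))"
      using order_trans[OF lower q(2)] pow2_pos[of "j + 1"] by (simp add: e_def)
    then have "i \<preceq> pow2 S (j + 1)" by (simp only: iota_leq)
    moreover have "I.DX (\<lambda>_. rc (min 1 (\<iota> i * e (j + 1)))) x < kr (e j)"
    proof -
      have m: "min 1 (\<iota> i * e (j + 1)) = \<iota> i * e (j + 1)" using lower q(2) by simp
      have "rv (\<lambda>_. rc (\<iota> i * e (j + 1))) = kr (\<iota> i * e (j + 1))"
        using rconst(2)[of "rc (\<iota> i * e (j + 1))"] unfolding rconst_def by (simp only: rc)
      then have DX: "I.DX (\<lambda>_. rc (min 1 (\<iota> i * e (j + 1)))) x = \<bar>kr (\<iota> i * e (j + 1)) - rv x\<bar>"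
        using unit_interval_DX[OF I.point_const[OF dense] x, of i j] unfolding m by simp
      have "q \<le> \<iota> i * e (j + 1) + e (j + 1)" using i(1) by (simp add: distrib_right less_imp_le)
      from kr_mono[OF lower] kr_mono[OF this]
      have "\<bar>kr (\<iota> i * e (j + 1)) - rv x\<bar> \<le> kr (e (j + 1)) + kr (e (j + 1 + 1))"
        using q(3) unfolding kr_simps(3) abs_le_iff by linarith
      also have "\<dots> < kr (e j)"
        unfolding kr_simps(3)[symmetric] kr_less using e_double[of j] e_double[of "j + 1"] e_pos[of "j + 1 + 1"] by linarith
      finally show ?thesis unfolding DX .
    qed
    ultimately show ?thesis unfolding eq using I.rlt_pdist[OF I.point_const[OF dense] x] by blast
  qed
  show ?thesis unfolding is_compact_def
    by (intro exI[of _ "\<lambda>j. pow2 S (j + 1)"] exI[of _ ?P] conjI allI impI fn pt near)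
qed

theorem theorem5p10:
  fixes S :: "'a::l2_sig set set"
  assumes "RCA0 S"
  shows "(ACA0 S \<longleftrightarrow> CFP S (\<lambda>X F V. is_continuous F \<or> is_continuous V)) \<and>
         (ACA0 S \<longleftrightarrow> CFP S (\<lambda>X F V. is_compact S X)) \<and>
         (ACA0 S \<longleftrightarrow> CFP S (\<lambda>X F V. X = unit_interval \<and> is_baire_class_1 F)) \<and>
         (ACA0 S \<longleftrightarrow> CFP S (\<lambda>X F V. X = baire_space S \<and> is_continuous F \<and> is_continuous V))"
    (is "(_ \<longleftrightarrow> CFP S ?b) \<and> (_ \<longleftrightarrow> CFP S ?c) \<and> (_ \<longleftrightarrow> CFP S ?d) \<and> (_ \<longleftrightarrow> CFP S ?e)")
proof -
  interpret rca0 S by unfold_locales (rule assms)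
  have asys: "asys S X F V" if "ACA0 S" "caristi_system S X F V" for X F V
    using that by unfold_locales (auto simp: caristi_system_def)
  have forward: "CFP S ?b" "CFP S ?c" if "ACA0 S"
    using asys[OF that, THEN asys.fixed_point_cont_function] asys[OF that, THEN asys.fixed_point_cont_potential]
      asys[OF that, THEN asys.fixed_point_compact] unfolding CFP_def by blast+
  \<comment> \<open>The unit interval is compact, and a system on Baire space with both components
    continuous is covered by the first principle; so only two reversals are left.\<close>
  have sub: "CFP S ?c \<Longrightarrow> CFP S ?d" "CFP S ?b \<Longrightarrow> CFP S ?e"
    unfolding CFP_def using unit_interval_compact by blast+
  have "ACA0 S" if "CFP S ?d \<or> CFP S ?e"
  proof (rule aca0I, rule ccontr)
    fix Z assume "Z \<in> S" "{n. \<exists>m. pr n m \<in> Z} \<notin> S"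
    then interpret gap S Z by unfold_locales
    show False using that not_CFP_unit_interval not_CFP_baire by blast
  qed
  then show ?thesis using forward sub by blast
qed

end
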